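(* Let $\xi=\xi_N$ satisfy $\xi\log\xi\gg\log^2N$ and $D\gg\xi^2$. For any fixed $\kappa>0$ and any index $i\in[\kappa N,(1-\kappa)N]\cap\mathbb Z$, we have, with probability at least $1-e^{-\xi\log\xi}$, $$|\lambda_i-\gamma_i|=O\Big(\frac{\xi^2}{D^{1/4}}\Big),$$ where $\lambda_1\le\dots\le\lambda_N$ are the eigenvalues of $X_*$ in increasing order and $\gamma_i$ is the $i$-th classical location of the Marchenko–Pastur law.
   Context: Let $V_b$ be a set of $M$ labelled black vertices and $V_w$ a set of $N$ labelled white vertices, $M\ge N$. A simple graph on $V_b\cup V_w$ is $(d_b,d_w)$-regular if every edge joins a black and a white vertex, every black vertex has exactly $d_b$ neighbours and every white vertex exactly $d_w$ neighbours; thus $Md_b=Nd_w$. Let $\Omega$ be the finite set of such graphs with the uniform probability measure. Set $\alpha=M/N=d_w/d_b$ and $\gamma=N/M$. All parameters depend on $N$; asymptotics are as $M,N\to\infty$, and $\lim\alpha\ge1$. The adjacency matrix of a graph in $\Omega$ is $\begin{pmatrix} 0 & A \\ A^* & 0 \end{pmatrix}$ with $A$ of size $M\times N$. Let $\mathbf e_b,\mathbf e_w$ be the constant $\ell^2$-normalized vectors of dimensions $M,N$, put $H=d_w^{-1/2}\big(A-\sqrt{d_bd_w}\,\mathbf e_b\mathbf e_w^*\big)$ (i.e. $H_{ij}=d_w^{-1/2}(A_{ij}-d_b/N)$), and $X_*=H^*H$ ($N\times N$). Set $D=d_b\wedge\frac{N^2}{d_b^3}$. The Marchenko–Pastur density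 is $\varrho_\infty(x)=\frac{\sqrt{(\lambda_+-x)(x-\lambda_-)}}{2\pi\gamma x}\mathbf 1_{x\in[\lambda_-,\lambda_+]}$ with $\lambda_\pm=(1\pm\sqrt\gamma)^2$. For $1\le i\le N$ the $i$-th classical location $\gamma_i$ is defined by $\frac iN=\int_{-\infty}^{\gamma_i}\varrho_\infty(E)\,dE$. Here $a\gg b$ means $a/b\to\infty$ as $N\to\infty$, and the implied constant in $O(\cdot)$ is independent of $N$ and $i$ (it may depend on $\kappa$). *)

theory Defs
  imports
    "HOL-Probability.Probability"
    "Jordan_Normal_Form.Char_Poly"
begin

(* The M black vertices are Inl 0, ..., Inl (M - 1), the N white ones Inr 0, ..., Inr (N - 1). *)

definition black_vertices :: "nat \<Rightarrow> (nat + nat) set" where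
  "black_vertices M = Inl ` {..<M}"

definition white_vertices :: "nat \<Rightarrow> (nat + nat) set" where
  "white_vertices N = Inr ` {..<N}"

text \<open>A simple graph on a fixed vertex set is identified with its set of edges, each edge being a
  two-element set of vertices.\<close>

definition simple_graphs :: "'v set \<Rightarrow> 'v set set set" where
  "simple_graphs V = Pow {e. e \<subseteq> V \<and> card e = 2}"

definition neighbours :: "'v set set \<Rightarrow> 'v \<Rightarrow> 'v set" where
  "neighbours E v = {u. {v, u} \<in> E}"

definition biregular_graphs :: "nat \<Rightarrow> nat \<Rightarrow> nat \<Rightarrow> nat \<Rightarrow> (nat + nat) set set set" where
  "biregular_graphs M N db dw =
     {E \<in> simple_graphs (black_vertices M \<union> white_vertices N).
        (\<forall>e\<in>E. \<exists>b\<in>black_vertices M. \<exists>w\<in>white_vertices N. e = {b, w}) \<and>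
        (\<forall>b\<in>black_vertices M. card (neighbours E b) = db) \<and>
        (\<forall>w\<in>white_vertices N. card (neighbours E w) = dw)}"

text \<open>The upper right \<open>M \<times> N\<close> block of the adjacency matrix; row and column indices start at 0.\<close>

definition adj_block :: "nat \<Rightarrow> nat \<Rightarrow> (nat + nat) set set \<Rightarrow> real mat" where
  "adj_block M N E = mat M N (\<lambda>(i, j). if {Inl i, Inr j} \<in> E then 1 else 0)"

definition const_unit_vec :: "nat \<Rightarrow> real vec" where
  "const_unit_vec n = vec n (\<lambda>_. 1 / sqrt (real n))"

definition outer_prod :: "real vec \<Rightarrow> real vec \<Rightarrow> real mat" where
  "outer_prod u v = mat (dim_vec u) (dim_vec v) (\<lambda>(i, j). vec_index u i * vec_index v j)"

definition H_mat :: "nat \<Rightarrow> nat \<Rightarrow> nat \<Rightarrow> nat \<Rightarrow> (nat + nat) set set \<Rightarrow> real mat" where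
  "H_mat M N db dw E =
     (1 / sqrt (real dw)) \<cdot>\<^sub>m
       (adj_block M N E -
        sqrt (real db * real dw) \<cdot>\<^sub>m outer_prod (const_unit_vec M) (const_unit_vec N))"

definition X_star :: "nat \<Rightarrow> nat \<Rightarrow> nat \<Rightarrow> nat \<Rightarrow> (nat + nat) set set \<Rightarrow> real mat" where
  "X_star M N db dw E = transpose_mat (H_mat M N db dw E) * H_mat M N db dw E"

text \<open>The real eigenvalues of a square matrix in increasing order, repeated according to algebraic
  multiplicity. For a symmetric \<open>n \<times> n\<close> matrix such as \<open>X_star\<close> this list has length \<open>n\<close>.\<close>

definition sorted_eigenvalues :: "real mat \<Rightarrow> real list" where
  "sorted_eigenvalues A = sorted_list_of_multiset (proots (char_poly A))"

text \<open>The \<open>i\<close>-th smallest eigenvalue, counted from \<open>i = 1\<close>.\<close>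

definition nth_eigenvalue :: "real mat \<Rightarrow> nat \<Rightarrow> real" where
  "nth_eigenvalue A i = sorted_eigenvalues A ! (i - 1)"

definition mp_lower :: "real \<Rightarrow> real" where
  "mp_lower \<gamma> = (1 - sqrt \<gamma>)\<^sup>2"

definition mp_upper :: "real \<Rightarrow> real" where
  "mp_upper \<gamma> = (1 + sqrt \<gamma>)\<^sup>2"

definition mp_density :: "real \<Rightarrow> real \<Rightarrow> real" where
  "mp_density \<gamma> x =
     sqrt ((mp_upper \<gamma> - x) * (x - mp_lower \<gamma>)) / (2 * pi * \<gamma> * x)
       * indicator {mp_lower \<gamma>..mp_upper \<gamma>} x"

text \<open>For \<open>0 < i < N\<close> the defining equation has exactly one solution. For \<open>i = N\<close> every point to the
  right of the support solves it, and \<open>LEAST\<close> selects the upper edge.\<close>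

definition classical_location :: "real \<Rightarrow> nat \<Rightarrow> nat \<Rightarrow> real" where
  "classical_location \<gamma> N i =
     (LEAST x. real i / real N = (LBINT E:{..x}. mp_density \<gamma> E))"

definition D_param :: "nat \<Rightarrow> nat \<Rightarrow> real" where
  "D_param N db = min (real db) ((real N)\<^sup>2 / (real db) ^ 3)"

definition much_greater :: "(nat \<Rightarrow> real) \<Rightarrow> (nat \<Rightarrow> real) \<Rightarrow> bool"  (infix \<open>\<ggreater>\<close> 50) where
  "a \<ggreater> b \<longleftrightarrow> filterlim (\<lambda>n. a n / b n) at_top sequentially"

end

theory Submission
  imports Defs "Jordan_Normal_Form.Spectral_Radius"
begin

text \<open>Under the measure making the entries of the \<open>M \<times> N\<close> zero-one matrix independent Bernoulli
  variables of parameter \<open>db / N\<close>, all biregular graphs have the same weight, and together they have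
  probability at least \<open>1 / ((M * N + 1) * (N + 1) ^ M * (M + 1) ^ N)\<close>: the number of zero-one
  matrices with given row and column sums is largest when the sums are balanced. An event
  whose Bernoulli probability beats this factor therefore fails rarely for the uniform graph as well.

  For the Bernoulli matrix, the sum over \<open>k\<close> of \<open>max (s k) a\<close>, with \<open>s k\<close> the singular values, has
  as subgradient a partial isometry, and the entropy method gives deviations of order
  \<open>N * h\<^sup>2\<close> with probability at most \<open>exp (N - N * h\<^sup>2 * sqrt dw)\<close>. Difference quotients of this
  convex functional of \<open>a\<close> sandwich the empirical distribution function of the singular values between
  shifts by \<open>h\<close> of its expectation. The choice \<open>h = \<xi>\<^sup>2 / D powr (1/4)\<close> makes the exponent of
  order \<open>N * \<xi> ^ 4\<close>, which dominates the cost of conditioning.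

  It remains to compare the expected distribution function with the Marchenko--Pastur law. The two-point
  integration by parts formula and a rank-one-type resolvent perturbation yield the self-consistent
  equation for the expected Stieltjes transform, with an error \<open>O(1 / (db * t ^ 4) + p / t\<^sup>2)\<close> at height
  \<open>t\<close>. Its solution has an explicit antiderivative, so integrating the error along the vertical line above
  a bulk point down to height \<open>\<eta> = \<xi> / D powr (1/4)\<close> compares arctangent-smoothed distribution
  functions; the smoothing costs a dyadic sum of Poisson kernels, that is \<open>O(\<eta> * log N)\<close>.\<close>

text \<open>Conditioning costs exp(O(N log N)), so the exponents of the failure probabilities must
  carry a factor \<open>N\<close>. Bounded differences would lose it: each of the
  \<open>M * N\<close> entries can move the functional by \<open>1 / sqrt dw\<close>. The partial
  isometry saves the factor, since its squared entries sum to at most \<open>N\<close>, and the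
  one-sided entropy bound needs it only at the current sample. The two arguments of the minimum in D
  are what \<open>\<eta>\<close> requires: D \<le> db gives 1 / db \<le> D^(-1), and D \<le> N^2 /
  db^3 gives p = db / N \<le> D^(-1/2), so both errors of the self-consistent equation are bounded
  at height \<open>\<eta>\<close>. The hypothesis on \<xi> yields log N \<le> \<xi> eventually: the
  logarithm in the smoothing then costs just the second factor \<xi> of the rate, and N \<xi>^4
  outweighs both N log N and \<xi> log \<xi>. Singular values, rather than eigenvalues of the Gram
  matrix, keep the subgradient, the integration by parts and the perturbation by one entry linear in
  the matrix.\<close>

section \<open>Concentration on the weighted cube\<close>

text \<open>Expectation under independent coordinates that are one with probability
  \<open>p\<close>; an outcome is the set of its ones. As a finite weighted sum it serves real and
  complex integrands alike and needs no measurability.\<close>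

definition cube_exp :: "'a set \<Rightarrow> real \<Rightarrow> ('a set \<Rightarrow> 'b::real_vector) \<Rightarrow> 'b" where
  "cube_exp I p f = (\<Sum>S\<in>Pow I. (p ^ card S * (1 - p) ^ card (I - S)) *\<^sub>R f S)"

lemma cube_exp_empty [simp]: "cube_exp {} p f = f {}"
  by (simp add: cube_exp_def)

lemma cube_exp_insert:
  assumes "finite I" "e \<notin> I"
  shows "cube_exp (insert e I) p f = cube_exp I p (\<lambda>S. p *\<^sub>R f (insert e S) + (1 - p) *\<^sub>R f S)"
proof -
  have disj: "Pow I \<inter> insert e ` Pow I = {}" using assms(2) by auto
  have inj: "inj_on (insert e) (Pow I)" using assms(2) by (auto simp: inj_on_def)
  have fin: "finite S" if "S \<in> Pow I" for S using that assms(1) finite_subset by auto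
  have "cube_exp (insert e I) p f =
      (\<Sum>S\<in>Pow I. (p ^ card S * (1 - p) ^ card (insert e I - S)) *\<^sub>R f S)
    + (\<Sum>S\<in>Pow I. (p ^ card (insert e S) * (1 - p) ^ card (insert e I - insert e S)) *\<^sub>R f (insert e S))"
    unfolding cube_exp_def Pow_insert
    by (subst sum.union_disjoint) (use assms disj inj in \<open>auto simp: sum.reindex\<close>)
  also have "(\<Sum>S\<in>Pow I. (p ^ card S * (1 - p) ^ card (insert e I - S)) *\<^sub>R f S)
    = (\<Sum>S\<in>Pow I. (p ^ card S * (1 - p) ^ card (I - S)) *\<^sub>R ((1 - p) *\<^sub>R f S))"
  proof (rule sum.cong[OF refl])
    fix S assume "S \<in> Pow I"
    then have "insert e I - S = insert e (I - S)" "e \<notin> I - S" using assms(2) by auto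
    then have "card (insert e I - S) = Suc (card (I - S))" using assms(1) by simp
    then show "(p ^ card S * (1 - p) ^ card (insert e I - S)) *\<^sub>R f S =
      (p ^ card S * (1 - p) ^ card (I - S)) *\<^sub>R ((1 - p) *\<^sub>R f S)" by (simp add: mult_ac)
  qed
  also have "(\<Sum>S\<in>Pow I. (p ^ card (insert e S) * (1 - p) ^ card (insert e I - insert e S)) *\<^sub>R f (insert e S))
    = (\<Sum>S\<in>Pow I. (p ^ card S * (1 - p) ^ card (I - S)) *\<^sub>R (p *\<^sub>R f (insert e S)))"
  proof (rule sum.cong[OF refl])
    fix S assume S: "S \<in> Pow I"
    then have "insert e I - insert e S = I - S" "e \<notin> S" using assms(2) by auto
    then show "(p ^ card (insert e S) * (1 - p) ^ card (insert e I - insert e S)) *\<^sub>R f (insert e S) =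
      (p ^ card S * (1 - p) ^ card (I - S)) *\<^sub>R (p *\<^sub>R f (insert e S))"
      using fin[OF S] by (simp add: mult_ac)
  qed
  finally show ?thesis unfolding cube_exp_def
    by (simp add: sum.distrib[symmetric] scaleR_add_right add_ac)
qed

lemma cube_exp_cong:
  assumes "\<And>S. S \<subseteq> I \<Longrightarrow> f S = g S"
  shows "cube_exp I p f = cube_exp I p g"
  unfolding cube_exp_def using assms by (intro sum.cong) auto

text \<open>Averaging over the coordinate \<open>e\<close> afresh does not change the expectation.
  This form, which treats samples with and without \<open>e\<close> alike, underlies the entropy
  bound and the integration by parts.\<close>

lemma cube_exp_split:
  assumes "finite I" "e \<in> I"
  shows "cube_exp I p f = cube_exp I p (\<lambda>S. p *\<^sub>R f (insert e S) + (1 - p) *\<^sub>R f (S - {e}))"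
proof -
  have I: "I = insert e (I - {e})" using assms by auto
  have fin: "finite (I - {e})" using assms by auto
  have *: "e \<notin> S \<Longrightarrow> insert e S - {e} = S" for S by auto
  show ?thesis
    by (subst (1 2) I, subst (1 2) cube_exp_insert[OF fin])
      (auto intro!: cube_exp_cong simp: subset_Diff_insert * scaleR_add_right scaleR_add_left[symmetric] algebra_simps)
qed

lemma cube_exp_add: "cube_exp I p (\<lambda>S. f S + g S) = cube_exp I p f + cube_exp I p g"
  by (simp add: cube_exp_def scaleR_add_right sum.distrib)

lemma cube_exp_diff: "cube_exp I p (\<lambda>S. f S - g S) = cube_exp I p f - cube_exp I p g"
  by (simp add: cube_exp_def scaleR_diff_right sum_subtractf)

lemma cube_exp_sum: "cube_exp I p (\<lambda>S. \<Sum>x\<in>A. f x S) = (\<Sum>x\<in>A. cube_exp I p (f x))"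
  unfolding cube_exp_def by (simp add: scaleR_sum_right) (rule sum.swap)

lemma cube_exp_cmult: "cube_exp I p (\<lambda>S. c * f S) = c * cube_exp I p f"
  for c :: "'b::real_algebra"
  by (simp add: cube_exp_def sum_distrib_left)

lemma cube_exp_const:
  assumes "finite I" shows "cube_exp I p (\<lambda>_. c) = c"
  using assms
proof (induction I)
  case (insert e I)
  then show ?case by (simp add: cube_exp_insert scaleR_add_left[symmetric])
qed simp

lemma cube_exp_mono:
  fixes f g :: "'a set \<Rightarrow> real"
  assumes "0 \<le> p" "p \<le> 1" "\<And>S. S \<subseteq> I \<Longrightarrow> f S \<le> g S"
  shows "cube_exp I p f \<le> cube_exp I p g"
  unfolding cube_exp_def using assms by (intro sum_mono) (auto intro!: mult_left_mono)

lemma cube_exp_norm: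
  fixes f :: "'a set \<Rightarrow> 'b::real_normed_vector"
  assumes "0 \<le> p" "p \<le> 1"
  shows "norm (cube_exp I p f) \<le> cube_exp I p (\<lambda>S. norm (f S))"
proof -
  have "norm (cube_exp I p f) \<le> (\<Sum>S\<in>Pow I. norm ((p ^ card S * (1 - p) ^ card (I - S)) *\<^sub>R f S))"
    unfolding cube_exp_def by (rule norm_sum)
  also have "\<dots> = cube_exp I p (\<lambda>S. norm (f S))"
    unfolding cube_exp_def using assms by (intro sum.cong) (auto simp: abs_mult)
  finally show ?thesis .
qed

lemma cube_exp_pos:
  fixes f :: "'a set \<Rightarrow> real"
  assumes "finite I" "0 \<le> p" "p \<le> 1" "\<And>S. S \<subseteq> I \<Longrightarrow> f S > 0"
  shows "cube_exp I p f > 0"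
proof -
  have ne: "finite (f ` Pow I)" "f ` Pow I \<noteq> {}" using assms(1) by auto
  have "0 < Min (f ` Pow I)" using assms(4) ne by (subst Min_gr_iff) auto
  also have "\<dots> = cube_exp I p (\<lambda>_. Min (f ` Pow I))" by (simp add: cube_exp_const assms(1))
  also have "\<dots> \<le> cube_exp I p f" using assms by (intro cube_exp_mono) (auto intro!: Min_le)
  finally show ?thesis .
qed

section \<open>Variance on the cube\<close>

lemma two_point_variance:
  fixes a b :: "'b::real_inner"
  shows "p * (norm a)\<^sup>2 + (1 - p) * (norm b)\<^sup>2
    = (norm (p *\<^sub>R a + (1 - p) *\<^sub>R b))\<^sup>2 + p * (1 - p) * (norm (a - b))\<^sup>2"
  unfolding power2_norm_eq_inner
  by (simp add: inner_add_left inner_add_right inner_diff_left inner_diff_right inner_commute algebra_simps power2_eq_square)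

text \<open>Induction on the coordinates. Averaging out \<open>e\<close> yields \<open>g\<close>;
  the variance of \<open>f\<close> is that of \<open>g\<close> plus the mean two-point variance in
  \<open>e\<close>, and the differences of \<open>g\<close> are averages of those of
  \<open>f\<close>, hence controlled by convexity of the squared norm.\<close>

lemma efron_stein_cube:
  fixes f :: "'a set \<Rightarrow> 'b::real_inner"
  assumes "finite I" "0 \<le> p" "p \<le> 1"
  shows "cube_exp I p (\<lambda>S. (norm (f S))\<^sup>2) - (norm (cube_exp I p f))\<^sup>2
    \<le> p * (1 - p) * (\<Sum>e\<in>I. cube_exp I p (\<lambda>S. (norm (f (insert e S) - f (S - {e})))\<^sup>2))"
  using assms(1)
proof (induction I arbitrary: f)
  case empty
  show ?case by simp
next
  case (insert e I)
  define g where "g S = p *\<^sub>R f (insert e S) + (1 - p) *\<^sub>R f S" for S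
  have pq: "0 \<le> p * (1 - p)" using assms by simp
  have conv: "(norm (p *\<^sub>R a + (1 - p) *\<^sub>R b))\<^sup>2 \<le> p * (norm a)\<^sup>2 + (1 - p) * (norm b)\<^sup>2" for a b :: 'b
    unfolding two_point_variance using pq by simp
  have sub: "insert e S - {x} = insert e (S - {x})" if "x \<in> I" for x S
    using that insert by auto
  have t1: "cube_exp (insert e I) p (\<lambda>S. (norm (f S))\<^sup>2)
    = cube_exp I p (\<lambda>S. (norm (g S))\<^sup>2) + p * (1 - p) * cube_exp I p (\<lambda>S. (norm (f (insert e S) - f S))\<^sup>2)"
    using insert(1,2) by (simp add: cube_exp_insert two_point_variance cube_exp_add cube_exp_cmult g_def)
  have t2: "cube_exp I p (\<lambda>S. (norm (g (insert x S) - g (S - {x})))\<^sup>2)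
     \<le> cube_exp (insert e I) p (\<lambda>S. (norm (f (insert x S) - f (S - {x})))\<^sup>2)" if x: "x \<in> I" for x
    unfolding cube_exp_insert[OF insert(1,2)]
  proof (rule cube_exp_mono[OF assms(2,3)])
    fix S assume "S \<subseteq> I"
    have "g (insert x S) - g (S - {x}) = p *\<^sub>R (f (insert x (insert e S)) - f (insert e S - {x}))
       + (1 - p) *\<^sub>R (f (insert x S) - f (S - {x}))"
      unfolding g_def sub[OF x] by (simp add: insert_commute algebra_simps)
    then show "(norm (g (insert x S) - g (S - {x})))\<^sup>2
      \<le> p *\<^sub>R (norm (f (insert x (insert e S)) - f (insert e S - {x})))\<^sup>2
       + (1 - p) *\<^sub>R (norm (f (insert x S) - f (S - {x})))\<^sup>2"
      using conv by simp
  qed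
  have t3: "cube_exp (insert e I) p (\<lambda>S. (norm (f (insert e S) - f (S - {e})))\<^sup>2)
     = cube_exp I p (\<lambda>S. (norm (f (insert e S) - f S))\<^sup>2)"
    unfolding cube_exp_insert[OF insert(1,2)]
  proof (rule cube_exp_cong)
    fix S assume "S \<subseteq> I"
    then have "S - {e} = S" using insert(2) by auto
    then show "p *\<^sub>R (norm (f (insert e (insert e S)) - f (insert e S - {e})))\<^sup>2
      + (1 - p) *\<^sub>R (norm (f (insert e S) - f (S - {e})))\<^sup>2 = (norm (f (insert e S) - f S))\<^sup>2"
      by (simp add: algebra_simps)
  qed
  have "cube_exp (insert e I) p (\<lambda>S. (norm (f S))\<^sup>2) - (norm (cube_exp (insert e I) p f))\<^sup>2
    = cube_exp I p (\<lambda>S. (norm (g S))\<^sup>2) - (norm (cube_exp I p g))\<^sup>2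
      + p * (1 - p) * cube_exp I p (\<lambda>S. (norm (f (insert e S) - f S))\<^sup>2)"
    using insert(1,2) t1 by (simp add: cube_exp_insert g_def[abs_def])
  also have "\<dots> \<le> p * (1 - p) * (\<Sum>x\<in>I. cube_exp I p (\<lambda>S. (norm (g (insert x S) - g (S - {x})))\<^sup>2))
      + p * (1 - p) * cube_exp I p (\<lambda>S. (norm (f (insert e S) - f S))\<^sup>2)"
    using insert.IH by simp
  also have "\<dots> \<le> p * (1 - p) * (\<Sum>x\<in>I. cube_exp (insert e I) p (\<lambda>S. (norm (f (insert x S) - f (S - {x})))\<^sup>2))
      + p * (1 - p) * cube_exp I p (\<lambda>S. (norm (f (insert e S) - f S))\<^sup>2)"
    using t2 pq by (intro add_right_mono mult_left_mono sum_mono) auto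
  finally show ?case using insert(1,2) t3 by (simp add: algebra_simps)
qed

section \<open>Entropy on the cube\<close>

definition two_point_ent :: "real \<Rightarrow> real \<Rightarrow> real \<Rightarrow> real" where
  "two_point_ent p a b = p * (a * ln a) + (1 - p) * (b * ln b)
     - (p * a + (1 - p) * b) * ln (p * a + (1 - p) * b)"

lemma convex_comb_pos: "0 \<le> p \<Longrightarrow> p \<le> 1 \<Longrightarrow> 0 < a \<Longrightarrow> 0 < b \<Longrightarrow> 0 < p * a + (1 - p) * (b::real)"
  by (cases "p = 0") (auto intro!: add_pos_nonneg)

lemma xlnx_tangent:
  fixes a c :: real assumes "a > 0" "c > 0"
  shows "a * ln c + a - c \<le> a * ln a"
proof -
  have "ln (c / a) \<le> c / a - 1" using assms by (intro ln_le_minus_one) auto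
  then have "a * (ln c - ln a) \<le> a * (c / a - 1)" using assms by (intro mult_left_mono) (auto simp: ln_div)
  then show ?thesis using assms by (simp add: algebra_simps)
qed

text \<open>Variational form of the entropy: the mean is the best reference point for the Bregman
  divergence of x ln x, so any other \<open>c\<close> gives an upper bound.\<close>

lemma two_point_ent_le:
  assumes "0 \<le> p" "p \<le> 1" "0 < a" "0 < b" "0 < c"
  shows "two_point_ent p a b \<le> p * (a * ln a - a * ln c - a + c) + (1 - p) * (b * ln b - b * ln c - b + c)"
proof -
  define m where "m = p * a + (1 - p) * b"
  have "m > 0" unfolding m_def using assms by (intro convex_comb_pos) auto
  from xlnx_tangent[OF this assms(5)] have "m * ln c + m - c \<le> m * ln m" .
  then show ?thesis unfolding two_point_ent_def m_def[symmetric]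
    by (simp add: m_def algebra_simps)
qed

text \<open>Each term is x ln (x / u) with \<open>u\<close> the mean, a jointly convex function of
  (x, u), and \<open>u\<close> is linear in the pair of values.\<close>

lemma two_point_ent_convex:
  assumes p: "0 \<le> p" "p \<le> 1" and q: "0 \<le> q" "q \<le> 1" and pos: "0 < a" "0 < b" "0 < a'" "0 < b'"
  shows "two_point_ent p (q * a + (1 - q) * a') (q * b + (1 - q) * b')
    \<le> q * two_point_ent p a b + (1 - q) * two_point_ent p a' b'"
proof -
  define A where "A = q * a + (1 - q) * a'"
  define B where "B = q * b + (1 - q) * b'"
  define m where "m = p * a + (1 - p) * b"
  define m' where "m' = p * a' + (1 - p) * b'"
  define Mm where "Mm = p * A + (1 - p) * B"
  have AB: "A > 0" "B > 0" unfolding A_def B_def using q pos by (auto intro!: convex_comb_pos)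
  have mp: "m > 0" "m' > 0" "Mm > 0" unfolding m_def m'_def Mm_def using p pos AB by (auto intro!: convex_comb_pos)
  \<comment> \<open>The tangent plane of x ln (x / u) at (X, Mm), which by homogeneity of degree one
    has no constant term.\<close>
  have key: "x * ln X - x * ln Mm + x - u * X / Mm \<le> x * ln x - x * ln u"
    if "x > 0" "X > 0" "u > 0" for x X u
  proof -
    have "ln (u * X / (Mm * x)) \<le> u * X / (Mm * x) - 1" using that mp by (intro ln_le_minus_one) auto
    then have "x * ln (u * X / (Mm * x)) \<le> x * (u * X / (Mm * x) - 1)" using that by (intro mult_left_mono) auto
    moreover have "ln (u * X / (Mm * x)) = ln u + ln X - ln Mm - ln x" using that mp by (simp add: ln_div ln_mult)
    moreover have "x * (u * X / (Mm * x) - 1) = u * X / Mm - x" using that mp by (simp add: field_simps)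
    ultimately have "x * (ln u + ln X - ln Mm - ln x) \<le> u * X / Mm - x" by metis
    then show ?thesis by (simp add: algebra_simps)
  qed
  have e1: "two_point_ent p x y = p * (x * ln x - x * ln u) + (1 - p) * (y * ln y - y * ln u)"
    if "u = p * x + (1 - p) * y" for x y u
    unfolding two_point_ent_def that by (simp add: algebra_simps)
  have MmE: "Mm = q * m + (1 - q) * m'" unfolding Mm_def A_def B_def m_def m'_def by (simp add: algebra_simps)
  have k1: "q * (a * ln a - a * ln m) + (1 - q) * (a' * ln a' - a' * ln m') \<ge> A * ln A - A * ln Mm"
  proof -
    have "q * (a * ln a - a * ln m) + (1 - q) * (a' * ln a' - a' * ln m') \<ge>
      q * (a * ln A - a * ln Mm + a - m * A / Mm) + (1 - q) * (a' * ln A - a' * ln Mm + a' - m' * A / Mm)"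
      using key[of a A m] key[of a' A m'] pos AB mp q by (intro add_mono mult_left_mono) auto
    also have "q * (a * ln A - a * ln Mm + a - m * A / Mm) + (1 - q) * (a' * ln A - a' * ln Mm + a' - m' * A / Mm)
      = A * ln A - A * ln Mm + A - (q * m + (1 - q) * m') * A / Mm"
      unfolding A_def by (simp add: algebra_simps add_divide_distrib diff_divide_distrib)
    also have "\<dots> = A * ln A - A * ln Mm" unfolding MmE[symmetric] using mp by simp
    finally show ?thesis .
  qed
  have k2: "q * (b * ln b - b * ln m) + (1 - q) * (b' * ln b' - b' * ln m') \<ge> B * ln B - B * ln Mm"
  proof -
    have "q * (b * ln b - b * ln m) + (1 - q) * (b' * ln b' - b' * ln m') \<ge>
      q * (b * ln B - b * ln Mm + b - m * B / Mm) + (1 - q) * (b' * ln B - b' * ln Mm + b' - m' * B / Mm)"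
      using key[of b B m] key[of b' B m'] pos AB mp q by (intro add_mono mult_left_mono) auto
    also have "q * (b * ln B - b * ln Mm + b - m * B / Mm) + (1 - q) * (b' * ln B - b' * ln Mm + b' - m' * B / Mm)
      = B * ln B - B * ln Mm + B - (q * m + (1 - q) * m') * B / Mm"
      unfolding B_def by (simp add: algebra_simps add_divide_distrib diff_divide_distrib)
    also have "\<dots> = B * ln B - B * ln Mm" unfolding MmE[symmetric] using mp by simp
    finally show ?thesis .
  qed
  have "two_point_ent p A B = p * (A * ln A - A * ln Mm) + (1 - p) * (B * ln B - B * ln Mm)"
    by (rule e1) (simp add: Mm_def)
  also have "\<dots> \<le> p * (q * (a * ln a - a * ln m) + (1 - q) * (a' * ln a' - a' * ln m'))
     + (1 - p) * (q * (b * ln b - b * ln m) + (1 - q) * (b' * ln b' - b' * ln m'))"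
    using k1 k2 p by (intro add_mono mult_left_mono) auto
  also have "\<dots> = q * two_point_ent p a b + (1 - q) * two_point_ent p a' b'"
    by (subst e1[OF m_def], subst e1[OF m'_def]) (simp add: algebra_simps)
  finally show ?thesis unfolding A_def B_def .
qed

text \<open>The induction of \<open>efron_stein_cube\<close> with entropy in place of variance;
  joint convexity of the two-point entropy replaces that of the squared norm.\<close>

lemma entropy_tensorization:
  fixes f :: "'a set \<Rightarrow> real"
  assumes "finite I" "0 \<le> p" "p \<le> 1" "\<And>S. f S > 0"
  shows "cube_exp I p (\<lambda>S. f S * ln (f S)) - cube_exp I p f * ln (cube_exp I p f)
    \<le> (\<Sum>e\<in>I. cube_exp I p (\<lambda>S. two_point_ent p (f (insert e S)) (f (S - {e}))))"
  using assms(1,4)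
proof (induction I arbitrary: f)
  case empty
  show ?case by simp
next
  case (insert e I)
  note fpos = insert.prems
  define g where "g S = p * f (insert e S) + (1 - p) * f S" for S
  have gpos: "g S > 0" for S unfolding g_def using assms(2,3) fpos by (auto intro!: convex_comb_pos)
  have sub: "insert e S - {x} = insert e (S - {x})" if "x \<in> I" for x S
    using that insert by auto
  have t0: "cube_exp (insert e I) p f = cube_exp I p g"
    using insert(1,2) by (simp add: cube_exp_insert g_def[abs_def])
  have t1: "cube_exp (insert e I) p (\<lambda>S. f S * ln (f S))
    = cube_exp I p (\<lambda>S. g S * ln (g S)) + cube_exp I p (\<lambda>S. two_point_ent p (f (insert e S)) (f S))"
    using insert(1,2) by (simp add: cube_exp_insert cube_exp_add[symmetric] two_point_ent_def g_def)
  have t2: "cube_exp I p (\<lambda>S. two_point_ent p (g (insert x S)) (g (S - {x})))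
     \<le> cube_exp (insert e I) p (\<lambda>S. two_point_ent p (f (insert x S)) (f (S - {x})))" if x: "x \<in> I" for x
    unfolding cube_exp_insert[OF insert(1,2)]
  proof (rule cube_exp_mono[OF assms(2,3)])
    fix S assume "S \<subseteq> I"
    show "two_point_ent p (g (insert x S)) (g (S - {x}))
      \<le> p *\<^sub>R two_point_ent p (f (insert x (insert e S))) (f (insert e S - {x}))
       + (1 - p) *\<^sub>R two_point_ent p (f (insert x S)) (f (S - {x}))"
      unfolding g_def sub[OF x] insert_commute[of e x] real_scaleR_def
      using assms(2,3) fpos by (intro two_point_ent_convex) auto
  qed
  have t3: "cube_exp (insert e I) p (\<lambda>S. two_point_ent p (f (insert e S)) (f (S - {e})))
     = cube_exp I p (\<lambda>S. two_point_ent p (f (insert e S)) (f S))"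
    unfolding cube_exp_insert[OF insert(1,2)]
  proof (rule cube_exp_cong)
    fix S assume "S \<subseteq> I"
    then have "S - {e} = S" using insert(2) by auto
    then show "p *\<^sub>R two_point_ent p (f (insert e (insert e S))) (f (insert e S - {e}))
      + (1 - p) *\<^sub>R two_point_ent p (f (insert e S)) (f (S - {e})) = two_point_ent p (f (insert e S)) (f S)"
      by (simp add: algebra_simps)
  qed
  have "cube_exp (insert e I) p (\<lambda>S. f S * ln (f S)) - cube_exp (insert e I) p f * ln (cube_exp (insert e I) p f)
    = (cube_exp I p (\<lambda>S. g S * ln (g S)) - cube_exp I p g * ln (cube_exp I p g))
      + cube_exp I p (\<lambda>S. two_point_ent p (f (insert e S)) (f S))"
    unfolding t0 t1 by simp
  also have "\<dots> \<le> (\<Sum>x\<in>I. cube_exp I p (\<lambda>S. two_point_ent p (g (insert x S)) (g (S - {x}))))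
      + cube_exp I p (\<lambda>S. two_point_ent p (f (insert e S)) (f S))"
    using insert.IH[of g] gpos by simp
  also have "\<dots> \<le> (\<Sum>x\<in>I. cube_exp (insert e I) p (\<lambda>S. two_point_ent p (f (insert x S)) (f (S - {x}))))
      + cube_exp I p (\<lambda>S. two_point_ent p (f (insert e S)) (f S))"
    using t2 by (intro add_right_mono sum_mono) auto
  finally show ?case using insert(1,2) t3 by simp
qed

section \<open>Exponential moments and tails\<close>

lemma exp_minus_le_quadratic:
  fixes u :: real assumes "\<bar>u\<bar> \<le> 1" shows "exp (- u) \<le> 1 - u + u\<^sup>2"
proof (cases "u \<ge> 0")
  case True
  have "exp (- u) \<le> 1 / (1 + u)"
    using exp_ge_add_one_self[of u] True by (simp add: exp_minus inverse_eq_divide frac_le)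
  also have "\<dots> \<le> 1 - u + u\<^sup>2"
  proof -
    have "1 \<le> (1 - u + u\<^sup>2) * (1 + u)" using True by (simp add: algebra_simps power2_eq_square)
    then show ?thesis using True by (simp add: divide_le_eq)
  qed
  finally show ?thesis .
next
  case False
  then show ?thesis using exp_bound[of "- u"] assms by simp
qed

text \<open>Taking the value at the endpoint with the smaller argument as reference annihilates that
  endpoint's term, so only the larger one pays. The sign of \<open>t\<close> is free, which later
  gives both tails.\<close>

lemma two_point_ent_exp:
  fixes x y t :: real
  assumes "0 \<le> p" "p \<le> 1" "\<bar>t\<bar> * \<bar>x - y\<bar> \<le> 1"
  shows "two_point_ent p (exp (t * x)) (exp (t * y))
    \<le> t\<^sup>2 * (p * (exp (t * x) * (max 0 (x - y))\<^sup>2) + (1 - p) * (exp (t * y) * (max 0 (y - x))\<^sup>2))"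
proof -
  have key: "exp (t * a) * (t * a) - exp (t * a) * (t * b) - exp (t * a) + exp (t * b)
     \<le> t\<^sup>2 * (exp (t * a) * (a - b)\<^sup>2)" if "\<bar>t\<bar> * \<bar>a - b\<bar> \<le> 1" for a b
  proof -
    have "exp (- (t * (a - b))) \<le> 1 - t * (a - b) + (t * (a - b))\<^sup>2"
      using that by (intro exp_minus_le_quadratic) (simp add: abs_mult)
    then have "exp (t * a) * exp (- (t * (a - b))) \<le> exp (t * a) * (1 - t * (a - b) + (t * (a - b))\<^sup>2)"
      by (intro mult_left_mono) auto
    also have "exp (t * a) * exp (- (t * (a - b))) = exp (t * b)"
      by (simp add: exp_add[symmetric] algebra_simps)
    finally show ?thesis by (simp add: algebra_simps power2_eq_square)
  qed
  show ?thesis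
  proof (cases "x \<ge> y")
    case True
    have "two_point_ent p (exp (t * x)) (exp (t * y)) \<le>
      p * (exp (t * x) * (t * x) - exp (t * x) * (t * y) - exp (t * x) + exp (t * y))"
      using two_point_ent_le[of p "exp (t * x)" "exp (t * y)" "exp (t * y)"] assms(1,2) by simp
    also have "\<dots> \<le> p * (t\<^sup>2 * (exp (t * x) * (x - y)\<^sup>2))"
      using key[of x y] assms by (intro mult_left_mono) auto
    finally have "two_point_ent p (exp (t * x)) (exp (t * y)) \<le> p * (t\<^sup>2 * (exp (t * x) * (x - y)\<^sup>2))" .
    moreover have "max 0 (x - y) = x - y" "max 0 (y - x) = 0" using True by auto
    ultimately show ?thesis by (simp add: algebra_simps)
  next
    case False
    have "two_point_ent p (exp (t * x)) (exp (t * y)) \<le>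
      (1 - p) * (exp (t * y) * (t * y) - exp (t * y) * (t * x) - exp (t * y) + exp (t * x))"
      using two_point_ent_le[of p "exp (t * x)" "exp (t * y)" "exp (t * x)"] assms(1,2) by simp
    also have "\<dots> \<le> (1 - p) * (t\<^sup>2 * (exp (t * y) * (y - x)\<^sup>2))"
      using key[of y x] assms by (intro mult_left_mono) (auto simp: abs_minus_commute)
    finally have "two_point_ent p (exp (t * x)) (exp (t * y)) \<le> (1 - p) * (t\<^sup>2 * (exp (t * y) * (y - x)\<^sup>2))" .
    moreover have "max 0 (y - x) = y - x" "max 0 (x - y) = 0" using False by auto
    ultimately show ?thesis by (simp add: algebra_simps)
  qed
qed

definition flip :: "'a \<Rightarrow> 'a set \<Rightarrow> 'a set" where
  "flip e S = (if e \<in> S then S - {e} else insert e S)"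

text \<open>A modified logarithmic Sobolev inequality in which only flips that decrease
  \<open>Z\<close> count. Such a decrease is bounded by a subgradient at \<open>S\<close> itself,
  with no reference to the flipped sample.\<close>

lemma entropy_exp_le:
  fixes Z :: "'a set \<Rightarrow> real"
  assumes "finite I" "0 \<le> p" "p \<le> 1"
    and lip: "\<And>e S. e \<in> I \<Longrightarrow> S \<subseteq> I \<Longrightarrow> \<bar>t\<bar> * \<bar>Z (insert e S) - Z (S - {e})\<bar> \<le> 1"
    and grad: "\<And>S. S \<subseteq> I \<Longrightarrow> (\<Sum>e\<in>I. (max 0 (Z S - Z (flip e S)))\<^sup>2) \<le> v"
  shows "cube_exp I p (\<lambda>S. exp (t * Z S) * (t * Z S))
      - cube_exp I p (\<lambda>S. exp (t * Z S)) * ln (cube_exp I p (\<lambda>S. exp (t * Z S)))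
    \<le> t\<^sup>2 * v * cube_exp I p (\<lambda>S. exp (t * Z S))"
proof -
  have step: "cube_exp I p (\<lambda>S. two_point_ent p (exp (t * Z (insert e S))) (exp (t * Z (S - {e}))))
     \<le> t\<^sup>2 * cube_exp I p (\<lambda>S. exp (t * Z S) * (max 0 (Z S - Z (flip e S)))\<^sup>2)" if e: "e \<in> I" for e
  proof -
    have "cube_exp I p (\<lambda>S. two_point_ent p (exp (t * Z (insert e S))) (exp (t * Z (S - {e}))))
      \<le> cube_exp I p (\<lambda>S. t\<^sup>2 * (p * (exp (t * Z (insert e S)) * (max 0 (Z (insert e S) - Z (S - {e})))\<^sup>2)
        + (1 - p) * (exp (t * Z (S - {e})) * (max 0 (Z (S - {e}) - Z (insert e S)))\<^sup>2)))"
      using assms(2,3) lip[OF e] by (intro cube_exp_mono two_point_ent_exp) auto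
    also have "\<dots> = t\<^sup>2 * cube_exp I p (\<lambda>S. p *\<^sub>R (exp (t * Z (insert e S)) * (max 0 (Z (insert e S) - Z (flip e (insert e S))))\<^sup>2)
        + (1 - p) *\<^sub>R (exp (t * Z (S - {e})) * (max 0 (Z (S - {e}) - Z (flip e (S - {e}))))\<^sup>2))"
      by (simp add: cube_exp_cmult flip_def insert_Diff_if)
    also have "\<dots> = t\<^sup>2 * cube_exp I p (\<lambda>S. exp (t * Z S) * (max 0 (Z S - Z (flip e S)))\<^sup>2)"
      by (subst (2) cube_exp_split[OF assms(1) e]) simp
    finally show ?thesis .
  qed
  have "cube_exp I p (\<lambda>S. exp (t * Z S) * (t * Z S))
      - cube_exp I p (\<lambda>S. exp (t * Z S)) * ln (cube_exp I p (\<lambda>S. exp (t * Z S)))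
     \<le> (\<Sum>e\<in>I. cube_exp I p (\<lambda>S. two_point_ent p (exp (t * Z (insert e S))) (exp (t * Z (S - {e})))))"
    using entropy_tensorization[OF assms(1-3), of "\<lambda>S. exp (t * Z S)"] by simp
  also have "\<dots> \<le> (\<Sum>e\<in>I. t\<^sup>2 * cube_exp I p (\<lambda>S. exp (t * Z S) * (max 0 (Z S - Z (flip e S)))\<^sup>2))"
    using step by (rule sum_mono)
  also have "\<dots> = t\<^sup>2 * cube_exp I p (\<lambda>S. exp (t * Z S) * (\<Sum>e\<in>I. (max 0 (Z S - Z (flip e S)))\<^sup>2))"
    by (simp add: sum_distrib_left[symmetric] cube_exp_sum[symmetric])
  also have "\<dots> \<le> t\<^sup>2 * cube_exp I p (\<lambda>S. v * exp (t * Z S))"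
  proof (intro mult_left_mono cube_exp_mono assms)
    fix S assume "S \<subseteq> I"
    then show "exp (t * Z S) * (\<Sum>e\<in>I. (max 0 (Z S - Z (flip e S)))\<^sup>2) \<le> v * exp (t * Z S)"
      using grad[of S] by (simp add: mult.commute)
  qed auto
  finally show ?thesis by (simp add: cube_exp_cmult)
qed

text \<open>Herbst's argument: the entropy bound is a differential inequality for the logarithmic moment
  generating function divided by its argument.\<close>

lemma cube_mgf_bound:
  fixes Z :: "'a set \<Rightarrow> real"
  assumes "finite I" "0 \<le> p" "p \<le> 1"
    and lip: "\<And>e S. e \<in> I \<Longrightarrow> S \<subseteq> I \<Longrightarrow> \<bar>T\<bar> * \<bar>Z (insert e S) - Z (S - {e})\<bar> \<le> 1"
    and grad: "\<And>S. S \<subseteq> I \<Longrightarrow> (\<Sum>e\<in>I. (max 0 (Z S - Z (flip e S)))\<^sup>2) \<le> v"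
  shows "cube_exp I p (\<lambda>S. exp (T * Z S)) \<le> exp (T * cube_exp I p Z + T\<^sup>2 * v)"
proof -
  define F where "F u = cube_exp I p (\<lambda>S. exp (u * T * Z S))" for u
  define F' where "F' u = cube_exp I p (\<lambda>S. exp (u * T * Z S) * (T * Z S))" for u
  define K where "K u = ln (F u)" for u
  have Fpos: "F u > 0" for u unfolding F_def using assms(1-3) by (intro cube_exp_pos) auto
  have dF: "(F has_real_derivative F' u) (at u)" for u
    unfolding F_def F'_def cube_exp_def
    by (auto intro!: derivative_eq_intros sum.cong simp: mult_ac)
  have dK: "(K has_real_derivative F' u / F u) (at u)" for u
    unfolding K_def using Fpos[of u] dF[of u] by (auto intro!: derivative_eq_intros)
  have K0: "K 0 = 0" by (simp add: K_def F_def cube_exp_const assms(1))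
  have F'0: "F' 0 / F 0 = T * cube_exp I p Z"
    by (simp add: F'_def F_def cube_exp_const assms(1) cube_exp_cmult)
  have ent: "u * (F' u / F u) - K u \<le> u\<^sup>2 * T\<^sup>2 * v" if "0 \<le> u" "u \<le> 1" for u
  proof -
    have "cube_exp I p (\<lambda>S. exp (u * T * Z S) * (u * T * Z S)) - F u * ln (F u) \<le> (u * T)\<^sup>2 * v * F u"
      unfolding F_def
    proof (rule entropy_exp_le[OF assms(1-3) _ grad])
      fix e S assume "e \<in> I" "S \<subseteq> I"
      have "\<bar>u * T\<bar> * \<bar>Z (insert e S) - Z (S - {e})\<bar> \<le> 1 * (\<bar>T\<bar> * \<bar>Z (insert e S) - Z (S - {e})\<bar>)"
        using that by (simp add: abs_mult mult.assoc mult_left_le_one_le)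
      also have "\<dots> \<le> 1" using lip[OF \<open>e \<in> I\<close> \<open>S \<subseteq> I\<close>] by simp
      finally show "\<bar>u * T\<bar> * \<bar>Z (insert e S) - Z (S - {e})\<bar> \<le> 1" .
    qed auto
    also have "cube_exp I p (\<lambda>S. exp (u * T * Z S) * (u * T * Z S)) = u * F' u"
      unfolding F'_def cube_exp_cmult[symmetric] by (simp add: mult_ac)
    finally have "(u * F' u - F u * K u) / F u \<le> ((u * T)\<^sup>2 * v * F u) / F u"
      unfolding K_def using Fpos[of u] by (intro divide_right_mono) auto
    then show ?thesis using Fpos[of u] by (simp add: diff_divide_distrib power_mult_distrib)
  qed
  \<comment> \<open>The derivative of \<open>K u / u\<close> is the left side of \<open>ent\<close>
    divided by \<open>u\<^sup>2\<close>, hence at most \<open>T\<^sup>2 * v\<close>; its limit at 0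
    is the mean of \<open>T * Z\<close>.\<close>
  define q where "q u = K u / u - u * T\<^sup>2 * v" for u
  have qdec: "q 1 \<le> q u" if u: "0 < u" "u \<le> 1" for u
  proof (rule DERIV_nonpos_imp_nonincreasing[of u 1 q])
    fix x assume x: "u \<le> x" "x \<le> 1"
    have "(q has_real_derivative ((F' x / F x) * x - K x) / x\<^sup>2 - T\<^sup>2 * v) (at x)"
      unfolding q_def using x u dK[of x] by (auto intro!: derivative_eq_intros simp: power2_eq_square)
    moreover have "((F' x / F x) * x - K x) / x\<^sup>2 - T\<^sup>2 * v \<le> 0"
      using ent[of x] x u by (simp add: divide_le_eq mult_ac)
    ultimately show "\<exists>y. (q has_real_derivative y) (at x) \<and> y \<le> 0" by blast
  qed (use u in auto)
  have lim: "((\<lambda>u. K u / u - u * T\<^sup>2 * v) \<longlongrightarrow> T * cube_exp I p Z - 0 * T\<^sup>2 * v) (at_right 0)"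
  proof (intro tendsto_intros)
    have "((\<lambda>u. (K u - K 0) / (u - 0)) \<longlongrightarrow> F' 0 / F 0) (at 0)"
      using dK[of 0] unfolding has_field_derivative_iff by simp
    then show "((\<lambda>u. K u / u) \<longlongrightarrow> T * cube_exp I p Z) (at_right 0)"
      unfolding F'0 K0 by (simp add: filterlim_at_split)
  qed
  have "q 1 \<le> T * cube_exp I p Z - 0 * T\<^sup>2 * v"
  proof (rule tendsto_lowerbound[OF lim])
    have "\<forall>\<^sub>F u in at_right (0::real). u \<in> {0<..<1}"
      by (rule eventually_at_right_real) simp
    then show "\<forall>\<^sub>F u in at_right 0. q 1 \<le> K u / u - u * T\<^sup>2 * v"
      by eventually_elim (use qdec in \<open>auto simp: q_def\<close>)
  qed simp
  then have "K 1 \<le> T * cube_exp I p Z + T\<^sup>2 * v" by (simp add: q_def)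
  then have "exp (K 1) \<le> exp (T * cube_exp I p Z + T\<^sup>2 * v)" by simp
  moreover have "exp (K 1) = F 1" using Fpos[of 1] by (simp add: K_def)
  ultimately show ?thesis by (simp add: F_def)
qed

text \<open>Exponential Markov inequality for both signs at one given \<open>T\<close>. There is no
  optimization over \<open>T\<close>: the increment condition caps it, and the application takes the
  largest value that it knows to be admissible.\<close>

lemma cube_concentration:
  fixes Z :: "'a set \<Rightarrow> real"
  assumes "finite I" "0 \<le> p" "p \<le> 1" "0 \<le> T"
    and lip: "\<And>e S. e \<in> I \<Longrightarrow> S \<subseteq> I \<Longrightarrow> T * \<bar>Z (insert e S) - Z (S - {e})\<bar> \<le> 1"
    and grad: "\<And>S. S \<subseteq> I \<Longrightarrow> (\<Sum>e\<in>I. (max 0 (Z S - Z (flip e S)))\<^sup>2) \<le> v"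
  shows "cube_exp I p (\<lambda>S. if \<bar>Z S - cube_exp I p Z\<bar> \<ge> r then 1 else 0) \<le> 2 * exp (T\<^sup>2 * v - T * r)"
proof -
  define m where "m = cube_exp I p Z"
  have up: "cube_exp I p (\<lambda>S. exp (T * Z S)) \<le> exp (T * m + T\<^sup>2 * v)"
    unfolding m_def using cube_mgf_bound[of I p T Z v] assms by auto
  have lo: "cube_exp I p (\<lambda>S. exp (- T * Z S)) \<le> exp (- T * m + T\<^sup>2 * v)"
    unfolding m_def using cube_mgf_bound[of I p "- T" Z v] assms by auto
  have "cube_exp I p (\<lambda>S. if \<bar>Z S - m\<bar> \<ge> r then 1 else 0)
    \<le> cube_exp I p (\<lambda>S. exp (- T * m - T * r) * exp (T * Z S) + exp (T * m - T * r) * exp (- T * Z S))"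
  proof (rule cube_exp_mono[OF assms(2,3)])
    fix S assume "S \<subseteq> I"
    show "(if \<bar>Z S - m\<bar> \<ge> r then 1 else 0)
      \<le> exp (- T * m - T * r) * exp (T * Z S) + exp (T * m - T * r) * exp (- T * Z S)"
    proof (cases "\<bar>Z S - m\<bar> \<ge> r")
      case True
      then consider "Z S \<ge> m + r" | "Z S \<le> m - r" by linarith
      then show ?thesis
      proof cases
        case 1
        then have "T * (m + r) \<le> T * Z S" using assms(4) by (intro mult_left_mono)
        then have "1 \<le> exp (- T * m - T * r + T * Z S)" by (simp add: algebra_simps)
        then show ?thesis unfolding exp_add using True by (simp add: add_increasing2)
      next
        case 2
        then have "T * Z S \<le> T * (m - r)" using assms(4) by (intro mult_left_mono)
        then have "1 \<le> exp (T * m - T * r + - T * Z S)" by (simp add: algebra_simps)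
        then show ?thesis unfolding exp_add using True by (simp add: add_increasing)
      qed
    qed simp
  qed
  also have "\<dots> \<le> exp (- T * m - T * r) * exp (T * m + T\<^sup>2 * v) + exp (T * m - T * r) * exp (- T * m + T\<^sup>2 * v)"
    unfolding cube_exp_add cube_exp_cmult using up lo by (intro add_mono mult_left_mono) auto
  also have "\<dots> = 2 * exp (T\<^sup>2 * v - T * r)" by (simp add: exp_add[symmetric] algebra_simps)
  finally show ?thesis unfolding m_def .
qed

section \<open>Zero-one matrices with prescribed margins\<close>

definition row_deg :: "('a \<times> 'b) set \<Rightarrow> 'a \<Rightarrow> nat" where "row_deg S i = card {j. (i, j) \<in> S}"
definition col_deg :: "('a \<times> 'b) set \<Rightarrow> 'b \<Rightarrow> nat" where "col_deg S j = card {i. (i, j) \<in> S}"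

definition margin_sets :: "'a set \<Rightarrow> 'b set \<Rightarrow> ('a \<Rightarrow> nat) \<Rightarrow> ('b \<Rightarrow> nat) \<Rightarrow> ('a \<times> 'b) set set" where
  "margin_sets A B r c = {S. S \<subseteq> A \<times> B \<and> (\<forall>i\<in>A. row_deg S i = r i) \<and> (\<forall>j\<in>B. col_deg S j = c j)}"

lemma finite_margin_sets: "finite A \<Longrightarrow> finite B \<Longrightarrow> finite (margin_sets A B r c)"
  unfolding margin_sets_def by (rule finite_subset[of _ "Pow (A \<times> B)"]) auto

text \<open>Above the middle, binomial coefficients decrease with the size of the subset. Sizes are
  written as \<open>2 * card U = card D + e\<close>, so that an odd right side just makes the first
  family empty.\<close>

lemma ex_inj_smaller_subsets:
  assumes "finite D" "2 \<le> e"
  shows "\<exists>\<phi>. inj_on \<phi> {U. U \<subseteq> D \<and> 2 * card U = card D + e} \<and>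
     \<phi> ` {U. U \<subseteq> D \<and> 2 * card U = card D + e} \<subseteq> {U. U \<subseteq> D \<and> 2 * card U + 2 = card D + e}"
proof (cases "even (card D + e)")
  case False
  have "2 * card U \<noteq> card D + e" for U :: "'a set" using False by (metis dvd_triv_left)
  then show ?thesis by simp
next
  case True
  then obtain x where x: "card D + e = 2 * x" by (elim evenE)
  have 1: "{U. U \<subseteq> D \<and> 2 * card U = card D + e} = {U. U \<subseteq> D \<and> card U = x}" using x by auto
  have 2: "{U. U \<subseteq> D \<and> 2 * card U + 2 = card D + e} = {U. U \<subseteq> D \<and> card U = x - 1}" using x assms(2) by auto
  have "card D choose x \<le> card D choose (x - 1)"
  proof (cases "x \<le> card D")
    case True
    then show ?thesis using x assms(2) by (intro binomial_antimono) auto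
  qed (simp add: binomial_eq_0)
  then have le: "card {U. U \<subseteq> D \<and> card U = x} \<le> card {U. U \<subseteq> D \<and> card U = x - 1}"
    by (simp add: n_subsets[OF assms(1)])
  have fin: "finite {U. U \<subseteq> D \<and> card U = y}" for y
    by (rule finite_subset[of _ "Pow D"]) (use assms(1) in auto)
  from card_le_inj[OF fin fin le] show ?thesis unfolding 1 2 by (simp only: conj_commute)
qed

text \<open>Only the rows in which the columns \<open>j1\<close> and \<open>j2\<close> differ matter. Among these, the rows with entry one
  in column \<open>j1\<close> form more than half, so they inject into the subsets with one element fewer.\<close>

lemma card_margin_sets_balance_step:
  fixes A :: "'a set" and B :: "'b set"
  assumes fin: "finite A" "finite B" and j: "j1 \<in> B" "j2 \<in> B" "c j2 + 2 \<le> c j1"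
  shows "card (margin_sets A B r c) \<le> card (margin_sets A B r (c(j1 := c j1 - 1, j2 := c j2 + 1)))"
proof -
  have ne: "j1 \<noteq> j2" using j by auto
  define e where "e = c j1 - c j2"
  have e2: "e \<ge> 2" using j by (simp add: e_def)
  define D where "D S = {i. ((i, j1) \<in> S) \<noteq> ((i, j2) \<in> S)}" for S :: "('a \<times> 'b) set"
  define U where "U S = {i \<in> D S. (i, j1) \<in> S}" for S :: "('a \<times> 'b) set"
  define K where "K S = {i. (i, j1) \<in> S \<and> (i, j2) \<in> S}" for S :: "('a \<times> 'b) set"
  \<comment> \<open>One injection per set \<open>D0\<close> of rows, chosen before \<open>S\<close>:
    the modified matrix has the same \<open>D\<close>, so the injection that was used can be
    identified and undone.\<close>
  have "\<forall>D0. \<exists>\<phi>. finite D0 \<longrightarrow> inj_on \<phi> {V. V \<subseteq> D0 \<and> 2 * card V = card D0 + e} \<and>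
     \<phi> ` {V. V \<subseteq> (D0::'a set) \<and> 2 * card V = card D0 + e} \<subseteq> {V. V \<subseteq> D0 \<and> 2 * card V + 2 = card D0 + e}"
    using ex_inj_smaller_subsets[OF _ e2] by blast
  then obtain \<phi> where \<phi>0: "\<forall>D0. finite D0 \<longrightarrow> inj_on (\<phi> D0) {V. V \<subseteq> D0 \<and> 2 * card V = card D0 + e} \<and>
     \<phi> D0 ` {V. V \<subseteq> (D0::'a set) \<and> 2 * card V = card D0 + e} \<subseteq> {V. V \<subseteq> D0 \<and> 2 * card V + 2 = card D0 + e}"
    by (rule choice[THEN exE])
  have \<phi>: "inj_on (\<phi> D0) {V. V \<subseteq> D0 \<and> 2 * card V = card D0 + e}"
    "\<And>V. V \<subseteq> D0 \<Longrightarrow> 2 * card V = card D0 + e \<Longrightarrow> \<phi> D0 V \<subseteq> D0 \<and> 2 * card (\<phi> D0 V) + 2 = card D0 + e"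
    if "finite D0" for D0
    using \<phi>0[rule_format, OF that] by (auto simp: image_subset_iff)
  \<comment> \<open>On the rows of \<open>D S\<close> exactly one of the two columns holds a one;
    \<open>sw S V\<close> puts it into \<open>j1\<close> for the rows in \<open>V\<close> and into
    \<open>j2\<close> for the others. Row sums, \<open>D S\<close> and \<open>K S\<close> survive,
    and \<open>V\<close> can be read off.\<close>
  define sw where "sw S V = {(i, j). (i, j) \<in> S \<and> \<not> (i \<in> D S \<and> (j = j1 \<or> j = j2))} \<union> V \<times> {j1} \<union> (D S - V) \<times> {j2}"
    for S V
  have sw_j1: "(i, j1) \<in> sw S V \<longleftrightarrow> i \<in> V \<or> i \<in> K S" if "V \<subseteq> D S" for i S V
    using that ne by (auto simp: sw_def D_def K_def)
  have sw_j2: "(i, j2) \<in> sw S V \<longleftrightarrow> i \<in> D S - V \<or> i \<in> K S" if "V \<subseteq> D S" for i S V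
    using that ne by (auto simp: sw_def D_def K_def)
  have sw_j: "(i, j) \<in> sw S V \<longleftrightarrow> (i, j) \<in> S" if "j \<noteq> j1" "j \<noteq> j2" for i j S V
    using that by (auto simp: sw_def)
  have DK: "D S \<inter> K S = {}" for S by (auto simp: D_def K_def)
  have sw_D: "D (sw S V) = D S" "U (sw S V) = V" if "V \<subseteq> D S" for S V
    using that sw_j1[OF that] sw_j2[OF that] DK[of S] unfolding D_def[of "sw S V"] U_def[of "sw S V"] by blast+
  define f where "f S = sw S (\<phi> (D S) (U S))" for S
  let ?c' = "c(j1 := c j1 - 1, j2 := c j2 + 1)"
  have S_facts: "finite (D S)" "finite (K S)" "U S \<subseteq> D S" "2 * card (U S) = card (D S) + e"
      "c j1 = card (K S) + card (U S)" "c j2 + card (U S) = card (K S) + card (D S)"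
    if S: "S \<in> margin_sets A B r c" for S
  proof -
    have sub: "S \<subseteq> A \<times> B" using S by (auto simp: margin_sets_def)
    show finD: "finite (D S)" by (rule finite_subset[OF _ fin(1)]) (use sub in \<open>auto simp: D_def\<close>)
    show finK: "finite (K S)" by (rule finite_subset[OF _ fin(1)]) (use sub in \<open>auto simp: K_def\<close>)
    show UD: "U S \<subseteq> D S" by (auto simp: U_def)
    have finU: "finite (U S)" using UD finD finite_subset by auto
    have "{i. (i, j1) \<in> S} = K S \<union> U S" by (auto simp: K_def U_def D_def)
    then have "col_deg S j1 = card (K S) + card (U S)"
      unfolding col_deg_def using finK finU DK[of S] UD by (subst card_Un_disjoint[symmetric]) auto
    then show c1: "c j1 = card (K S) + card (U S)" using S j by (auto simp: margin_sets_def)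
    have "{i. (i, j2) \<in> S} = K S \<union> (D S - U S)" by (auto simp: K_def U_def D_def)
    then have "col_deg S j2 = card (K S) + card (D S - U S)"
      unfolding col_deg_def using finK finD DK[of S] by (subst card_Un_disjoint[symmetric]) auto
    then have c2: "c j2 = card (K S) + card (D S - U S)" using S j by (auto simp: margin_sets_def)
    have cd: "card (D S - U S) = card (D S) - card (U S)" "card (U S) \<le> card (D S)"
      using UD finD finU by (auto simp: card_Diff_subset card_mono)
    show "c j2 + card (U S) = card (K S) + card (D S)" using c2 cd by simp
    show "2 * card (U S) = card (D S) + e" using c1 c2 cd j(3) unfolding e_def by simp
  qed
  have V_facts: "\<phi> (D S) (U S) \<subseteq> D S" "2 * card (\<phi> (D S) (U S)) + 2 = card (D S) + e"
    if S: "S \<in> margin_sets A B r c" for S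
    using \<phi>(2)[OF S_facts(1)[OF S] S_facts(3)[OF S] S_facts(4)[OF S]] by auto
  have "f ` margin_sets A B r c \<subseteq> margin_sets A B r ?c'"
  proof (rule image_subsetI)
    fix S assume S: "S \<in> margin_sets A B r c"
    define V where "V = \<phi> (D S) (U S)"
    note V = V_facts[OF S, folded V_def]
    note SF = S_facts[OF S]
    have finV: "finite V" using V(1) SF(1) finite_subset by auto
    have fS: "f S = sw S V" by (simp add: f_def V_def)
    have sub: "S \<subseteq> A \<times> B" using S by (auto simp: margin_sets_def)
    have DA: "D S \<subseteq> A" using sub by (auto simp: D_def)
    have "sw S V \<subseteq> A \<times> B" using sub DA V(1) j by (auto simp: sw_def)
    moreover have "row_deg (sw S V) i = r i" if "i \<in> A" for i
    proof -
      let ?R = "{j. (i, j) \<in> S}" let ?R' = "{j. (i, j) \<in> sw S V}"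
      have finR: "finite ?R" by (rule finite_subset[OF _ fin(2)]) (use sub in auto)
      have same: "?R' - {j1, j2} = ?R - {j1, j2}" using sw_j by auto
      have "card ?R' = card ?R"
      proof (cases "i \<in> D S")
        case False
        then have "?R' = ?R" by (auto simp: sw_def dest: subsetD[OF V(1)])
        then show ?thesis by simp
      next
        case True
        have "i \<notin> K S" using True DK by auto
        have "\<exists>x\<in>{j1, j2}. ?R = insert x (?R - {j1, j2})" using True by (auto simp: D_def)
        then have 1: "card ?R = Suc (card (?R - {j1, j2}))"
          by (metis (no_types, lifting) DiffD2 card_insert_disjoint finR finite_Diff)
        have "\<exists>x\<in>{j1, j2}. ?R' = insert x (?R' - {j1, j2})"
          using True \<open>i \<notin> K S\<close> sw_j1[OF V(1), of i] sw_j2[OF V(1), of i] by (cases "i \<in> V") auto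
        then have 2: "card ?R' = Suc (card (?R' - {j1, j2}))"
          by (metis (no_types, lifting) DiffD2 card_insert_disjoint finR finite_Diff same)
        show ?thesis using 1 2 same by simp
      qed
      then show ?thesis using S that by (simp add: margin_sets_def row_deg_def)
    qed
    moreover have "col_deg (sw S V) j = ?c' j" if jB: "j \<in> B" for j
    proof -
      consider "j = j1" | "j = j2" | "j \<noteq> j1" "j \<noteq> j2" by auto
      then show ?thesis
      proof cases
        case 1
        have "{i. (i, j1) \<in> sw S V} = K S \<union> V" using sw_j1[OF V(1)] by auto
        moreover have "K S \<inter> V = {}" using DK[of S] V(1) by auto
        ultimately have "col_deg (sw S V) j1 = card (K S) + card V"
          unfolding col_deg_def using SF(2) finV by (simp add: card_Un_disjoint)
        then show ?thesis using 1 ne SF V by simp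
      next
        case 2
        have "{i. (i, j2) \<in> sw S V} = K S \<union> (D S - V)" using sw_j2[OF V(1)] by auto
        moreover have "K S \<inter> (D S - V) = {}" using DK[of S] by auto
        ultimately have "col_deg (sw S V) j2 = card (K S) + card (D S - V)"
          unfolding col_deg_def using SF(1,2) by (simp add: card_Un_disjoint)
        moreover have "card (D S - V) + card V = card (D S)"
          using V(1) SF(1) finV by (metis card_Diff_subset card_mono le_add_diff_inverse2)
        ultimately show ?thesis using 2 ne SF V by simp
      next
        case 3
        then have "{i. (i, j) \<in> sw S V} = {i. (i, j) \<in> S}" using sw_j by auto
        then show ?thesis using 3 S jB by (simp add: margin_sets_def col_deg_def)
      qed
    qed
    ultimately show "f S \<in> margin_sets A B r ?c'" unfolding fS margin_sets_def by blast
  qed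
  moreover have "inj_on f (margin_sets A B r c)"
  proof (rule inj_onI)
    fix S T assume S: "S \<in> margin_sets A B r c" and T: "T \<in> margin_sets A B r c" and eq: "f S = f T"
    have D: "D S = D T" using eq sw_D(1)[OF V_facts(1)[OF S]] sw_D(1)[OF V_facts(1)[OF T]] by (simp add: f_def)
    have "\<phi> (D S) (U S) = \<phi> (D T) (U T)"
      using eq sw_D(2)[OF V_facts(1)[OF S]] sw_D(2)[OF V_facts(1)[OF T]] by (simp add: f_def)
    then have U: "U S = U T"
      using inj_onD[OF \<phi>(1)[OF S_facts(1)[OF S]], of "U S" "U T"] S_facts(3,4)[OF S] S_facts(3,4)[OF T]
      unfolding D by blast
    have off: "(i, j) \<in> S \<longleftrightarrow> (i, j) \<in> T" if "i \<notin> D S \<or> j \<noteq> j1 \<and> j \<noteq> j2" for i j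
    proof -
      have "(i, j) \<in> f S \<longleftrightarrow> (i, j) \<in> S" "(i, j) \<in> f T \<longleftrightarrow> (i, j) \<in> T"
        unfolding f_def sw_def using that D V_facts(1)[OF S] V_facts(1)[OF T] by auto
      then show ?thesis using eq by simp
    qed
    have on1: "(i, j1) \<in> S \<longleftrightarrow> (i, j1) \<in> T" if "i \<in> D S" for i using that U D by (auto simp: U_def)
    have on2: "(i, j2) \<in> S \<longleftrightarrow> (i, j2) \<in> T" if "i \<in> D S" for i
      using that on1[OF that] D by (auto simp: D_def)
    show "S = T" using off on1 on2 by (metis subrelI subset_antisym)
  qed
  ultimately show ?thesis using finite_margin_sets[OF fin] by (intro card_inj_on_le) auto
qed

text \<open>Moving a unit from a column above \<open>d\<close> to one below it lowers the total
  excess over \<open>d\<close>, a sum of truncated differences on which the induction runs, and does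
  not lower the count.\<close>

lemma card_margin_sets_balanced:
  fixes A :: "'a set" and B :: "'b set"
  assumes fin: "finite A" "finite B" and "(\<Sum>j\<in>B. c j) = card B * d"
  shows "card (margin_sets A B r c) \<le> card (margin_sets A B r (\<lambda>_. d))"
  using assms(3)
proof (induction "\<Sum>j\<in>B. c j - d" arbitrary: c rule: less_induct)
  case (less c)
  show ?case
  proof (cases "\<forall>j\<in>B. c j = d")
    case True
    then show ?thesis by (simp add: margin_sets_def cong: conj_cong)
  next
    case False
    have "\<exists>j1\<in>B. c j1 > d"
    proof (rule ccontr)
      assume a: "\<not> (\<exists>j1\<in>B. c j1 > d)"
      obtain j where "j \<in> B" "c j \<noteq> d" using False by auto
      then have "c j < d" using a by (meson linorder_neqE_nat)
      then have "(\<Sum>j\<in>B. c j) < (\<Sum>j\<in>B. d)" using a fin \<open>j \<in> B\<close> by (intro sum_strict_mono_ex1) (auto simp: not_less)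
      then show False using less.prems by simp
    qed
    then obtain j1 where j1: "j1 \<in> B" "c j1 > d" by auto
    have "\<exists>j2\<in>B. c j2 < d"
    proof (rule ccontr)
      assume a: "\<not> (\<exists>j1\<in>B. c j1 < d)"
      then have "(\<Sum>j\<in>B. d) < (\<Sum>j\<in>B. c j)" using fin j1 by (intro sum_strict_mono_ex1) (auto simp: not_less)
      then show False using less.prems by simp
    qed
    then obtain j2 where j2: "j2 \<in> B" "c j2 < d" by auto
    have ne: "j1 \<noteq> j2" using j1 j2 by auto
    let ?c' = "c(j1 := c j1 - 1, j2 := c j2 + 1)"
    have Bd: "B = insert j1 (insert j2 (B - {j1, j2}))" using j1 j2 by auto
    have fB: "finite (B - {j1, j2})" using fin by simp
    have s: "(\<Sum>j\<in>B. g j) = g j1 + (g j2 + (\<Sum>j\<in>B - {j1, j2}. g j))" for g :: "'b \<Rightarrow> nat"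
      by (subst Bd) (use fB ne in simp)
    have rest: "(\<Sum>j\<in>B - {j1, j2}. h (?c' j)) = (\<Sum>j\<in>B - {j1, j2}. h (c j))" for h :: "nat \<Rightarrow> nat"
      by (rule sum.cong) auto
    have "(\<Sum>j\<in>B. ?c' j) = (\<Sum>j\<in>B. c j)"
      unfolding s[of ?c'] s[of c] rest[of "\<lambda>x. x"] using ne j1 by simp
    then have sum': "(\<Sum>j\<in>B. ?c' j) = card B * d" using less.prems by simp
    have "(\<Sum>j\<in>B. ?c' j - d) < (\<Sum>j\<in>B. c j - d)"
      unfolding s[of "\<lambda>j. ?c' j - d"] s[of "\<lambda>j. c j - d"] rest[of "\<lambda>x. x - d"] using ne j1 j2 by simp
    then have "card (margin_sets A B r ?c') \<le> card (margin_sets A B r (\<lambda>_. d))"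
      by (rule less.hyps[OF _ sum'])
    moreover have "card (margin_sets A B r c) \<le> card (margin_sets A B r ?c')"
      using card_margin_sets_balance_step[OF fin j1(1) j2(1), of c r] j1 j2 by linarith
    ultimately show ?thesis by (rule order_trans[rotated])
  qed
qed

lemma card_margin_sets_transpose: "card (margin_sets A B r c) = card (margin_sets B A c r)"
proof (rule bij_betw_same_card)
  show "bij_betw converse (margin_sets A B r c) (margin_sets B A c r)"
    by (rule bij_betwI[where g = converse]) (auto simp: margin_sets_def row_deg_def col_deg_def)
qed

lemma sum_row_deg:
  assumes "finite A" "finite B" "S \<subseteq> A \<times> B"
  shows "(\<Sum>i\<in>A. row_deg S i) = card S"
proof -
  have S: "S = Sigma A (\<lambda>i. {j. (i, j) \<in> S})" using assms(3) by auto
  have "\<forall>i\<in>A. finite {j. (i, j) \<in> S}" using assms by (auto intro: finite_subset[of _ B])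
  then show ?thesis by (subst S) (simp add: row_deg_def card_SigmaI assms(1))
qed

lemma sum_col_deg:
  assumes "finite A" "finite B" "S \<subseteq> A \<times> B"
  shows "(\<Sum>j\<in>B. col_deg S j) = card S"
proof -
  have "(\<Sum>j\<in>B. row_deg (S\<inverse>) j) = card (S\<inverse>)" using assms by (intro sum_row_deg) auto
  then show ?thesis by (simp add: row_deg_def col_deg_def)
qed

text \<open>Balance the column sums with \<open>r\<close> kept fixed, transpose, and balance the
  other margin. The member of size \<open>k\<close> makes both margins sum to \<open>k\<close>, so
  that their averages are \<open>a\<close> and \<open>b\<close>.\<close>

lemma card_margin_sets_max:
  fixes A :: "'a set" and B :: "'b set"
  assumes fin: "finite A" "finite B" and k: "card A * a = k" "card B * b = k"
    and rc: "margin_sets A B r c \<inter> {S. card S = k} \<noteq> {}"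
  shows "card (margin_sets A B r c) \<le> card (margin_sets A B (\<lambda>_. a) (\<lambda>_. b))"
proof -
  obtain S where S: "S \<in> margin_sets A B r c" "card S = k" using rc by auto
  then have sub: "S \<subseteq> A \<times> B" by (auto simp: margin_sets_def)
  have sr: "(\<Sum>i\<in>A. r i) = card A * a" using sum_row_deg[OF fin sub] S k by (simp add: margin_sets_def)
  have sc: "(\<Sum>i\<in>B. c i) = card B * b" using sum_col_deg[OF fin sub] S k by (simp add: margin_sets_def)
  have "card (margin_sets A B r c) \<le> card (margin_sets A B r (\<lambda>_. b))"
    by (rule card_margin_sets_balanced[OF fin sc])
  also have "\<dots> = card (margin_sets B A (\<lambda>_. b) r)" by (rule card_margin_sets_transpose)
  also have "\<dots> \<le> card (margin_sets B A (\<lambda>_. b) (\<lambda>_. a))"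
    by (rule card_margin_sets_balanced[OF fin(2,1) sr])
  also have "\<dots> = card (margin_sets A B (\<lambda>_. a) (\<lambda>_. b))" by (rule card_margin_sets_transpose)
  finally show ?thesis .
qed

text \<open>Sort the sets of size \<open>k\<close> by their margins. Each row sum has at most
  \<open>card B + 1\<close> values and each column sum at most \<open>card A + 1\<close>, and no
  class exceeds the balanced one.\<close>

lemma card_subsets_le_margin_sets:
  fixes A :: "'a set" and B :: "'b set"
  assumes fin: "finite A" "finite B" and k: "card A * a = k" "card B * b = k"
  shows "card {S. S \<subseteq> A \<times> B \<and> card S = k}
    \<le> (card B + 1) ^ card A * (card A + 1) ^ card B * card (margin_sets A B (\<lambda>_. a) (\<lambda>_. b))"
proof -
  define \<tau> where "\<tau> S = (restrict (row_deg S) A, restrict (col_deg S) B)" for S :: "('a \<times> 'b) set"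
  define X where "X = {S. S \<subseteq> A \<times> B \<and> card S = k}"
  define P where "P = PiE A (\<lambda>_. {..card B}) \<times> PiE B (\<lambda>_. {..card A})"
  have finP: "finite P" unfolding P_def using fin by (intro finite_cartesian_product finite_PiE) auto
  have finX: "finite X" unfolding X_def by (rule finite_subset[of _ "Pow (A \<times> B)"]) (use fin in auto)
  have "\<tau> S \<in> P" if "S \<in> X" for S
  proof -
    have "row_deg S i \<le> card B" if "i \<in> A" for i
      unfolding row_deg_def using \<open>S \<in> X\<close> fin by (intro card_mono) (auto simp: X_def)
    moreover have "col_deg S j \<le> card A" if "j \<in> B" for j
      unfolding col_deg_def using \<open>S \<in> X\<close> fin by (intro card_mono) (auto simp: X_def)
    ultimately show ?thesis by (auto simp: \<tau>_def P_def)
  qed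
  then have X: "X = (\<Union>y\<in>P. {S \<in> X. \<tau> S = y})" by auto
  have "card X \<le> (\<Sum>y\<in>P. card {S \<in> X. \<tau> S = y})"
    by (subst X) (rule card_UN_le[OF finP])
  also have "\<dots> \<le> (\<Sum>y\<in>P. card (margin_sets A B (\<lambda>_. a) (\<lambda>_. b)))"
  proof (rule sum_mono)
    fix y assume "y \<in> P"
    show "card {S \<in> X. \<tau> S = y} \<le> card (margin_sets A B (\<lambda>_. a) (\<lambda>_. b))"
    proof (cases "{S \<in> X. \<tau> S = y} = {}")
      case False
      have sub: "{S \<in> X. \<tau> S = y} \<subseteq> margin_sets A B (fst y) (snd y)"
        by (auto simp: X_def \<tau>_def margin_sets_def)
      then have "card {S \<in> X. \<tau> S = y} \<le> card (margin_sets A B (fst y) (snd y))"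
        by (intro card_mono finite_margin_sets fin)
      also have "\<dots> \<le> card (margin_sets A B (\<lambda>_. a) (\<lambda>_. b))"
        by (rule card_margin_sets_max[OF fin k]) (use False sub in \<open>auto simp: X_def\<close>)
      finally show ?thesis .
    qed (metis card.empty le0)
  qed
  also have "\<dots> = card P * card (margin_sets A B (\<lambda>_. a) (\<lambda>_. b))" by simp
  also have "card P = (card B + 1) ^ card A * (card A + 1) ^ card B"
    unfolding P_def using fin by (simp add: card_cartesian_product card_PiE)
  finally show ?thesis unfolding X_def .
qed

text \<open>Since \<open>n * p\<close> is the integer \<open>k\<close>, the binomial weights
  increase up to \<open>k\<close> and decrease afterwards; the largest of \<open>n + 1\<close>
  weights with sum one is at least their average.\<close>

lemma binomial_mode:
  fixes n k :: nat and p :: real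
  assumes "k < n" "p = real k / real n"
  shows "1 / (real n + 1) \<le> real (n choose k) * p ^ k * (1 - p) ^ (n - k)"
proof -
  define q where "q = 1 - p"
  have p: "0 \<le> p" "p < 1" using assms by auto
  have q: "0 < q" using p by (simp add: q_def)
  define b where "b j = real (n choose j) * p ^ j * q ^ (n - j)" for j
  have np: "real n * p = real k" using assms by simp
  have rec: "b (Suc j) * ((real j + 1) * q) = b j * ((real n - real j) * p)" if "j < n" for j
  proof -
    have "Suc j * (n choose Suc j) = (n - j) * (n choose j)"
      using that by (metis binomial_absorb_comp binomial_absorption mult.commute)
    then have "real (Suc j * (n choose Suc j)) = real ((n - j) * (n choose j))" by simp
    then have 1: "(real j + 1) * real (n choose Suc j) = (real n - real j) * real (n choose j)"
      using that unfolding of_nat_mult by (simp add: of_nat_diff add_ac)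
    have 2: "q ^ (n - j) = q * q ^ (n - Suc j)" using that by (metis Suc_diff_Suc power_Suc)
    have "b (Suc j) * ((real j + 1) * q) = ((real j + 1) * real (n choose Suc j)) * p ^ Suc j * q ^ (n - Suc j) * q"
      by (simp add: b_def mult_ac)
    also have "\<dots> = b j * ((real n - real j) * p)" unfolding 1 by (simp add: b_def 2 mult_ac)
    finally show ?thesis .
  qed
  have bnn: "b j \<ge> 0" for j using p q by (simp add: b_def)
  \<comment> \<open>By \<open>rec\<close>, consecutive weights are ordered according to the sign of
    this difference: nonnegative for \<open>j < k\<close>, negative from \<open>k\<close>
    on.\<close>
  have eqn: "(real n - real j) * p - (real j + 1) * q = real k - real j - q" for j
    using np by (simp add: q_def algebra_simps)
  have up: "b j \<le> b (Suc j)" if "j < k" for j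
  proof -
    have "(real j + 1) * q \<le> (real n - real j) * p" using eqn[of j] that q p by (simp add: q_def)
    then have "b j * ((real j + 1) * q) \<le> b (Suc j) * ((real j + 1) * q)"
      using mult_left_mono[OF _ bnn[of j]] rec[of j] that assms(1) by force
    moreover have "0 < (real j + 1) * q" using q by simp
    ultimately show ?thesis by (simp only: mult_le_cancel_right_pos)
  qed
  have down: "b (Suc j) \<le> b j" if "k \<le> j" "j < n" for j
  proof -
    have "(real n - real j) * p \<le> (real j + 1) * q" using eqn[of j] that q by simp
    then have "b (Suc j) * ((real j + 1) * q) \<le> b j * ((real j + 1) * q)"
      using mult_left_mono[OF _ bnn[of j]] rec[of j] that by force
    moreover have "0 < (real j + 1) * q" using q by simp
    ultimately show ?thesis by (simp only: mult_le_cancel_right_pos)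
  qed
  have max: "b j \<le> b k" if "j \<le> n" for j
  proof (cases "j \<le> k")
    case True
    then show ?thesis
      by (induction j rule: inc_induct) (auto intro: order_trans[OF up])
  next
    case False
    then have "k \<le> j" by simp
    then show ?thesis using that
      by (induction j rule: dec_induct) (auto intro: order_trans[OF down])
  qed
  have "1 = (p + q) ^ n" by (simp add: q_def)
  also have "\<dots> = (\<Sum>j\<le>n. b j)" unfolding binomial_ring b_def by simp
  also have "\<dots> \<le> (\<Sum>j\<le>n. b k)" by (intro sum_mono max) auto
  also have "\<dots> = (real n + 1) * b k" by simp
  finally show ?thesis by (simp add: divide_le_eq b_def q_def mult_ac)
qed

lemma cube_exp_indicator_fixed_card:
  assumes "finite I" "X \<subseteq> {S. S \<subseteq> I \<and> card S = k}"
  shows "cube_exp I p (\<lambda>S. if S \<in> X then 1 else 0) = real (card X) * (p ^ k * (1 - p) ^ (card I - k))"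
proof -
  have "cube_exp I p (\<lambda>S. if S \<in> X then 1 else 0)
    = (\<Sum>S\<in>Pow I. if S \<in> X then p ^ card S * (1 - p) ^ card (I - S) else 0)"
    unfolding cube_exp_def by (intro sum.cong) auto
  also have "\<dots> = (\<Sum>S\<in>X. p ^ card S * (1 - p) ^ card (I - S))"
    using assms by (subst sum.inter_filter[symmetric]) (auto intro!: sum.cong)
  also have "\<dots> = (\<Sum>S\<in>X. p ^ k * (1 - p) ^ (card I - k))"
  proof (rule sum.cong[OF refl])
    fix S assume "S \<in> X"
    then have "S \<subseteq> I" "card S = k" using assms by auto
    then show "p ^ card S * (1 - p) ^ card (I - S) = p ^ k * (1 - p) ^ (card I - k)"
      using assms(1) by (simp add: card_Diff_subset finite_subset)
  qed
  finally show ?thesis by simp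
qed

text \<open>Sets of equal size have equal weight, so the weight of all sets of size \<open>k\<close>
  (\<open>binomial_mode\<close>) is multiplied by the share of the balanced class among them
  (\<open>card_subsets_le_margin_sets\<close>).\<close>

lemma margin_sets_probability:
  fixes A :: "'a set" and B :: "'b set"
  assumes fin: "finite A" "finite B" and k: "card A * a = k" "card B * b = k"
    and lt: "k < card A * card B" and p: "p = real k / real (card A * card B)"
  shows "1 \<le> (real (card A * card B) + 1) * (real (card B) + 1) ^ card A * (real (card A) + 1) ^ card B
     * cube_exp (A \<times> B) p (\<lambda>S. if S \<in> margin_sets A B (\<lambda>_. a) (\<lambda>_. b) then 1 else 0)"
proof -
  let ?n = "card A * card B"
  define w where "w = p ^ k * (1 - p) ^ (?n - k)"
  have w: "w \<ge> 0" unfolding w_def using p lt by (auto intro!: mult_nonneg_nonneg zero_le_power simp: divide_le_eq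
      simp flip: of_nat_mult)
  have sub: "margin_sets A B (\<lambda>_. a) (\<lambda>_. b) \<subseteq> {S. S \<subseteq> A \<times> B \<and> card S = k}"
  proof safe
    fix S assume S: "S \<in> margin_sets A B (\<lambda>_. a) (\<lambda>_. b)"
    then have "S \<subseteq> A \<times> B" by (auto simp: margin_sets_def)
    from sum_row_deg[OF fin this] show "card S = k" using S k by (simp add: margin_sets_def)
  qed (auto simp: margin_sets_def)
  have cI: "card (A \<times> B) = ?n" by (simp add: card_cartesian_product)
  have finI: "finite (A \<times> B)" using fin by simp
  have pr: "cube_exp (A \<times> B) p (\<lambda>S. if S \<in> margin_sets A B (\<lambda>_. a) (\<lambda>_. b) then 1 else 0)
     = real (card (margin_sets A B (\<lambda>_. a) (\<lambda>_. b))) * w"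
    unfolding w_def using cube_exp_indicator_fixed_card[OF finI sub, of p] unfolding cI .
  have "1 / (real ?n + 1) \<le> real (?n choose k) * w"
    unfolding w_def using binomial_mode[OF lt p] by (simp add: mult_ac)
  also have "?n choose k = card {S. S \<subseteq> A \<times> B \<and> card S = k}" using n_subsets[OF finI] cI by simp
  also have "real \<dots> * w \<le> real ((card B + 1) ^ card A * (card A + 1) ^ card B * card (margin_sets A B (\<lambda>_. a) (\<lambda>_. b))) * w"
    using card_subsets_le_margin_sets[OF fin k] w by (intro mult_right_mono) (simp_all only: of_nat_le_iff)
  finally have *: "1 / (real ?n + 1) \<le> real ((card B + 1) ^ card A * (card A + 1) ^ card B * card (margin_sets A B (\<lambda>_. a) (\<lambda>_. b))) * w" .
  have "0 < real ?n + 1" by (rule add_nonneg_pos) auto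
  from *[unfolded pos_divide_le_eq[OF this]] show ?thesis unfolding pr by (simp add: mult_ac add_ac)
qed

section \<open>Diagonalization of real symmetric matrices\<close>

text \<open>Over the complex numbers an eigenvector \<open>v\<close> exists. Symmetry makes the
  quadratic form \<open>q\<close> real, hence the eigenvalue; then the real and imaginary parts of
  \<open>v\<close> both satisfy the eigenvalue equation, and one of them is nonzero.\<close>

lemma real_symmetric_real_eigenvector:
  fixes A :: "real mat"
  assumes A: "A \<in> carrier_mat n n" and sym: "A\<^sup>T = A" and n: "n > 0"
  shows "\<exists>e v. eigenvector A v e"
proof -
  define C where "C = map_mat complex_of_real A"
  have C: "C \<in> carrier_mat n n" using A by (simp add: C_def)
  obtain z where "z \<in> spectrum C" using spectrum_non_empty[OF C] n by auto
  then obtain v where "eigenvector C v z" by (auto simp: spectrum_def eigenvalue_def)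
  then have v: "v \<in> carrier_vec n" "v \<noteq> 0\<^sub>v n" and ev: "C *\<^sub>v v = z \<cdot>\<^sub>v v"
    using C by (auto simp: eigenvector_def)
  have symA: "A $$ (i, j) = A $$ (j, i)" if "i < n" "j < n" for i j
    using that A sym by (metis index_transpose_mat(1) carrier_matD)
  have evi: "(\<Sum>j<n. complex_of_real (A $$ (i, j)) * v $ j) = z * v $ i" if "i < n" for i
  proof -
    have "(C *\<^sub>v v) $ i = (\<Sum>j<n. complex_of_real (A $$ (i, j)) * v $ j)"
      using that C A v by (simp add: C_def scalar_prod_def atLeast0LessThan)
    then show ?thesis using ev that v by simp
  qed
  define q where "q = (\<Sum>i<n. \<Sum>j<n. cnj (v $ i) * (complex_of_real (A $$ (i, j)) * v $ j))"
  define r where "r = (\<Sum>i<n. (cmod (v $ i))\<^sup>2)"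
  have qz: "q = z * complex_of_real r"
  proof -
    have "q = (\<Sum>i<n. cnj (v $ i) * (z * v $ i))"
      unfolding q_def by (intro sum.cong refl) (simp add: sum_distrib_left[symmetric] evi)
    also have "\<dots> = z * complex_of_real r"
      unfolding r_def of_real_sum sum_distrib_left
      by (intro sum.cong refl) (simp add: complex_norm_square[symmetric] mult_ac del: complex_mult_cnj)
    finally show ?thesis .
  qed
  have "cnj q = (\<Sum>i<n. \<Sum>j<n. v $ i * (complex_of_real (A $$ (i, j)) * cnj (v $ j)))"
    unfolding q_def by simp
  also have "\<dots> = (\<Sum>j<n. \<Sum>i<n. v $ i * (complex_of_real (A $$ (i, j)) * cnj (v $ j)))" by (rule sum.swap)
  also have "\<dots> = q" unfolding q_def by (intro sum.cong refl) (simp add: symA mult_ac)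
  finally have cq: "cnj q = q" .
  have "r > 0"
  proof -
    obtain i where "i < n" "v $ i \<noteq> 0" using v by (metis carrier_vecD eq_vecI index_zero_vec)
    then have "0 < (cmod (v $ i))\<^sup>2" by simp
    also have "\<dots> \<le> r" unfolding r_def using \<open>i < n\<close> by (intro member_le_sum) auto
    finally show ?thesis .
  qed
  then have "cnj z = z" using cq unfolding qz by simp
  then have zr: "z = complex_of_real (Re z)" by (simp add: complex_eq_iff)
  have re: "A *\<^sub>v vec n (\<lambda>i. Re (v $ i)) = Re z \<cdot>\<^sub>v vec n (\<lambda>i. Re (v $ i))"
  proof (intro eq_vecI)
    fix i assume "i < dim_vec (Re z \<cdot>\<^sub>v vec n (\<lambda>i. Re (v $ i)))"
    then have i: "i < n" by simp
    have "Re (\<Sum>j<n. complex_of_real (A $$ (i, j)) * v $ j) = Re (complex_of_real (Re z) * v $ i)"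
      using evi[OF i] zr by simp
    then show "(A *\<^sub>v vec n (\<lambda>i. Re (v $ i))) $ i = (Re z \<cdot>\<^sub>v vec n (\<lambda>i. Re (v $ i))) $ i"
      using i A by (simp add: scalar_prod_def atLeast0LessThan)
  qed (use A in auto)
  have im: "A *\<^sub>v vec n (\<lambda>i. Im (v $ i)) = Re z \<cdot>\<^sub>v vec n (\<lambda>i. Im (v $ i))"
  proof (intro eq_vecI)
    fix i assume "i < dim_vec (Re z \<cdot>\<^sub>v vec n (\<lambda>i. Im (v $ i)))"
    then have i: "i < n" by simp
    have "Im (\<Sum>j<n. complex_of_real (A $$ (i, j)) * v $ j) = Im (complex_of_real (Re z) * v $ i)"
      using evi[OF i] zr by simp
    then show "(A *\<^sub>v vec n (\<lambda>i. Im (v $ i))) $ i = (Re z \<cdot>\<^sub>v vec n (\<lambda>i. Im (v $ i))) $ i"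
      using i A by (simp add: scalar_prod_def atLeast0LessThan)
  qed (use A in auto)
  have "vec n (\<lambda>i. Re (v $ i)) \<noteq> 0\<^sub>v n \<or> vec n (\<lambda>i. Im (v $ i)) \<noteq> 0\<^sub>v n"
  proof (rule ccontr)
    assume "\<not> ?thesis"
    then have h: "vec n (\<lambda>i. Re (v $ i)) = 0\<^sub>v n" "vec n (\<lambda>i. Im (v $ i)) = 0\<^sub>v n" by auto
    have "v $ i = 0" if "i < n" for i
      using arg_cong[OF h(1), of "\<lambda>w. w $ i"] arg_cong[OF h(2), of "\<lambda>w. w $ i"] that by (simp add: complex_eq_iff)
    then show False using v by auto
  qed
  then show ?thesis using re im A unfolding eigenvector_def by (metis carrier_matD(1) vec_carrier)
qed

lemma orthonormal_completion:
  fixes v :: "real vec"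
  assumes v: "v \<in> carrier_vec n" "v \<noteq> 0\<^sub>v n"
  shows "\<exists>U c. U \<in> carrier_mat n n \<and> U\<^sup>T * U = 1\<^sub>m n \<and> col U 0 = c \<cdot>\<^sub>v v"
proof -
  have n: "n > 0" using v by (cases n) auto
  interpret cof_vec_space n "TYPE(real)" .
  define b where "b = basis_completion v"
  define ws where "ws = gram_schmidt n b"
  from basis_completion[OF v, folded b_def]
  have dist_b: "distinct b" and indep: "\<not> lin_dep (set b)" and b: "set b \<subseteq> carrier_vec n" and hdb: "hd b = v"
    and len_b: "length b = n" by auto
  from hdb len_b n obtain vs where bv: "b = v # vs" by (cases b, auto)
  from gram_schmidt_result[OF b dist_b indep refl, folded ws_def]
  have ws: "set ws \<subseteq> carrier_vec n" "corthogonal ws" "length ws = n"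
    by (auto simp: len_b)
  from gram_schmidt_hd[OF v(1), of vs, folded bv] have hdws: "hd ws = v" unfolding ws_def .
  have wsc: "ws ! i \<in> carrier_vec n" if "i < n" for i using ws that by (auto simp: subset_iff)
  have orth: "ws ! i \<bullet> ws ! j = 0 \<longleftrightarrow> i \<noteq> j" if "i < n" "j < n" for i j
    using corthogonalD[OF ws(2)] that ws(3) by simp
  have nn: "ws ! i \<bullet> ws ! i > 0" if "i < n" for i
  proof -
    have "ws ! i \<bullet> ws ! i \<ge> 0" unfolding scalar_prod_def by (intro sum_nonneg) auto
    then show ?thesis using orth[OF that that] by simp
  qed
  define U where "U = mat n n (\<lambda>(i, j). ws ! j $ i / sqrt (ws ! j \<bullet> ws ! j))"
  have U: "U \<in> carrier_mat n n" by (simp add: U_def)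
  have colU: "col U j = (1 / sqrt (ws ! j \<bullet> ws ! j)) \<cdot>\<^sub>v (ws ! j)" if "j < n" for j
    using that wsc[OF that] by (intro eq_vecI) (auto simp: U_def)
  have "U\<^sup>T * U = 1\<^sub>m n"
  proof (rule eq_matI)
    fix i j assume "i < dim_row (1\<^sub>m n :: real mat)" "j < dim_col (1\<^sub>m n :: real mat)"
    then have ij: "i < n" "j < n" by auto
    have "(U\<^sup>T * U) $$ (i, j) = col U i \<bullet> col U j" using ij U by simp
    also have "\<dots> = (1 / sqrt (ws ! i \<bullet> ws ! i)) * ((1 / sqrt (ws ! j \<bullet> ws ! j)) * (ws ! i \<bullet> ws ! j))"
      using ij scalar_prod_smult_left[of "ws ! i" "ws ! j"] wsc[OF ij(1)] wsc[OF ij(2)] by (simp add: colU)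
    also have "\<dots> = (1\<^sub>m n) $$ (i, j)"
      using ij orth[OF ij] nn[OF ij(1)] by (auto simp: field_simps)
    finally show "(U\<^sup>T * U) $$ (i, j) = (1\<^sub>m n) $$ (i, j)" .
  qed (use U in auto)
  moreover have "ws ! 0 = v" using hdws ws(3) n by (simp add: hd_conv_nth flip: length_greater_0_conv)
  ultimately show ?thesis using U colU[OF n] by metis
qed

text \<open>Deflation: in an orthonormal basis starting with an eigenvector the first column of the
  matrix vanishes off the diagonal, symmetry clears the first row, and the induction hypothesis
  diagonalizes the remaining block.\<close>

lemma real_symmetric_diagonalization:
  fixes A :: "real mat"
  assumes "A \<in> carrier_mat n n" "A\<^sup>T = A"
  shows "\<exists>V d. V \<in> carrier_mat n n \<and> V\<^sup>T * V = 1\<^sub>m n \<and> A * V = V * mat_diag n d"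
  using assms
proof (induction n arbitrary: A)
  case 0
  have "A * 1\<^sub>m 0 = 1\<^sub>m 0 * mat_diag 0 (\<lambda>_. 0)" using 0 by (intro eq_matI) (auto simp: mat_diag_def)
  then show ?case by (intro exI[of _ "1\<^sub>m 0"] exI[of _ "\<lambda>_. 0"]) auto
next
  case (Suc n A)
  note A = Suc.prems(1)
  obtain e v where "eigenvector A v e" using real_symmetric_real_eigenvector[OF Suc.prems] by auto
  then have v: "v \<in> carrier_vec (Suc n)" "v \<noteq> 0\<^sub>v (Suc n)" and ev: "A *\<^sub>v v = e \<cdot>\<^sub>v v"
    using A by (auto simp: eigenvector_def)
  obtain U c where U: "U \<in> carrier_mat (Suc n) (Suc n)" and UU: "U\<^sup>T * U = 1\<^sub>m (Suc n)" and U0: "col U 0 = c \<cdot>\<^sub>v v"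
    using orthonormal_completion[OF v] by auto
  have UT: "U\<^sup>T \<in> carrier_mat (Suc n) (Suc n)" using U by simp
  have UU': "U * U\<^sup>T = 1\<^sub>m (Suc n)" using mat_mult_left_right_inverse[OF UT U UU] .
  define B where "B = U\<^sup>T * (A * U)"
  have B: "B \<in> carrier_mat (Suc n) (Suc n)" using U A by (simp add: B_def)
  have AU: "A * U = U * B"
  proof -
    have "U * B = (U * U\<^sup>T) * (A * U)" unfolding B_def using U A by (intro assoc_mult_mat[symmetric]) auto
    then show ?thesis unfolding UU' using A U by simp
  qed
  have Bsym: "B\<^sup>T = B"
  proof -
    have "B\<^sup>T = (A * U)\<^sup>T * U" unfolding B_def using U A by (subst transpose_mult) auto
    also have "(A * U)\<^sup>T = U\<^sup>T * A" using Suc.prems(2) U A by (subst transpose_mult) auto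
    also have "U\<^sup>T * A * U = B" unfolding B_def using U A by (intro assoc_mult_mat) auto
    finally show ?thesis .
  qed
  have col0: "B $$ (i, 0) = (if i = 0 then e else 0)" if i: "i < Suc n" for i
  proof -
    have "A *\<^sub>v col U 0 = e \<cdot>\<^sub>v col U 0"
      unfolding U0 using A v ev by (simp add: mult_mat_vec smult_smult_assoc mult.commute)
    then have "B $$ (i, 0) = col U i \<bullet> (e \<cdot>\<^sub>v col U 0)"
      using i U A unfolding B_def by (simp add: col_mult2[symmetric])
    also have "\<dots> = e * (U\<^sup>T * U) $$ (i, 0)" using i U by simp
    finally show ?thesis unfolding UU using i by simp
  qed
  have row0: "B $$ (0, i) = (if i = 0 then e else 0)" if i: "i < Suc n" for i
    using col0[OF i] Bsym B i by (metis index_transpose_mat(1) carrier_matD zero_less_Suc)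
  define A3 where "A3 = mat n n (\<lambda>(i, j). B $$ (Suc i, Suc j))"
  have A3: "A3 \<in> carrier_mat n n" by (simp add: A3_def)
  have A3sym: "A3\<^sup>T = A3"
  proof (rule eq_matI)
    fix i j assume "i < dim_row A3" "j < dim_col A3"
    then have ij: "i < n" "j < n" by (auto simp: A3_def)
    have "B $$ (Suc j, Suc i) = B\<^sup>T $$ (Suc i, Suc j)" using B ij by simp
    then show "A3\<^sup>T $$ (i, j) = A3 $$ (i, j)" unfolding Bsym using ij by (simp add: A3_def)
  qed (auto simp: A3_def)
  let ?e = "mat 1 1 (\<lambda>_. e)"
  have Bblk: "B = four_block_mat ?e (0\<^sub>m 1 n) (0\<^sub>m n 1) A3"
  proof (rule eq_matI)
    fix i j assume "i < dim_row (four_block_mat ?e (0\<^sub>m 1 n) (0\<^sub>m n 1) A3)" "j < dim_col (four_block_mat ?e (0\<^sub>m 1 n) (0\<^sub>m n 1) A3)"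
    then have ij: "i < Suc n" "j < Suc n" by (auto simp: A3_def)
    then show "B $$ (i, j) = four_block_mat ?e (0\<^sub>m 1 n) (0\<^sub>m n 1) A3 $$ (i, j)"
      using col0 row0 by (cases i; cases j) (auto simp: A3_def)
  qed (use B in \<open>auto simp: A3_def\<close>)
  obtain V3 d3 where V3: "V3 \<in> carrier_mat n n" and VV3: "V3\<^sup>T * V3 = 1\<^sub>m n" and AV3: "A3 * V3 = V3 * mat_diag n d3"
    using Suc.IH[OF A3 A3sym] by auto
  define P where "P = four_block_mat (1\<^sub>m 1) (0\<^sub>m 1 n) (0\<^sub>m n 1) V3"
  define d where "d k = (case k of 0 \<Rightarrow> e | Suc k \<Rightarrow> d3 k)" for k
  have P: "P \<in> carrier_mat (Suc n) (Suc n)" using V3 by (auto simp: P_def)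
  have D: "mat_diag (Suc n) d = four_block_mat ?e (0\<^sub>m 1 n) (0\<^sub>m n 1) (mat_diag n d3)"
  proof (rule eq_matI)
    fix i j assume "i < dim_row (four_block_mat ?e (0\<^sub>m 1 n) (0\<^sub>m n 1) (mat_diag n d3))"
      "j < dim_col (four_block_mat ?e (0\<^sub>m 1 n) (0\<^sub>m n 1) (mat_diag n d3))"
    then have ij: "i < Suc n" "j < Suc n" by (auto simp: mat_diag_def)
    then show "mat_diag (Suc n) d $$ (i, j) = four_block_mat ?e (0\<^sub>m 1 n) (0\<^sub>m n 1) (mat_diag n d3) $$ (i, j)"
      by (cases i; cases j) (auto simp: mat_diag_def d_def)
  qed (auto simp: mat_diag_def)
  have PT: "P\<^sup>T = four_block_mat (1\<^sub>m 1) (0\<^sub>m 1 n) (0\<^sub>m n 1) V3\<^sup>T"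
    unfolding P_def using V3 by (subst transpose_four_block_mat[of _ 1 1 _ n _ n]) auto
  have PP: "P\<^sup>T * P = 1\<^sub>m (Suc n)"
  proof -
    have "P\<^sup>T * P = four_block_mat (1\<^sub>m 1) (0\<^sub>m 1 n) (0\<^sub>m n 1) (1\<^sub>m n)"
      unfolding PT unfolding P_def using V3 VV3
      by (subst mult_four_block_mat[of _ 1 1 _ n _ n _ _ 1 _ n]) auto
    also have "\<dots> = 1\<^sub>m (Suc n)"
    proof (rule eq_matI)
      fix i j assume "i < dim_row (1\<^sub>m (Suc n) :: real mat)" "j < dim_col (1\<^sub>m (Suc n) :: real mat)"
      then show "four_block_mat (1\<^sub>m 1) (0\<^sub>m 1 n) (0\<^sub>m n 1) (1\<^sub>m n) $$ (i, j) = (1\<^sub>m (Suc n) :: real mat) $$ (i, j)"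
        by (cases i; cases j) auto
    qed auto
    finally show ?thesis .
  qed
  have BP: "B * P = P * mat_diag (Suc n) d"
  proof -
    have "B * P = four_block_mat ?e (0\<^sub>m 1 n) (0\<^sub>m n 1) (A3 * V3)"
      unfolding Bblk P_def using V3 A3 by (subst mult_four_block_mat[of _ 1 1 _ n _ n _ _ 1 _ n]) auto
    also have "\<dots> = P * mat_diag (Suc n) d"
      unfolding D P_def AV3 using V3 left_mult_zero_mat[OF mat_diag_dim[of n d3], of "Suc 0"]
      by (subst mult_four_block_mat[of _ 1 1 _ n _ n _ _ 1 _ n]) auto
    finally show ?thesis .
  qed
  have UP: "U * P \<in> carrier_mat (Suc n) (Suc n)" using U P by simp
  have "(U * P)\<^sup>T * (U * P) = P\<^sup>T * (U\<^sup>T * (U * P))"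
    using U P by (subst transpose_mult[OF U P]) (intro assoc_mult_mat, auto)
  also have "U\<^sup>T * (U * P) = (U\<^sup>T * U) * P" using U P by (intro assoc_mult_mat[symmetric]) auto
  also have "P\<^sup>T * (U\<^sup>T * U * P) = 1\<^sub>m (Suc n)" unfolding UU using P PP by simp
  finally have 1: "(U * P)\<^sup>T * (U * P) = 1\<^sub>m (Suc n)" .
  have "A * (U * P) = (A * U) * P" using A U P by (intro assoc_mult_mat[symmetric]) auto
  also have "\<dots> = U * (B * P)" unfolding AU using B U P by (intro assoc_mult_mat) auto
  also have "\<dots> = (U * P) * mat_diag (Suc n) d"
    unfolding BP using U P by (intro assoc_mult_mat[symmetric, of _ "Suc n" "Suc n" _ "Suc n" _ "Suc n"]) auto
  finally have 2: "A * (U * P) = (U * P) * mat_diag (Suc n) d" .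
  show ?case using 1 2 UP by blast
qed

lemma proots_linear_factors: "proots (\<Prod>a\<leftarrow>as. [:- a, 1:]) = mset (as :: 'a::idom list)"
proof (induction as)
  case (Cons a as)
  have "(\<Prod>a\<leftarrow>as. [:- a, 1:]) \<noteq> 0" by (auto simp: prod_list_zero_iff)
  then have "proots ([:- a, 1:] * (\<Prod>a\<leftarrow>as. [:- a, 1:])) = proots [:- a, 1:] + proots (\<Prod>a\<leftarrow>as. [:- a, 1:])"
    by (intro proots_mult) auto
  then show ?case using Cons by simp
qed simp

text \<open>The eigenbasis in coordinates: \<open>v k\<close> is the \<open>k\<close>-th eigenvector.\<close>

lemma real_symmetric_eigenbasis:
  fixes A :: "real mat"
  assumes A: "A \<in> carrier_mat n n" and sym: "A\<^sup>T = A"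
  shows "\<exists>v d. (\<forall>k<n. \<forall>l<n. (\<Sum>j<n. v k j * v l j) = (if k = l then 1 else 0))
     \<and> (\<forall>i<n. \<forall>j<n. (\<Sum>k<n. v k i * v k j) = (if i = j then 1 else 0))
     \<and> (\<forall>k<n. \<forall>i<n. (\<Sum>j<n. A $$ (i, j) * v k j) = d k * v k i)
     \<and> proots (char_poly A) = mset (map d [0..<n])"
proof -
  obtain V d where V: "V \<in> carrier_mat n n" and VV: "V\<^sup>T * V = 1\<^sub>m n" and AV: "A * V = V * mat_diag n d"
    using real_symmetric_diagonalization[OF assms] by auto
  have VT: "V\<^sup>T \<in> carrier_mat n n" using V by simp
  have VV': "V * V\<^sup>T = 1\<^sub>m n" using mat_mult_left_right_inverse[OF VT V VV] .
  define v where "v k j = V $$ (j, k)" for k j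
  have 1: "(\<Sum>j<n. v k j * v l j) = (if k = l then 1 else 0)" if "k < n" "l < n" for k l
  proof -
    have "(V\<^sup>T * V) $$ (k, l) = (\<Sum>j<n. v k j * v l j)"
      using that V by (simp add: scalar_prod_def v_def atLeast0LessThan)
    then show ?thesis unfolding VV using that by simp
  qed
  have 2: "(\<Sum>k<n. v k i * v k j) = (if i = j then 1 else 0)" if "i < n" "j < n" for i j
  proof -
    have "(V * V\<^sup>T) $$ (i, j) = (\<Sum>k<n. v k i * v k j)"
      using that V by (simp add: scalar_prod_def v_def atLeast0LessThan)
    then show ?thesis unfolding VV' using that by simp
  qed
  have 3: "(\<Sum>j<n. A $$ (i, j) * v k j) = d k * v k i" if "k < n" "i < n" for k i
  proof -
    have "(A * V) $$ (i, k) = (\<Sum>j<n. A $$ (i, j) * v k j)"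
      using that V A by (simp add: scalar_prod_def v_def atLeast0LessThan)
    moreover have "(V * mat_diag n d) $$ (i, k) = d k * v k i"
      using that V by (simp add: mat_diag_mult_right[OF V] v_def)
    ultimately show ?thesis unfolding AV by simp
  qed
  have "A = A * (V * V\<^sup>T)" unfolding VV' using A by simp
  also have "\<dots> = V * mat_diag n d * V\<^sup>T" unfolding AV[symmetric] using A V by (intro assoc_mult_mat[symmetric]) auto
  finally have "similar_mat A (mat_diag n d)"
    unfolding similar_mat_def using A V VV VV'
    by (intro exI[of _ V] exI[of _ "V\<^sup>T"] similar_mat_witI[of _ _ n]) auto
  then have "char_poly A = char_poly (mat_diag n d)" by (rule char_poly_similar)
  also have "\<dots> = (\<Prod>a\<leftarrow>diag_mat (mat_diag n d). [:- a, 1:])"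
    by (rule char_poly_upper_triangular[of _ n]) (auto simp: mat_diag_def)
  also have "diag_mat (mat_diag n d) = map d [0..<n]" by (auto simp: diag_mat_def mat_diag_def)
  finally have "proots (char_poly A) = mset (map d [0..<n])" by (metis proots_linear_factors)
  then show ?thesis using 1 2 3 by blast
qed

section \<open>Singular values\<close>

text \<open>The \<open>v k\<close> are right singular vectors of \<open>H\<close> and the
  \<open>s k\<close> its singular values. Orthonormality and completeness are both recorded, so that
  expansions become exchanges of finite sums.\<close>

definition gram_eigenbasis :: "nat \<Rightarrow> nat \<Rightarrow> (nat \<Rightarrow> nat \<Rightarrow> real) \<Rightarrow> (nat \<Rightarrow> nat \<Rightarrow> real) \<Rightarrow> (nat \<Rightarrow> real) \<Rightarrow> bool" where
  "gram_eigenbasis M N H v s \<longleftrightarrow>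
     (\<forall>k<N. \<forall>l<N. (\<Sum>j<N. v k j * v l j) = (if k = l then 1 else 0)) \<and>
     (\<forall>i<N. \<forall>j<N. (\<Sum>k<N. v k i * v k j) = (if i = j then 1 else 0)) \<and>
     (\<forall>k<N. 0 \<le> s k) \<and>
     (\<forall>k<N. \<forall>j<N. (\<Sum>i<M. H i j * (\<Sum>l<N. H i l * v k l)) = (s k)\<^sup>2 * v k j)"

lemma bessel_inequality:
  fixes u :: "'k \<Rightarrow> 'i \<Rightarrow> real"
  assumes "finite K" "finite I"
    and on: "\<And>k l. k \<in> K \<Longrightarrow> l \<in> K \<Longrightarrow> (\<Sum>i\<in>I. u k i * u l i) = (if k = l then 1 else 0)"
  shows "(\<Sum>k\<in>K. (\<Sum>i\<in>I. u k i * x i)\<^sup>2) \<le> (\<Sum>i\<in>I. (x i)\<^sup>2)"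
proof -
  define c where "c k = (\<Sum>i\<in>I. u k i * x i)" for k
  have a: "(\<Sum>i\<in>I. x i * (\<Sum>k\<in>K. c k * u k i)) = (\<Sum>k\<in>K. (c k)\<^sup>2)"
  proof -
    have "(\<Sum>i\<in>I. x i * (\<Sum>k\<in>K. c k * u k i)) = (\<Sum>k\<in>K. \<Sum>i\<in>I. x i * (c k * u k i))"
      unfolding sum_distrib_left by (rule sum.swap)
    also have "\<dots> = (\<Sum>k\<in>K. c k * c k)"
      by (intro sum.cong refl) (simp add: c_def sum_distrib_left mult_ac)
    finally show ?thesis by (simp add: power2_eq_square)
  qed
  have b: "(\<Sum>i\<in>I. (\<Sum>k\<in>K. c k * u k i) * (\<Sum>l\<in>K. c l * u l i)) = (\<Sum>k\<in>K. (c k)\<^sup>2)"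
  proof -
    have "(\<Sum>i\<in>I. (\<Sum>k\<in>K. c k * u k i) * (\<Sum>l\<in>K. c l * u l i))
      = (\<Sum>i\<in>I. \<Sum>k\<in>K. \<Sum>l\<in>K. c k * c l * (u k i * u l i))"
      by (simp add: sum_product mult_ac)
    also have "\<dots> = (\<Sum>k\<in>K. \<Sum>i\<in>I. \<Sum>l\<in>K. c k * c l * (u k i * u l i))" by (rule sum.swap)
    also have "\<dots> = (\<Sum>k\<in>K. \<Sum>l\<in>K. \<Sum>i\<in>I. c k * c l * (u k i * u l i))"
      by (intro sum.cong refl sum.swap)
    also have "\<dots> = (\<Sum>k\<in>K. \<Sum>l\<in>K. if k = l then c k * c l else 0)"
      by (intro sum.cong refl) (simp add: sum_distrib_left[symmetric] on)
    also have "\<dots> = (\<Sum>k\<in>K. (c k)\<^sup>2)"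
      by (intro sum.cong refl) (simp add: assms(1) power2_eq_square)
    finally show ?thesis .
  qed
  have "0 \<le> (\<Sum>i\<in>I. (x i - (\<Sum>k\<in>K. c k * u k i))\<^sup>2)" by (intro sum_nonneg) auto
  also have "\<dots> = (\<Sum>i\<in>I. (x i)\<^sup>2) - 2 * (\<Sum>i\<in>I. x i * (\<Sum>k\<in>K. c k * u k i))
     + (\<Sum>i\<in>I. (\<Sum>k\<in>K. c k * u k i) * (\<Sum>l\<in>K. c l * u l i))"
  proof -
    have "(\<Sum>i\<in>I. (x i - y i)\<^sup>2) = (\<Sum>i\<in>I. (x i)\<^sup>2) - 2 * (\<Sum>i\<in>I. x i * y i) + (\<Sum>i\<in>I. y i * y i)" for y
    proof -
      have "(x i - y i)\<^sup>2 = (x i)\<^sup>2 - 2 * (x i * y i) + y i * y i" for i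
        by (simp add: power2_eq_square algebra_simps)
      then show ?thesis by (simp only: sum.distrib sum_subtractf sum_distrib_left)
    qed
    then show ?thesis .
  qed
  finally show ?thesis unfolding a b by (simp add: c_def)
qed

definition left_vec :: "nat \<Rightarrow> (nat \<Rightarrow> nat \<Rightarrow> real) \<Rightarrow> (nat \<Rightarrow> nat \<Rightarrow> real) \<Rightarrow> nat \<Rightarrow> nat \<Rightarrow> real" where
  "left_vec N H v k i = (\<Sum>j<N. H i j * v k j)"

text \<open>The left singular vectors; the zero vector when \<open>s k = 0\<close>.\<close>

definition left_unit :: "nat \<Rightarrow> (nat \<Rightarrow> nat \<Rightarrow> real) \<Rightarrow> (nat \<Rightarrow> nat \<Rightarrow> real) \<Rightarrow> (nat \<Rightarrow> real) \<Rightarrow> nat \<Rightarrow> nat \<Rightarrow> real" where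
  "left_unit N H v s k i = left_vec N H v k i / s k"

text \<open>The gradient in \<open>H\<close> of the sum of \<open>max (s k) a\<close>, wherever no
  \<open>s k\<close> equals \<open>a\<close>.\<close>

definition sv_grad :: "nat \<Rightarrow> (nat \<Rightarrow> nat \<Rightarrow> real) \<Rightarrow> (nat \<Rightarrow> nat \<Rightarrow> real) \<Rightarrow> (nat \<Rightarrow> real) \<Rightarrow> real \<Rightarrow> nat \<Rightarrow> nat \<Rightarrow> real" where
  "sv_grad N H v s a i j = (\<Sum>k | k < N \<and> a < s k. left_unit N H v s k i * v k j)"

context
  fixes M N :: nat and H v :: "nat \<Rightarrow> nat \<Rightarrow> real" and s :: "nat \<Rightarrow> real"
  assumes geb: "gram_eigenbasis M N H v s"
begin

lemma v_orthonormal: "k < N \<Longrightarrow> l < N \<Longrightarrow> (\<Sum>j<N. v k j * v l j) = (if k = l then 1 else 0)"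
  and v_complete: "i < N \<Longrightarrow> j < N \<Longrightarrow> (\<Sum>k<N. v k i * v k j) = (if i = j then 1 else 0)"
  and s_nonneg: "k < N \<Longrightarrow> 0 \<le> s k"
  and gram_ev: "k < N \<Longrightarrow> j < N \<Longrightarrow> (\<Sum>i<M. H i j * (\<Sum>l<N. H i l * v k l)) = (s k)\<^sup>2 * v k j"
  using geb by (auto simp: gram_eigenbasis_def)

lemma left_vec_inner:
  assumes "k < N" "l < N"
  shows "(\<Sum>i<M. left_vec N H v k i * left_vec N H v l i) = (if k = l then (s k)\<^sup>2 else 0)"
proof -
  have "(\<Sum>i<M. left_vec N H v k i * left_vec N H v l i)
    = (\<Sum>i<M. \<Sum>j<N. v l j * (H i j * left_vec N H v k i))"
    unfolding left_vec_def[of N H v l] sum_distrib_left by (simp add: mult_ac)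
  also have "\<dots> = (\<Sum>j<N. v l j * (\<Sum>i<M. H i j * left_vec N H v k i))"
    unfolding sum_distrib_left by (rule sum.swap)
  also have "\<dots> = (\<Sum>j<N. v l j * ((s k)\<^sup>2 * v k j))"
    by (intro sum.cong refl) (simp add: left_vec_def gram_ev assms)
  also have "\<dots> = (s k)\<^sup>2 * (\<Sum>j<N. v k j * v l j)" by (simp add: sum_distrib_left mult_ac)
  finally show ?thesis using v_orthonormal[OF assms] by simp
qed

lemma left_vec_zero:
  assumes "k < N" "s k = 0" "i < M" shows "left_vec N H v k i = 0"
proof -
  have "(\<Sum>i<M. left_vec N H v k i * left_vec N H v k i) = 0" using left_vec_inner[OF assms(1,1)] assms by simp
  then have "\<forall>i\<in>{..<M}. left_vec N H v k i * left_vec N H v k i = 0" by (subst (asm) sum_nonneg_eq_0_iff) auto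
  then show ?thesis using assms by auto
qed

lemma left_vec_unit: "k < N \<Longrightarrow> i < M \<Longrightarrow> left_vec N H v k i = s k * left_unit N H v s k i"
  using left_vec_zero by (cases "s k = 0") (auto simp: left_unit_def)

lemma left_unit_orthonormal:
  assumes "k < N" "l < N" "s k \<noteq> 0" "s l \<noteq> 0"
  shows "(\<Sum>i<M. left_unit N H v s k i * left_unit N H v s l i) = (if k = l then 1 else 0)"
proof -
  have "(\<Sum>i<M. left_unit N H v s k i * left_unit N H v s l i)
     = (\<Sum>i<M. left_vec N H v k i * left_vec N H v l i) / (s k * s l)"
    by (simp add: left_unit_def sum_divide_distrib)
  then show ?thesis using left_vec_inner[OF assms(1,2)] assms by (simp add: power2_eq_square)
qed

text \<open>Completeness of the \<open>v k\<close> alone; with \<open>left_vec\<close> instead of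
  unit vectors, vanishing singular values need no separate treatment.\<close>

lemma matrix_expansion:
  assumes "j < N" shows "H i j = (\<Sum>k<N. left_vec N H v k i * v k j)"
proof -
  have "(\<Sum>k<N. left_vec N H v k i * v k j) = (\<Sum>k<N. \<Sum>l<N. H i l * (v k l * v k j))"
    by (simp add: left_vec_def sum_distrib_right mult.assoc)
  also have "\<dots> = (\<Sum>l<N. H i l * (\<Sum>k<N. v k l * v k j))" unfolding sum_distrib_left by (rule sum.swap)
  also have "\<dots> = (\<Sum>l<N. if l = j then H i l else 0)"
    using assms by (intro sum.cong refl) (simp add: v_complete)
  also have "\<dots> = H i j" using assms by simp
  finally show ?thesis by simp
qed

lemma sum_squares_singular_values: "(\<Sum>k<N. (s k)\<^sup>2) = (\<Sum>i<M. \<Sum>j<N. (H i j)\<^sup>2)"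
proof -
  have row: "(\<Sum>j<N. (H i j)\<^sup>2) = (\<Sum>k<N. (left_vec N H v k i)\<^sup>2)" for i
  proof -
    have "(\<Sum>j<N. (H i j)\<^sup>2) = (\<Sum>j<N. H i j * (\<Sum>k<N. left_vec N H v k i * v k j))"
      unfolding power2_eq_square by (intro sum.cong refl) (metis lessThan_iff matrix_expansion)
    also have "\<dots> = (\<Sum>k<N. \<Sum>j<N. H i j * (left_vec N H v k i * v k j))"
      unfolding sum_distrib_left by (rule sum.swap)
    also have "\<dots> = (\<Sum>k<N. (left_vec N H v k i)\<^sup>2)"
      by (intro sum.cong refl) (simp add: left_vec_def sum_distrib_left power2_eq_square mult_ac)
    finally show ?thesis .
  qed
  have "(\<Sum>i<M. \<Sum>j<N. (H i j)\<^sup>2) = (\<Sum>k<N. \<Sum>i<M. (left_vec N H v k i)\<^sup>2)"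
    unfolding row by (rule sum.swap)
  also have "\<dots> = (\<Sum>k<N. (s k)\<^sup>2)"
    by (intro sum.cong refl) (use left_vec_inner in \<open>simp add: power2_eq_square\<close>)
  finally show ?thesis by simp
qed

lemma right_bessel: "(\<Sum>k<N. (\<Sum>j<N. v k j * x j)\<^sup>2) \<le> (\<Sum>j<N. (x j)\<^sup>2)"
  by (rule bessel_inequality) (auto simp: v_orthonormal)

lemma left_bessel: "(\<Sum>k<N. (\<Sum>i<M. left_unit N H v s k i * x i)\<^sup>2) \<le> (\<Sum>i<M. (x i)\<^sup>2)"
proof -
  have "(\<Sum>k<N. (\<Sum>i<M. left_unit N H v s k i * x i)\<^sup>2) = (\<Sum>k | k < N \<and> s k \<noteq> 0. (\<Sum>i<M. left_unit N H v s k i * x i)\<^sup>2)"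
    by (rule sum.mono_neutral_right) (auto simp: left_unit_def)
  also have "\<dots> \<le> (\<Sum>i<M. (x i)\<^sup>2)"
    by (rule bessel_inequality) (auto simp: left_unit_orthonormal)
  finally show ?thesis .
qed

lemma left_unit_norm: "k < N \<Longrightarrow> (\<Sum>i<M. (left_unit N H v s k i)\<^sup>2) \<le> 1"
  using left_unit_orthonormal[of k k] by (cases "s k = 0") (auto simp: power2_eq_square left_unit_def)

lemma v_norm: "k < N \<Longrightarrow> (\<Sum>j<N. (v k j)\<^sup>2) = 1"
  using v_orthonormal[of k k] by (simp add: power2_eq_square)

lemma sv_grad_abs_le:
  assumes "i < M" "j < N" shows "\<bar>sv_grad N H v s a i j\<bar> \<le> 1"
proof -
  let ?K = "{k. k < N \<and> a < s k}"
  have 1: "(\<Sum>k\<in>?K. (left_unit N H v s k i)\<^sup>2) \<le> 1"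
  proof -
    have "(\<Sum>k\<in>?K. (left_unit N H v s k i)\<^sup>2) \<le> (\<Sum>k<N. (left_unit N H v s k i)\<^sup>2)"
      by (intro sum_mono2) auto
    also have "\<dots> \<le> 1" using left_bessel[of "\<lambda>x. if x = i then 1 else 0"] assms
      by (simp add: if_distrib[of "\<lambda>x. x\<^sup>2"] if_distrib[of "\<lambda>x. _ * x"] cong: if_cong)
    finally show ?thesis .
  qed
  have 2: "(\<Sum>k\<in>?K. (v k j)\<^sup>2) \<le> 1"
  proof -
    have "(\<Sum>k\<in>?K. (v k j)\<^sup>2) \<le> (\<Sum>k<N. (v k j)\<^sup>2)" by (intro sum_mono2) auto
    also have "\<dots> \<le> 1" using v_complete[OF assms(2,2)] by (simp add: power2_eq_square)
    finally show ?thesis .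
  qed
  have "(sv_grad N H v s a i j)\<^sup>2 \<le> (\<Sum>k\<in>?K. (left_unit N H v s k i)\<^sup>2) * (\<Sum>k\<in>?K. (v k j)\<^sup>2)"
    unfolding sv_grad_def by (rule Cauchy_Schwarz_ineq_sum)
  also have "\<dots> \<le> 1 * 1" using 1 2 by (intro mult_mono) (auto intro: sum_nonneg)
  finally show ?thesis by (simp add: abs_square_le_1)
qed

text \<open>The squared Frobenius norm of a partial isometry is its rank, whereas the entrywise
  bound would only give \<open>M * N\<close>.\<close>

lemma sv_grad_norm:
  assumes "0 \<le> a" shows "(\<Sum>i<M. \<Sum>j<N. (sv_grad N H v s a i j)\<^sup>2) \<le> real N"
proof -
  let ?K = "{k. k < N \<and> a < s k}"
  let ?u = "left_unit N H v s"
  have "(\<Sum>j<N. (sv_grad N H v s a i j)\<^sup>2) = (\<Sum>k\<in>?K. (?u k i)\<^sup>2)" for i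
  proof -
    have "(\<Sum>j<N. (sv_grad N H v s a i j)\<^sup>2) = (\<Sum>j<N. \<Sum>k\<in>?K. \<Sum>l\<in>?K. ?u k i * ?u l i * (v k j * v l j))"
      by (simp add: sv_grad_def power2_eq_square sum_product mult_ac)
    also have "\<dots> = (\<Sum>k\<in>?K. \<Sum>j<N. \<Sum>l\<in>?K. ?u k i * ?u l i * (v k j * v l j))" by (rule sum.swap)
    also have "\<dots> = (\<Sum>k\<in>?K. \<Sum>l\<in>?K. \<Sum>j<N. ?u k i * ?u l i * (v k j * v l j))" by (intro sum.cong refl sum.swap)
    also have "\<dots> = (\<Sum>k\<in>?K. \<Sum>l\<in>?K. if k = l then ?u k i * ?u l i else 0)"
      by (intro sum.cong refl) (simp add: sum_distrib_left[symmetric] v_orthonormal)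
    also have "\<dots> = (\<Sum>k\<in>?K. (?u k i)\<^sup>2)" by (intro sum.cong refl) (simp add: power2_eq_square)
    finally show ?thesis .
  qed
  then have "(\<Sum>i<M. \<Sum>j<N. (sv_grad N H v s a i j)\<^sup>2) = (\<Sum>i<M. \<Sum>k\<in>?K. (?u k i)\<^sup>2)" by simp
  also have "\<dots> = (\<Sum>k\<in>?K. \<Sum>i<M. (?u k i)\<^sup>2)" by (rule sum.swap)
  also have "\<dots> \<le> (\<Sum>k\<in>?K. 1)" by (intro sum_mono left_unit_norm) auto
  also have "\<dots> \<le> real N" using card_mono[of "{..<N}" ?K] by auto
  finally show ?thesis .
qed

lemma sv_grad_inner:
  "(\<Sum>i<M. \<Sum>j<N. sv_grad N H v s a i j * B i j)
    = (\<Sum>k | k < N \<and> a < s k. \<Sum>i<M. left_unit N H v s k i * (\<Sum>j<N. B i j * v k j))"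
proof -
  let ?K = "{k. k < N \<and> a < s k}"
  have "(\<Sum>i<M. \<Sum>j<N. sv_grad N H v s a i j * B i j)
    = (\<Sum>i<M. \<Sum>j<N. \<Sum>k\<in>?K. left_unit N H v s k i * (B i j * v k j))"
    by (simp add: sv_grad_def sum_distrib_right) (simp add: mult_ac)
  also have "\<dots> = (\<Sum>i<M. \<Sum>k\<in>?K. \<Sum>j<N. left_unit N H v s k i * (B i j * v k j))"
    by (intro sum.cong refl sum.swap)
  also have "\<dots> = (\<Sum>k\<in>?K. \<Sum>i<M. \<Sum>j<N. left_unit N H v s k i * (B i j * v k j))" by (rule sum.swap)
  finally show ?thesis by (simp add: sum_distrib_left)
qed

end

text \<open>The matrix \<open>sv_grad\<close> is a partial isometry, so its pairing with the competitor \<open>H'\<close> is at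
  most a weighted sum of the singular values of \<open>H'\<close> with weights in \<open>[0, 1]\<close> of total mass
  at most its rank.\<close>

lemma singular_value_max_subgradient:
  assumes geb: "gram_eigenbasis M N H v s" and geb': "gram_eigenbasis M N H' v' s'" and a: "0 \<le> a"
  shows "(\<Sum>k<N. max (s k) a) - (\<Sum>k<N. max (s' k) a)
    \<le> (\<Sum>i<M. \<Sum>j<N. sv_grad N H v s a i j * (H i j - H' i j))"
proof -
  let ?K = "{k. k < N \<and> a < s k}"
  let ?u = "left_unit N H v s" and ?u' = "left_unit N H' v' s'"
  define \<alpha> where "\<alpha> k l = (\<Sum>i<M. ?u k i * ?u' l i)" for k l
  define \<beta> where "\<beta> k l = (\<Sum>j<N. v k j * v' l j)" for k l
  \<comment> \<open>\<open>C l\<close> dominates the weight of \<open>s' l\<close> in the pairing,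
    by the inequality of arithmetic and geometric means. Bessel's inequality over \<open>k\<close>
    gives \<open>C l \<le> 1\<close>, and over \<open>l\<close> a total of at most the rank
    \<open>card ?K\<close>.\<close>
  define C where "C l = (\<Sum>k\<in>?K. ((\<alpha> k l)\<^sup>2 + (\<beta> k l)\<^sup>2) / 2)" for l
  have HH: "(\<Sum>i<M. \<Sum>j<N. sv_grad N H v s a i j * H i j) = (\<Sum>k\<in>?K. s k)"
    unfolding sv_grad_inner[OF geb]
  proof (rule sum.cong[OF refl])
    fix k assume "k \<in> ?K"
    then have k: "k < N" "s k > 0" using a by auto
    have "(\<Sum>i<M. ?u k i * (\<Sum>j<N. H i j * v k j)) = (\<Sum>i<M. ?u k i * (s k * ?u k i))"
      by (intro sum.cong refl) (use left_vec_unit[OF geb k(1)] in \<open>simp add: left_vec_def\<close>)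
    also have "\<dots> = s k * (\<Sum>i<M. ?u k i * ?u k i)" by (simp add: sum_distrib_left mult_ac)
    finally show "(\<Sum>i<M. ?u k i * (\<Sum>j<N. H i j * v k j)) = s k"
      using left_unit_orthonormal[OF geb k(1,1)] k by simp
  qed
  have HH': "(\<Sum>i<M. \<Sum>j<N. sv_grad N H v s a i j * H' i j) = (\<Sum>l<N. s' l * (\<Sum>k\<in>?K. \<alpha> k l * \<beta> k l))"
  proof -
    have exp: "(\<Sum>j<N. H' i j * v k j) = (\<Sum>l<N. s' l * (?u' l i * \<beta> k l))" if i: "i < M" for i k
    proof -
      have "(\<Sum>j<N. H' i j * v k j) = (\<Sum>j<N. (\<Sum>l<N. left_vec N H' v' l i * v' l j) * v k j)"
        by (intro sum.cong refl) (simp add: matrix_expansion[OF geb', symmetric])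
      also have "\<dots> = (\<Sum>j<N. \<Sum>l<N. left_vec N H' v' l i * (v k j * v' l j))"
        by (simp add: sum_distrib_right) (simp add: mult_ac)
      also have "\<dots> = (\<Sum>l<N. \<Sum>j<N. left_vec N H' v' l i * (v k j * v' l j))" by (rule sum.swap)
      also have "\<dots> = (\<Sum>l<N. s' l * (?u' l i * \<beta> k l))"
        by (intro sum.cong refl) (simp add: \<beta>_def left_vec_unit[OF geb'] i sum_distrib_left mult_ac)
      finally show ?thesis .
    qed
    have "(\<Sum>i<M. \<Sum>j<N. sv_grad N H v s a i j * H' i j)
      = (\<Sum>k\<in>?K. \<Sum>i<M. \<Sum>l<N. s' l * (?u k i * ?u' l i * \<beta> k l))"
      unfolding sv_grad_inner[OF geb] by (intro sum.cong refl) (simp add: exp sum_distrib_left mult_ac)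
    also have "\<dots> = (\<Sum>k\<in>?K. \<Sum>l<N. \<Sum>i<M. s' l * (?u k i * ?u' l i * \<beta> k l))"
      by (intro sum.cong refl sum.swap)
    also have "\<dots> = (\<Sum>l<N. \<Sum>k\<in>?K. \<Sum>i<M. s' l * (?u k i * ?u' l i * \<beta> k l))" by (rule sum.swap)
    also have "\<dots> = (\<Sum>l<N. s' l * (\<Sum>k\<in>?K. \<alpha> k l * \<beta> k l))"
      by (simp add: \<alpha>_def sum_distrib_left sum_distrib_right mult_ac)
    finally show ?thesis .
  qed
  have C_nonneg: "0 \<le> C l" for l unfolding C_def by (intro sum_nonneg) auto
  have C_le: "C l \<le> 1" if l: "l < N" for l
  proof -
    have "(\<Sum>k\<in>?K. (\<alpha> k l)\<^sup>2) \<le> (\<Sum>k<N. (\<alpha> k l)\<^sup>2)" by (intro sum_mono2) auto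
    also have "\<dots> \<le> (\<Sum>i<M. (?u' l i)\<^sup>2)" unfolding \<alpha>_def by (rule left_bessel[OF geb])
    also have "\<dots> \<le> 1" by (rule left_unit_norm[OF geb' l])
    finally have 1: "(\<Sum>k\<in>?K. (\<alpha> k l)\<^sup>2) \<le> 1" .
    have "(\<Sum>k\<in>?K. (\<beta> k l)\<^sup>2) \<le> (\<Sum>k<N. (\<beta> k l)\<^sup>2)" by (intro sum_mono2) auto
    also have "\<dots> \<le> (\<Sum>i<N. (v' l i)\<^sup>2)" unfolding \<beta>_def by (rule right_bessel[OF geb])
    finally have 2: "(\<Sum>k\<in>?K. (\<beta> k l)\<^sup>2) \<le> 1" using v_norm[OF geb' l] by simp
    show ?thesis using 1 2 by (simp add: C_def sum_divide_distrib[symmetric] sum.distrib)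
  qed
  have sumC: "(\<Sum>l<N. C l) \<le> real (card ?K)"
  proof -
    have "(\<Sum>l<N. C l) = (\<Sum>k\<in>?K. ((\<Sum>l<N. (\<alpha> k l)\<^sup>2) + (\<Sum>l<N. (\<beta> k l)\<^sup>2)) / 2)"
      unfolding C_def by (subst sum.swap) (simp add: sum_divide_distrib[symmetric] sum.distrib)
    also have "\<dots> \<le> (\<Sum>k\<in>?K. 1)"
    proof (rule sum_mono)
      fix k assume "k \<in> ?K"
      then have k: "k < N" by simp
      have "(\<Sum>l<N. (\<alpha> k l)\<^sup>2) \<le> (\<Sum>i<M. (?u k i)\<^sup>2)"
        using left_bessel[OF geb', of "?u k"] unfolding \<alpha>_def by (simp add: mult.commute)
      moreover have "(\<Sum>l<N. (\<beta> k l)\<^sup>2) \<le> (\<Sum>i<N. (v k i)\<^sup>2)"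
        using right_bessel[OF geb', of "v k"] unfolding \<beta>_def by (simp add: mult.commute)
      ultimately show "((\<Sum>l<N. (\<alpha> k l)\<^sup>2) + (\<Sum>l<N. (\<beta> k l)\<^sup>2)) / 2 \<le> 1"
        using left_unit_norm[OF geb k] v_norm[OF geb k] by simp
    qed
    finally show ?thesis by simp
  qed
  \<comment> \<open>\<open>max (s' l) a\<close> is split into its excess over \<open>a\<close>,
    which gets weight at most one, and the constant \<open>a\<close>, whose total weight is at most
    the rank.\<close>
  have "(\<Sum>l<N. s' l * (\<Sum>k\<in>?K. \<alpha> k l * \<beta> k l)) \<le> (\<Sum>l<N. (max (s' l) a - a) + a * C l)"
  proof (rule sum_mono)
    fix l assume "l \<in> {..<N}"
    then have l: "l < N" by simp
    have "\<alpha> k l * \<beta> k l \<le> ((\<alpha> k l)\<^sup>2 + (\<beta> k l)\<^sup>2) / 2" for k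
      using sum_squares_bound[of "\<alpha> k l" "\<beta> k l"] by simp
    then have "(\<Sum>k\<in>?K. \<alpha> k l * \<beta> k l) \<le> C l" unfolding C_def by (intro sum_mono)
    then have "s' l * (\<Sum>k\<in>?K. \<alpha> k l * \<beta> k l) \<le> s' l * C l"
      using s_nonneg[OF geb' l] by (rule mult_left_mono)
    also have "\<dots> \<le> max (s' l) a * C l" using C_nonneg by (intro mult_right_mono) auto
    also have "\<dots> = (max (s' l) a - a) * C l + a * C l" by (simp add: algebra_simps)
    also have "\<dots> \<le> (max (s' l) a - a) * 1 + a * C l"
      using C_le[OF l] by (intro add_right_mono mult_left_mono) auto
    finally show "s' l * (\<Sum>k\<in>?K. \<alpha> k l * \<beta> k l) \<le> (max (s' l) a - a) + a * C l" by simp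
  qed
  also have "\<dots> = (\<Sum>l<N. max (s' l) a) - real N * a + a * (\<Sum>l<N. C l)"
    by (simp add: sum.distrib sum_subtractf sum_distrib_left)
  also have "\<dots> \<le> (\<Sum>l<N. max (s' l) a) - real N * a + a * real (card ?K)"
    using sumC a by (intro add_left_mono mult_left_mono)
  finally have up: "(\<Sum>l<N. s' l * (\<Sum>k\<in>?K. \<alpha> k l * \<beta> k l)) \<le> \<dots>" .
  have "(\<Sum>k<N. max (s k) a) = (\<Sum>k<N. a + (if a < s k then s k - a else 0))"
    by (intro sum.cong) (auto simp: max_def)
  also have "\<dots> = real N * a + (\<Sum>k\<in>?K. s k - a)"
    by (simp add: sum.distrib sum.If_cases Collect_conj_eq lessThan_def inf_commute)
  also have "\<dots> = real N * a + (\<Sum>k\<in>?K. s k) - a * real (card ?K)" by (simp add: sum_subtractf)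
  finally have Z: "(\<Sum>k<N. max (s k) a) = \<dots>" .
  have "(\<Sum>i<M. \<Sum>j<N. sv_grad N H v s a i j * (H i j - H' i j))
    = (\<Sum>k\<in>?K. s k) - (\<Sum>l<N. s' l * (\<Sum>k\<in>?K. \<alpha> k l * \<beta> k l))"
    by (simp add: right_diff_distrib sum_subtractf HH HH')
  then show ?thesis using up Z by linarith
qed

section \<open>Concentration of singular value sums\<close>

definition bern_mat :: "real \<Rightarrow> real \<Rightarrow> (nat \<times> nat) set \<Rightarrow> nat \<Rightarrow> nat \<Rightarrow> real" where
  "bern_mat p q S i j = ((if (i, j) \<in> S then 1 else 0) - p) * q"

text \<open>A flip changes one entry by \<open>q\<close>, and the subgradient at \<open>S\<close>
  bounds the decrease by that entry of \<open>sv_grad\<close> times \<open>q\<close>. The squares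
  sum to at most \<open>N * q\<^sup>2\<close>; with \<open>1 / q\<close> as the parameter of the
  exponential moment, the quadratic term becomes \<open>N\<close>.\<close>

lemma singular_value_max_concentration:
  assumes p: "0 \<le> p" "p \<le> 1" and q: "0 < q" and a: "0 \<le> a"
    and geb: "\<And>S. gram_eigenbasis M N (bern_mat p q S) (v S) (s S)"
  defines "Z \<equiv> \<lambda>S. \<Sum>k<N. max (s S k) a"
  shows "cube_exp ({..<M} \<times> {..<N}) p (\<lambda>S. if \<bar>Z S - cube_exp ({..<M} \<times> {..<N}) p Z\<bar> \<ge> r then 1 else 0)
     \<le> 2 * exp (real N - r / q)"
proof -
  let ?I = "{..<M} \<times> {..<N}"
  let ?g = "\<lambda>S. sv_grad N (bern_mat p q S) (v S) (s S) a"
  have one: "Z S - Z T \<le> ?g S i j * (bern_mat p q S i j - bern_mat p q T i j)"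
    if "i < M" "j < N" "\<And>x. x \<noteq> (i, j) \<Longrightarrow> x \<in> S \<longleftrightarrow> x \<in> T" for S T i j
  proof -
    have "Z S - Z T \<le> (\<Sum>i<M. \<Sum>j<N. ?g S i j * (bern_mat p q S i j - bern_mat p q T i j))"
      unfolding Z_def using singular_value_max_subgradient[OF geb geb a] .
    also have "\<dots> = (\<Sum>x\<in>?I. case x of (i', j') \<Rightarrow> ?g S i' j' * (bern_mat p q S i' j' - bern_mat p q T i' j'))"
      by (simp add: sum.cartesian_product)
    also have "\<dots> = (\<Sum>x\<in>{(i, j)}. case x of (i', j') \<Rightarrow> ?g S i' j' * (bern_mat p q S i' j' - bern_mat p q T i' j'))"
    proof (rule sum.mono_neutral_right)
      show "\<forall>x\<in>?I - {(i, j)}. (case x of (i', j') \<Rightarrow> ?g S i' j' * (bern_mat p q S i' j' - bern_mat p q T i' j')) = 0"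
      proof
        fix x assume "x \<in> ?I - {(i, j)}"
        then have "x \<in> S \<longleftrightarrow> x \<in> T" using that(3) by auto
        then show "(case x of (i', j') \<Rightarrow> ?g S i' j' * (bern_mat p q S i' j' - bern_mat p q T i' j')) = 0"
          by (cases x) (simp add: bern_mat_def)
      qed
    qed (use that in auto)
    finally show ?thesis by simp
  qed
  have bd: "\<bar>bern_mat p q S i j - bern_mat p q T i j\<bar> \<le> q" for S T i j
    using q by (auto simp: bern_mat_def algebra_simps)
  have one': "Z S - Z T \<le> \<bar>?g S i j\<bar> * q"
    if "i < M" "j < N" "\<And>x. x \<noteq> (i, j) \<Longrightarrow> x \<in> S \<longleftrightarrow> x \<in> T" for S T i j
  proof -
    have "?g S i j * (bern_mat p q S i j - bern_mat p q T i j) \<le> \<bar>?g S i j\<bar> * \<bar>bern_mat p q S i j - bern_mat p q T i j\<bar>"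
      by (metis abs_ge_self abs_mult)
    also have "\<dots> \<le> \<bar>?g S i j\<bar> * q" using bd by (intro mult_left_mono) auto
    finally show ?thesis using one[OF that] by simp
  qed
  have gle: "\<bar>?g S i j\<bar> * q \<le> q" if "i < M" "j < N" for S i j
    using sv_grad_abs_le[OF geb that] q by (simp add: mult_left_le_one_le)
  have conc: "cube_exp ?I p (\<lambda>S. if \<bar>Z S - cube_exp ?I p Z\<bar> \<ge> r then 1 else 0)
     \<le> 2 * exp ((1 / q)\<^sup>2 * (real N * q\<^sup>2) - (1 / q) * r)"
  proof (rule cube_concentration)
    fix e S assume "e \<in> ?I" "S \<subseteq> ?I"
    then obtain i j where e: "e = (i, j)" "i < M" "j < N" by auto
    have "Z (insert e S) - Z (S - {e}) \<le> q"
      by (rule order_trans[OF one'[OF e(2,3)] gle[OF e(2,3)]]) (auto simp: e)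
    moreover have "Z (S - {e}) - Z (insert e S) \<le> q"
      by (rule order_trans[OF one'[OF e(2,3)] gle[OF e(2,3)]]) (auto simp: e)
    ultimately show "1 / q * \<bar>Z (insert e S) - Z (S - {e})\<bar> \<le> 1" using q by (simp add: divide_le_eq)
  next
    fix S assume "S \<subseteq> ?I"
    have "(\<Sum>e\<in>?I. (max 0 (Z S - Z (flip e S)))\<^sup>2) \<le> (\<Sum>e\<in>?I. case e of (i, j) \<Rightarrow> (?g S i j)\<^sup>2 * q\<^sup>2)"
    proof (rule sum_mono)
      fix e assume "e \<in> ?I"
      then obtain i j where e: "e = (i, j)" "i < M" "j < N" by auto
      have "Z S - Z (flip e S) \<le> \<bar>?g S i j\<bar> * q" by (rule one'[OF e(2,3)]) (auto simp: flip_def e)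
      then have "max 0 (Z S - Z (flip e S)) \<le> \<bar>?g S i j\<bar> * q" using q by simp
      then have "(max 0 (Z S - Z (flip e S)))\<^sup>2 \<le> (\<bar>?g S i j\<bar> * q)\<^sup>2" by (intro power_mono) auto
      then show "(max 0 (Z S - Z (flip e S)))\<^sup>2 \<le> (case e of (i, j) \<Rightarrow> (?g S i j)\<^sup>2 * q\<^sup>2)"
        by (simp add: e power_mult_distrib)
    qed
    also have "\<dots> = (\<Sum>i<M. \<Sum>j<N. (?g S i j)\<^sup>2) * q\<^sup>2"
      by (simp add: sum.cartesian_product[symmetric] sum_distrib_right)
    also have "\<dots> \<le> real N * q\<^sup>2" using sv_grad_norm[OF geb a] by (intro mult_right_mono) auto
    finally show "(\<Sum>e\<in>?I. (max 0 (Z S - Z (flip e S)))\<^sup>2) \<le> real N * q\<^sup>2" .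
  qed (use p q in auto)
  also have "(1 / q)\<^sup>2 * (real N * q\<^sup>2) - (1 / q) * r = real N - r / q" using q by (simp add: power_divide)
  finally show ?thesis .
qed

section \<open>The resolvent of the Hermitization\<close>

text \<open>Entries of the symmetric block matrix with \<open>H\<close> and its transpose off the
  diagonal. It is linear in \<open>H\<close>, unlike the Gram matrix, so changing one entry perturbs
  the resolvent by two explicit products.\<close>

fun bip :: "(nat \<Rightarrow> nat \<Rightarrow> real) \<Rightarrow> nat + nat \<Rightarrow> nat + nat \<Rightarrow> real" where
  "bip H (Inl i) (Inr j) = H i j"
| "bip H (Inr j) (Inl i) = H i j"
| "bip H (Inl i) (Inl i') = 0"
| "bip H (Inr j) (Inr j') = 0"

definition bip_index :: "nat \<Rightarrow> nat \<Rightarrow> (nat + nat) set" where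
  "bip_index M N = Inl ` {..<M} \<union> Inr ` {..<N}"

lemma finite_bip_index [simp]: "finite (bip_index M N)" by (simp add: bip_index_def)

lemma sum_bip_index: "(\<Sum>x\<in>bip_index M N. f x) = (\<Sum>i<M. f (Inl i)) + (\<Sum>j<N. f (Inr j))"
  unfolding bip_index_def by (subst sum.union_disjoint) (auto simp: sum.reindex)

lemma bip_index_iff [simp]: "Inl i \<in> bip_index M N \<longleftrightarrow> i < M" "Inr j \<in> bip_index M N \<longleftrightarrow> j < N"
  by (auto simp: bip_index_def)

text \<open>Only the right inverse equation is imposed; as \<open>bip H\<close> is symmetric, the symmetry of \<open>G\<close>
  supplies the left one.\<close>

definition is_resolvent :: "nat \<Rightarrow> nat \<Rightarrow> (nat \<Rightarrow> nat \<Rightarrow> real) \<Rightarrow> complex \<Rightarrow> (nat + nat \<Rightarrow> nat + nat \<Rightarrow> complex) \<Rightarrow> bool" where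
  "is_resolvent M N H z G \<longleftrightarrow>
     (\<forall>u\<in>bip_index M N. \<forall>w\<in>bip_index M N.
        (\<Sum>x\<in>bip_index M N. of_real (bip H u x) * G x w) = z * G u w + (if u = w then 1 else 0)
      \<and> G u w = G w u)"

lemma bip_sym: "bip H u x = bip H x u"
  by (cases u; cases x) auto

context
  fixes M N H z G
  assumes res: "is_resolvent M N H z G"
begin

lemma resolvent_left: "u \<in> bip_index M N \<Longrightarrow> w \<in> bip_index M N \<Longrightarrow>
    (\<Sum>x\<in>bip_index M N. of_real (bip H u x) * G x w) = z * G u w + (if u = w then 1 else 0)"
  and resolvent_sym: "u \<in> bip_index M N \<Longrightarrow> w \<in> bip_index M N \<Longrightarrow> G u w = G w u"
  using res unfolding is_resolvent_def by blast+

lemma resolvent_right: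
  assumes "u \<in> bip_index M N" "w \<in> bip_index M N"
  shows "(\<Sum>x\<in>bip_index M N. G u x * of_real (bip H x w)) = z * G u w + (if u = w then 1 else 0)"
proof -
  have "(\<Sum>x\<in>bip_index M N. G u x * of_real (bip H x w)) = (\<Sum>x\<in>bip_index M N. of_real (bip H w x) * G x u)"
    by (intro sum.cong refl) (simp add: bip_sym[of H w] resolvent_sym[OF assms(1)])
  then show ?thesis using resolvent_left[OF assms(2,1)] resolvent_sym[OF assms] by auto
qed

text \<open>The Ward identity: the squared norm of the column times \<open>Im z\<close> is
  \<open>Im (G w w)\<close>, because the quadratic form \<open>q\<close> of the symmetric matrix
  \<open>bip H\<close> on that column is real.\<close>

lemma resolvent_column_norm:
  assumes w: "w \<in> bip_index M N" and t: "Im z > 0"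
  shows "(\<Sum>u\<in>bip_index M N. (cmod (G u w))\<^sup>2) \<le> 1 / (Im z)\<^sup>2" "cmod (G w w) \<le> 1 / Im z"
proof -
  let ?V = "bip_index M N"
  define r where "r = (\<Sum>u\<in>?V. (cmod (G u w))\<^sup>2)"
  define q where "q = (\<Sum>u\<in>?V. \<Sum>x\<in>?V. cnj (G u w) * (of_real (bip H u x) * G x w))"
  have "q = (\<Sum>u\<in>?V. cnj (G u w) * (z * G u w + (if u = w then 1 else 0)))"
    unfolding q_def by (intro sum.cong refl) (simp add: sum_distrib_left[symmetric] resolvent_left w)
  also have "\<dots> = (\<Sum>u\<in>?V. z * of_real ((cmod (G u w))\<^sup>2) + (if u = w then cnj (G u w) else 0))"
  proof (intro sum.cong refl)
    fix u
    have "cnj (G u w) * G u w = of_real ((cmod (G u w))\<^sup>2)" by (metis complex_norm_square mult.commute)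
    then show "cnj (G u w) * (z * G u w + (if u = w then 1 else 0))
      = z * of_real ((cmod (G u w))\<^sup>2) + (if u = w then cnj (G u w) else 0)"
      by (simp only: distrib_left mult.left_commute[of "cnj (G u w)" z]) auto
  qed
  also have "\<dots> = z * of_real r + cnj (G w w)"
    unfolding r_def of_real_sum sum_distrib_left using w by (simp add: sum.distrib)
  finally have q1: "q = z * of_real r + cnj (G w w)" .
  have "cnj q = (\<Sum>u\<in>?V. \<Sum>x\<in>?V. cnj (G x w) * (of_real (bip H x u) * G u w))"
    unfolding q_def by (simp add: bip_sym mult_ac)
  also have "\<dots> = q" unfolding q_def by (rule sum.swap)
  finally have "Im q = 0" by (simp add: complex_eq_iff)
  then have r: "Im z * r = Im (G w w)" unfolding q1 by simp
  have le: "r * Im z \<le> cmod (G w w)" using r abs_Im_le_cmod[of "G w w"] by (simp add: mult.commute)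
  have "(cmod (G w w))\<^sup>2 \<le> r" unfolding r_def using w by (intro member_le_sum) auto
  then have "(cmod (G w w))\<^sup>2 * Im z \<le> cmod (G w w)" using le t
    by (meson mult_right_mono order_trans less_imp_le)
  then show 1: "cmod (G w w) \<le> 1 / Im z"
    using t by (cases "G w w = 0") (auto simp: power2_eq_square pos_le_divide_eq)
  have "r \<le> (1 / Im z) / Im z" by (subst pos_le_divide_eq[OF t]) (rule order_trans[OF le 1])
  then show "r \<le> 1 / (Im z)\<^sup>2" by (simp add: power2_eq_square)
qed

lemma resolvent_entry_le:
  assumes "u \<in> bip_index M N" "w \<in> bip_index M N" and t: "Im z > 0"
  shows "cmod (G u w) \<le> 1 / Im z"
proof -
  have "(cmod (G u w))\<^sup>2 \<le> (\<Sum>u\<in>bip_index M N. (cmod (G u w))\<^sup>2)"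
    using assms by (intro member_le_sum) auto
  also have "\<dots> \<le> (1 / Im z)\<^sup>2" using resolvent_column_norm(1)[OF assms(2) t] by (simp add: power_divide)
  finally show ?thesis using t by (simp add: abs_le_square_iff[symmetric])
qed

text \<open>Both partial traces of the block matrix times \<open>G\<close> are the same double sum;
  comparing them ties the black trace to the white one.\<close>

lemma resolvent_block_traces:
  "(\<Sum>i<M. \<Sum>j<N. of_real (H i j) * G (Inl i) (Inr j)) = of_nat M + z * (\<Sum>i<M. G (Inl i) (Inl i))"
  "(\<Sum>i<M. \<Sum>j<N. of_real (H i j) * G (Inl i) (Inr j)) = of_nat N + z * (\<Sum>j<N. G (Inr j) (Inr j))"
proof -
  have a: "(\<Sum>j<N. of_real (H i j) * G (Inl i) (Inr j)) = z * G (Inl i) (Inl i) + 1" if "i < M" for i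
  proof -
    have "(\<Sum>j<N. of_real (H i j) * G (Inl i) (Inr j)) = (\<Sum>j<N. of_real (H i j) * G (Inr j) (Inl i))"
      using that by (intro sum.cong refl) (simp add: resolvent_sym[of "Inl i"])
    then show ?thesis using resolvent_left[of "Inl i" "Inl i"] that by (simp add: sum_bip_index)
  qed
  show "(\<Sum>i<M. \<Sum>j<N. of_real (H i j) * G (Inl i) (Inr j)) = of_nat M + z * (\<Sum>i<M. G (Inl i) (Inl i))"
    by (simp add: a sum.distrib sum_distrib_left)
  have b: "(\<Sum>i<M. of_real (H i j) * G (Inl i) (Inr j)) = z * G (Inr j) (Inr j) + 1" if "j < N" for j
    using resolvent_left[of "Inr j" "Inr j"] that by (simp add: sum_bip_index)
  show "(\<Sum>i<M. \<Sum>j<N. of_real (H i j) * G (Inl i) (Inr j)) = of_nat N + z * (\<Sum>j<N. G (Inr j) (Inr j))"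
    by (subst sum.swap) (simp add: b sum.distrib sum_distrib_left)
qed

end

text \<open>The resolvent identity G' - G = - G' (H' - H) G, obtained by evaluating the product on
  the right with the equations of both resolvents. The changed entry occupies two symmetric
  positions, hence two products.\<close>

lemma resolvent_perturbation:
  assumes G: "is_resolvent M N H z G" and G': "is_resolvent M N H' z G'"
    and ij: "i < M" "j < N" and u: "u \<in> bip_index M N" and w: "w \<in> bip_index M N"
    and H': "\<And>a b. a < M \<Longrightarrow> b < N \<Longrightarrow> H' a b = H a b + (if a = i \<and> b = j then \<theta> else 0)"
  shows "G' u w - G u w = - of_real \<theta> * (G' u (Inl i) * G (Inr j) w + G' u (Inr j) * G (Inl i) w)"
proof -
  let ?V = "bip_index M N"
  define \<Delta> where "\<Delta> x y = complex_of_real (bip H' x y) - of_real (bip H x y)" for x y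
  have "(\<Sum>x\<in>?V. \<Sum>y\<in>?V. G' u x * \<Delta> x y * G y w)
     = (\<Sum>x\<in>?V. \<Sum>y\<in>?V. G' u x * of_real (bip H' x y) * G y w) - (\<Sum>x\<in>?V. \<Sum>y\<in>?V. G' u x * (of_real (bip H x y) * G y w))"
    unfolding \<Delta>_def by (simp add: sum_subtractf algebra_simps)
  also have "(\<Sum>x\<in>?V. \<Sum>y\<in>?V. G' u x * of_real (bip H' x y) * G y w)
    = (\<Sum>y\<in>?V. (\<Sum>x\<in>?V. G' u x * of_real (bip H' x y)) * G y w)"
    unfolding sum_distrib_right by (rule sum.swap)
  also have "\<dots> = (\<Sum>y\<in>?V. z * (G' u y * G y w) + (if u = y then G y w else 0))"
    by (intro sum.cong refl) (auto simp: resolvent_right[OF G' u] algebra_simps)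
  also have "\<dots> = z * (\<Sum>y\<in>?V. G' u y * G y w) + G u w"
    using u by (simp add: sum.distrib sum_distrib_left)
  also have "(\<Sum>x\<in>?V. \<Sum>y\<in>?V. G' u x * (of_real (bip H x y) * G y w))
    = (\<Sum>x\<in>?V. z * (G' u x * G x w) + (if x = w then G' u x else 0))"
    by (intro sum.cong refl, subst sum_distrib_left[symmetric], subst resolvent_left[OF G _ w])
      (auto simp: algebra_simps)
  also have "\<dots> = z * (\<Sum>y\<in>?V. G' u y * G y w) + G' u w"
    using w by (simp add: sum.distrib sum_distrib_left)
  finally have 1: "(\<Sum>x\<in>?V. \<Sum>y\<in>?V. G' u x * \<Delta> x y * G y w) = G u w - G' u w" by simp
  have D1: "\<Delta> (Inl a) (Inr b) = (if a = i \<and> b = j then of_real \<theta> else 0)" if "a < M" "b < N" for a b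
    using that by (simp add: \<Delta>_def H')
  have D2: "\<Delta> (Inr b) (Inl a) = (if a = i \<and> b = j then of_real \<theta> else 0)" if "a < M" "b < N" for a b
    using that by (simp add: \<Delta>_def H')
  have D3: "\<Delta> (Inl a) (Inl b) = 0" "\<Delta> (Inr a) (Inr b) = 0" for a b by (simp_all add: \<Delta>_def)
  have "(\<Sum>x\<in>?V. \<Sum>y\<in>?V. G' u x * \<Delta> x y * G y w)
    = (\<Sum>a<M. \<Sum>b<N. if a = i \<and> b = j then G' u (Inl a) * of_real \<theta> * G (Inr b) w else 0)
    + (\<Sum>b<N. \<Sum>a<M. if a = i \<and> b = j then G' u (Inr b) * of_real \<theta> * G (Inl a) w else 0)"
    by (auto simp: sum_bip_index D3 intro!: arg_cong2[where f = "(+)"] sum.cong simp: D1 D2)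
  also have "\<dots> = of_real \<theta> * (G' u (Inl i) * G (Inr j) w + G' u (Inr j) * G (Inl i) w)"
  proof -
    have "(\<Sum>a<M. \<Sum>b<N. if a = i \<and> b = j then f a b else 0) = f i j" for f :: "nat \<Rightarrow> nat \<Rightarrow> complex"
    proof -
      have "(\<Sum>a<M. \<Sum>b<N. if a = i \<and> b = j then f a b else 0) = (\<Sum>a<M. if a = i then f a j else 0)"
        using ij by (intro sum.cong) auto
      then show ?thesis using ij by simp
    qed
    moreover have "(\<Sum>b<N. \<Sum>a<M. if a = i \<and> b = j then f a b else 0) = f i j" for f :: "nat \<Rightarrow> nat \<Rightarrow> complex"
    proof -
      have "(\<Sum>b<N. \<Sum>a<M. if a = i \<and> b = j then f a b else 0) = (\<Sum>b<N. if b = j then f i b else 0)"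
        using ij by (intro sum.cong) auto
      then show ?thesis using ij by simp
    qed
    ultimately show ?thesis by (simp add: algebra_simps)
  qed
  finally show ?thesis using 1 by (simp add: algebra_simps)
qed

text \<open>The black block is solved from the resolvent equation, as (H G - 1) / z with
  \<open>G\<close> the white-black block. This spares a basis for the complement of the column space
  of \<open>H\<close>, on which the resolvent acts as - 1 / z.\<close>

fun svd_resolvent :: "nat \<Rightarrow> (nat \<Rightarrow> nat \<Rightarrow> real) \<Rightarrow> (nat \<Rightarrow> nat \<Rightarrow> real) \<Rightarrow> (nat \<Rightarrow> real) \<Rightarrow> complex \<Rightarrow> nat + nat \<Rightarrow> nat + nat \<Rightarrow> complex" where
  "svd_resolvent N H v s z (Inr j) (Inr l) = (\<Sum>k<N. of_real (v k j * v k l) * (z / ((of_real (s k))\<^sup>2 - z\<^sup>2)))"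
| "svd_resolvent N H v s z (Inl i) (Inr l) = (\<Sum>k<N. of_real (left_vec N H v k i * v k l) * (1 / ((of_real (s k))\<^sup>2 - z\<^sup>2)))"
| "svd_resolvent N H v s z (Inr l) (Inl i) = (\<Sum>k<N. of_real (left_vec N H v k i * v k l) * (1 / ((of_real (s k))\<^sup>2 - z\<^sup>2)))"
| "svd_resolvent N H v s z (Inl i) (Inl i') =
     ((\<Sum>k<N. of_real (left_vec N H v k i * left_vec N H v k i') * (1 / ((of_real (s k))\<^sup>2 - z\<^sup>2))) - (if i = i' then 1 else 0)) / z"

lemma real_square_neq_square:
  assumes "Im z > 0" shows "(complex_of_real s)\<^sup>2 - z\<^sup>2 \<noteq> 0"
proof
  assume "(complex_of_real s)\<^sup>2 - z\<^sup>2 = 0"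
  then have "(complex_of_real s)\<^sup>2 = z\<^sup>2" by simp
  then have "z = of_real s \<or> z = - of_real s" by (metis power2_eq_iff minus_minus)
  then show False using assms by auto
qed

lemma svd_resolvent:
  assumes geb: "gram_eigenbasis M N H v s" and z: "Im z > 0"
  shows "is_resolvent M N H z (svd_resolvent N H v s z)"
proof -
  let ?G = "svd_resolvent N H v s z" and ?L = "left_vec N H v"
  define q where "q k = 1 / ((complex_of_real (s k))\<^sup>2 - z\<^sup>2)" for k
  have nz: "(complex_of_real (s k))\<^sup>2 - z\<^sup>2 \<noteq> 0" for k by (rule real_square_neq_square[OF z])
  have z0: "z \<noteq> 0" using z by auto
  have q: "(of_real (s k))\<^sup>2 * q k = 1 + z\<^sup>2 * q k" for k
  proof -
    have "(of_real (s k))\<^sup>2 * q k - z\<^sup>2 * q k = ((of_real (s k))\<^sup>2 - z\<^sup>2) * q k" by (simp add: algebra_simps)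
    also have "\<dots> = 1" using nz[of k] by (simp add: q_def)
    finally show ?thesis by (simp add: algebra_simps)
  qed
  have Gww: "?G (Inr j) (Inr l) = z * (\<Sum>k<N. of_real (v k j * v k l) * q k)" for j l
    by (simp add: q_def sum_distrib_left mult_ac)
  have Gbw: "?G (Inl i) (Inr l) = (\<Sum>k<N. of_real (?L k i * v k l) * q k)" for i l by (simp add: q_def)
  have Gwb: "?G (Inr l) (Inl i) = (\<Sum>k<N. of_real (?L k i * v k l) * q k)" for i l by (simp add: q_def)
  have Gbb: "z * ?G (Inl i) (Inl i') = (\<Sum>k<N. of_real (?L k i * ?L k i') * q k) - (if i = i' then 1 else 0)" for i i'
    using z0 by (simp add: q_def)
  have HL: "(\<Sum>i<M. of_real (H i j) * (\<Sum>k<N. of_real (?L k i * f k) * q k))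
     = (\<Sum>k<N. of_real (f k * v k j)) + z\<^sup>2 * (\<Sum>k<N. of_real (f k * v k j) * q k)" if j: "j < N" for j f
  proof -
    have "(\<Sum>i<M. of_real (H i j) * (\<Sum>k<N. of_real (?L k i * f k) * q k))
      = (\<Sum>i<M. \<Sum>k<N. of_real (H i j * ?L k i) * (of_real (f k) * q k))"
      by (simp add: sum_distrib_left mult_ac)
    also have "\<dots> = (\<Sum>k<N. \<Sum>i<M. of_real (H i j * ?L k i) * (of_real (f k) * q k))" by (rule sum.swap)
    also have "\<dots> = (\<Sum>k<N. of_real (\<Sum>i<M. H i j * ?L k i) * (of_real (f k) * q k))"
      unfolding of_real_sum sum_distrib_right ..
    also have "\<dots> = (\<Sum>k<N. of_real (f k * v k j) * ((of_real (s k))\<^sup>2 * q k))"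
      by (intro sum.cong refl) (simp add: left_vec_def gram_ev[OF geb _ j] mult_ac)
    also have "\<dots> = (\<Sum>k<N. of_real (f k * v k j)) + z\<^sup>2 * (\<Sum>k<N. of_real (f k * v k j) * q k)"
      unfolding q by (simp add: sum.distrib sum_distrib_left algebra_simps)
    finally show ?thesis .
  qed
  have HV: "(\<Sum>j<N. of_real (H i j) * (\<Sum>k<N. of_real (f k * v k j) * q k))
     = (\<Sum>k<N. of_real (?L k i * f k) * q k)" for i f
  proof -
    have "(\<Sum>j<N. of_real (H i j) * (\<Sum>k<N. of_real (f k * v k j) * q k))
      = (\<Sum>j<N. \<Sum>k<N. of_real (H i j * v k j) * (of_real (f k) * q k))"
      by (simp add: sum_distrib_left mult_ac)
    also have "\<dots> = (\<Sum>k<N. \<Sum>j<N. of_real (H i j * v k j) * (of_real (f k) * q k))" by (rule sum.swap)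
    also have "\<dots> = (\<Sum>k<N. of_real (\<Sum>j<N. H i j * v k j) * (of_real (f k) * q k))"
      unfolding of_real_sum sum_distrib_right ..
    also have "\<dots> = (\<Sum>k<N. of_real (?L k i * f k) * q k)" by (simp add: left_vec_def mult_ac)
    finally show ?thesis .
  qed
  have main: "(\<Sum>x\<in>bip_index M N. of_real (bip H u x) * ?G x w) = z * ?G u w + (if u = w then 1 else 0)"
    if u: "u \<in> bip_index M N" and w: "w \<in> bip_index M N" for u w
  proof (cases u)
    case (Inr j)
    then have j: "j < N" using u by simp
    show ?thesis
    proof (cases w)
      case (Inr l)
      then have l: "l < N" using w by simp
      have "(\<Sum>k<N. of_real (v k l * v k j)) = (if l = j then 1 else (0::complex))"
        unfolding of_real_sum[symmetric] using v_complete[OF geb l j] by simp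
      then have "(\<Sum>i<M. of_real (H i j) * ?G (Inl i) (Inr l))
        = (if l = j then 1 else 0) + z\<^sup>2 * (\<Sum>k<N. of_real (v k l * v k j) * q k)"
        unfolding Gbw HL[OF j, of "\<lambda>k. v k l"] by simp
      also have "z\<^sup>2 * (\<Sum>k<N. of_real (v k l * v k j) * q k) = z * ?G (Inr j) (Inr l)"
        unfolding Gww power2_eq_square by (simp only: mult_ac)
      finally show ?thesis unfolding \<open>u = Inr j\<close> Inr
        by (simp add: sum_bip_index del: svd_resolvent.simps)
    next
      case (Inl i')
      then have i': "i' < M" using w by simp
      have "(\<Sum>k<N. of_real (?L k i' * v k j)) = complex_of_real (H i' j)"
        unfolding of_real_sum[symmetric] by (simp add: matrix_expansion[OF geb j])
      then have e: "(\<Sum>i<M. of_real (H i j) * (\<Sum>k<N. of_real (?L k i * ?L k i') * q k))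
        = of_real (H i' j) + z\<^sup>2 * (\<Sum>k<N. of_real (?L k i' * v k j) * q k)"
        unfolding HL[OF j, of "\<lambda>k. ?L k i'"] by simp
      have "z * (\<Sum>i<M. of_real (H i j) * ?G (Inl i) (Inl i')) = (\<Sum>i<M. of_real (H i j) * (z * ?G (Inl i) (Inl i')))"
        by (simp only: sum_distrib_left mult_ac)
      also have "\<dots> = (\<Sum>i<M. of_real (H i j) * (\<Sum>k<N. of_real (?L k i * ?L k i') * q k) - (if i = i' then of_real (H i j) else 0))"
        unfolding Gbb by (intro sum.cong refl) (auto simp: algebra_simps)
      also have "\<dots> = z\<^sup>2 * (\<Sum>k<N. of_real (?L k i' * v k j) * q k)"
        unfolding sum_subtractf e using i' by simp
      also have "\<dots> = z * (z * ?G (Inr j) (Inl i'))" unfolding Gwb by (simp add: power2_eq_square)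
      finally have "(\<Sum>i<M. of_real (H i j) * ?G (Inl i) (Inl i')) = z * ?G (Inr j) (Inl i')" using z0 by simp
      then show ?thesis unfolding \<open>u = Inr j\<close> Inl
        by (simp add: sum_bip_index del: svd_resolvent.simps)
    qed
  next
    case (Inl i)
    show ?thesis
    proof (cases w)
      case (Inr l)
      have "(\<Sum>j<N. of_real (H i j) * ?G (Inr j) (Inr l)) = z * (\<Sum>j<N. of_real (H i j) * (\<Sum>k<N. of_real (v k l * v k j) * q k))"
        unfolding Gww by (simp add: sum_distrib_left mult_ac)
      also have "\<dots> = z * ?G (Inl i) (Inr l)" unfolding HV Gbw ..
      finally show ?thesis unfolding \<open>u = Inl i\<close> Inr by (simp add: sum_bip_index del: svd_resolvent.simps)
    next
      case (Inl i')
      have "(\<Sum>j<N. of_real (H i j) * ?G (Inr j) (Inl i')) = (\<Sum>k<N. of_real (?L k i * ?L k i') * q k)"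
        unfolding Gwb HV ..
      also have "\<dots> = z * ?G (Inl i) (Inl i') + (if i = i' then 1 else 0)" unfolding Gbb by simp
      finally show ?thesis unfolding \<open>u = Inl i\<close> Inl by (simp add: sum_bip_index del: svd_resolvent.simps)
    qed
  qed
  have sym: "?G u w = ?G w u" for u w
    by (cases u; cases w) (auto simp: mult_ac)
  show ?thesis unfolding is_resolvent_def using main sym by blast
qed

lemma svd_resolvent_white_trace:
  assumes "gram_eigenbasis M N H v s"
  shows "(\<Sum>j<N. svd_resolvent N H v s z (Inr j) (Inr j)) = (\<Sum>k<N. z / ((of_real (s k))\<^sup>2 - z\<^sup>2))"
proof -
  have "(\<Sum>j<N. svd_resolvent N H v s z (Inr j) (Inr j))
    = (\<Sum>k<N. \<Sum>j<N. of_real (v k j * v k j) * (z / ((of_real (s k))\<^sup>2 - z\<^sup>2)))"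
    unfolding svd_resolvent.simps by (rule sum.swap)
  also have "\<dots> = (\<Sum>k<N. of_real (\<Sum>j<N. v k j * v k j) * (z / ((of_real (s k))\<^sup>2 - z\<^sup>2)))"
    unfolding of_real_sum sum_distrib_right ..
  finally show ?thesis by (simp add: v_orthonormal[OF assms])
qed

section \<open>The self-consistent equation\<close>

text \<open>Exact two-point counterpart of Gaussian integration by parts: a centred entry only sees
  the difference of \<open>f\<close> between the entry on and off, so there is no Taylor
  remainder.\<close>

lemma centered_bernoulli_ibp:
  fixes f :: "(nat \<times> nat) set \<Rightarrow> complex"
  assumes "finite I" "(i, j) \<in> I"
  shows "cube_exp I p (\<lambda>S. of_real (bern_mat p q S i j) * f S)
    = of_real (p * (1 - p) * q) * cube_exp I p (\<lambda>S. f (insert (i, j) S) - f (S - {(i, j)}))"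
  unfolding cube_exp_cmult[symmetric]
  by (subst cube_exp_split[OF assms])
    (intro cube_exp_cong, simp add: bern_mat_def scaleR_conv_of_real algebra_simps)

text \<open>One eigenbasis is fixed for every \<open>S\<close> at once, so that the singular values
  become random variables on the cube.\<close>

locale bernoulli_spectrum =
  fixes M N db dw :: nat and p q \<gamma> :: real
    and v :: "(nat \<times> nat) set \<Rightarrow> nat \<Rightarrow> nat \<Rightarrow> real" and s :: "(nat \<times> nat) set \<Rightarrow> nat \<Rightarrow> real"
  assumes sizes: "0 < N" "N \<le> M" "0 < db" "db \<le> N" "M * db = N * dw"
    and p_def: "p = real db / real N" and q_def: "q = 1 / sqrt (real dw)" and \<gamma>_def: "\<gamma> = real N / real M"
    and geb: "\<And>S. gram_eigenbasis M N (bern_mat p q S) (v S) (s S)"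
begin

abbreviation "I \<equiv> {..<M} \<times> {..<N}"
abbreviation "E \<equiv> cube_exp I p"

lemma parameter_bounds: "0 < \<gamma>" "\<gamma> \<le> 1" "0 \<le> p" "p \<le> 1" "0 < M" "0 < dw" "db \<le> dw" "0 < q"
proof -
  show M: "0 < M" using sizes by simp
  show dw: "0 < dw" using sizes M by (cases dw) auto
  have "N * db \<le> N * dw" using sizes(2,5) by (metis mult_le_mono1)
  then show "db \<le> dw" using sizes by simp
  show "0 < q" "0 \<le> p" "p \<le> 1" using sizes dw by (auto simp: q_def p_def)
  show "0 < \<gamma>" "\<gamma> \<le> 1" using sizes by (auto simp: \<gamma>_def)
qed

end

locale bernoulli_resolvent = bernoulli_spectrum +
  fixes z :: complex
  assumes z: "Im z > 0"
begin

abbreviation "T \<equiv> 1 / Im z"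

definition G :: "(nat \<times> nat) set \<Rightarrow> nat + nat \<Rightarrow> nat + nat \<Rightarrow> complex" where
  "G S = svd_resolvent N (bern_mat p q S) (v S) (s S) z"

definition mw :: "(nat \<times> nat) set \<Rightarrow> complex" where "mw S = (\<Sum>j<N. G S (Inr j) (Inr j)) / of_nat N"
definition mb :: "(nat \<times> nat) set \<Rightarrow> complex" where "mb S = (\<Sum>i<M. G S (Inl i) (Inl i)) / of_nat M"

lemma G: "is_resolvent M N (bern_mat p q S) z (G S)"
  unfolding G_def by (rule svd_resolvent[OF geb z])

lemma pos: "0 < M" "0 < dw" "db \<le> dw" "0 < q" "0 \<le> p" "p \<le> 1" "0 < T" "z \<noteq> 0"
  using parameter_bounds z by auto

lemma pq2: "p * q\<^sup>2 = 1 / real M"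
proof -
  have "real M * real db = real N * real dw" using sizes(5) by (metis of_nat_mult)
  then show ?thesis using sizes pos by (simp add: p_def q_def power_divide field_simps)
qed

lemma q2: "q\<^sup>2 = 1 / real dw" using pos by (simp add: q_def power_divide)

lemma entry_le: "u \<in> bip_index M N \<Longrightarrow> w \<in> bip_index M N \<Longrightarrow> cmod (G S u w) \<le> T"
  by (rule resolvent_entry_le[OF G]) (use z in auto)

lemma column_le: "w \<in> bip_index M N \<Longrightarrow> (\<Sum>u\<in>bip_index M N. (cmod (G S u w))\<^sup>2) \<le> T\<^sup>2"
  using resolvent_column_norm(1)[OF G _ z] by (simp add: power_divide)

lemma G_sym: "u \<in> bip_index M N \<Longrightarrow> w \<in> bip_index M N \<Longrightarrow> G S u w = G S w u"
  by (rule resolvent_sym[OF G])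

lemma flip_entry:
  assumes "i < M" "j < N" "u \<in> bip_index M N" "w \<in> bip_index M N"
  shows "G (insert (i, j) S) u w - G (S - {(i, j)}) u w = - of_real q *
    (G (insert (i, j) S) u (Inl i) * G (S - {(i, j)}) (Inr j) w + G (insert (i, j) S) u (Inr j) * G (S - {(i, j)}) (Inl i) w)"
  by (rule resolvent_perturbation[OF G G assms]) (auto simp: bern_mat_def algebra_simps)

text \<open>Integration by parts couples the resolvents with the entry switched on and off; this replaces both
  by the resolvent of the matrix itself.\<close>

lemma product_replacement:
  fixes S :: "(nat \<times> nat) set"
  assumes "i < M" "j < N"
  defines "G1 \<equiv> G (insert (i, j) S)" and "G0 \<equiv> G (S - {(i, j)})"
  shows "cmod (G1 (Inl i) (Inl i) * G0 (Inr j) (Inr j) + G1 (Inl i) (Inr j) * G0 (Inl i) (Inr j)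
      - G S (Inl i) (Inl i) * G S (Inr j) (Inr j))
    \<le> 3 * (cmod (G S (Inl i) (Inr j)))\<^sup>2 + 4 * q\<^sup>2 * T ^ 4"
proof -
  have V: "Inl i \<in> bip_index M N" "Inr j \<in> bip_index M N" using assms by auto
  define a where "a = cmod (G S (Inl i) (Inr j))"
  define a1 where "a1 = cmod (G1 (Inl i) (Inr j))"
  define a0 where "a0 = cmod (G0 (Inl i) (Inr j))"
  note fl = flip_entry[OF assms(1,2), where S = S, folded G1_def G0_def]
  have T0: "0 \<le> T" using pos by simp
  have bd: "cmod (G1 u w) \<le> T" "cmod (G0 u w) \<le> T" if "u \<in> bip_index M N" "w \<in> bip_index M N" for u w
    unfolding G1_def G0_def using that by (auto intro: entry_le)
  have dec: "cmod (- of_real q * (x * y + x' * y')) \<le> q * (cmod x * cmod y + cmod x' * cmod y')" for x y x' y'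
  proof -
    have "cmod (- of_real q * (x * y + x' * y')) = q * cmod (x * y + x' * y')"
      using pos by (simp add: norm_mult)
    also have "\<dots> \<le> q * (cmod x * cmod y + cmod x' * cmod y')"
      using pos by (intro mult_left_mono) (auto simp: norm_mult[symmetric] intro: norm_triangle_ineq)
    finally show ?thesis .
  qed
  have off: "cmod (G1 (Inl i) (Inr j) - G0 (Inl i) (Inr j)) \<le> 2 * q * T\<^sup>2"
  proof -
    have "cmod (G1 (Inl i) (Inr j) - G0 (Inl i) (Inr j)) \<le>
      q * (cmod (G1 (Inl i) (Inl i)) * cmod (G0 (Inr j) (Inr j)) + cmod (G1 (Inl i) (Inr j)) * cmod (G0 (Inl i) (Inr j)))"
      unfolding fl[OF V] by (rule dec)
    also have "\<dots> \<le> q * (T * T + T * T)"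
      using pos V by (intro mult_left_mono add_mono mult_mono bd) auto
    finally show ?thesis by (simp add: power2_eq_square algebra_simps)
  qed
  have di: "cmod (G1 (Inl i) (Inl i) - G0 (Inl i) (Inl i)) \<le> q * T * (a0 + a1)"
  proof -
    have "cmod (G1 (Inl i) (Inl i) - G0 (Inl i) (Inl i)) \<le>
      q * (cmod (G1 (Inl i) (Inl i)) * cmod (G0 (Inr j) (Inl i)) + cmod (G1 (Inl i) (Inr j)) * cmod (G0 (Inl i) (Inl i)))"
      unfolding fl[OF V(1,1)] by (rule dec)
    also have "G0 (Inr j) (Inl i) = G0 (Inl i) (Inr j)" unfolding G0_def by (rule G_sym) (use V in auto)
    also have "q * (cmod (G1 (Inl i) (Inl i)) * cmod (G0 (Inl i) (Inr j)) + cmod (G1 (Inl i) (Inr j)) * cmod (G0 (Inl i) (Inl i)))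
      \<le> q * (T * a0 + a1 * T)"
      unfolding a0_def a1_def using pos V by (intro mult_left_mono add_mono mult_mono bd) auto
    finally show ?thesis by (simp add: algebra_simps add_divide_distrib)
  qed
  have dj: "cmod (G1 (Inr j) (Inr j) - G0 (Inr j) (Inr j)) \<le> q * T * (a0 + a1)"
  proof -
    have "cmod (G1 (Inr j) (Inr j) - G0 (Inr j) (Inr j)) \<le>
      q * (cmod (G1 (Inr j) (Inl i)) * cmod (G0 (Inr j) (Inr j)) + cmod (G1 (Inr j) (Inr j)) * cmod (G0 (Inl i) (Inr j)))"
      unfolding fl[OF V(2,2)] by (rule dec)
    also have "G1 (Inr j) (Inl i) = G1 (Inl i) (Inr j)" unfolding G1_def by (rule G_sym) (use V in auto)
    also have "q * (cmod (G1 (Inl i) (Inr j)) * cmod (G0 (Inr j) (Inr j)) + cmod (G1 (Inr j) (Inr j)) * cmod (G0 (Inl i) (Inr j)))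
      \<le> q * (a1 * T + T * a0)"
      unfolding a0_def a1_def using pos V by (intro mult_left_mono add_mono mult_mono bd) auto
    finally show ?thesis by (simp add: algebra_simps add_divide_distrib)
  qed
  define r where "r = q * T\<^sup>2"
  have r0: "r \<ge> 0" using pos by (simp add: r_def)
  have a01: "a0 \<le> a1 + 2 * r" "a1 \<le> a0 + 2 * r"
    using off norm_triangle_ineq2[of "G0 (Inl i) (Inr j)" "G1 (Inl i) (Inr j)"]
      norm_triangle_ineq2[of "G1 (Inl i) (Inr j)" "G0 (Inl i) (Inr j)"]
    by (simp_all add: a0_def a1_def r_def norm_minus_commute)
  have nn: "a0 \<ge> 0" "a1 \<ge> 0" by (auto simp: a0_def a1_def)
  \<comment> \<open>The sample \<open>S\<close> is itself one of the two, so \<open>a\<close> is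
    \<open>a0\<close> or \<open>a1\<close>, and the other one differs from it by at most
    \<open>2 * r\<close>.\<close>
  have "S = insert (i, j) S \<or> S = S - {(i, j)}" by auto
  then have cases: "(G S = G1 \<and> a = a1) \<or> (G S = G0 \<and> a = a0)"
    unfolding G1_def G0_def a_def a1_def a0_def by metis
  have prod: "a1 * a0 \<le> a * (a + 2 * r)"
    using cases mult_left_mono[OF a01(1) nn(2)] mult_left_mono[OF a01(2) nn(1)] by (auto simp: mult.commute)
  have sum: "a0 + a1 \<le> 2 * a + 2 * r" using cases a01 by auto
  have main: "cmod (G1 (Inl i) (Inl i) * G0 (Inr j) (Inr j) - G S (Inl i) (Inl i) * G S (Inr j) (Inr j)) \<le> T * (q * T * (a0 + a1))"
    using cases
  proof
    assume "G S = G1 \<and> a = a1"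
    then have "cmod (G1 (Inl i) (Inl i) * G0 (Inr j) (Inr j) - G S (Inl i) (Inl i) * G S (Inr j) (Inr j))
      = cmod (G1 (Inl i) (Inl i)) * cmod (G1 (Inr j) (Inr j) - G0 (Inr j) (Inr j))"
      by (metis norm_minus_commute norm_mult right_diff_distrib)
    also have "\<dots> \<le> T * (q * T * (a0 + a1))" using dj V T0 by (intro mult_mono bd) auto
    finally show ?thesis .
  next
    assume "G S = G0 \<and> a = a0"
    then have "cmod (G1 (Inl i) (Inl i) * G0 (Inr j) (Inr j) - G S (Inl i) (Inl i) * G S (Inr j) (Inr j))
      = cmod (G0 (Inr j) (Inr j)) * cmod (G1 (Inl i) (Inl i) - G0 (Inl i) (Inl i))"
      by (metis norm_mult left_diff_distrib mult.commute)
    also have "\<dots> \<le> T * (q * T * (a0 + a1))" using di V T0 by (intro mult_mono bd) auto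
    finally show ?thesis .
  qed
  have "cmod (G1 (Inl i) (Inl i) * G0 (Inr j) (Inr j) + G1 (Inl i) (Inr j) * G0 (Inl i) (Inr j)
      - G S (Inl i) (Inl i) * G S (Inr j) (Inr j))
     \<le> cmod (G1 (Inl i) (Inl i) * G0 (Inr j) (Inr j) - G S (Inl i) (Inl i) * G S (Inr j) (Inr j)) + a1 * a0"
    unfolding a1_def a0_def norm_mult[symmetric] by (rule order_trans[OF _ norm_triangle_ineq]) (simp add: algebra_simps)
  also have "\<dots> \<le> r * (a0 + a1) + a1 * a0" using main by (simp add: r_def power2_eq_square mult_ac)
  also have "\<dots> \<le> r * (2 * a + 2 * r) + a * (a + 2 * r)" 
    by (rule add_mono[OF mult_left_mono[OF sum r0] prod])
  \<comment> \<open>The mixed term \<open>4 * a * r\<close> is split into squares: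
    \<open>a\<^sup>2\<close> can be summed over all entries by the Ward identity, and
    \<open>r\<^sup>2\<close> carries the factor \<open>q\<^sup>2\<close>.\<close>
  also have "\<dots> \<le> 3 * a\<^sup>2 + 4 * r\<^sup>2"
    using sum_squares_bound[of a r] by (simp add: algebra_simps power2_eq_square)
  also have "r\<^sup>2 = q\<^sup>2 * T ^ 4" by (simp add: r_def power_mult_distrib power_even_eq[symmetric])
  finally show ?thesis by (simp add: a_def mult.assoc)
qed

section \<open>Averaging over all entries\<close>

lemma trace_relation: "of_nat N * (1 + z * mw S) = of_nat M * (1 + z * mb S)"
  using resolvent_block_traces[OF G[of S]] sizes pos by (simp add: mw_def mb_def algebra_simps)

lemma mb_eq: "mb S = of_real \<gamma> * mw S - of_real (1 - \<gamma>) / z"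
  using trace_relation[of S] pos by (simp add: \<gamma>_def field_simps)

lemma product_average: "(\<Sum>i<M. \<Sum>j<N. G S (Inl i) (Inl i) * G S (Inr j) (Inr j)) = of_nat M * of_nat N * (mw S * mb S)"
  by (subst sum_product[symmetric]) (use sizes pos in \<open>simp add: mw_def mb_def\<close>)

lemma off_diagonal_sum: "(\<Sum>i<M. \<Sum>j<N. (cmod (G S (Inl i) (Inr j)))\<^sup>2) \<le> real N * T\<^sup>2"
proof -
  have "(\<Sum>i<M. \<Sum>j<N. (cmod (G S (Inl i) (Inr j)))\<^sup>2) = (\<Sum>j<N. \<Sum>i<M. (cmod (G S (Inl i) (Inr j)))\<^sup>2)" by (rule sum.swap)
  also have "\<dots> \<le> (\<Sum>j<N. T\<^sup>2)"
  proof (rule sum_mono)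
    fix j assume "j \<in> {..<N}"
    then have "(\<Sum>u\<in>bip_index M N. (cmod (G S u (Inr j)))\<^sup>2) \<le> T\<^sup>2" by (intro column_le) auto
    moreover have "0 \<le> (\<Sum>l<N. (cmod (G S (Inr l) (Inr j)))\<^sup>2)" by (intro sum_nonneg) auto
    ultimately show "(\<Sum>i<M. (cmod (G S (Inl i) (Inr j)))\<^sup>2) \<le> T\<^sup>2" by (simp add: sum_bip_index)
  qed
  finally show ?thesis by simp
qed

text \<open>Integration by parts in every term of the trace of matrix times resolvent, with
  \<open>p * q\<^sup>2 = 1 / M\<close>. The products \<open>Q\<close> are replaced by diagonal
  entries, whose double sum factors into \<open>mw S * mb S\<close>; the two terms on the right come
  from the squared off-diagonal entries and from \<open>q\<^sup>2\<close>.\<close>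

lemma loop_equation:
  "cmod (1 + z * E mw + of_real (1 - p) * E (\<lambda>S. mw S * mb S)) \<le> 3 * T\<^sup>2 / real M + 4 * T ^ 4 / real dw"
proof -
  define Q where "Q S i j = G (insert (i, j) S) (Inl i) (Inl i) * G (S - {(i, j)}) (Inr j) (Inr j)
     + G (insert (i, j) S) (Inl i) (Inr j) * G (S - {(i, j)}) (Inl i) (Inr j)" for S i j
  have finI: "finite I" by simp
  have "of_nat N * (1 + z * E mw) = E (\<lambda>S. of_nat N * (1 + z * mw S))"
    by (simp add: cube_exp_cmult cube_exp_add cube_exp_const)
  also have "\<dots> = E (\<lambda>S. \<Sum>i<M. \<Sum>j<N. of_real (bern_mat p q S i j) * G S (Inl i) (Inr j))"
    using sizes by (intro cube_exp_cong) (simp add: resolvent_block_traces(2)[OF G] mw_def algebra_simps)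
  also have "\<dots> = (\<Sum>i<M. \<Sum>j<N. E (\<lambda>S. of_real (bern_mat p q S i j) * G S (Inl i) (Inr j)))"
    by (simp add: cube_exp_sum)
  also have "\<dots> = (\<Sum>i<M. \<Sum>j<N. - of_real ((1 - p) / real M) * E (\<lambda>S. Q S i j))"
  proof (intro sum.cong refl)
    fix i j assume "i \<in> {..<M}" "j \<in> {..<N}"
    then have ij: "i < M" "j < N" by auto
    have "E (\<lambda>S. of_real (bern_mat p q S i j) * G S (Inl i) (Inr j))
      = of_real (p * (1 - p) * q) * E (\<lambda>S. G (insert (i, j) S) (Inl i) (Inr j) - G (S - {(i, j)}) (Inl i) (Inr j))"
      using ij by (intro centered_bernoulli_ibp) auto
    also have "E (\<lambda>S. G (insert (i, j) S) (Inl i) (Inr j) - G (S - {(i, j)}) (Inl i) (Inr j)) = - of_real q * E (\<lambda>S. Q S i j)"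
      unfolding cube_exp_cmult[symmetric] Q_def using ij by (intro cube_exp_cong flip_entry) auto
    also have "of_real (p * (1 - p) * q) * (- of_real q * E (\<lambda>S. Q S i j)) = - of_real ((1 - p) * (p * q\<^sup>2)) * E (\<lambda>S. Q S i j)"
      by (simp add: power2_eq_square mult_ac)
    finally show "E (\<lambda>S. of_real (bern_mat p q S i j) * G S (Inl i) (Inr j)) = - of_real ((1 - p) / real M) * E (\<lambda>S. Q S i j)"
      unfolding pq2 by simp
  qed
  also have "\<dots> = - of_real ((1 - p) / real M) * E (\<lambda>S. \<Sum>i<M. \<Sum>j<N. Q S i j)"
    by (simp add: cube_exp_sum sum_distrib_left)
  finally have 1: "of_nat N * (1 + z * E mw) = - of_real ((1 - p) / real M) * E (\<lambda>S. \<Sum>i<M. \<Sum>j<N. Q S i j)" .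
  have "of_nat N * (of_real (1 - p) * E (\<lambda>S. mw S * mb S))
    = of_real ((1 - p) / real M) * E (\<lambda>S. \<Sum>i<M. \<Sum>j<N. G S (Inl i) (Inl i) * G S (Inr j) (Inr j))"
    unfolding product_average cube_exp_cmult using pos by simp
  then have "of_nat N * (1 + z * E mw + of_real (1 - p) * E (\<lambda>S. mw S * mb S))
    = - of_real ((1 - p) / real M) * E (\<lambda>S. \<Sum>i<M. \<Sum>j<N. Q S i j - G S (Inl i) (Inl i) * G S (Inr j) (Inr j))"
    unfolding distrib_left[of "of_nat N" "1 + z * E mw"] 1 by (simp add: sum_subtractf cube_exp_diff algebra_simps)
  then have "cmod (of_nat N * (1 + z * E mw + of_real (1 - p) * E (\<lambda>S. mw S * mb S)))
    = cmod (- of_real ((1 - p) / real M) * E (\<lambda>S. \<Sum>i<M. \<Sum>j<N. Q S i j - G S (Inl i) (Inl i) * G S (Inr j) (Inr j)))"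
    by (simp only:)
  moreover have c0: "0 \<le> (1 - p) / real M" using pos by simp
  ultimately have "real N * cmod (1 + z * E mw + of_real (1 - p) * E (\<lambda>S. mw S * mb S))
    = ((1 - p) / real M) * cmod (E (\<lambda>S. \<Sum>i<M. \<Sum>j<N. Q S i j - G S (Inl i) (Inl i) * G S (Inr j) (Inr j)))"
    by (simp only: norm_mult norm_minus_cancel norm_of_nat norm_of_real abs_of_nonneg[OF c0])
  also have "\<dots> \<le> (1 / real M) * (3 * (real N * T\<^sup>2) + real M * real N * (4 * q\<^sup>2 * T ^ 4))"
  proof (intro mult_mono)
    have "cmod (E (\<lambda>S. \<Sum>i<M. \<Sum>j<N. Q S i j - G S (Inl i) (Inl i) * G S (Inr j) (Inr j)))
      \<le> E (\<lambda>S. cmod (\<Sum>i<M. \<Sum>j<N. Q S i j - G S (Inl i) (Inl i) * G S (Inr j) (Inr j)))"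
      using pos by (intro cube_exp_norm) auto
    also have "\<dots> \<le> E (\<lambda>_. 3 * (real N * T\<^sup>2) + real M * real N * (4 * q\<^sup>2 * T ^ 4))"
    proof (intro cube_exp_mono)
      fix S
      have "cmod (\<Sum>i<M. \<Sum>j<N. Q S i j - G S (Inl i) (Inl i) * G S (Inr j) (Inr j))
        \<le> (\<Sum>i<M. cmod (\<Sum>j<N. Q S i j - G S (Inl i) (Inl i) * G S (Inr j) (Inr j)))" by (rule norm_sum)
      also have "\<dots> \<le> (\<Sum>i<M. \<Sum>j<N. cmod (Q S i j - G S (Inl i) (Inl i) * G S (Inr j) (Inr j)))"
        by (intro sum_mono norm_sum)
      also have "\<dots> \<le> (\<Sum>i<M. \<Sum>j<N. 3 * (cmod (G S (Inl i) (Inr j)))\<^sup>2 + 4 * q\<^sup>2 * T ^ 4)"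
        unfolding Q_def by (intro sum_mono product_replacement) auto
      also have "\<dots> = 3 * (\<Sum>i<M. \<Sum>j<N. (cmod (G S (Inl i) (Inr j)))\<^sup>2) + real M * real N * (4 * q\<^sup>2 * T ^ 4)"
        by (simp add: sum.distrib sum_distrib_left)
      also have "\<dots> \<le> 3 * (real N * T\<^sup>2) + real M * real N * (4 * q\<^sup>2 * T ^ 4)"
        by (intro add_right_mono mult_left_mono off_diagonal_sum) auto
      finally show "cmod (\<Sum>i<M. \<Sum>j<N. Q S i j - G S (Inl i) (Inl i) * G S (Inr j) (Inr j)) \<le> \<dots>" .
    qed (use pos in auto)
    finally show "cmod (E (\<lambda>S. \<Sum>i<M. \<Sum>j<N. Q S i j - G S (Inl i) (Inl i) * G S (Inr j) (Inr j))) \<le>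
       3 * (real N * T\<^sup>2) + real M * real N * (4 * q\<^sup>2 * T ^ 4)" by (simp add: cube_exp_const)
    show "(1 - p) / real M \<le> 1 / real M" using pos by (intro divide_right_mono) auto
  qed auto
  also have "\<dots> = real N * (3 * T\<^sup>2 / real M + 4 * T ^ 4 / real dw)"
    unfolding q2 using pos by (simp add: field_simps)
  finally show ?thesis using sizes by simp
qed

text \<open>Efron--Stein. By the perturbation formula and the Ward identity one flip changes the
  whole white trace by at most \<open>2 * q * T\<^sup>2\<close>, although it has \<open>N\<close>
  terms. Adding up over \<open>M * N\<close> entries uses
  \<open>p * q\<^sup>2 = 1 / M\<close>.\<close>

lemma mw_variance: "E (\<lambda>S. (cmod (mw S - E mw))\<^sup>2) \<le> 4 * T ^ 4 / real N"
proof -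
  define f where "f S = mw S - E mw" for S
  have Ef: "E f = 0" unfolding f_def by (simp add: cube_exp_diff cube_exp_const)
  have diff: "cmod (f (insert e S) - f (S - {e})) \<le> 2 * q * T\<^sup>2 / real N" if e: "e \<in> I" for e S
  proof -
    obtain i j where ij: "e = (i, j)" "i < M" "j < N" using e by auto
    let ?G1 = "G (insert e S)" and ?G0 = "G (S - {e})"
    have half: "(\<Sum>l<N. cmod (?G1 (Inr l) u) * cmod (?G0 w (Inr l))) \<le> T\<^sup>2"
      if u: "u \<in> bip_index M N" and w: "w \<in> bip_index M N" for u w
    proof -
      have c: "(\<Sum>l<N. (cmod (G S' (Inr l) u))\<^sup>2) \<le> T\<^sup>2" if "u \<in> bip_index M N" for S' u
      proof -
        have "0 \<le> (\<Sum>i<M. (cmod (G S' (Inl i) u))\<^sup>2)" by (intro sum_nonneg) auto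
        then show ?thesis using column_le[OF that, of S'] by (simp add: sum_bip_index)
      qed
      have "(\<Sum>l<N. cmod (?G1 (Inr l) u) * cmod (?G0 w (Inr l)))
        \<le> (\<Sum>l<N. ((cmod (?G1 (Inr l) u))\<^sup>2 + (cmod (?G0 (Inr l) w))\<^sup>2) / 2)"
      proof (rule sum_mono)
        fix l assume "l \<in> {..<N}"
        then have "?G0 w (Inr l) = ?G0 (Inr l) w" using w by (intro G_sym) auto
        then show "cmod (?G1 (Inr l) u) * cmod (?G0 w (Inr l)) \<le> ((cmod (?G1 (Inr l) u))\<^sup>2 + (cmod (?G0 (Inr l) w))\<^sup>2) / 2"
          using sum_squares_bound[of "cmod (?G1 (Inr l) u)" "cmod (?G0 (Inr l) w)"] by simp
      qed
      also have "\<dots> = ((\<Sum>l<N. (cmod (?G1 (Inr l) u))\<^sup>2) + (\<Sum>l<N. (cmod (?G0 (Inr l) w))\<^sup>2)) / 2"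
        by (simp add: sum_divide_distrib[symmetric] sum.distrib)
      also have "\<dots> \<le> T\<^sup>2" using c[OF u, of "insert e S"] c[OF w, of "S - {e}"] by simp
      finally show ?thesis .
    qed
    have "f (insert e S) - f (S - {e}) = (\<Sum>l<N. ?G1 (Inr l) (Inr l) - ?G0 (Inr l) (Inr l)) / of_nat N"
      by (simp add: f_def mw_def diff_divide_distrib sum_subtractf)
    also have "(\<Sum>l<N. ?G1 (Inr l) (Inr l) - ?G0 (Inr l) (Inr l))
      = (\<Sum>l<N. - of_real q * (?G1 (Inr l) (Inl i) * ?G0 (Inr j) (Inr l) + ?G1 (Inr l) (Inr j) * ?G0 (Inl i) (Inr l)))"
      unfolding ij(1) using ij by (intro sum.cong refl flip_entry) auto
    finally have "cmod (f (insert e S) - f (S - {e})) = cmod (\<Sum>l<N. - of_real q * (?G1 (Inr l) (Inl i) * ?G0 (Inr j) (Inr l) + ?G1 (Inr l) (Inr j) * ?G0 (Inl i) (Inr l))) / real N"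
      by (simp add: norm_divide)
    also have "\<dots> \<le> (\<Sum>l<N. q * (cmod (?G1 (Inr l) (Inl i)) * cmod (?G0 (Inr j) (Inr l)) + cmod (?G1 (Inr l) (Inr j)) * cmod (?G0 (Inl i) (Inr l)))) / real N"
    proof (intro divide_right_mono sum_norm_le)
      fix l
      show "cmod (- of_real q * (?G1 (Inr l) (Inl i) * ?G0 (Inr j) (Inr l) + ?G1 (Inr l) (Inr j) * ?G0 (Inl i) (Inr l)))
        \<le> q * (cmod (?G1 (Inr l) (Inl i)) * cmod (?G0 (Inr j) (Inr l)) + cmod (?G1 (Inr l) (Inr j)) * cmod (?G0 (Inl i) (Inr l)))"
        unfolding norm_mult norm_minus_cancel using pos
        by (auto intro!: mult_left_mono norm_triangle_le simp: norm_mult)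
    qed auto
    also have "\<dots> = q * ((\<Sum>l<N. cmod (?G1 (Inr l) (Inl i)) * cmod (?G0 (Inr j) (Inr l))) + (\<Sum>l<N. cmod (?G1 (Inr l) (Inr j)) * cmod (?G0 (Inl i) (Inr l)))) / real N"
      by (simp add: sum_distrib_left sum.distrib distrib_left)
    also have "\<dots> \<le> q * (T\<^sup>2 + T\<^sup>2) / real N"
      using pos ij by (intro divide_right_mono mult_left_mono add_mono half) auto
    finally show ?thesis by (simp add: mult_ac)
  qed
  have "E (\<lambda>S. (cmod (f S))\<^sup>2) \<le> p * (1 - p) * (\<Sum>e\<in>I. E (\<lambda>S. (cmod (f (insert e S) - f (S - {e})))\<^sup>2))"
    using efron_stein_cube[of I p f] pos Ef by simp
  also have "\<dots> \<le> p * (1 - p) * (\<Sum>e\<in>I. E (\<lambda>S. (2 * q * T\<^sup>2 / real N)\<^sup>2))"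
    using pos diff by (intro mult_left_mono sum_mono cube_exp_mono power_mono) auto
  also have "\<dots> = (1 - p) * (4 * (p * q\<^sup>2) * T ^ 4 * real M / real N)"
    using sizes by (simp add: cube_exp_const power_divide power_mult_distrib power2_eq_square power4_eq_xxxx mult_ac)
  also have "\<dots> = (1 - p) * (4 * T ^ 4 / real N)" unfolding pq2 using pos by simp
  also have "\<dots> \<le> 1 * (4 * T ^ 4 / real N)" using pos by (intro mult_right_mono) auto
  finally show ?thesis by (simp add: f_def)
qed

text \<open>\<open>mb\<close> is an affine function of \<open>mw\<close>, so decoupling the mean of
  their product costs only the variance of \<open>mw\<close>; replacing the factor
  \<open>1 - p\<close> by one costs \<open>2 * p * T\<^sup>2\<close>.\<close>

theorem selfconsistent_equation:
  "cmod (of_real \<gamma> * (E mw)\<^sup>2 + (z - of_real (1 - \<gamma>) / z) * E mw + 1)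
    \<le> (3 * T\<^sup>2 + 8 * T ^ 4) / real db + 2 * p * T\<^sup>2"
proof -
  define m where "m = E mw"
  define V where "V = E (\<lambda>S. (mw S - m)\<^sup>2)"
  have g: "0 \<le> \<gamma>" "\<gamma> \<le> 1" using sizes by (auto simp: \<gamma>_def)
  have V: "E (\<lambda>S. (mw S)\<^sup>2) = m\<^sup>2 + V"
  proof -
    have "V = E (\<lambda>S. (mw S)\<^sup>2 - 2 * m * mw S + m\<^sup>2)"
      unfolding V_def by (intro cube_exp_cong) (simp add: power2_eq_square algebra_simps)
    also have "\<dots> = E (\<lambda>S. (mw S)\<^sup>2) - 2 * m * m + m\<^sup>2"
      unfolding cube_exp_add cube_exp_diff cube_exp_cmult by (simp add: cube_exp_const m_def)
    finally show ?thesis by (simp add: power2_eq_square)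
  qed
  have Vn: "cmod V \<le> 4 * T ^ 4 / real N"
  proof -
    have "cmod V \<le> E (\<lambda>S. cmod ((mw S - m)\<^sup>2))" unfolding V_def using pos by (intro cube_exp_norm) auto
    also have "\<dots> \<le> 4 * T ^ 4 / real N" using mw_variance by (simp add: norm_power m_def)
    finally show ?thesis .
  qed
  have mT: "cmod m \<le> T"
  proof -
    have "cmod (mw S) \<le> T" for S
    proof -
      have "cmod (\<Sum>j<N. G S (Inr j) (Inr j)) \<le> (\<Sum>j<N. T)" by (intro sum_norm_le entry_le) auto
      then show ?thesis using sizes by (simp add: mw_def norm_divide divide_le_eq mult.commute)
    qed
    then have "E (\<lambda>S. cmod (mw S)) \<le> E (\<lambda>_. T)" using pos by (intro cube_exp_mono) auto
    moreover have "cmod m \<le> E (\<lambda>S. cmod (mw S))" unfolding m_def using pos by (intro cube_exp_norm) auto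
    ultimately show ?thesis by (simp add: cube_exp_const)
  qed
  have zT: "cmod (1 / z) \<le> T"
    using abs_Im_le_cmod[of z] z by (simp add: norm_divide frac_le)
  define W where "W = of_real \<gamma> * (m\<^sup>2 + V) - of_real (1 - \<gamma>) * m * (1 / z)"
  have W: "E (\<lambda>S. mw S * mb S) = W"
  proof -
    have "E (\<lambda>S. mw S * mb S) = E (\<lambda>S. of_real \<gamma> * (mw S)\<^sup>2 - (of_real (1 - \<gamma>) / z) * mw S)"
      by (intro cube_exp_cong) (simp add: mb_eq power2_eq_square algebra_simps)
    also have "\<dots> = of_real \<gamma> * (m\<^sup>2 + V) - (of_real (1 - \<gamma>) / z) * m"
      unfolding cube_exp_diff cube_exp_cmult V m_def ..
    finally show ?thesis by (simp add: W_def)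
  qed
  have eq: "of_real \<gamma> * m\<^sup>2 + (z - of_real (1 - \<gamma>) / z) * m + 1
    = (1 + z * m + of_real (1 - p) * W) - of_real ((1 - p) * \<gamma>) * V + of_real p * (of_real \<gamma> * (m * m) - of_real (1 - \<gamma>) * (m * (1 / z)))"
    unfolding W_def divide_inverse by (simp add: power2_eq_square algebra_simps)
  have "cmod (of_real \<gamma> * m\<^sup>2 + (z - of_real (1 - \<gamma>) / z) * m + 1)
    \<le> cmod (1 + z * m + of_real (1 - p) * W) + cmod (of_real ((1 - p) * \<gamma>) * V)
     + cmod (of_real p * (of_real \<gamma> * (m * m) - of_real (1 - \<gamma>) * (m * (1 / z))))"
    unfolding eq by (intro norm_triangle_le add_right_mono norm_triangle_ineq4)
  also have "cmod (1 + z * m + of_real (1 - p) * W) \<le> 3 * T\<^sup>2 / real M + 4 * T ^ 4 / real dw"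
    using loop_equation unfolding W[symmetric] m_def .
  also have "3 * T\<^sup>2 / real M + 4 * T ^ 4 / real dw \<le> 3 * T\<^sup>2 / real db + 4 * T ^ 4 / real db"
    using sizes pos by (intro add_mono divide_left_mono) auto
  also have "cmod (of_real ((1 - p) * \<gamma>) * V) \<le> 4 * T ^ 4 / real db"
  proof -
    have "cmod (of_real ((1 - p) * \<gamma>) * V) = ((1 - p) * \<gamma>) * cmod V"
      using pos g by (simp only: norm_mult norm_of_real) simp
    also have "\<dots> \<le> 1 * (4 * T ^ 4 / real N)" using pos g Vn by (intro mult_mono mult_le_one) auto
    also have "\<dots> \<le> 4 * T ^ 4 / real db" using sizes pos by (simp add: divide_left_mono)
    finally show ?thesis .
  qed
  also have "cmod (of_real p * (of_real \<gamma> * (m * m) - of_real (1 - \<gamma>) * (m * (1 / z)))) \<le> p * (1 * (T * T) + 1 * (T * T))"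
  proof -
    have "cmod (of_real p * (of_real \<gamma> * (m * m) - of_real (1 - \<gamma>) * (m * (1 / z))))
      \<le> p * (cmod (of_real \<gamma> * (m * m)) + cmod (of_real (1 - \<gamma>) * (m * (1 / z))))"
    proof -
      have "cmod (of_real p * x) = p * cmod x" for x using pos by (simp add: norm_mult)
      then show ?thesis using pos by (simp only:) (intro mult_left_mono norm_triangle_ineq4)
    qed
    also have "\<dots> = p * (\<gamma> * (cmod m * cmod m) + (1 - \<gamma>) * (cmod m * cmod (1 / z)))"
      using g by (simp only: norm_mult norm_of_real abs_of_nonneg diff_ge_0_iff_ge)
    also have "\<dots> \<le> p * (1 * (T * T) + 1 * (T * T))"
      using pos g mT zT by (intro mult_left_mono add_mono mult_mono) auto
    finally show ?thesis .
  qed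
  finally show ?thesis unfolding m_def by (simp add: add_divide_distrib power2_eq_square algebra_simps)
qed

lemma mw_eq: "mw S = (\<Sum>k<N. z / ((of_real (s S k))\<^sup>2 - z\<^sup>2)) / of_nat N"
  unfolding mw_def G_def svd_resolvent_white_trace[OF geb] ..

end

section \<open>The Marchenko--Pastur law\<close>

text \<open>Real boundary value of the linear coefficient in the self-consistent equation:
  \<open>4 * \<gamma> - (mp_b \<gamma> x)\<^sup>2\<close> is minus its discriminant and governs the
  density of the singular values.\<close>

definition mp_b :: "real \<Rightarrow> real \<Rightarrow> real" where "mp_b \<gamma> x = x - (1 - \<gamma>) / x"

text \<open>The distribution function of the law of the singular values: \<open>mp_sv_cdf \<gamma> x\<close> is the
  Marchenko--Pastur mass of \<open>[0, x\<^sup>2]\<close> for \<open>1 - sqrt \<gamma> \<le> x \<le> 1 + sqrt \<gamma>\<close>.\<close>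

definition mp_sv_cdf :: "real \<Rightarrow> real \<Rightarrow> real" where
  "mp_sv_cdf \<gamma> x = (arccos (- mp_b \<gamma> x / (2 * sqrt \<gamma>)) - arccos ((x + (1 - \<gamma>) / x) / 2) / \<gamma>
      + x * sqrt (4 * \<gamma> - (mp_b \<gamma> x)\<^sup>2) / (2 * \<gamma>)) / pi"

lemma mp_discriminant:
  assumes "0 < \<gamma>" "0 < x"
  shows "4 * \<gamma> - (mp_b \<gamma> x)\<^sup>2 = (mp_upper \<gamma> - x\<^sup>2) * (x\<^sup>2 - mp_lower \<gamma>) / x\<^sup>2"
proof -
  define g where "g = sqrt \<gamma>"
  have g: "\<gamma> = g\<^sup>2" using assms by (simp add: g_def)
  have "x\<^sup>2 * (4 * g\<^sup>2 - (x - (1 - g\<^sup>2) / x)\<^sup>2) = ((1 + g)\<^sup>2 - x\<^sup>2) * (x\<^sup>2 - (1 - g)\<^sup>2)"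
  proof -
    have "x\<^sup>2 * (4 * g\<^sup>2 - y\<^sup>2) = 4 * g\<^sup>2 * x\<^sup>2 - (x * y)\<^sup>2" for y
      by (simp add: power_mult_distrib algebra_simps)
    then have "x\<^sup>2 * (4 * g\<^sup>2 - (x - (1 - g\<^sup>2) / x)\<^sup>2) = 4 * g\<^sup>2 * x\<^sup>2 - (x * (x - (1 - g\<^sup>2) / x))\<^sup>2" .
    also have "x * (x - (1 - g\<^sup>2) / x) = x\<^sup>2 - (1 - g\<^sup>2)" using assms by (simp add: power2_eq_square field_simps)
    also have "4 * g\<^sup>2 * x\<^sup>2 - (x\<^sup>2 - (1 - g\<^sup>2))\<^sup>2 = ((1 + g)\<^sup>2 - x\<^sup>2) * (x\<^sup>2 - (1 - g)\<^sup>2)"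
      by (simp add: power2_eq_square algebra_simps)
    finally show ?thesis .
  qed
  then have "4 * g\<^sup>2 - (x - (1 - g\<^sup>2) / x)\<^sup>2 = ((1 + g)\<^sup>2 - x\<^sup>2) * (x\<^sup>2 - (1 - g)\<^sup>2) / x\<^sup>2"
    using assms by (metis less_numeral_extra(3) nonzero_mult_div_cancel_left zero_eq_power2)
  then show ?thesis unfolding mp_b_def mp_upper_def mp_lower_def g_def[symmetric] unfolding g .
qed

lemma mp_lower_upper:
  assumes "0 < \<gamma>" "\<gamma> \<le> 1"
  shows "0 \<le> mp_lower \<gamma>" "mp_lower \<gamma> < mp_upper \<gamma>" "sqrt (mp_lower \<gamma>) = 1 - sqrt \<gamma>" "sqrt (mp_upper \<gamma>) = 1 + sqrt \<gamma>"
proof -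
  have "0 < sqrt \<gamma>" "sqrt \<gamma> \<le> 1" using assms by auto
  then show "0 \<le> mp_lower \<gamma>" "sqrt (mp_lower \<gamma>) = 1 - sqrt \<gamma>" "sqrt (mp_upper \<gamma>) = 1 + sqrt \<gamma>"
    unfolding mp_lower_def mp_upper_def by (simp_all only: real_sqrt_abs) auto
  have "(1 - sqrt \<gamma>)\<^sup>2 < (1 + sqrt \<gamma>)\<^sup>2"
    using \<open>0 < sqrt \<gamma>\<close> \<open>sqrt \<gamma> \<le> 1\<close> by (intro power_strict_mono) auto
  then show "mp_lower \<gamma> < mp_upper \<gamma>" by (simp add: mp_lower_def mp_upper_def)
qed

lemma mp_interval_square:
  assumes "0 < \<gamma>" "\<gamma> \<le> 1" "1 - sqrt \<gamma> \<le> x" "x \<le> 1 + sqrt \<gamma>"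
  shows "mp_lower \<gamma> \<le> x\<^sup>2" "x\<^sup>2 \<le> mp_upper \<gamma>"
proof -
  have "sqrt \<gamma> \<le> 1" using assms by simp
  then have "0 \<le> 1 - sqrt \<gamma>" "0 \<le> x" using assms(3) by linarith+
  then show "mp_lower \<gamma> \<le> x\<^sup>2" "x\<^sup>2 \<le> mp_upper \<gamma>"
    using assms unfolding mp_lower_def mp_upper_def by (auto intro!: power_mono)
qed

lemma mp_b_bound:
  assumes "0 < \<gamma>" "\<gamma> \<le> 1" "1 - sqrt \<gamma> \<le> x" "x \<le> 1 + sqrt \<gamma>"
  shows "(mp_b \<gamma> x)\<^sup>2 \<le> 4 * \<gamma>"
proof (cases "x = 0")
  case True
  then show ?thesis using assms by (simp add: mp_b_def)
next
  case False
  moreover have "sqrt \<gamma> \<le> 1" using assms by simp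
  ultimately have x: "x > 0" using assms(3) by linarith
  have "0 \<le> 4 * \<gamma> - (mp_b \<gamma> x)\<^sup>2"
    unfolding mp_discriminant[OF assms(1) x] using mp_interval_square[OF assms] by simp
  then show ?thesis by simp
qed

lemma mp_b_bound_strict:
  assumes "0 < \<gamma>" "\<gamma> \<le> 1" "1 - sqrt \<gamma> < x" "x < 1 + sqrt \<gamma>"
  shows "0 < x" "(mp_b \<gamma> x)\<^sup>2 < 4 * \<gamma>"
proof -
  have g: "0 \<le> 1 - sqrt \<gamma>" using assms by simp
  then show x: "x > 0" using assms(3) by linarith
  have "mp_lower \<gamma> < x\<^sup>2" "x\<^sup>2 < mp_upper \<gamma>"
    unfolding mp_lower_def mp_upper_def using assms g x by (auto intro!: power_strict_mono)
  then have "0 < 4 * \<gamma> - (mp_b \<gamma> x)\<^sup>2"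
    unfolding mp_discriminant[OF assms(1) x] using x by simp
  then show "(mp_b \<gamma> x)\<^sup>2 < 4 * \<gamma>" by simp
qed

lemma mp_b_half_sum:
  assumes "x \<noteq> 0" shows "((x + (1 - \<gamma>) / x) / 2)\<^sup>2 = (mp_b \<gamma> x)\<^sup>2 / 4 + (1 - \<gamma>)"
  using assms by (simp add: mp_b_def power2_eq_square field_simps)

lemma mp_arccos_range:
  assumes "0 < \<gamma>" "\<gamma> \<le> 1" "1 - sqrt \<gamma> \<le> x" "x \<le> 1 + sqrt \<gamma>"
  shows "\<bar>- mp_b \<gamma> x / (2 * sqrt \<gamma>)\<bar> \<le> 1" "\<bar>(x + (1 - \<gamma>) / x) / 2\<bar> \<le> 1"
proof -
  have "(- mp_b \<gamma> x / (2 * sqrt \<gamma>))\<^sup>2 \<le> 1"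
    using mp_b_bound[OF assms] assms by (simp add: power_divide power_mult_distrib divide_le_eq)
  then show "\<bar>- mp_b \<gamma> x / (2 * sqrt \<gamma>)\<bar> \<le> 1" by (simp only: abs_square_le_1)
  have "((x + (1 - \<gamma>) / x) / 2)\<^sup>2 \<le> 1"
  proof (cases "x = 0")
    case False
    show ?thesis unfolding mp_b_half_sum[OF False] using mp_b_bound[OF assms] by simp
  qed simp
  then show "\<bar>(x + (1 - \<gamma>) / x) / 2\<bar> \<le> 1" by (simp only: abs_square_le_1)
qed

text \<open>The two angles have sines \<open>R / (2 * g)\<close> and \<open>R / 2\<close> with one
  and the same root \<open>R\<close>, so every term of the derivative is rational over
  \<open>R\<close>; \<open>key\<close> is then an identity modulo the equation for
  \<open>R\<^sup>2\<close>.\<close>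

lemma mp_sv_cdf_deriv:
  assumes "0 < \<gamma>" "\<gamma> \<le> 1" "1 - sqrt \<gamma> < x" "x < 1 + sqrt \<gamma>"
  shows "(mp_sv_cdf \<gamma> has_real_derivative sqrt (4 * \<gamma> - (mp_b \<gamma> x)\<^sup>2) / (pi * \<gamma>)) (at x)"
proof -
  define c where "c = 1 - \<gamma>"
  define g where "g = sqrt \<gamma>"
  define R where "R = sqrt (4 * \<gamma> - (mp_b \<gamma> x)\<^sup>2)"
  note x = mp_b_bound_strict[OF assms]
  have g: "0 < g" "g\<^sup>2 = \<gamma>" using assms by (auto simp: g_def)
  have R: "R > 0" "R\<^sup>2 = 4 * \<gamma> - (mp_b \<gamma> x)\<^sup>2" using x by (auto simp: R_def)
  have db: "(mp_b \<gamma> has_real_derivative (1 + c / x\<^sup>2)) (at x)"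
  proof -
    have "mp_b \<gamma> = (\<lambda>x. x - c / x)" by (auto simp: mp_b_def c_def)
    then show ?thesis using x by (auto intro!: derivative_eq_intros simp: power2_eq_square)
  qed
  have y1: "\<bar>- mp_b \<gamma> x / (2 * g)\<bar> < 1"
  proof -
    have "(- mp_b \<gamma> x / (2 * g))\<^sup>2 < 1"
      using x g assms by (simp add: power_divide power_mult_distrib divide_less_eq)
    then show ?thesis by (simp only: abs_square_less_1)
  qed
  have s1: "sqrt (1 - (- mp_b \<gamma> x / (2 * g))\<^sup>2) = R / (2 * g)"
  proof (rule real_sqrt_unique)
    show "(R / (2 * g))\<^sup>2 = 1 - (- mp_b \<gamma> x / (2 * g))\<^sup>2"
      unfolding power_divide R(2) using g assms by (simp add: power_mult_distrib field_simps)
  qed (use R g in auto)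
  have d1: "((\<lambda>x. arccos (- mp_b \<gamma> x / (2 * g))) has_real_derivative (1 + c / x\<^sup>2) / R) (at x)"
  proof -
    have "((\<lambda>x. arccos (- mp_b \<gamma> x / (2 * g))) has_real_derivative
      inverse (- sqrt (1 - (- mp_b \<gamma> x / (2 * g))\<^sup>2)) * (- (1 + c / x\<^sup>2) / (2 * g))) (at x)"
      using y1 by (intro DERIV_chain2[OF DERIV_arccos] DERIV_cdivide DERIV_minus db) (simp_all only: abs_less_iff minus_less_iff)
    moreover have "inverse (- (R / (2 * g))) * (- C / (2 * g)) = C / R" for C
      using g(1) R(1) by (simp add: field_simps)
    ultimately show ?thesis unfolding s1 by (simp only:)
  qed
  have y2: "\<bar>(x + c / x) / 2\<bar> < 1"
  proof -
    have "((x + c / x) / 2)\<^sup>2 < 1"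
      unfolding c_def using mp_b_half_sum[of x \<gamma>] x by simp
    then show ?thesis by (simp only: abs_square_less_1)
  qed
  have s2: "sqrt (1 - ((x + c / x) / 2)\<^sup>2) = R / 2"
  proof (rule real_sqrt_unique)
    have xn: "x \<noteq> 0" using x by simp
    show "(R / 2)\<^sup>2 = 1 - ((x + c / x) / 2)\<^sup>2"
      unfolding power_divide[of R] R(2) c_def mp_b_half_sum[OF xn] by simp
  qed (use R in auto)
  have d2: "((\<lambda>x. arccos ((x + c / x) / 2)) has_real_derivative - (1 - c / x\<^sup>2) / R) (at x)"
  proof -
    have "((\<lambda>x. arccos ((x + c / x) / 2)) has_real_derivative
      inverse (- sqrt (1 - ((x + c / x) / 2)\<^sup>2)) * ((1 - c / x\<^sup>2) / 2)) (at x)"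
      using y2 x by (intro DERIV_chain2[OF DERIV_arccos]) (auto intro!: derivative_eq_intros simp: power2_eq_square)
    moreover have "inverse (- (R / 2)) * (C / 2) = - C / R" for C
      using R(1) by (simp add: field_simps)
    ultimately show ?thesis unfolding s2 by (simp only:)
  qed
  have d3: "((\<lambda>x. sqrt (4 * \<gamma> - (mp_b \<gamma> x)\<^sup>2)) has_real_derivative - (mp_b \<gamma> x * (1 + c / x\<^sup>2)) / R) (at x)"
    unfolding R_def using x by (auto intro!: derivative_eq_intros db simp: field_simps)
  have key: "(1 + c / x\<^sup>2) / R + (1 - c / x\<^sup>2) / R / \<gamma> + (R - x * (mp_b \<gamma> x * (1 + c / x\<^sup>2)) / R) / (2 * \<gamma>) = R / \<gamma>"
  proof -
    define u where "u = 1 / x"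
    have u: "x * u = 1" using x by (simp add: u_def)
    have b: "mp_b \<gamma> x = x - c * u" by (simp add: mp_b_def c_def u_def)
    have cu: "c / x\<^sup>2 = c * u\<^sup>2" by (simp add: u_def power_divide)
    have \<gamma>c: "\<gamma> = 1 - c" by (simp add: c_def)
    have "2 * \<gamma> * (1 + c * u\<^sup>2) + 2 * (1 - c * u\<^sup>2) + R\<^sup>2 - x * (x - c * u) * (1 + c * u\<^sup>2) = 2 * R\<^sup>2"
    proof -
      have e1: "x * (x - c * u) * (1 + c * u\<^sup>2) = x\<^sup>2 - c\<^sup>2 * u\<^sup>2"
      proof -
        have "x * (x - c * u) * (1 + c * u\<^sup>2) = (x\<^sup>2 - c * (x * u)) * (1 + c * u\<^sup>2)"
          by (simp add: power2_eq_square algebra_simps)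
        also have "\<dots> = x\<^sup>2 + c * (x\<^sup>2 * u\<^sup>2) - c - c\<^sup>2 * u\<^sup>2"
          unfolding u by (simp add: power2_eq_square algebra_simps)
        also have "x\<^sup>2 * u\<^sup>2 = 1" unfolding power_mult_distrib[symmetric] u by simp
        finally show ?thesis by simp
      qed
      have e2: "R\<^sup>2 = 4 * \<gamma> - x\<^sup>2 + 2 * c - c\<^sup>2 * u\<^sup>2"
      proof -
        have "(x - c * u)\<^sup>2 = x\<^sup>2 - 2 * c * (x * u) + c\<^sup>2 * u\<^sup>2"
          by (simp add: power2_eq_square algebra_simps)
        then show ?thesis unfolding R(2) b by (simp add: u)
      qed
      show ?thesis unfolding e1 e2 \<gamma>c by (simp add: algebra_simps power2_eq_square)
    qed
    then have "(2 * \<gamma> * (1 + c * u\<^sup>2) + 2 * (1 - c * u\<^sup>2) + R\<^sup>2 - x * (x - c * u) * (1 + c * u\<^sup>2)) / (2 * \<gamma> * R) = 2 * R\<^sup>2 / (2 * \<gamma> * R)"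
      by (simp only:)
    moreover have "2 * R\<^sup>2 / (2 * \<gamma> * R) = R / \<gamma>" using R(1) assms(1) by (simp add: power2_eq_square)
    moreover have "(2 * \<gamma> * (1 + c * u\<^sup>2) + 2 * (1 - c * u\<^sup>2) + R\<^sup>2 - x * (x - c * u) * (1 + c * u\<^sup>2)) / (2 * \<gamma> * R)
      = (1 + c * u\<^sup>2) / R + (1 - c * u\<^sup>2) / R / \<gamma> + (R - x * ((x - c * u) * (1 + c * u\<^sup>2)) / R) / (2 * \<gamma>)"
      using R(1) assms(1) by (simp add: field_simps power2_eq_square)
    ultimately show ?thesis unfolding b cu by (simp only:)
  qed
  have "((\<lambda>x. (arccos (- mp_b \<gamma> x / (2 * g)) - arccos ((x + c / x) / 2) / \<gamma> + x * sqrt (4 * \<gamma> - (mp_b \<gamma> x)\<^sup>2) / (2 * \<gamma>)) / pi)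
    has_real_derivative ((1 + c / x\<^sup>2) / R - (- (1 - c / x\<^sup>2) / R) / \<gamma>
       + (1 * sqrt (4 * \<gamma> - (mp_b \<gamma> x)\<^sup>2) + (- (mp_b \<gamma> x * (1 + c / x\<^sup>2)) / R) * x) / (2 * \<gamma>)) / pi) (at x)"
    by (intro DERIV_cdivide DERIV_add DERIV_diff DERIV_mult d1 d2 d3 DERIV_ident)
  moreover have "((1 + c / x\<^sup>2) / R - (- (1 - c / x\<^sup>2) / R) / \<gamma>
       + (1 * sqrt (4 * \<gamma> - (mp_b \<gamma> x)\<^sup>2) + (- (mp_b \<gamma> x * (1 + c / x\<^sup>2)) / R) * x) / (2 * \<gamma>)) = R / \<gamma>"
  proof -
    have "A - (- C / R) / \<gamma> + (1 * R + (- B / R) * x) / (2 * \<gamma>) = A + C / R / \<gamma> + (R - x * B / R) / (2 * \<gamma>)" for A B C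
      by (simp add: mult_ac)
    then show ?thesis unfolding R_def[symmetric] using key by (simp only:)
  qed
  ultimately have "((\<lambda>x. (arccos (- mp_b \<gamma> x / (2 * g)) - arccos ((x + c / x) / 2) / \<gamma> + x * sqrt (4 * \<gamma> - (mp_b \<gamma> x)\<^sup>2) / (2 * \<gamma>)) / pi)
    has_real_derivative (R / \<gamma>) / pi) (at x)" by (simp only:)
  then show ?thesis unfolding mp_sv_cdf_def[abs_def] g_def c_def R_def by (simp add: mult.commute)
qed

lemma mp_sv_cdf_continuous:
  assumes "0 < \<gamma>" "\<gamma> \<le> 1"
  shows "continuous_on {1 - sqrt \<gamma>..1 + sqrt \<gamma>} (mp_sv_cdf \<gamma>)"
proof -
  let ?A = "{1 - sqrt \<gamma>..1 + sqrt \<gamma>}"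
  \<comment> \<open>For \<gamma> = 1 the interval contains 0, but then the quotient is identically
    zero.\<close>
  have q: "continuous_on ?A (\<lambda>x. (1 - \<gamma>) / x)"
  proof (cases "\<gamma> = 1")
    case False
    then have "sqrt \<gamma> < 1" using assms by simp
    then show ?thesis by (intro continuous_intros) auto
  qed simp
  have b: "continuous_on ?A (mp_b \<gamma>)" unfolding mp_b_def[abs_def] by (intro continuous_intros q)
  define q' where "q' x = (1 - \<gamma>) / x" for x
  have q': "continuous_on ?A q'" using q by (simp add: q'_def[abs_def])
  have "continuous_on ?A (\<lambda>x. (arccos (- mp_b \<gamma> x / (2 * sqrt \<gamma>)) - arccos ((x + q' x) / 2) / \<gamma>
      + x * sqrt (4 * \<gamma> - (mp_b \<gamma> x)\<^sup>2) / (2 * \<gamma>)) / pi)"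
  proof (intro continuous_intros b q' ballI)
    fix x assume "x \<in> ?A"
    then show "- 1 \<le> - mp_b \<gamma> x / (2 * sqrt \<gamma>) \<and> - mp_b \<gamma> x / (2 * sqrt \<gamma>) \<le> 1"
      "- 1 \<le> (x + q' x) / 2 \<and> (x + q' x) / 2 \<le> 1"
      using mp_arccos_range[OF assms, of x] unfolding q'_def by (auto simp only: abs_le_iff atLeastAtMost_iff minus_le_iff)
  qed (use assms in auto)
  then show ?thesis by (simp add: mp_sv_cdf_def[abs_def] q'_def)
qed

lemma mp_sv_cdf_lower:
  assumes "0 < \<gamma>" "\<gamma> \<le> 1" shows "mp_sv_cdf \<gamma> (1 - sqrt \<gamma>) = 0"
proof (cases "\<gamma> = 1")
  case True
  then show ?thesis by (simp add: mp_sv_cdf_def mp_b_def)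
next
  case False
  define g where "g = sqrt \<gamma>"
  have g: "0 < g" "g < 1" "\<gamma> = g\<^sup>2" using assms False by (auto simp: g_def)
  have "(1 - \<gamma>) / (1 - g) = 1 + g"
  proof -
    have "1 - \<gamma> = (1 + g) * (1 - g)" unfolding g(3) by (simp add: power2_eq_square algebra_simps)
    then show ?thesis using g by simp
  qed
  then show ?thesis unfolding mp_sv_cdf_def mp_b_def g_def[symmetric] using g by (simp add: power_mult_distrib)
qed

lemma mp_sv_cdf_upper:
  assumes "0 < \<gamma>" "\<gamma> \<le> 1" shows "mp_sv_cdf \<gamma> (1 + sqrt \<gamma>) = 1"
proof -
  define g where "g = sqrt \<gamma>"
  have g: "0 < g" "\<gamma> = g\<^sup>2" using assms by (auto simp: g_def)
  have "(1 - \<gamma>) / (1 + g) = 1 - g"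
  proof -
    have "1 - \<gamma> = (1 - g) * (1 + g)" unfolding g(2) by (simp add: power2_eq_square algebra_simps)
    then show ?thesis using g by simp
  qed
  then show ?thesis unfolding mp_sv_cdf_def mp_b_def g_def[symmetric] using g by (simp add: power_mult_distrib)
qed

lemma mp_sv_cdf_strict_mono:
  assumes "0 < \<gamma>" "\<gamma> \<le> 1" "1 - sqrt \<gamma> \<le> x" "x < y" "y \<le> 1 + sqrt \<gamma>"
  shows "mp_sv_cdf \<gamma> x < mp_sv_cdf \<gamma> y"
proof (rule DERIV_pos_imp_increasing_open[OF assms(4)])
  fix u assume u: "x < u" "u < y"
  then have u': "1 - sqrt \<gamma> < u" "u < 1 + sqrt \<gamma>" using assms by auto
  show "\<exists>d. (mp_sv_cdf \<gamma> has_real_derivative d) (at u) \<and> 0 < d"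
    using mp_sv_cdf_deriv[OF assms(1,2) u'] mp_b_bound_strict[OF assms(1,2) u'] assms(1) by fastforce
next
  show "continuous_on {x..y} (mp_sv_cdf \<gamma>)"
    using continuous_on_subset[OF mp_sv_cdf_continuous[OF assms(1,2)]] assms by auto
qed

lemma mp_sv_cdf_increment:
  assumes "0 < \<gamma>" "\<gamma> \<le> 1" "1 - sqrt \<gamma> \<le> x" "x \<le> y" "y \<le> 1 + sqrt \<gamma>"
  shows "mp_sv_cdf \<gamma> y - mp_sv_cdf \<gamma> x \<le> 2 / (pi * sqrt \<gamma>) * (y - x)"
proof (cases "x = y")
  case False
  then have xy: "x < y" using assms by simp
  have cont: "continuous_on {x..y} (mp_sv_cdf \<gamma>)"
    using continuous_on_subset[OF mp_sv_cdf_continuous[OF assms(1,2)]] assms by auto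
  obtain l u where u: "x < u" "u < y" and d: "(mp_sv_cdf \<gamma> has_real_derivative l) (at u)"
    and eq: "mp_sv_cdf \<gamma> y - mp_sv_cdf \<gamma> x = (y - x) * l"
  proof (rule MVT[OF xy cont, THEN exE], goal_cases)
    case (1 u)
    then show ?case using mp_sv_cdf_deriv[OF assms(1,2), of u] assms by (auto simp: real_differentiable_def)
  next
    case (2 l)
    then show ?case using that by blast
  qed
  have u': "1 - sqrt \<gamma> < u" "u < 1 + sqrt \<gamma>" using u assms by auto
  have "l = sqrt (4 * \<gamma> - (mp_b \<gamma> u)\<^sup>2) / (pi * \<gamma>)"
    using DERIV_unique[OF d mp_sv_cdf_deriv[OF assms(1,2) u']] .
  also have "\<dots> \<le> sqrt (4 * \<gamma>) / (pi * \<gamma>)" using assms(1) by (intro divide_right_mono real_sqrt_le_mono) auto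
  also have "\<dots> = 2 / (pi * sqrt \<gamma>)"
    using assms(1) by (simp add: real_sqrt_mult field_simps)
  finally have "(y - x) * l \<le> (y - x) * (2 / (pi * sqrt \<gamma>))" using xy by (intro mult_left_mono) auto
  then show ?thesis using eq by (simp add: mult.commute)
qed simp

lemma mp_discriminant_lower:
  assumes "0 < \<gamma>" "\<gamma> \<le> 1" "0 \<le> \<tau>" "1 - sqrt \<gamma> + \<tau> \<le> x" "x \<le> 1 + sqrt \<gamma> - \<tau>" "0 < x"
  shows "\<tau>\<^sup>2 \<le> 4 * \<gamma> - (mp_b \<gamma> x)\<^sup>2"
proof -
  define g where "g = sqrt \<gamma>"
  have g: "0 < g" "g \<le> 1" using assms by (auto simp: g_def)
  have "(\<tau> * x) * (\<tau> * x) \<le> ((1 + g - x) * (1 + g + x)) * ((x - (1 - g)) * (x + (1 - g)))"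
    using assms g unfolding g_def[symmetric] by (intro mult_mono mult_nonneg_nonneg) auto
  also have "\<dots> = (mp_upper \<gamma> - x\<^sup>2) * (x\<^sup>2 - mp_lower \<gamma>)"
    unfolding mp_upper_def mp_lower_def g_def[symmetric] by (simp add: power2_eq_square algebra_simps)
  finally have "\<tau>\<^sup>2 * x\<^sup>2 \<le> (mp_upper \<gamma> - x\<^sup>2) * (x\<^sup>2 - mp_lower \<gamma>)" by (simp add: power2_eq_square mult_ac)
  then show ?thesis unfolding mp_discriminant[OF assms(1,6)] using assms(6) by (simp add: pos_le_divide_eq)
qed

lemma mp_sv_cdf_growth:
  assumes "0 < \<gamma>" "\<gamma> \<le> 1" "0 < \<tau>" "1 - sqrt \<gamma> + \<tau> \<le> x" "x \<le> y" "y \<le> 1 + sqrt \<gamma> - \<tau>"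
  shows "\<tau> / pi * (y - x) \<le> mp_sv_cdf \<gamma> y - mp_sv_cdf \<gamma> x"
proof (cases "x = y")
  case False
  then have xy: "x < y" using assms by simp
  have cont: "continuous_on {x..y} (mp_sv_cdf \<gamma>)"
    using continuous_on_subset[OF mp_sv_cdf_continuous[OF assms(1,2)]] assms by auto
  obtain l u where u: "x < u" "u < y" and d: "(mp_sv_cdf \<gamma> has_real_derivative l) (at u)"
    and eq: "mp_sv_cdf \<gamma> y - mp_sv_cdf \<gamma> x = (y - x) * l"
  proof (rule MVT[OF xy cont, THEN exE], goal_cases)
    case (1 u)
    then show ?case using mp_sv_cdf_deriv[OF assms(1,2), of u] assms by (auto simp: real_differentiable_def)
  next
    case (2 l)
    then show ?case using that by blast
  qed
  have u': "1 - sqrt \<gamma> < u" "u < 1 + sqrt \<gamma>" using u assms by auto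
  have u0: "0 < u" using mp_b_bound_strict[OF assms(1,2) u'] by simp
  have "\<tau>\<^sup>2 \<le> 4 * \<gamma> - (mp_b \<gamma> u)\<^sup>2" using u u0 assms by (intro mp_discriminant_lower) auto
  then have "\<tau> \<le> sqrt (4 * \<gamma> - (mp_b \<gamma> u)\<^sup>2)" by (rule real_le_rsqrt)
  then have "\<tau> / (pi * 1) \<le> sqrt (4 * \<gamma> - (mp_b \<gamma> u)\<^sup>2) / (pi * \<gamma>)"
    using assms mp_b_bound_strict[OF assms(1,2) u'] by (intro frac_le mult_left_mono) auto
  also have "\<dots> = l" using DERIV_unique[OF d mp_sv_cdf_deriv[OF assms(1,2) u']] by simp
  finally have "(y - x) * (\<tau> / pi) \<le> (y - x) * l" using xy by (intro mult_left_mono) auto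
  then show ?thesis using eq by (simp add: mult.commute)
qed simp

text \<open>The antiderivative is \<open>mp_sv_cdf\<close> composed with the square root. For
  \<gamma> = 1 the density is unbounded at 0, so the fundamental theorem is used in its improper
  form, with one-sided limits and a nonnegative integrand.\<close>

lemma mp_integral_eq:
  assumes "0 < \<gamma>" "\<gamma> \<le> 1" "mp_lower \<gamma> \<le> X" "X \<le> mp_upper \<gamma>"
  shows "(LBINT E:{..X}. mp_density \<gamma> E) = mp_sv_cdf \<gamma> (sqrt X)"
proof -
  note lu = mp_lower_upper[OF assms(1,2)]
  define f where "f x = sqrt ((mp_upper \<gamma> - x) * (x - mp_lower \<gamma>)) / (2 * pi * \<gamma> * x)" for x
  have sq: "1 - sqrt \<gamma> < sqrt x" "sqrt x < 1 + sqrt \<gamma>" "0 < x" if "mp_lower \<gamma> < x" "x < mp_upper \<gamma>" for x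
    using that lu(1) lu(3,4)[symmetric] by auto
  have der: "((\<lambda>x. mp_sv_cdf \<gamma> (sqrt x)) has_real_derivative f x) (at x)" if x: "mp_lower \<gamma> < x" "x < mp_upper \<gamma>" for x
  proof -
    note s = sq[OF x]
    have "((\<lambda>x. mp_sv_cdf \<gamma> (sqrt x)) has_real_derivative
       sqrt (4 * \<gamma> - (mp_b \<gamma> (sqrt x))\<^sup>2) / (pi * \<gamma>) * (inverse (sqrt x) / 2)) (at x)"
      by (rule DERIV_chain2[OF mp_sv_cdf_deriv[OF assms(1,2) s(1,2)] DERIV_real_sqrt[OF s(3)]])
    moreover have "sqrt (4 * \<gamma> - (mp_b \<gamma> (sqrt x))\<^sup>2) = sqrt ((mp_upper \<gamma> - x) * (x - mp_lower \<gamma>)) / sqrt x"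
      using mp_discriminant[OF assms(1), of "sqrt x"] s(3) by (simp add: real_sqrt_divide)
    moreover have "sqrt ((mp_upper \<gamma> - x) * (x - mp_lower \<gamma>)) / sqrt x / (pi * \<gamma>) * (inverse (sqrt x) / 2) = f x"
      unfolding f_def using s(3) assms(1) by (simp add: field_simps)
    ultimately show ?thesis by simp
  qed
  have contf: "isCont f x" if "mp_lower \<gamma> < x" for x
    unfolding f_def using that lu assms by (intro continuous_intros) auto
  have cK: "continuous_on {mp_lower \<gamma>..mp_upper \<gamma>} (\<lambda>x. mp_sv_cdf \<gamma> (sqrt x))"
  proof (rule continuous_on_compose2[OF mp_sv_cdf_continuous[OF assms(1,2)]])
    show "sqrt ` {mp_lower \<gamma>..mp_upper \<gamma>} \<subseteq> {1 - sqrt \<gamma>..1 + sqrt \<gamma>}"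
      using lu(3,4)[symmetric] by auto
  qed (intro continuous_intros)
  have int: "(LBINT E:{mp_lower \<gamma>..X}. f E) = mp_sv_cdf \<gamma> (sqrt X)"
  proof (cases "mp_lower \<gamma> = X")
    case True
    then show ?thesis using mp_sv_cdf_lower[OF assms(1,2)] lu(3)
      using interval_integral_Icc[of X X f] interval_integral_endpoints_same[of X f] by simp
  next
    case False
    then have lt: "mp_lower \<gamma> < X" using assms by simp
    have cX: "continuous_on {mp_lower \<gamma>..X} (\<lambda>x. mp_sv_cdf \<gamma> (sqrt x))"
      by (rule continuous_on_subset[OF cK]) (use assms in auto)
    have "(LBINT x=ereal (mp_lower \<gamma>)..ereal X. f x) = mp_sv_cdf \<gamma> (sqrt X) - mp_sv_cdf \<gamma> (sqrt (mp_lower \<gamma>))"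
    proof (rule interval_integral_FTC_nonneg(2))
      show "(((\<lambda>x. mp_sv_cdf \<gamma> (sqrt x)) \<circ> real_of_ereal) \<longlongrightarrow> mp_sv_cdf \<gamma> (sqrt (mp_lower \<gamma>))) (at_right (ereal (mp_lower \<gamma>)))"
        unfolding ereal_tendsto_simps by (rule continuous_on_Icc_at_rightD[OF cX lt])
      show "(((\<lambda>x. mp_sv_cdf \<gamma> (sqrt x)) \<circ> real_of_ereal) \<longlongrightarrow> mp_sv_cdf \<gamma> (sqrt X)) (at_left (ereal X))"
        unfolding ereal_tendsto_simps by (rule continuous_on_Icc_at_leftD[OF cX lt])
      show "AE x in lborel. ereal (mp_lower \<gamma>) < ereal x \<longrightarrow> ereal x < ereal X \<longrightarrow> 0 \<le> f x"
        using lu assms by (intro AE_I2) (auto simp: f_def intro!: divide_nonneg_nonneg mult_nonneg_nonneg)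
    qed (use lt der contf assms in auto)
    then show ?thesis using lt lu(3) mp_sv_cdf_lower[OF assms(1,2)] by (simp add: interval_integral_Icc)
  qed
  have "(LBINT E:{..X}. mp_density \<gamma> E) = (LBINT E:{mp_lower \<gamma>..X}. f E)"
    unfolding set_lebesgue_integral_def
  proof (rule Bochner_Integration.integral_cong[OF refl])
    fix x
    show "indicator {..X} x *\<^sub>R mp_density \<gamma> x = indicator {mp_lower \<gamma>..X} x *\<^sub>R f x"
      using assms by (auto simp: mp_density_def f_def indicator_def)
  qed
  then show ?thesis using int by simp
qed

lemma mp_integral_below:
  assumes "X < mp_lower \<gamma>" shows "(LBINT E:{..X}. mp_density \<gamma> E) = 0"
proof -
  have "(\<lambda>x. indicator {..X} x *\<^sub>R mp_density \<gamma> x) = (\<lambda>x. 0)"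
    using assms by (auto simp: mp_density_def indicator_def fun_eq_iff)
  then show ?thesis by (simp add: set_lebesgue_integral_def)
qed

text \<open>The least solution lies inside the support: further left the distribution function is
  strictly smaller, and it vanishes below the support. Its square root \<open>a\<close> is the point
  near which the singular values are counted.\<close>

theorem classical_location_sv:
  assumes "0 < \<gamma>" "\<gamma> \<le> 1" "0 < i" "i < N"
  shows "\<exists>a. 1 - sqrt \<gamma> < a \<and> a < 1 + sqrt \<gamma> \<and> mp_sv_cdf \<gamma> a = real i / real N \<and> classical_location \<gamma> N i = a\<^sup>2"
proof -
  note lu = mp_lower_upper[OF assms(1,2)]
  define y where "y = real i / real N"
  have y: "0 < y" "y < 1" using assms by (auto simp: y_def)
  have g: "0 < sqrt \<gamma>" "sqrt \<gamma> \<le> 1" using assms by auto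
  have "\<exists>a\<ge>1 - sqrt \<gamma>. a \<le> 1 + sqrt \<gamma> \<and> mp_sv_cdf \<gamma> a = y"
    using mp_sv_cdf_lower[OF assms(1,2)] mp_sv_cdf_upper[OF assms(1,2)] y g
    by (intro IVT' mp_sv_cdf_continuous[OF assms(1,2)]) auto
  then obtain a where a: "1 - sqrt \<gamma> \<le> a" "a \<le> 1 + sqrt \<gamma>" and Ga: "mp_sv_cdf \<gamma> a = y" by auto
  have a': "1 - sqrt \<gamma> < a" "a < 1 + sqrt \<gamma>"
    using a Ga y mp_sv_cdf_lower[OF assms(1,2)] mp_sv_cdf_upper[OF assms(1,2)] by (auto simp: less_le)
  have a0: "0 < a" using mp_b_bound_strict[OF assms(1,2) a'] by simp
  note sq = mp_interval_square[OF assms(1,2) a]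
  have "classical_location \<gamma> N i = a\<^sup>2"
    unfolding classical_location_def y_def[symmetric]
  proof (rule Least_equality)
    show "y = (LBINT E:{..a\<^sup>2}. mp_density \<gamma> E)"
      using mp_integral_eq[OF assms(1,2) sq] Ga a0 by simp
  next
    fix x assume x: "y = (LBINT E:{..x}. mp_density \<gamma> E)"
    show "a\<^sup>2 \<le> x"
    proof (rule ccontr)
      assume "\<not> a\<^sup>2 \<le> x"
      then have lt: "x < a\<^sup>2" by simp
      have lx: "mp_lower \<gamma> \<le> x" using x y mp_integral_below[of x \<gamma>] by (cases "x < mp_lower \<gamma>") auto
      have ux: "x \<le> mp_upper \<gamma>" using lt sq by simp
      have "sqrt x < a" using lt a0 lx lu by (metis real_sqrt_less_mono real_sqrt_abs abs_of_pos)
      moreover have "1 - sqrt \<gamma> \<le> sqrt x" using lx lu(3) by (metis real_sqrt_le_mono)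
      ultimately have "mp_sv_cdf \<gamma> (sqrt x) < mp_sv_cdf \<gamma> a"
        using a by (intro mp_sv_cdf_strict_mono[OF assms(1,2)]) auto
      then show False using x mp_integral_eq[OF assms(1,2) lx ux] Ga by simp
    qed
  qed
  then show ?thesis using a' Ga y_def by blast
qed

section \<open>The limiting Stieltjes transform on vertical lines\<close>

definition mp_cb :: "real \<Rightarrow> complex \<Rightarrow> complex" where "mp_cb \<gamma> z = z - of_real (1 - \<gamma>) / z"

text \<open>The root with positive imaginary part of \<open>w\<^sup>2 - mp_cb \<gamma> z * w + \<gamma> = 0\<close>; the Stieltjes
  transform of the symmetrized law of the singular values is \<open>- 1 / mp_w \<gamma> z\<close>.\<close>

definition mp_w :: "real \<Rightarrow> complex \<Rightarrow> complex" where
  "mp_w \<gamma> z = (mp_cb \<gamma> z + \<i> * csqrt (of_real (4 * \<gamma>) - (mp_cb \<gamma> z)\<^sup>2)) / 2"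

text \<open>With m = - 1 / \<open>mp_w\<close> and n = - 1 / \<open>mp_v\<close> one has
  \<open>mp_w\<close> = z + n and \<open>mp_v\<close> = z + \<gamma> m, the coupled form of the
  quadratic equation: m and n belong to the white and the black vertices.\<close>

definition mp_v :: "real \<Rightarrow> complex \<Rightarrow> complex" where "mp_v \<gamma> z = z - of_real \<gamma> / mp_w \<gamma> z"

text \<open>An antiderivative of \<open>- 1 / mp_w \<gamma> z\<close> in the upper half plane. It is the value at its
  critical point of the function
  \<open>- (Ln (z + n) + Ln (z + \<gamma> * m) / \<gamma> + m * n) / 2\<close> of two variables \<open>m\<close>, \<open>n\<close>,
  corrected by a multiple of \<open>Ln z\<close>.\<close>

definition mp_potential :: "real \<Rightarrow> complex \<Rightarrow> complex" where
  "mp_potential \<gamma> z = - (Ln (- \<i> * mp_w \<gamma> z) + Ln (- \<i> * mp_v \<gamma> z) / of_real \<gamma> + z / mp_w \<gamma> z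
     - of_real ((1 - \<gamma>) / \<gamma>) * Ln (- \<i> * z)) / 2"

lemma csqrt_Re_pos:
  assumes "x \<notin> \<real>\<^sub>\<le>\<^sub>0" shows "Re (csqrt x) > 0"
proof (rule ccontr)
  assume "\<not> Re (csqrt x) > 0"
  then have "Re (csqrt x) = 0" using csqrt_principal[of x] by auto
  then have "csqrt x = \<i> * of_real (Im (csqrt x))" by (simp add: complex_eq_iff)
  then have "x = (\<i> * of_real (Im (csqrt x)))\<^sup>2" by (metis power2_csqrt)
  also have "\<dots> = of_real (- (Im (csqrt x))\<^sup>2)" by (simp add: power_mult_distrib)
  finally have "x \<in> \<real>\<^sub>\<le>\<^sub>0" by (metis neg_le_0_iff_le nonpos_Reals_of_real_iff zero_le_power2)
  then show False using assms by simp
qed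

text \<open>Multiplication by - i carries the upper half plane to the right half plane, where the
  principal logarithm has no cut and the argument is an arctangent.\<close>

lemma Im_Ln_rotated:
  assumes "Im u > 0"
  shows "Im (Ln (- \<i> * u)) = - arctan (Re u / Im u)"
proof -
  have ne: "- \<i> * u \<noteq> 0" using assms by auto
  have "Im (Ln (- \<i> * u)) = Arg (- \<i> * u)" using Arg_eq_Im_Ln[OF ne] by simp
  also have "\<dots> = arctan (Im (- \<i> * u) / Re (- \<i> * u))" using assms by (intro arg_conv_arctan) simp
  finally show ?thesis by (simp add: arctan_minus)
qed

lemma Im_Ln_rotated_arccos:
  assumes "Im u > 0"
  shows "Im (Ln (- \<i> * u)) = arccos (Re u / cmod u) - pi / 2"
proof -
  have cm: "cmod u > 0" using assms by auto
  have sq: "(cmod u)\<^sup>2 = (Re u)\<^sup>2 + (Im u)\<^sup>2" by (rule cmod_power2)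
  have s: "sqrt (1 - (Re u / cmod u)\<^sup>2) = Im u / cmod u"
    by (rule real_sqrt_unique) (use cm sq assms in \<open>auto simp: power_divide field_simps\<close>)
  have "\<bar>Re u / cmod u\<bar> < 1"
  proof -
    have "(Re u)\<^sup>2 < (cmod u)\<^sup>2" using sq assms by simp
    then have "(Re u / cmod u)\<^sup>2 < 1" using cm by (simp add: power_divide)
    then show ?thesis by (simp only: abs_square_less_1)
  qed
  then have "arccos (Re u / cmod u) = pi / 2 - arctan (Re u / cmod u / (Im u / cmod u))"
    using arccos_arctan[of "Re u / cmod u"] unfolding s by (simp only: abs_less_iff minus_less_iff)
  also have "Re u / cmod u / (Im u / cmod u) = Re u / Im u" using cm by simp
  finally show ?thesis using Im_Ln_rotated[OF assms] by simp
qed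

context
  fixes \<gamma> a :: real
  assumes \<gamma>: "0 < \<gamma>" "\<gamma> \<le> 1" and bulk: "1 - sqrt \<gamma> < a" "a < 1 + sqrt \<gamma>"
begin

lemma a_pos: "0 < a" and mp_b_strict: "(mp_b \<gamma> a)\<^sup>2 < 4 * \<gamma>"
  using mp_b_bound_strict[OF \<gamma> bulk] .

lemma line_nonzero: "Complex a t \<noteq> 0" using a_pos by (simp add: complex_eq_iff)

lemma mp_cb_line:
  "Re (mp_cb \<gamma> (Complex a t)) = a - (1 - \<gamma>) * a / (a\<^sup>2 + t\<^sup>2)"
  "Im (mp_cb \<gamma> (Complex a t)) = t + (1 - \<gamma>) * t / (a\<^sup>2 + t\<^sup>2)"
  by (simp_all add: mp_cb_def Re_divide Im_divide)

lemma mp_cb_line_0: "mp_cb \<gamma> (Complex a 0) = of_real (mp_b \<gamma> a)"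
  using a_pos by (simp add: complex_eq_iff mp_cb_line mp_b_def power2_eq_square)

lemma Im_mp_cb_ge: assumes "0 \<le> t" shows "t \<le> Im (mp_cb \<gamma> (Complex a t))"
  using assms \<gamma> by (simp add: mp_cb_line)

text \<open>On the cut the square of \<open>mp_cb\<close> would be real and at least
  \<open>4 * \<gamma>\<close>, which forces \<open>t = 0\<close> and contradicts the bulk condition.
  Hence \<open>csqrt\<close> is differentiable along the whole closed half line.\<close>

lemma mp_disc_slit:
  assumes t: "0 \<le> t"
  shows "of_real (4 * \<gamma>) - (mp_cb \<gamma> (Complex a t))\<^sup>2 \<notin> \<real>\<^sub>\<le>\<^sub>0"
proof
  let ?b = "mp_cb \<gamma> (Complex a t)"
  assume "of_real (4 * \<gamma>) - ?b\<^sup>2 \<in> \<real>\<^sub>\<le>\<^sub>0"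
  then have im: "Im (?b\<^sup>2) = 0" and re: "4 * \<gamma> \<le> Re (?b\<^sup>2)"
    by (auto simp: complex_nonpos_Reals_iff)
  have 1: "2 * Re ?b * Im ?b = 0" using im by (auto simp: power2_eq_square)
  have 2: "4 * \<gamma> \<le> (Re ?b)\<^sup>2 - (Im ?b)\<^sup>2" using re by (simp add: power2_eq_square)
  then have "Re ?b \<noteq> 0" using \<gamma> by (auto simp: power2_eq_square) (smt (verit) zero_le_square)
  then have "Im ?b = 0" using 1 by simp
  then have "t = 0" using Im_mp_cb_ge[OF t] t by simp
  then have "(Re ?b)\<^sup>2 = (mp_b \<gamma> a)\<^sup>2" using mp_cb_line_0 by simp
  then show False using 2 mp_b_strict \<open>Im ?b = 0\<close> by simp
qed

lemma mp_w_line: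
  assumes t: "0 \<le> t"
  shows "(mp_w \<gamma> (Complex a t))\<^sup>2 - mp_cb \<gamma> (Complex a t) * mp_w \<gamma> (Complex a t) + of_real \<gamma> = 0"
    and "0 < Im (mp_w \<gamma> (Complex a t))"
    and "Im (mp_w \<gamma> (Complex a t)) \<ge> Re (csqrt (of_real (4 * \<gamma>) - (mp_cb \<gamma> (Complex a t))\<^sup>2)) / 2"
proof -
  define b where "b = mp_cb \<gamma> (Complex a t)"
  define r where "r = csqrt (of_real (4 * \<gamma>) - b\<^sup>2)"
  have w: "mp_w \<gamma> (Complex a t) = (b + \<i> * r) / 2" by (simp add: mp_w_def b_def r_def)
  have r2: "r\<^sup>2 = of_real (4 * \<gamma>) - b\<^sup>2" by (simp add: r_def)
  have "((b + \<i> * r) / 2)\<^sup>2 - b * ((b + \<i> * r) / 2) + of_real \<gamma> = - (b\<^sup>2 + r\<^sup>2) / 4 + of_real \<gamma>"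
    by (simp add: power2_eq_square field_simps)
  also have "\<dots> = 0" unfolding r2 by simp
  finally show "(mp_w \<gamma> (Complex a t))\<^sup>2 - mp_cb \<gamma> (Complex a t) * mp_w \<gamma> (Complex a t) + of_real \<gamma> = 0"
    unfolding w b_def[symmetric] .
  have rp: "Re r > 0" unfolding r_def b_def by (rule csqrt_Re_pos[OF mp_disc_slit[OF t]])
  have bp: "Im b \<ge> 0" using Im_mp_cb_ge[OF t] t unfolding b_def by linarith
  show "0 < Im (mp_w \<gamma> (Complex a t))" unfolding w using rp bp by simp
  show "Im (mp_w \<gamma> (Complex a t)) \<ge> Re (csqrt (of_real (4 * \<gamma>) - (mp_cb \<gamma> (Complex a t))\<^sup>2)) / 2"
    unfolding w b_def[symmetric] r_def[symmetric] using bp by simp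
qed

lemma mp_w_nonzero: "0 \<le> t \<Longrightarrow> mp_w \<gamma> (Complex a t) \<noteq> 0"
  using mp_w_line(2)[of t] by auto

lemma mp_w_quotient:
  assumes t: "0 \<le> t" shows "of_real \<gamma> / mp_w \<gamma> (Complex a t) = mp_cb \<gamma> (Complex a t) - mp_w \<gamma> (Complex a t)"
  using mp_w_line(1)[OF t] mp_w_nonzero[OF t] by (simp add: field_simps power2_eq_square)

lemma Im_quotient_nonpos:
  assumes t: "0 \<le> t" shows "Im (of_real \<gamma> / mp_w \<gamma> (Complex a t)) = - \<gamma> * Im (mp_w \<gamma> (Complex a t)) / (cmod (mp_w \<gamma> (Complex a t)))\<^sup>2"
  by (simp add: Im_divide cmod_power2)

text \<open>The bounds come from imaginary parts in \<gamma> / w = \<open>mp_cb\<close> - w. The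
  left side is negative there, so Im w exceeds the imaginary part of \<open>mp_cb\<close>; written
  as a multiple of Im w, it also forces \<gamma> \<le> |w|^2.\<close>

lemma mp_w_bounds:
  assumes t: "0 \<le> t"
  shows "t \<le> Im (mp_w \<gamma> (Complex a t))" "sqrt \<gamma> \<le> cmod (mp_w \<gamma> (Complex a t))"
    "0 < Im (mp_v \<gamma> (Complex a t))" "t \<le> Im (mp_v \<gamma> (Complex a t))"
    "(Complex a t - mp_w \<gamma> (Complex a t)) * mp_v \<gamma> (Complex a t) = 1"
    "mp_v \<gamma> (Complex a t) = mp_w \<gamma> (Complex a t) + of_real (1 - \<gamma>) / Complex a t"
proof -
  define w where "w = mp_w \<gamma> (Complex a t)"
  define b where "b = mp_cb \<gamma> (Complex a t)"
  have w0: "Im w > 0" "w \<noteq> 0" using mp_w_line(2)[OF t] by (auto simp: w_def)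
  have q: "of_real \<gamma> / w = b - w" using mp_w_quotient[OF t] by (simp add: w_def b_def)
  have iq: "Im (of_real \<gamma> / w) = - \<gamma> * Im w / (cmod w)\<^sup>2" using Im_quotient_nonpos[OF t] by (simp add: w_def)
  have iq0: "Im (of_real \<gamma> / w) < 0" unfolding iq using w0 \<gamma> by (simp add: divide_neg_pos)
  have bt: "t \<le> Im b" using Im_mp_cb_ge[OF t] by (simp add: b_def)
  show "t \<le> Im (mp_w \<gamma> (Complex a t))" using q iq0 bt unfolding w_def[symmetric] by simp
  have "Im (of_real \<gamma> / w) = Im b - Im w" unfolding q by simp
  then have "Im w * (1 - \<gamma> / (cmod w)\<^sup>2) = Im b" unfolding iq by (simp add: algebra_simps)
  then have "0 \<le> Im w * (1 - \<gamma> / (cmod w)\<^sup>2)" using bt t by linarith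
  then have "0 \<le> 1 - \<gamma> / (cmod w)\<^sup>2" using w0(1) by (simp add: zero_le_mult_iff)
  then have "\<gamma> \<le> (cmod w)\<^sup>2" using w0 by (simp add: divide_le_eq)
  then show "sqrt \<gamma> \<le> cmod (mp_w \<gamma> (Complex a t))" unfolding w_def[symmetric] by (simp add: real_le_lsqrt)
  have v: "mp_v \<gamma> (Complex a t) = Complex a t - of_real \<gamma> / w" by (simp add: mp_v_def w_def)
  show "0 < Im (mp_v \<gamma> (Complex a t))" "t \<le> Im (mp_v \<gamma> (Complex a t))" unfolding v using iq0 t by simp_all
  show v2: "mp_v \<gamma> (Complex a t) = mp_w \<gamma> (Complex a t) + of_real (1 - \<gamma>) / Complex a t"
    unfolding v q w_def[symmetric] by (simp add: b_def mp_cb_def)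
  define z where "z = Complex a t"
  have z0: "z \<noteq> 0" using line_nonzero by (simp add: z_def)
  have eq: "w\<^sup>2 = b * w - of_real \<gamma>" 
  proof -
    have "w\<^sup>2 = (w\<^sup>2 - b * w + of_real \<gamma>) + (b * w - of_real \<gamma>)" by simp
    then show ?thesis using mp_w_line(1)[OF t] unfolding w_def b_def by simp
  qed
  have bz: "b = z - of_real (1 - \<gamma>) / z" by (simp add: b_def mp_cb_def z_def)
  have "(z - w) * (w + of_real (1 - \<gamma>) / z) = z * w + of_real (1 - \<gamma>) - w\<^sup>2 - of_real (1 - \<gamma>) / z * w"
    using z0 by (simp add: field_simps power2_eq_square)
  also have "\<dots> = 1" unfolding eq bz by (simp add: algebra_simps)
  finally show "(Complex a t - mp_w \<gamma> (Complex a t)) * mp_v \<gamma> (Complex a t) = 1"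
    by (simp only: v2 w_def z_def)
qed

lemma mp_w_differentiable:
  assumes t: "0 \<le> t" shows "\<exists>w'. (mp_w \<gamma> has_field_derivative w') (at (Complex a t))"
proof -
  let ?z = "Complex a t"
  define b' where "b' = 1 - (0 * ?z - of_real (1 - \<gamma>) * 1) / (?z * ?z)"
  have db: "(mp_cb \<gamma> has_field_derivative b') (at ?z)"
    unfolding mp_cb_def[abs_def] b'_def
    by (intro DERIV_diff DERIV_ident DERIV_divide DERIV_const line_nonzero)
  have d: "((\<lambda>z. of_real (4 * \<gamma>) - (mp_cb \<gamma> z)\<^sup>2) has_field_derivative (0 - of_nat 2 * mp_cb \<gamma> ?z ^ (2 - 1) * b')) (at ?z)"
    by (intro DERIV_diff DERIV_const) (use DERIV_power[OF db, of 2] in \<open>simp add: mult_ac\<close>)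
  have "(mp_w \<gamma> has_field_derivative ((b' + \<i> * (inverse (2 * csqrt (of_real (4 * \<gamma>) - (mp_cb \<gamma> ?z)\<^sup>2)) * (0 - of_nat 2 * mp_cb \<gamma> ?z ^ (2 - 1) * b'))) / 2)) (at ?z)"
    unfolding mp_w_def[abs_def]
    by (intro DERIV_cdivide DERIV_add db DERIV_cmult DERIV_chain2[OF has_field_derivative_csqrt d] mp_disc_slit t)
  then show ?thesis by blast
qed

lemma mp_potential_deriv:
  assumes t: "0 \<le> t"
  shows "(mp_potential \<gamma> has_field_derivative - 1 / mp_w \<gamma> (Complex a t)) (at (Complex a t))"
proof -
  let ?z = "Complex a t"
  define w where "w = mp_w \<gamma> ?z"
  define v where "v = mp_v \<gamma> ?z"
  define c where "c = complex_of_real ((1 - \<gamma>) / \<gamma>)"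
  define g where "g = complex_of_real \<gamma>"
  obtain w' where dw: "(mp_w \<gamma> has_field_derivative w') (at ?z)" using mp_w_differentiable[OF t] by auto
  have g0: "g \<noteq> 0" using \<gamma> by (simp add: g_def)
  have w0: "w \<noteq> 0" "Im w > 0" using mp_w_line(2)[OF t] by (auto simp: w_def)
  have vp: "Im v > 0" using mp_w_bounds(3)[OF t] by (simp add: v_def)
  have z0: "?z \<noteq> 0" by (rule line_nonzero)
  have slit: "- \<i> * u \<notin> \<real>\<^sub>\<le>\<^sub>0" if "Im u \<ge> 0" "u \<noteq> 0" for u
    using that by (auto simp: complex_nonpos_Reals_iff complex_eq_iff)
  have dv: "(mp_v \<gamma> has_field_derivative (1 + g * w' / w\<^sup>2)) (at ?z)"
    unfolding mp_v_def[abs_def] using dw w0 mp_w_nonzero[OF t]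
    by (auto intro!: derivative_eq_intros simp: w_def g_def power2_eq_square)
  have LnC: "((\<lambda>z. Ln (- \<i> * f z)) has_field_derivative (f' / f ?z)) (at ?z)"
    if "(f has_field_derivative f') (at ?z)" "Im (f ?z) \<ge> 0" "f ?z \<noteq> 0" for f f'
  proof -
    have "((\<lambda>z. Ln (- \<i> * f z)) has_field_derivative (inverse (- \<i> * f ?z) * (- \<i> * f'))) (at ?z)"
      by (intro DERIV_chain2[OF has_field_derivative_Ln] DERIV_cmult that slit)
    then show ?thesis using that(3) by (simp add: field_simps)
  qed
  have d1: "((\<lambda>z. Ln (- \<i> * mp_w \<gamma> z)) has_field_derivative (w' / w)) (at ?z)"
    unfolding w_def using LnC[OF dw] w0 by (simp add: w_def)
  have d2: "((\<lambda>z. Ln (- \<i> * mp_v \<gamma> z)) has_field_derivative ((1 + g * w' / w\<^sup>2) / v)) (at ?z)"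
    unfolding v_def by (rule LnC[OF dv]) (use vp in \<open>auto simp: v_def\<close>)
  have d3: "((\<lambda>z. z / mp_w \<gamma> z) has_field_derivative (1 * w - ?z * w') / (w * w)) (at ?z)"
    unfolding w_def by (intro DERIV_divide DERIV_ident dw mp_w_nonzero t)
  have d4: "((\<lambda>z. Ln (- \<i> * z)) has_field_derivative (1 / ?z)) (at ?z)"
    using LnC[OF DERIV_ident] z0 t by simp
  have d: "(mp_potential \<gamma> has_field_derivative
     (- (w' / w + ((1 + g * w' / w\<^sup>2) / v) / g + (1 * w - ?z * w') / (w * w) - c * (1 / ?z)) / 2)) (at ?z)"
    unfolding mp_potential_def[abs_def] c_def[symmetric] g_def[symmetric]
    by (intro DERIV_cdivide DERIV_minus DERIV_add DERIV_diff DERIV_cmult d1 d2 d3 d4)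
  have vi: "1 / v = ?z - w" using mp_w_bounds(5)[OF t] vp unfolding w_def[symmetric] v_def[symmetric]
    by (metis divide_eq_eq less_irrefl zero_complex.sel(2))
  have q: "g / w = ?z - c * g / ?z - w"
    using mp_w_quotient[OF t] \<gamma> by (simp add: w_def g_def c_def mp_cb_def)
  have "w' / w + ((1 + g * w' / w\<^sup>2) / v) / g + (1 * w - ?z * w') / (w * w) - c * (1 / ?z)
     = w' / w + (1 + g * w' / w\<^sup>2) * (1 / v) / g + (1 * w - ?z * w') / (w * w) - c * (1 / ?z)" by simp
  \<comment> \<open>All terms with \<open>w'\<close> cancel: the potential is stationary in
    \<open>w\<close>, so only its explicit dependence on z contributes.\<close>
  also have "\<dots> = (?z - w) / g + 1 / w - c / ?z"
    unfolding vi using w0(1) g0 by (simp add: field_simps power2_eq_square)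
  also have "\<dots> = (?z - c * g / ?z - w) / g + 1 / w" using g0 by (simp add: diff_divide_distrib)
  also have "\<dots> = 2 / w" unfolding q[symmetric] using g0 by simp
  finally show ?thesis using d by (simp add: w_def)
qed

text \<open>The counterpart for the limit law of the arctangent sum \<open>f\<close> in
  \<open>mean_cdf_close\<close>: both vanish at infinity, and both have minus the real part of a
  Stieltjes transform as derivative.\<close>

definition mp_phase :: "real \<Rightarrow> real" where "mp_phase t = - Im (mp_potential \<gamma> (Complex a t))"

lemma mp_phase_eq: "mp_phase t = (Im (Ln (- \<i> * mp_w \<gamma> (Complex a t))) + Im (Ln (- \<i> * mp_v \<gamma> (Complex a t))) / \<gamma>
     + Im (Complex a t / mp_w \<gamma> (Complex a t)) - (1 - \<gamma>) / \<gamma> * Im (Ln (- \<i> * Complex a t))) / 2"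
proof -
  have 1: "Im (- x / 2) = - (Im x / 2)" for x by simp
  have 2: "Im (x / of_real \<gamma>) = Im x / \<gamma>" for x by (rule Im_divide_of_real)
  have 3: "Im (of_real r * x) = r * Im x" for r x by simp
  show ?thesis unfolding mp_phase_def mp_potential_def 1 minus_minus minus_complex.sel plus_complex.sel 2 3 ..
qed

lemma mp_phase_deriv:
  assumes t: "0 \<le> t"
  shows "(mp_phase has_real_derivative Re (1 / mp_w \<gamma> (Complex a t))) (at t)"
proof -
  have line: "(Complex a has_vector_derivative \<i>) (at t)"
  proof -
    have "((\<lambda>t. of_real a + \<i> * of_real t) has_vector_derivative \<i>) (at t)"
      by (auto intro!: derivative_eq_intros)
    moreover have "Complex a = (\<lambda>t. of_real a + \<i> * of_real t)" by (auto simp: Complex_eq)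
    ultimately show ?thesis by simp
  qed
  have "((mp_potential \<gamma> \<circ> Complex a) has_vector_derivative (\<i> * (- 1 / mp_w \<gamma> (Complex a t)))) (at t)"
    by (rule field_vector_diff_chain_at[OF line mp_potential_deriv[OF t]])
  then have "((\<lambda>t. - Im (mp_potential \<gamma> (Complex a t))) has_vector_derivative - Im (\<i> * (- 1 / mp_w \<gamma> (Complex a t)))) (at t)"
    by (intro has_vector_derivative_minus bounded_linear.has_vector_derivative[OF bounded_linear_Im]) (simp add: o_def)
  moreover have "- Im (\<i> * (- 1 / mp_w \<gamma> (Complex a t))) = Re (1 / mp_w \<gamma> (Complex a t))"
    by (simp add: Im_divide Re_divide)
  ultimately show ?thesis unfolding mp_phase_def[abs_def] has_real_derivative_iff_has_vector_derivative by (simp only:)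
qed

text \<open>On the real axis \<open>mp_w\<close> and \<open>mp_v\<close> have moduli
  \<open>sqrt \<gamma>\<close> and 1, so their arguments are given by the two arccosines in
  \<open>mp_sv_cdf\<close>.\<close>

lemma mp_phase_0: "mp_phase 0 = - pi / 2 * mp_sv_cdf \<gamma> a"
proof -
  define R where "R = sqrt (4 * \<gamma> - (mp_b \<gamma> a)\<^sup>2)"
  have R: "R > 0" "R\<^sup>2 = 4 * \<gamma> - (mp_b \<gamma> a)\<^sup>2" using mp_b_strict by (auto simp: R_def)
  let ?z = "Complex a 0"
  have z: "?z = of_real a" by (simp add: complex_eq_iff)
  have an: "a \<noteq> 0" using a_pos by simp
  have "of_real (4 * \<gamma>) - (of_real (mp_b \<gamma> a))\<^sup>2 = complex_of_real (R\<^sup>2)" unfolding R(2) by simp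
  then have "csqrt (of_real (4 * \<gamma>) - (of_real (mp_b \<gamma> a))\<^sup>2) = csqrt (of_real (R\<^sup>2))" by (simp only:)
  also have "\<dots> = of_real R" using R(1) by (simp add: csqrt_of_real_nonneg)
  finally have w: "mp_w \<gamma> ?z = (of_real (mp_b \<gamma> a) + \<i> * of_real R) / 2"
    unfolding mp_w_def mp_cb_line_0 by simp
  have v: "mp_v \<gamma> ?z = (of_real (mp_b \<gamma> a) + \<i> * of_real R) / 2 + of_real ((1 - \<gamma>) / a)"
    using mp_w_bounds(6)[of 0] unfolding w by (simp add: z)
  have Rew: "Re (mp_w \<gamma> ?z) = mp_b \<gamma> a / 2" "Im (mp_w \<gamma> ?z) = R / 2" unfolding w by simp_all
  have Rev: "Re (mp_v \<gamma> ?z) = (a + (1 - \<gamma>) / a) / 2" "Im (mp_v \<gamma> ?z) = R / 2" unfolding v by (simp_all add: mp_b_def field_simps)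
  have cw2: "(cmod (mp_w \<gamma> ?z))\<^sup>2 = \<gamma>" unfolding cmod_power2 Rew power_divide R(2) by (simp add: diff_divide_distrib)
  then have cw: "cmod (mp_w \<gamma> ?z) = sqrt \<gamma>" by (metis norm_ge_zero real_sqrt_abs abs_of_nonneg)
  have "(cmod (mp_v \<gamma> ?z))\<^sup>2 = 1" unfolding cmod_power2 Rev mp_b_half_sum[OF an] power_divide[of R] R(2) by (simp add: diff_divide_distrib)
  then have cv: "cmod (mp_v \<gamma> ?z) = 1" by (metis norm_ge_zero real_sqrt_abs abs_of_nonneg real_sqrt_one)
  have L1: "Im (Ln (- \<i> * mp_w \<gamma> ?z)) = arccos (mp_b \<gamma> a / (2 * sqrt \<gamma>)) - pi / 2"
    by (subst Im_Ln_rotated_arccos) (use R in \<open>simp_all add: Rew cw\<close>)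
  have L2: "Im (Ln (- \<i> * mp_v \<gamma> ?z)) = arccos ((a + (1 - \<gamma>) / a) / 2) - pi / 2"
    by (subst Im_Ln_rotated_arccos) (use R in \<open>simp_all add: Rev cv\<close>)
  have L4: "Im (Ln (- \<i> * ?z)) = - pi / 2"
  proof -
    have "Ln (of_real a * (- \<i>)) = of_real (ln a) + Ln (- \<i>)" using Ln_times_of_real[OF a_pos, of "- \<i>"] a_pos by (simp add: Ln_of_real)
    moreover have "- \<i> * ?z = of_real a * (- \<i>)" unfolding z by simp
    ultimately have "Ln (- \<i> * ?z) = of_real (ln a) + Ln (- \<i>)" by (simp only:)
    then show ?thesis by simp
  qed
  have L3: "Im (?z / mp_w \<gamma> ?z) = - a * R / (2 * \<gamma>)"
  proof -
    have "Im (?z / mp_w \<gamma> ?z) = - (a * Im (mp_w \<gamma> ?z)) / ((Re (mp_w \<gamma> ?z))\<^sup>2 + (Im (mp_w \<gamma> ?z))\<^sup>2)"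
      by (simp add: Im_divide)
    then show ?thesis using cw2 unfolding cmod_power2 by (simp add: Rew)
  qed
  have ac: "arccos (- mp_b \<gamma> a / (2 * sqrt \<gamma>)) = pi - arccos (mp_b \<gamma> a / (2 * sqrt \<gamma>))"
  proof -
    have "\<bar>mp_b \<gamma> a / (2 * sqrt \<gamma>)\<bar> \<le> 1" using mp_arccos_range(1)[OF \<gamma>, of a] bulk by simp
    then have "arccos (- (mp_b \<gamma> a / (2 * sqrt \<gamma>))) = pi - arccos (mp_b \<gamma> a / (2 * sqrt \<gamma>))"
      by (intro arccos_minus) (simp_all only: abs_le_iff minus_le_iff)
    then show ?thesis by simp
  qed
  have "mp_phase 0 = (Im (Ln (- \<i> * mp_w \<gamma> ?z)) + Im (Ln (- \<i> * mp_v \<gamma> ?z)) / \<gamma> + Im (?z / mp_w \<gamma> ?z)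
     - (1 - \<gamma>) / \<gamma> * Im (Ln (- \<i> * ?z))) / 2"
    by (rule mp_phase_eq)
  also have "\<dots> = - pi / 2 * mp_sv_cdf \<gamma> a"
    unfolding L1 L2 L3 L4 mp_sv_cdf_def ac R_def[symmetric] using \<gamma> by (simp add: field_simps)
  finally show ?thesis .
qed

text \<open>Real parts stay bounded while imaginary parts are at least \<open>t\<close>, so all
  angles tend to 0. The remaining quotient is z / w = 1 + 1 / (v w), whose limit is real.\<close>

lemma mp_phase_at_top: "(mp_phase \<longlongrightarrow> 0) at_top"
proof -
  let ?w = "\<lambda>t. mp_w \<gamma> (Complex a t)" and ?v = "\<lambda>t. mp_v \<gamma> (Complex a t)"
  have c: "0 \<le> 1 - \<gamma>" using \<gamma> by simp
  have inv0: "((\<lambda>t. K / t) \<longlongrightarrow> 0) at_top" for K :: real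
    by (rule tendsto_divide_0[OF tendsto_const filterlim_at_top_imp_at_infinity[OF filterlim_ident]])
  have gw: "cmod (of_real \<gamma> / ?w t) \<le> 1" if "1 \<le> t" for t
  proof -
    have "1 \<le> cmod (?w t)" using mp_w_bounds(1)[of t] that abs_Im_le_cmod[of "?w t"] by linarith
    then show ?thesis using \<gamma> by (simp add: norm_divide divide_le_eq)
  qed
  have rv: "\<bar>Re (?v t)\<bar> \<le> a + 1" if "1 \<le> t" for t
    using gw[OF that] abs_Re_le_cmod[of "of_real \<gamma> / ?w t"] a_pos by (simp add: mp_v_def)
  have rb: "\<bar>Re (mp_cb \<gamma> (Complex a t))\<bar> \<le> a + 1 / a" for t
  proof -
    have "(1 - \<gamma>) * a / (a\<^sup>2 + t\<^sup>2) \<le> 1 * a / a\<^sup>2"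
      using \<gamma> a_pos by (intro frac_le mult_right_mono) auto
    moreover have "0 \<le> (1 - \<gamma>) * a / (a\<^sup>2 + t\<^sup>2)" using c a_pos by simp
    ultimately show ?thesis using a_pos unfolding mp_cb_line by (simp add: power2_eq_square abs_le_iff)
  qed
  have rw: "\<bar>Re (?w t)\<bar> \<le> a + 1 / a + 1" if "1 \<le> t" for t
  proof -
    have "?w t = mp_cb \<gamma> (Complex a t) - of_real \<gamma> / ?w t" using mp_w_quotient[of t] that by simp
    then have "Re (?w t) = Re (mp_cb \<gamma> (Complex a t)) - Re (of_real \<gamma> / ?w t)" by (metis minus_complex.sel(1))
    then show ?thesis using rb[of t] gw[OF that] abs_Re_le_cmod[of "of_real \<gamma> / ?w t"] by linarith
  qed
  have ratio: "((\<lambda>t. Im (Ln (- \<i> * u t))) \<longlongrightarrow> 0) at_top"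
    if u: "\<And>t. 1 \<le> t \<Longrightarrow> t \<le> Im (u t)" "\<And>t. 1 \<le> t \<Longrightarrow> \<bar>Re (u t)\<bar> \<le> K" for u and K :: real
  proof -
    have "((\<lambda>t. Re (u t) / Im (u t)) \<longlongrightarrow> 0) at_top"
    proof (rule Lim_null_comparison[OF _ inv0[of K]])
      show "\<forall>\<^sub>F t in at_top. norm (Re (u t) / Im (u t)) \<le> K / t"
        using eventually_ge_at_top[of 1]
      proof eventually_elim
        case (elim t)
        then show ?case using u[OF elim] by (auto simp: intro!: frac_le)
      qed
    qed
    then have "((\<lambda>t. - arctan (Re (u t) / Im (u t))) \<longlongrightarrow> - arctan 0) at_top" by (intro tendsto_intros)
    then have l: "((\<lambda>t. - arctan (Re (u t) / Im (u t))) \<longlongrightarrow> 0) at_top" by simp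
    show ?thesis
    proof (rule Lim_transform_eventually[OF l])
      show "\<forall>\<^sub>F t in at_top. - arctan (Re (u t) / Im (u t)) = Im (Ln (- \<i> * u t))"
        using eventually_ge_at_top[of 1]
      proof eventually_elim
        case (elim t)
        then have "Im (u t) > 0" using u(1)[OF elim] by linarith
        then show ?case using Im_Ln_rotated by simp
      qed
    qed
  qed
  have l1: "((\<lambda>t. Im (Ln (- \<i> * ?w t))) \<longlongrightarrow> 0) at_top"
    by (rule ratio[OF _ rw]) (use mp_w_bounds(1) in auto)
  have l2: "((\<lambda>t. Im (Ln (- \<i> * ?v t))) \<longlongrightarrow> 0) at_top"
    by (rule ratio[OF _ rv]) (use mp_w_bounds(4) in auto)
  have l4: "((\<lambda>t. Im (Ln (- \<i> * Complex a t))) \<longlongrightarrow> 0) at_top"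
    by (rule ratio[of _ "\<bar>a\<bar>"]) auto
  have l3: "((\<lambda>t. Im (Complex a t / ?w t)) \<longlongrightarrow> 0) at_top"
  proof (rule Lim_null_comparison[OF _ inv0[of 1]])
    show "\<forall>\<^sub>F t in at_top. norm (Im (Complex a t / ?w t)) \<le> 1 / t"
      using eventually_ge_at_top[of 1]
    proof eventually_elim
      case (elim t)
      then have t: "0 \<le> t" by simp
      have w1: "t \<le> cmod (?w t)" using mp_w_bounds(1)[OF t] abs_Im_le_cmod[of "?w t"] by linarith
      have v1: "t \<le> cmod (?v t)" using mp_w_bounds(4)[OF t] abs_Im_le_cmod[of "?v t"] by linarith
      have "Complex a t - ?w t = 1 / ?v t" using mp_w_bounds(5)[OF t] v1 elim
        by (metis eq_divide_eq norm_zero not_one_le_zero order_trans)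
      then have "Complex a t / ?w t = 1 + 1 / ?v t / ?w t" using mp_w_nonzero[OF t]
        by (simp add: field_simps)
      then have "\<bar>Im (Complex a t / ?w t)\<bar> = \<bar>Im (1 / ?v t / ?w t)\<bar>" by simp
      also have "\<dots> \<le> cmod (1 / ?v t / ?w t)" by (rule abs_Im_le_cmod)
      also have "\<dots> = 1 / (cmod (?v t) * cmod (?w t))" by (simp add: norm_divide norm_mult)
      also have "\<dots> \<le> 1 / (1 * t)" using v1 w1 elim by (intro divide_left_mono mult_mono mult_pos_pos) auto
      finally show ?case by simp
    qed
  qed
  have "((\<lambda>t. (Im (Ln (- \<i> * ?w t)) + Im (Ln (- \<i> * ?v t)) / \<gamma> + Im (Complex a t / ?w t)
     - (1 - \<gamma>) / \<gamma> * Im (Ln (- \<i> * Complex a t))) / 2) \<longlongrightarrow> (0 + 0 / \<gamma> + 0 - (1 - \<gamma>) / \<gamma> * 0) / 2) at_top"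
    using \<gamma> by (intro tendsto_intros l1 l2 l3 l4) auto
  moreover have "mp_phase = (\<lambda>t. (Im (Ln (- \<i> * ?w t)) + Im (Ln (- \<i> * ?v t)) / \<gamma> + Im (Complex a t / ?w t)
     - (1 - \<gamma>) / \<gamma> * Im (Ln (- \<i> * Complex a t))) / 2)"
    by (rule ext) (rule mp_phase_eq)
  ultimately show ?thesis by simp
qed

text \<open>The quadratic factors as \<gamma> (m + 1 / w) (m + w / \<gamma>). The second root - w /
  \<gamma> lies in the lower half plane, at distance at least Im w / \<gamma> from any
  \<open>m\<close> with nonnegative imaginary part, so the right root is selected at each height
  separately.\<close>

lemma mp_stability:
  assumes t: "0 < t" and m: "0 \<le> Im m"
  shows "cmod (m + 1 / mp_w \<gamma> (Complex a t)) \<le>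
    cmod (of_real \<gamma> * m\<^sup>2 + mp_cb \<gamma> (Complex a t) * m + 1) / Im (mp_w \<gamma> (Complex a t))"
proof -
  define w where "w = mp_w \<gamma> (Complex a t)"
  define b where "b = mp_cb \<gamma> (Complex a t)"
  have t0: "0 \<le> t" using t by simp
  have w: "Im w > 0" "w \<noteq> 0" using mp_w_line(2)[OF t0] by (auto simp: w_def)
  have g0: "complex_of_real \<gamma> \<noteq> 0" using \<gamma> by simp
  have q: "of_real \<gamma> / w = b - w" using mp_w_quotient[OF t0] by (simp add: w_def b_def)
  have "of_real \<gamma> * (m + 1 / w) * (m + w / of_real \<gamma>) = of_real \<gamma> * m\<^sup>2 + (w + of_real \<gamma> / w) * m + 1"
    using g0 w by (simp add: field_simps power2_eq_square)
  also have "\<dots> = of_real \<gamma> * m\<^sup>2 + b * m + 1" unfolding q by simp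
  finally have eq: "\<gamma> * cmod (m + 1 / w) * cmod (m + w / of_real \<gamma>) = cmod (of_real \<gamma> * m\<^sup>2 + b * m + 1)"
    using \<gamma> by (metis abs_of_pos norm_mult norm_of_real)
  have "Im w / \<gamma> \<le> Im (m + w / of_real \<gamma>)" using m by simp
  also have "\<dots> \<le> cmod (m + w / of_real \<gamma>)" using abs_Im_le_cmod[of "m + w / of_real \<gamma>"] by linarith
  finally have le: "Im w \<le> \<gamma> * cmod (m + w / of_real \<gamma>)" using \<gamma> by (simp add: divide_le_eq mult.commute)
  have "cmod (m + 1 / w) * Im w \<le> cmod (m + 1 / w) * (\<gamma> * cmod (m + w / of_real \<gamma>))"
    using le by (intro mult_left_mono) auto
  also have "\<dots> = cmod (of_real \<gamma> * m\<^sup>2 + b * m + 1)" unfolding eq[symmetric] by (simp add: mult_ac)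
  finally show ?thesis unfolding w_def[symmetric] b_def[symmetric] using w by (simp add: pos_le_divide_eq)
qed

text \<open>\<open>h\<close> has minus the error bound as derivative and vanishes at infinity, so
  \<open>h - D\<close> and \<open>h + D\<close> are nonincreasing with limit 0. The last term is the
  change of the phase between heights 0 and \<open>\<eta>\<close>, whose speed is at most
  \<open>1 / sqrt \<gamma>\<close>.\<close>

lemma mp_phase_comparison:
  fixes f :: "real \<Rightarrow> real" and m :: "real \<Rightarrow> complex"
  assumes \<eta>: "0 < \<eta>" and f: "\<And>t. \<eta> \<le> t \<Longrightarrow> (f has_real_derivative - Re (m t)) (at t)"
    and f0: "(f \<longlongrightarrow> 0) at_top"
    and m: "\<And>t. \<eta> \<le> t \<Longrightarrow> cmod (m t + 1 / mp_w \<gamma> (Complex a t)) \<le> e2 / t\<^sup>2 + e4 / t ^ 4"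
  shows "\<bar>f \<eta> + pi / 2 * mp_sv_cdf \<gamma> a\<bar> \<le> e2 / \<eta> + e4 / (3 * \<eta> ^ 3) + \<eta> / sqrt \<gamma>"
proof -
  define h where "h t = e2 / t + e4 / (3 * t ^ 3)" for t :: real
  have inv0: "((\<lambda>t. K / t) \<longlongrightarrow> 0) at_top" for K :: real
    by (rule tendsto_divide_0[OF tendsto_const filterlim_at_top_imp_at_infinity[OF filterlim_ident]])
  have h0: "(h \<longlongrightarrow> 0) at_top"
  proof -
    have "((\<lambda>t::real. e2 / t + (e4 / 3) * ((1 / t) * (1 / t) * (1 / t))) \<longlongrightarrow> 0 + (e4 / 3) * (0 * 0 * 0)) at_top"
      by (intro tendsto_intros inv0)
    then show ?thesis by (simp add: h_def[abs_def] power3_eq_cube)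
  qed
  have dh: "(h has_real_derivative - (e2 / t\<^sup>2 + e4 / t ^ 4)) (at t)" if "\<eta> \<le> t" for t
    unfolding h_def using that \<eta>
    by (auto intro!: derivative_eq_intros simp: field_simps power2_eq_square power3_eq_cube power4_eq_xxxx)
  define D where "D t = f t - mp_phase t" for t
  have dD: "(D has_real_derivative - Re (m t + 1 / mp_w \<gamma> (Complex a t))) (at t)" if "\<eta> \<le> t" for t
    unfolding D_def using DERIV_diff[OF f[OF that] mp_phase_deriv[of t]] that \<eta> by simp
  have D0: "(D \<longlongrightarrow> 0) at_top" unfolding D_def using tendsto_diff[OF f0 mp_phase_at_top] by simp
  have re: "\<bar>Re (m t + 1 / mp_w \<gamma> (Complex a t))\<bar> \<le> e2 / t\<^sup>2 + e4 / t ^ 4" if "\<eta> \<le> t" for t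
    using abs_Re_le_cmod m[OF that] by (rule order_trans)
  have up: "D \<eta> \<le> h \<eta>"
  proof -
    have mon: "h \<eta> - D \<eta> \<ge> h t - D t" if "\<eta> \<le> t" for t
    proof (rule DERIV_nonpos_imp_nonincreasing[OF that])
      fix x assume x: "\<eta> \<le> x" "x \<le> t"
      show "\<exists>y. ((\<lambda>x. h x - D x) has_real_derivative y) (at x) \<and> y \<le> 0"
        by (rule exI, rule conjI, rule DERIV_diff[OF dh[OF x(1)] dD[OF x(1)]]) (use re[OF x(1)] in linarith)
    qed
    have "\<forall>\<^sub>F t in at_top. h t - D t \<le> h \<eta> - D \<eta>" by (rule eventually_mono[OF eventually_ge_at_top[of \<eta>] mon])
    then have "0 - 0 \<le> h \<eta> - D \<eta>" by (intro tendsto_upperbound[OF tendsto_diff[OF h0 D0]]) auto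
    then show ?thesis by simp
  qed
  have lo: "- D \<eta> \<le> h \<eta>"
  proof -
    have mon: "h \<eta> + D \<eta> \<ge> h t + D t" if "\<eta> \<le> t" for t
    proof (rule DERIV_nonpos_imp_nonincreasing[OF that])
      fix x assume x: "\<eta> \<le> x" "x \<le> t"
      show "\<exists>y. ((\<lambda>x. h x + D x) has_real_derivative y) (at x) \<and> y \<le> 0"
        by (rule exI, rule conjI, rule DERIV_add[OF dh[OF x(1)] dD[OF x(1)]]) (use re[OF x(1)] in linarith)
    qed
    have "\<forall>\<^sub>F t in at_top. h t + D t \<le> h \<eta> + D \<eta>" by (rule eventually_mono[OF eventually_ge_at_top[of \<eta>] mon])
    then have "0 + 0 \<le> h \<eta> + D \<eta>" by (intro tendsto_upperbound[OF tendsto_add[OF h0 D0]]) auto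
    then show ?thesis by simp
  qed
  have ph: "\<bar>mp_phase \<eta> - mp_phase 0\<bar> \<le> \<eta> / sqrt \<gamma>"
  proof -
    obtain x where x: "0 < x" "x < \<eta>" "mp_phase \<eta> - mp_phase 0 = (\<eta> - 0) * Re (1 / mp_w \<gamma> (Complex a x))"
      using MVT2[OF \<eta>, of mp_phase "\<lambda>t. Re (1 / mp_w \<gamma> (Complex a t))"] mp_phase_deriv by auto
    have "\<bar>Re (1 / mp_w \<gamma> (Complex a x))\<bar> \<le> cmod (1 / mp_w \<gamma> (Complex a x))" by (rule abs_Re_le_cmod)
    also have "\<dots> \<le> 1 / sqrt \<gamma>" using mp_w_bounds(2)[of x] x \<gamma> by (simp add: norm_divide frac_le)
    finally show ?thesis unfolding x(3) abs_mult using \<eta> mult_left_mono[of _ "1 / sqrt \<gamma>" \<eta>] by simp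
  qed
  have "f \<eta> + pi / 2 * mp_sv_cdf \<gamma> a = D \<eta> + (mp_phase \<eta> - mp_phase 0)" unfolding D_def mp_phase_0 by simp
  then show ?thesis using up lo ph unfolding h_def by linarith
qed

text \<open>For large t the bound t \<le> Im w suffices. For t^2 \<le> \<tau>^5 / 10 the real part
  of \<open>mp_cb\<close> moves by \<open>\<delta> \<le> \<tau>\<^sup>2 / 10\<close>, as
  \<open>\<tau> \<le> a\<close>; its square then grows by at most \<open>5 * \<delta>\<close>, which
  leaves half of the lower bound \<open>\<tau>\<^sup>2\<close> of
  \<open>mp_discriminant_lower\<close>.\<close>

lemma mp_w_Im_lower:
  assumes \<tau>: "0 < \<tau>" "\<tau> \<le> 1" "1 - sqrt \<gamma> + \<tau> \<le> a" "a \<le> 1 + sqrt \<gamma> - \<tau>" and t: "0 \<le> t"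
  shows "min (\<tau> / 4) (sqrt (\<tau> ^ 5 / 10)) \<le> Im (mp_w \<gamma> (Complex a t))"
proof (cases "t\<^sup>2 \<le> \<tau> ^ 5 / 10")
  case False
  then have "sqrt (\<tau> ^ 5 / 10) \<le> t" using t by (simp add: real_le_lsqrt)
  then show ?thesis using mp_w_bounds(1)[OF t] by linarith
next
  case True
  define b where "b = mp_cb \<gamma> (Complex a t)"
  define r where "r = csqrt (of_real (4 * \<gamma>) - b\<^sup>2)"
  define \<delta> where "\<delta> = (1 - \<gamma>) * t\<^sup>2 / (a * (a\<^sup>2 + t\<^sup>2))"
  have c: "0 \<le> 1 - \<gamma>" using \<gamma> by simp
  have a\<tau>: "\<tau> \<le> a" using \<tau> \<gamma> by (smt (verit) real_sqrt_le_1_iff)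
  have pos: "0 < a\<^sup>2 + t\<^sup>2" using a_pos by (simp add: add_pos_nonneg)
  have Reb: "Re b = mp_b \<gamma> a + \<delta>"
  proof -
    have "(1 - \<gamma>) * a / (a\<^sup>2 + t\<^sup>2) = (1 - \<gamma>) / a - \<delta>"
    proof -
      define q where "q = a\<^sup>2 + t\<^sup>2"
      have q: "0 < q" "q - t\<^sup>2 = a\<^sup>2" using pos by (auto simp: q_def)
      have "1 / a - t\<^sup>2 / (a * q) = (q - t\<^sup>2) / (a * q)" using q(1) by (simp add: diff_divide_distrib)
      also have "\<dots> = a / q" unfolding q(2) using a_pos by (simp add: power2_eq_square)
      finally have "(1 - \<gamma>) * (a / q) = (1 - \<gamma>) * (1 / a - t\<^sup>2 / (a * q))" by simp
      then show ?thesis unfolding \<delta>_def q_def[symmetric] by (simp add: right_diff_distrib)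
    qed
    then show ?thesis unfolding b_def mp_cb_line mp_b_def by simp
  qed
  have \<delta>: "0 \<le> \<delta>" "\<delta> \<le> \<tau>\<^sup>2 / 10"
  proof -
    show "0 \<le> \<delta>" unfolding \<delta>_def using c a_pos by simp
    have "\<delta> \<le> 1 * t\<^sup>2 / (\<tau> * (\<tau>\<^sup>2 + 0))"
      unfolding \<delta>_def using c \<gamma> a\<tau> \<tau>(1) t by (intro frac_le mult_mono add_mono power_mono mult_pos_pos) auto
    also have "1 * t\<^sup>2 / (\<tau> * (\<tau>\<^sup>2 + 0)) = t\<^sup>2 / (\<tau> * \<tau>\<^sup>2)" by simp
    also have "\<dots> \<le> (\<tau> ^ 5 / 10) / (\<tau> * \<tau>\<^sup>2)" by (rule divide_right_mono[OF True]) (use \<tau>(1) in auto)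
    also have "\<dots> = \<tau>\<^sup>2 / 10" using \<tau>(1) by (simp add: power2_eq_square power_numeral_reduce)
    finally show "\<delta> \<le> \<tau>\<^sup>2 / 10" .
  qed
  have b2: "\<bar>mp_b \<gamma> a\<bar> \<le> 2"
  proof -
    have "(mp_b \<gamma> a)\<^sup>2 \<le> 2\<^sup>2" using mp_b_strict \<gamma> by simp
    then show ?thesis using abs_le_square_iff[of "mp_b \<gamma> a" 2] by simp
  qed
  have "\<tau>\<^sup>2 \<le> 1" using \<tau> by (simp add: power_le_one)
  then have \<delta>1: "\<delta> \<le> 1" using \<delta> by simp
  have "(Re b)\<^sup>2 = (mp_b \<gamma> a)\<^sup>2 + 2 * mp_b \<gamma> a * \<delta> + \<delta> * \<delta>" unfolding Reb by (simp add: power2_eq_square algebra_simps)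
  also have "\<dots> \<le> (mp_b \<gamma> a)\<^sup>2 + 4 * \<delta> + 1 * \<delta>"
    using b2 \<delta> \<delta>1 by (intro add_mono mult_right_mono) auto
  also have "\<dots> \<le> (mp_b \<gamma> a)\<^sup>2 + \<tau>\<^sup>2 / 2" using \<delta> by simp
  also have "\<dots> \<le> 4 * \<gamma> - \<tau>\<^sup>2 / 2" using mp_discriminant_lower[OF \<gamma> _ \<tau>(3,4) a_pos] \<tau>(1) by simp
  finally have Rb: "\<tau>\<^sup>2 / 2 \<le> 4 * \<gamma> - (Re b)\<^sup>2" by simp
  have "r\<^sup>2 = of_real (4 * \<gamma>) - b\<^sup>2" by (simp add: r_def)
  then have "Re (r\<^sup>2) = 4 * \<gamma> - ((Re b)\<^sup>2 - (Im b)\<^sup>2)" by (simp add: power2_eq_square)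
  moreover have "Re (r\<^sup>2) = (Re r)\<^sup>2 - (Im r)\<^sup>2" by (simp add: power2_eq_square)
  ultimately have "\<tau>\<^sup>2 / 2 \<le> (Re r)\<^sup>2" using Rb by (smt (verit) zero_le_power2)
  moreover have "(\<tau> / 2)\<^sup>2 \<le> \<tau>\<^sup>2 / 2" by (simp add: power_divide)
  ultimately have "(\<tau> / 2)\<^sup>2 \<le> (Re r)\<^sup>2" by linarith
  moreover have "0 < Re r" unfolding r_def b_def by (rule csqrt_Re_pos[OF mp_disc_slit[OF t]])
  ultimately have "\<tau> / 2 \<le> Re r" by (simp add: power2_le_iff_abs_le)
  then have "\<tau> / 4 \<le> Im (mp_w \<gamma> (Complex a t))" using mp_w_line(3)[OF t] unfolding r_def b_def by linarith
  then show ?thesis by linarith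
qed

end

section \<open>Distribution functions of the singular values\<close>

lemma arctan_le_self: "0 \<le> x \<Longrightarrow> arctan x \<le> (x::real)"
proof -
  assume x: "0 \<le> x"
  have "(\<lambda>x. x - arctan x) 0 \<le> (\<lambda>x. x - arctan x) x"
  proof (rule DERIV_nonneg_imp_nondecreasing[OF x])
    fix y :: real
    have "((\<lambda>x. x - arctan x) has_real_derivative 1 - inverse (1 + y\<^sup>2)) (at y)"
      by (intro DERIV_diff DERIV_ident DERIV_arctan)
    moreover have "0 \<le> 1 - inverse (1 + y\<^sup>2)" by (simp add: inverse_le_1_iff)
    ultimately show "\<exists>d. ((\<lambda>x. x - arctan x) has_real_derivative d) (at y) \<and> 0 \<le> d" by blast
  qed
  then show ?thesis by simp
qed

lemma arctan_complement_le:
  assumes "0 < y" "0 < \<eta>" shows "pi / 2 - arctan (y / \<eta>) \<le> \<eta> / y"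
proof -
  have "pi / 2 - arctan (y / \<eta>) = arctan (\<eta> / y)" using arctan_inverse[of "y / \<eta>"] assms by simp
  also have "\<dots> \<le> \<eta> / y" using assms by (intro arctan_le_self) auto
  finally show ?thesis .
qed

text \<open>The error made in replacing a sign by an arctangent is dominated by a dyadic sum of
  Poisson kernels.\<close>

lemma arctan_leak_dyadic:
  assumes \<eta>: "0 < \<eta>" and K: "1 \<le> 2 ^ K * \<eta>"
  shows "pi / 2 - arctan (\<bar>y\<bar> / \<eta>) \<le> 4 * \<eta> * (1 + (\<Sum>k\<le>K. (2 ^ k * \<eta>) / (y\<^sup>2 + (2 ^ k * \<eta>)\<^sup>2)))"
proof -
  define P where "P k = (2 ^ k * \<eta>) / (y\<^sup>2 + (2 ^ k * \<eta>)\<^sup>2)" for k :: nat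
  have P0: "0 \<le> P k" for k unfolding P_def using \<eta> by simp
  have one: "P k \<le> (\<Sum>k\<le>K. P k)" if "k \<le> K" for k using that P0 by (intro member_le_sum) auto
  have S0: "0 \<le> (\<Sum>k\<le>K. P k)" using P0 by (intro sum_nonneg) auto
  have pi2: "pi / 2 - arctan (\<bar>y\<bar> / \<eta>) \<le> 2"
  proof -
    have "0 \<le> arctan (\<bar>y\<bar> / \<eta>)" using \<eta> by simp
    then show ?thesis using pi_less_4 by linarith
  qed
  \<comment> \<open>Close to 0 the kernel with \<open>k = 0\<close> is large enough, and beyond 1
    the constant term is. In between, the first dyadic height above \<open>\<bar>y\<bar>\<close> is
    within a factor 2 of it, so its kernel is comparable to
    \<open>1 / \<bar>y\<bar>\<close>.\<close>
  consider "\<bar>y\<bar> \<le> \<eta>" | "1 \<le> \<bar>y\<bar>" | "\<eta> < \<bar>y\<bar>" "\<bar>y\<bar> < 1" by linarith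
  then have "pi / 2 - arctan (\<bar>y\<bar> / \<eta>) \<le> 4 * \<eta> * (1 + (\<Sum>k\<le>K. P k))" (is ?G)
  proof cases
    case 1
    have "y\<^sup>2 \<le> \<eta>\<^sup>2" using 1 by (metis abs_ge_zero power_mono power2_abs)
    then have "\<eta> / (2 * \<eta>\<^sup>2) \<le> P 0" unfolding P_def using \<eta> by (auto intro!: divide_left_mono mult_pos_pos add_nonneg_pos)
    then have "1 / 2 \<le> \<eta> * P 0" using \<eta> by (simp add: power2_eq_square field_simps)
    also have "\<dots> \<le> \<eta> * (\<Sum>k\<le>K. P k)" using one[of 0] \<eta> by (intro mult_left_mono) auto
    finally have "2 \<le> 4 * \<eta> * (1 + (\<Sum>k\<le>K. P k))" using \<eta> by (simp add: algebra_simps)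
    then show ?G using pi2 by linarith
  next
    case 2
    have "pi / 2 - arctan (\<bar>y\<bar> / \<eta>) \<le> \<eta> / \<bar>y\<bar>" using 2 \<eta> by (intro arctan_complement_le) auto
    also have "\<dots> \<le> \<eta> / 1" using 2 \<eta> by (intro divide_left_mono) auto
    also have "\<dots> \<le> 4 * \<eta> * (1 + (\<Sum>k\<le>K. P k))" using \<eta> S0 by (simp add: algebra_simps)
    finally show ?G .
  next
    case 3
    define k where "k = (LEAST k. \<bar>y\<bar> \<le> 2 ^ k * \<eta>)"
    have ex: "\<bar>y\<bar> \<le> 2 ^ K * \<eta>" using 3 K by linarith
    have k: "\<bar>y\<bar> \<le> 2 ^ k * \<eta>" unfolding k_def by (rule LeastI[of _ K]) (rule ex)
    have kK: "k \<le> K" unfolding k_def by (rule Least_le) (rule ex)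
    have "k \<noteq> 0" using k 3 by (intro notI) simp
    then obtain k' where k': "k = Suc k'" by (cases k) auto
    have "\<not> \<bar>y\<bar> \<le> 2 ^ k' * \<eta>" unfolding k_def by (rule not_less_Least) (use k' k_def in simp)
    then have lt: "2 ^ k * \<eta> < 2 * \<bar>y\<bar>" unfolding k' by simp
    define t where "t = 2 ^ k * \<eta>"
    have t: "0 < t" "\<bar>y\<bar> \<le> t" "t < 2 * \<bar>y\<bar>" using k lt \<eta> by (auto simp: t_def)
    have "y\<^sup>2 \<le> t\<^sup>2" using t(2) by (metis abs_ge_zero power_mono power2_abs)
    then have "t / (2 * t\<^sup>2) \<le> P k" unfolding P_def t_def[symmetric] using t by (intro frac_le) (auto simp: add_pos_nonneg)
    moreover have "t / (2 * t\<^sup>2) = 1 / (2 * t)" using t by (simp add: power2_eq_square)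
    moreover have "1 / (4 * \<bar>y\<bar>) \<le> 1 / (2 * t)" using t 3 \<eta> by (intro divide_left_mono) auto
    ultimately have "1 / (4 * \<bar>y\<bar>) \<le> P k" by linarith
    then have "1 / (4 * \<bar>y\<bar>) \<le> (\<Sum>k\<le>K. P k)" using one[OF kK] by linarith
    then have "4 * \<eta> * (1 / (4 * \<bar>y\<bar>)) \<le> 4 * \<eta> * (\<Sum>k\<le>K. P k)" using \<eta> by (intro mult_left_mono) auto
    then have "\<eta> / \<bar>y\<bar> \<le> 4 * \<eta> * (1 + (\<Sum>k\<le>K. P k))" using \<eta> by (simp add: algebra_simps)
    moreover have "pi / 2 - arctan (\<bar>y\<bar> / \<eta>) \<le> \<eta> / \<bar>y\<bar>" using 3 \<eta> by (intro arctan_complement_le) auto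
    ultimately show ?G by linarith
  qed
  then show ?thesis unfolding P_def .
qed

text \<open>For small \<open>\<eta>\<close> the halved difference is near - pi / 2 below
  \<open>a\<close> and near 0 above. Both arctangents are at least as saturated as the one at
  \<open>\<bar>s - a\<bar>\<close>, because \<open>s + a\<close> is no smaller than that.\<close>

lemma arctan_pair_indicator:
  assumes "0 \<le> s" "0 < a" "0 < \<eta>"
  shows "\<bar>(arctan ((s - a) / \<eta>) - arctan ((s + a) / \<eta>)) / 2 + pi / 2 * (if s \<le> a then 1 else 0)\<bar>
    \<le> pi / 2 - arctan (\<bar>s - a\<bar> / \<eta>)"
proof (cases "s \<le> a")
  case True
  have gen: "\<bar>(- A - B) / 2 + P\<bar> \<le> P - A" if "A \<le> B" "B < P" for A B P :: real
    using that by (intro abs_leI) (simp_all add: field_simps)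
  have "(s - a) / \<eta> = - (\<bar>s - a\<bar> / \<eta>)" using True by (simp add: minus_divide_left)
  then have 1: "arctan ((s - a) / \<eta>) = - arctan (\<bar>s - a\<bar> / \<eta>)" by (simp only: arctan_minus)
  have 2: "arctan (\<bar>s - a\<bar> / \<eta>) \<le> arctan ((s + a) / \<eta>)"
    using True assms by (simp add: arctan_le_iff divide_right_mono)
  show ?thesis unfolding 1 using gen[OF 2 arctan_ubound] True by simp
next
  case False
  have gen: "\<bar>(A - B) / 2\<bar> \<le> P - A" if "A \<le> B" "B < P" for A B P :: real
    using that by (intro abs_leI) (simp_all add: field_simps)
  have 1: "\<bar>s - a\<bar> = s - a" using False by simp
  have 2: "arctan ((s - a) / \<eta>) \<le> arctan ((s + a) / \<eta>)" using assms by (simp add: arctan_le_iff divide_right_mono)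
  show ?thesis unfolding 1 using gen[OF 2 arctan_ubound] False by simp
qed

text \<open>Singular values enter in pairs \<open>s\<close> and \<open>- s\<close>: two simple poles
  with weight one half each.\<close>

lemma partial_fraction_pair:
  assumes t: "0 < t"
  shows "Complex a t / ((of_real s)\<^sup>2 - (Complex a t)\<^sup>2) = (1 / Complex (s - a) (- t) - 1 / Complex (s + a) t) / 2"
    and "Re (1 / Complex (s - a) (- t)) = (s - a) / ((s - a)\<^sup>2 + t\<^sup>2)"
    and "Re (1 / Complex (s + a) t) = (s + a) / ((s + a)\<^sup>2 + t\<^sup>2)"
    and "Im (1 / Complex (s - a) (- t)) = t / ((s - a)\<^sup>2 + t\<^sup>2)"
    and "Im (1 / Complex (s + a) t) = - t / ((s + a)\<^sup>2 + t\<^sup>2)"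
proof -
  define x where "x = Complex (s - a) (- t)"
  define y where "y = Complex (s + a) t"
  have xy: "x \<noteq> 0" "y \<noteq> 0" using t by (auto simp: x_def y_def complex_eq_iff)
  have z: "Complex a t = (y - x) / 2" by (simp add: x_def y_def complex_eq_iff)
  have d: "(complex_of_real s)\<^sup>2 - (Complex a t)\<^sup>2 = x * y"
  proof -
    have "(complex_of_real s)\<^sup>2 - (Complex a t)\<^sup>2 = (of_real s - Complex a t) * (of_real s + Complex a t)"
      by (simp add: power2_eq_square algebra_simps)
    moreover have "of_real s - Complex a t = x" "of_real s + Complex a t = y" by (simp_all add: x_def y_def complex_eq_iff)
    ultimately show ?thesis by simp
  qed
  have "(1 / x - 1 / y) / 2 = ((y - x) / 2) / (x * y)" using xy by (simp add: field_simps)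
  then show "Complex a t / ((of_real s)\<^sup>2 - (Complex a t)\<^sup>2) = (1 / Complex (s - a) (- t) - 1 / Complex (s + a) t) / 2"
    unfolding d z[symmetric] x_def[symmetric] y_def[symmetric] by simp
qed (simp_all add: Re_divide Im_divide)

lemma arctan_scaled_deriv:
  assumes "0 < t" shows "((\<lambda>t. arctan (y / t)) has_real_derivative - (y / (y\<^sup>2 + t\<^sup>2))) (at t)"
proof -
  have "((\<lambda>t. arctan (y / t)) has_real_derivative inverse (1 + (y / t)\<^sup>2) * ((0 * t - y * 1) / (t * t))) (at t)"
    using assms by (intro DERIV_chain2[OF DERIV_arctan] DERIV_divide DERIV_const DERIV_ident) auto
  moreover have "inverse (1 + (y / t)\<^sup>2) * ((0 * t - y * 1) / (t * t)) = - (y / (y\<^sup>2 + t\<^sup>2))"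
  proof -
    have "1 + (y / t)\<^sup>2 = (y\<^sup>2 + t\<^sup>2) / t\<^sup>2" using assms by (simp add: power_divide add_divide_distrib)
    then show ?thesis using assms by (simp add: power2_eq_square)
  qed
  ultimately show ?thesis by (simp only:)
qed

section \<open>Sample and mean distribution functions\<close>

context bernoulli_spectrum
begin

definition sv_cdf :: "(nat \<times> nat) set \<Rightarrow> real \<Rightarrow> real" where
  "sv_cdf S x = real (card {k. k < N \<and> s S k \<le> x}) / real N"

definition sv_max :: "real \<Rightarrow> (nat \<times> nat) set \<Rightarrow> real" where
  "sv_max a S = (\<Sum>k<N. max (s S k) a)"

lemma sv_cdf_eq: "sv_cdf S x = (\<Sum>k<N. if s S k \<le> x then 1 else 0) / real N"
  unfolding sv_cdf_def by (simp add: sum.If_cases Collect_conj_eq lessThan_def)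

text \<open>As the level rises from \<open>x\<close> to \<open>x + h\<close>, a term gains
  \<open>h\<close> if its singular value is at most \<open>x\<close>, nothing if it is at least
  \<open>x + h\<close>, and an amount in between otherwise.\<close>

lemma sv_max_increment:
  assumes h: "0 < h"
  shows "sv_cdf S x * (real N * h) \<le> sv_max (x + h) S - sv_max x S"
    and "sv_max (x + h) S - sv_max x S \<le> sv_cdf S (x + h) * (real N * h)"
proof -
  have N: "real N \<noteq> 0" using sizes by simp
  have e: "sv_cdf S y * (real N * h) = (\<Sum>k<N. if s S k \<le> y then h else 0)" for y
  proof -
    have "sv_cdf S y * (real N * h) = (\<Sum>k<N. if s S k \<le> y then 1 else 0) * h"
      unfolding sv_cdf_eq using N by simp
    then show ?thesis by (simp add: sum_distrib_right if_distrib[of "\<lambda>x. x * h"] cong: if_cong)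
  qed
  show "sv_cdf S x * (real N * h) \<le> sv_max (x + h) S - sv_max x S"
    unfolding e sv_max_def sum_subtractf[symmetric] using h by (intro sum_mono) auto
  show "sv_max (x + h) S - sv_max x S \<le> sv_cdf S (x + h) * (real N * h)"
    unfolding e sv_max_def sum_subtractf[symmetric] using h by (intro sum_mono) auto
qed

text \<open>The sandwich of \<open>sv_max_increment\<close> holds for the sample and for the mean.
  Two deviations of \<open>N * h\<^sup>2\<close>, divided by \<open>N * h\<close>, make the error
  \<open>2 * h\<close>; the arguments shift by \<open>h\<close> since nothing is known of the
  regularity of either function.\<close>

lemma sample_cdf_bounds:
  assumes h: "0 < h"
    and dev: "\<bar>sv_max x S - E (sv_max x)\<bar> < real N * h\<^sup>2" "\<bar>sv_max (x + h) S - E (sv_max (x + h))\<bar> < real N * h\<^sup>2"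
  shows "sv_cdf S x \<le> E (\<lambda>S. sv_cdf S (x + h)) + 2 * h" "E (\<lambda>S. sv_cdf S x) - 2 * h \<le> sv_cdf S (x + h)"
proof -
  have Nh: "0 < real N * h" using sizes h by simp
  have up: "E (sv_max (x + h)) - E (sv_max x) \<le> E (\<lambda>S. sv_cdf S (x + h)) * (real N * h)"
  proof -
    have "E (\<lambda>S. sv_max (x + h) S - sv_max x S) \<le> E (\<lambda>S. (real N * h) * sv_cdf S (x + h))"
      using sv_max_increment(2)[OF h] parameter_bounds by (intro cube_exp_mono) (auto simp: mult.commute)
    then show ?thesis unfolding cube_exp_diff cube_exp_cmult by (simp add: mult.commute)
  qed
  have lo: "E (\<lambda>S. sv_cdf S x) * (real N * h) \<le> E (sv_max (x + h)) - E (sv_max x)"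
  proof -
    have "E (\<lambda>S. (real N * h) * sv_cdf S x) \<le> E (\<lambda>S. sv_max (x + h) S - sv_max x S)"
      using sv_max_increment(1)[OF h] parameter_bounds by (intro cube_exp_mono) (auto simp: mult.commute)
    then show ?thesis unfolding cube_exp_diff cube_exp_cmult by (simp add: mult.commute)
  qed
  have sq: "real N * h\<^sup>2 = (real N * h) * h" by (simp add: power2_eq_square)
  have sq2: "2 * h * (real N * h) = 2 * ((real N * h) * h)" by simp
  have "sv_cdf S x * (real N * h) \<le> (E (\<lambda>S. sv_cdf S (x + h)) + 2 * h) * (real N * h)"
    using sv_max_increment(1)[OF h, of S x] up dev unfolding sq distrib_right sq2 by linarith
  then show "sv_cdf S x \<le> E (\<lambda>S. sv_cdf S (x + h)) + 2 * h" by (rule mult_right_le_imp_le[OF _ Nh])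
  have "(E (\<lambda>S. sv_cdf S x) - 2 * h) * (real N * h) \<le> sv_cdf S (x + h) * (real N * h)"
    using sv_max_increment(2)[OF h, of x S] lo dev unfolding sq left_diff_distrib sq2 by linarith
  then show "E (\<lambda>S. sv_cdf S x) - 2 * h \<le> sv_cdf S (x + h)" by (rule mult_right_le_imp_le[OF _ Nh])
qed

lemma sv_max_tail:
  assumes "0 \<le> a"
  shows "E (\<lambda>S. if \<bar>sv_max a S - E (sv_max a)\<bar> \<ge> r then 1 else 0) \<le> 2 * exp (real N - r * sqrt (real dw))"
  using singular_value_max_concentration[OF parameter_bounds(3,4,8) assms geb, of r] unfolding sv_max_def[abs_def]
  by (simp add: q_def)

definition mean_stieltjes :: "complex \<Rightarrow> complex" where
  "mean_stieltjes z = E (\<lambda>S. (\<Sum>k<N. z / ((of_real (s S k))\<^sup>2 - z\<^sup>2)) / of_nat N)"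

lemma mean_stieltjes_equation:
  assumes "0 < Im z"
  shows "cmod (of_real \<gamma> * (mean_stieltjes z)\<^sup>2 + mp_cb \<gamma> z * mean_stieltjes z + 1)
    \<le> (3 * (1 / Im z)\<^sup>2 + 8 * (1 / Im z) ^ 4) / real db + 2 * p * (1 / Im z)\<^sup>2"
proof -
  interpret bernoulli_resolvent M N db dw p q \<gamma> v s z by unfold_locales (rule assms)
  have "mean_stieltjes z = E mw" unfolding mean_stieltjes_def mw_eq ..
  then show ?thesis using selfconsistent_equation unfolding mp_cb_def by simp
qed

lemma cube_exp_Re: "Re (E f) = E (\<lambda>S. Re (f S))" and cube_exp_Im: "Im (E f) = E (\<lambda>S. Im (f S))"
  unfolding cube_exp_def by simp_all

lemma mean_stieltjes_line:
  assumes t: "0 < t"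
  shows "Re (mean_stieltjes (Complex a t)) = E (\<lambda>S. (\<Sum>k<N. ((s S k - a) / ((s S k - a)\<^sup>2 + t\<^sup>2) - (s S k + a) / ((s S k + a)\<^sup>2 + t\<^sup>2)) / 2) / real N)"
    and "Im (mean_stieltjes (Complex a t)) = E (\<lambda>S. (\<Sum>k<N. (t / ((s S k - a)\<^sup>2 + t\<^sup>2) + t / ((s S k + a)\<^sup>2 + t\<^sup>2)) / 2) / real N)"
  unfolding mean_stieltjes_def cube_exp_Re cube_exp_Im
  by (intro cube_exp_cong; simp add: Re_sum Im_sum partial_fraction_pair[OF t] Re_divide_of_nat Im_divide_of_nat
        del: complex_of_real_def)+

text \<open>\<open>f \<eta>\<close> is the arctangent-smoothed mean distribution function.
  \<open>mp_phase_comparison\<close> compares it with the limit. Its distance to the unsmoothed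
  function is a sum of Poisson kernels, which are controlled by the imaginary part of the same
  Stieltjes transform and hence by \<open>W\<close> at all heights above
  \<open>\<eta>\<close>.\<close>

theorem mean_cdf_close:
  assumes \<tau>: "0 < \<tau>" "\<tau> \<le> 1" "1 - sqrt \<gamma> + \<tau> \<le> a" "a \<le> 1 + sqrt \<gamma> - \<tau>"
    and \<eta>: "0 < \<eta>" and K: "1 \<le> 2 ^ K * \<eta>"
  defines "c0 \<equiv> min (\<tau> / 4) (sqrt (\<tau> ^ 5 / 10))"
  defines "e2 \<equiv> (3 / real db + 2 * p) / c0" and "e4 \<equiv> 8 / real db / c0"
  shows "\<bar>E (\<lambda>S. sv_cdf S a) - mp_sv_cdf \<gamma> a\<bar> \<le> e2 / \<eta> + e4 / (3 * \<eta> ^ 3) + \<eta> / sqrt \<gamma>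
     + 4 * \<eta> * (1 + 2 * (real K + 1) * (1 / sqrt \<gamma> + e2 / \<eta>\<^sup>2 + e4 / \<eta> ^ 4))"
proof -
  note \<gamma> = parameter_bounds(1,2)
  have bulk: "1 - sqrt \<gamma> < a" "a < 1 + sqrt \<gamma>" using \<tau> by auto
  have a: "0 < a" by (rule a_pos[OF \<gamma> bulk])
  have c0: "0 < c0" using \<tau> by (simp add: c0_def)
  have e: "0 \<le> e2" "0 \<le> e4" unfolding e2_def e4_def using c0 parameter_bounds by simp_all
  have N: "0 < real N" using sizes by simp
  let ?m = "\<lambda>t. mean_stieltjes (Complex a t)"
  have Im_m: "0 \<le> Im (?m t)" if t: "0 < t" for t
  proof -
    have "E (\<lambda>_. 0) \<le> Im (?m t)" unfolding mean_stieltjes_line(2)[OF t] using parameter_bounds t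
      by (intro cube_exp_mono divide_nonneg_nonneg sum_nonneg add_nonneg_nonneg) auto
    then show ?thesis by (simp add: cube_exp_const)
  qed
  have close: "cmod (?m t + 1 / mp_w \<gamma> (Complex a t)) \<le> e2 / t\<^sup>2 + e4 / t ^ 4" if t: "0 < t" for t
  proof -
    let ?w = "Im (mp_w \<gamma> (Complex a t))"
    have w: "c0 \<le> ?w" unfolding c0_def using mp_w_Im_lower[OF \<gamma> bulk \<tau>] t by simp
    define B where "B = (3 * (1 / t)\<^sup>2 + 8 * (1 / t) ^ 4) / real db + 2 * p * (1 / t)\<^sup>2"
    have B: "0 \<le> B" unfolding B_def using parameter_bounds by simp
    have "cmod (?m t + 1 / mp_w \<gamma> (Complex a t)) \<le>
      cmod (of_real \<gamma> * (?m t)\<^sup>2 + mp_cb \<gamma> (Complex a t) * ?m t + 1) / ?w"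
      by (rule mp_stability[OF \<gamma> bulk t Im_m[OF t]])
    also have "\<dots> \<le> B / ?w"
      unfolding B_def using mean_stieltjes_equation[of "Complex a t"] t w c0 by (intro divide_right_mono) auto
    also have "\<dots> \<le> B / c0" using B w c0 by (intro divide_left_mono) auto
    also have "\<dots> = e2 / t\<^sup>2 + e4 / t ^ 4"
      unfolding B_def e2_def e4_def by (simp add: power_divide add_divide_distrib distrib_right mult.commute)
    finally show ?thesis .
  qed
  define f where "f t = E (\<lambda>S. (\<Sum>k<N. (arctan ((s S k - a) / t) - arctan ((s S k + a) / t)) / 2) / real N)" for t
  have df: "(f has_real_derivative - Re (?m t)) (at t)" if "\<eta> \<le> t" for t
  proof -
    have t: "0 < t" using that \<eta> by simp
    have "(f has_real_derivative E (\<lambda>S. (\<Sum>k<N. (- ((s S k - a) / ((s S k - a)\<^sup>2 + t\<^sup>2)) - (- ((s S k + a) / ((s S k + a)\<^sup>2 + t\<^sup>2)))) / 2) / real N)) (at t)"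
      unfolding f_def[abs_def] cube_exp_def real_scaleR_def
      by (intro DERIV_sum DERIV_cmult DERIV_cdivide DERIV_diff arctan_scaled_deriv t)
    moreover have "E (\<lambda>S. (\<Sum>k<N. (- ((s S k - a) / ((s S k - a)\<^sup>2 + t\<^sup>2)) - (- ((s S k + a) / ((s S k + a)\<^sup>2 + t\<^sup>2)))) / 2) / real N)
      = E (\<lambda>S. (- 1) * ((\<Sum>k<N. ((s S k - a) / ((s S k - a)\<^sup>2 + t\<^sup>2) - (s S k + a) / ((s S k + a)\<^sup>2 + t\<^sup>2)) / 2) / real N))"
    proof (intro cube_exp_cong)
      have "(\<Sum>k<N. (- A k - - B k) / 2) / real N = - 1 * ((\<Sum>k<N. (A k - B k) / 2) / real N)" for A B :: "nat \<Rightarrow> real"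
      proof -
        have "(- x - - y) / 2 = - ((x - y) / 2)" for x y :: real by (simp add: field_simps)
        then show ?thesis by (simp only: sum_negf)
      qed
      then show "(\<Sum>k<N. (- ((s S k - a) / ((s S k - a)\<^sup>2 + t\<^sup>2)) - (- ((s S k + a) / ((s S k + a)\<^sup>2 + t\<^sup>2)))) / 2) / real N
        = - 1 * ((\<Sum>k<N. ((s S k - a) / ((s S k - a)\<^sup>2 + t\<^sup>2) - (s S k + a) / ((s S k + a)\<^sup>2 + t\<^sup>2)) / 2) / real N)" for S .
    qed
    ultimately show ?thesis unfolding mean_stieltjes_line(1)[OF t] by (simp only: cube_exp_cmult) simp
  qed
  have inv0: "((\<lambda>t. K / t) \<longlongrightarrow> 0) at_top" for K :: real
    by (rule tendsto_divide_0[OF tendsto_const filterlim_at_top_imp_at_infinity[OF filterlim_ident]])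
  have at0: "((\<lambda>t. arctan (y / t)) \<longlongrightarrow> 0) at_top" for y
    using tendsto_arctan[OF inv0[of y]] by simp
  have f0: "(f \<longlongrightarrow> 0) at_top"
  proof -
    have "(f \<longlongrightarrow> E (\<lambda>S. (\<Sum>k<N. (0 - 0) / 2) / real N)) at_top"
      unfolding f_def[abs_def] cube_exp_def by (intro tendsto_intros at0) (use N in auto)
    then show ?thesis by (simp add: cube_exp_const)
  qed
  have main: "\<bar>f \<eta> + pi / 2 * mp_sv_cdf \<gamma> a\<bar> \<le> e2 / \<eta> + e4 / (3 * \<eta> ^ 3) + \<eta> / sqrt \<gamma>"
    by (rule mp_phase_comparison[OF \<gamma> bulk \<eta> df f0]) (use close \<eta> in auto)
  define W where "W = 1 / sqrt \<gamma> + e2 / \<eta>\<^sup>2 + e4 / \<eta> ^ 4"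
  \<comment> \<open>Adding the kernel of the mirrored atom \<open>- s\<close> turns the sum into
    twice the imaginary part.\<close>
  have poisson: "E (\<lambda>S. (\<Sum>k<N. t / ((s S k - a)\<^sup>2 + t\<^sup>2)) / real N) \<le> 2 * W" if "\<eta> \<le> t" for t
  proof -
    have t: "0 < t" using that \<eta> by simp
    have "E (\<lambda>S. (\<Sum>k<N. t / ((s S k - a)\<^sup>2 + t\<^sup>2)) / real N)
      \<le> E (\<lambda>S. 2 * ((\<Sum>k<N. (t / ((s S k - a)\<^sup>2 + t\<^sup>2) + t / ((s S k + a)\<^sup>2 + t\<^sup>2)) / 2) / real N))"
    proof (intro cube_exp_mono parameter_bounds)
      fix S
      have "(\<Sum>k<N. t / ((s S k - a)\<^sup>2 + t\<^sup>2)) \<le> (\<Sum>k<N. 2 * ((t / ((s S k - a)\<^sup>2 + t\<^sup>2) + t / ((s S k + a)\<^sup>2 + t\<^sup>2)) / 2))"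
      proof (rule sum_mono)
        fix k
        have gen: "A \<le> 2 * ((A + B) / 2)" if "0 \<le> B" for A B :: real using that by simp
        have "0 \<le> t / ((s S k + a)\<^sup>2 + t\<^sup>2)" using t by simp
        then show "t / ((s S k - a)\<^sup>2 + t\<^sup>2) \<le> 2 * ((t / ((s S k - a)\<^sup>2 + t\<^sup>2) + t / ((s S k + a)\<^sup>2 + t\<^sup>2)) / 2)"
          by (rule gen)
      qed
      then show "(\<Sum>k<N. t / ((s S k - a)\<^sup>2 + t\<^sup>2)) / real N
        \<le> 2 * ((\<Sum>k<N. (t / ((s S k - a)\<^sup>2 + t\<^sup>2) + t / ((s S k + a)\<^sup>2 + t\<^sup>2)) / 2) / real N)"
        unfolding sum_distrib_left[symmetric] using N by (simp add: divide_right_mono)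
    qed
    also have "\<dots> = 2 * Im (?m t)" unfolding cube_exp_cmult mean_stieltjes_line(2)[OF t] ..
    also have "Im (?m t) \<le> cmod (?m t)" using abs_Im_le_cmod[of "?m t"] by linarith
    also have "cmod (?m t) \<le> cmod (?m t + 1 / mp_w \<gamma> (Complex a t)) + cmod (1 / mp_w \<gamma> (Complex a t))"
      by (metis add_diff_cancel_right' norm_triangle_ineq4)
    also have "cmod (1 / mp_w \<gamma> (Complex a t)) \<le> 1 / sqrt \<gamma>"
      using mp_w_bounds(2)[OF \<gamma> bulk, of t] t \<gamma> by (simp add: norm_divide frac_le)
    also have "cmod (?m t + 1 / mp_w \<gamma> (Complex a t)) \<le> e2 / t\<^sup>2 + e4 / t ^ 4" by (rule close[OF t])
    also have "e2 / t\<^sup>2 + e4 / t ^ 4 \<le> e2 / \<eta>\<^sup>2 + e4 / \<eta> ^ 4"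
      using that \<eta> e t by (intro add_mono divide_left_mono power_mono) auto
    finally show ?thesis by (simp add: W_def)
  qed
  have leak: "E (\<lambda>S. (\<Sum>k<N. pi / 2 - arctan (\<bar>s S k - a\<bar> / \<eta>)) / real N) \<le> 4 * \<eta> * (1 + 2 * (real K + 1) * W)"
  proof -
    have "E (\<lambda>S. (\<Sum>k<N. pi / 2 - arctan (\<bar>s S k - a\<bar> / \<eta>)) / real N)
      \<le> E (\<lambda>S. (\<Sum>k<N. 4 * \<eta> * (1 + (\<Sum>l\<le>K. (2 ^ l * \<eta>) / ((s S k - a)\<^sup>2 + (2 ^ l * \<eta>)\<^sup>2)))) / real N)"
      by (intro cube_exp_mono parameter_bounds divide_right_mono sum_mono arctan_leak_dyadic \<eta> K) auto
    also have "\<dots> = E (\<lambda>S. 4 * \<eta> * (1 + (\<Sum>l\<le>K. (\<Sum>k<N. (2 ^ l * \<eta>) / ((s S k - a)\<^sup>2 + (2 ^ l * \<eta>)\<^sup>2)) / real N)))"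
    proof (intro cube_exp_cong)
      fix S
      define g where "g l k = (2 ^ l * \<eta>) / ((s S k - a)\<^sup>2 + (2 ^ l * \<eta>)\<^sup>2)" for l k :: nat
      have "(\<Sum>k<N. 4 * \<eta> * (1 + (\<Sum>l\<le>K. g l k))) = 4 * \<eta> * (real N + (\<Sum>k<N. \<Sum>l\<le>K. g l k))"
        by (simp add: sum_distrib_left[symmetric] sum.distrib)
      also have "(\<Sum>k<N. \<Sum>l\<le>K. g l k) = (\<Sum>l\<le>K. \<Sum>k<N. g l k)" by (rule sum.swap)
      finally have "(\<Sum>k<N. 4 * \<eta> * (1 + (\<Sum>l\<le>K. g l k))) / real N = 4 * \<eta> * (1 + (\<Sum>l\<le>K. (\<Sum>k<N. g l k) / real N))"
        using N by (simp only: sum_divide_distrib[symmetric]) (simp add: field_simps)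
      then show "(\<Sum>k<N. 4 * \<eta> * (1 + (\<Sum>l\<le>K. (2 ^ l * \<eta>) / ((s S k - a)\<^sup>2 + (2 ^ l * \<eta>)\<^sup>2)))) / real N
        = 4 * \<eta> * (1 + (\<Sum>l\<le>K. (\<Sum>k<N. (2 ^ l * \<eta>) / ((s S k - a)\<^sup>2 + (2 ^ l * \<eta>)\<^sup>2)) / real N))"
        unfolding g_def .
    qed
    also have "\<dots> = 4 * \<eta> * (1 + (\<Sum>l\<le>K. E (\<lambda>S. (\<Sum>k<N. (2 ^ l * \<eta>) / ((s S k - a)\<^sup>2 + (2 ^ l * \<eta>)\<^sup>2)) / real N)))"
      by (simp only: cube_exp_cmult cube_exp_add cube_exp_sum cube_exp_const finite_cartesian_product finite_lessThan)
    also have "\<dots> \<le> 4 * \<eta> * (1 + (\<Sum>l\<le>K. 2 * W))"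
    proof (intro mult_left_mono add_left_mono sum_mono poisson)
      fix l
      have "1 * \<eta> \<le> 2 ^ l * \<eta>" using \<eta> by (intro mult_right_mono) auto
      then show "\<eta> \<le> 2 ^ l * \<eta>" by simp
    qed (use \<eta> in auto)
    finally show ?thesis by (simp add: algebra_simps)
  qed
  have diff: "\<bar>f \<eta> + pi / 2 * E (\<lambda>S. sv_cdf S a)\<bar> \<le> 4 * \<eta> * (1 + 2 * (real K + 1) * W)"
  proof -
    have eq: "f \<eta> + pi / 2 * E (\<lambda>S. sv_cdf S a)
      = E (\<lambda>S. (\<Sum>k<N. (arctan ((s S k - a) / \<eta>) - arctan ((s S k + a) / \<eta>)) / 2 + pi / 2 * (if s S k \<le> a then 1 else 0)) / real N)"
      unfolding f_def cube_exp_cmult[symmetric] cube_exp_add[symmetric] sv_cdf_eq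
      by (intro cube_exp_cong) (simp add: sum.distrib sum_distrib_left add_divide_distrib)
    have "\<bar>f \<eta> + pi / 2 * E (\<lambda>S. sv_cdf S a)\<bar> \<le> E (\<lambda>S. \<bar>(\<Sum>k<N. (arctan ((s S k - a) / \<eta>) - arctan ((s S k + a) / \<eta>)) / 2 + pi / 2 * (if s S k \<le> a then 1 else 0)) / real N\<bar>)"
      using cube_exp_norm[OF parameter_bounds(3,4), where 'b = real] unfolding eq real_norm_def by blast
    also have "\<dots> \<le> E (\<lambda>S. (\<Sum>k<N. pi / 2 - arctan (\<bar>s S k - a\<bar> / \<eta>)) / real N)"
    proof (intro cube_exp_mono parameter_bounds)
      fix S
      have "\<bar>\<Sum>k<N. (arctan ((s S k - a) / \<eta>) - arctan ((s S k + a) / \<eta>)) / 2 + pi / 2 * (if s S k \<le> a then 1 else 0)\<bar>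
        \<le> (\<Sum>k<N. pi / 2 - arctan (\<bar>s S k - a\<bar> / \<eta>))"
      proof (rule order_trans[OF sum_abs], rule sum_mono)
        fix k assume "k \<in> {..<N}"
        then have k: "k < N" by simp
        show "\<bar>(arctan ((s S k - a) / \<eta>) - arctan ((s S k + a) / \<eta>)) / 2 + pi / 2 * (if s S k \<le> a then 1 else 0)\<bar>
          \<le> pi / 2 - arctan (\<bar>s S k - a\<bar> / \<eta>)"
          by (rule arctan_pair_indicator[OF s_nonneg[OF geb k] a \<eta>])
      qed
      then show "\<bar>(\<Sum>k<N. (arctan ((s S k - a) / \<eta>) - arctan ((s S k + a) / \<eta>)) / 2 + pi / 2 * (if s S k \<le> a then 1 else 0)) / real N\<bar>
        \<le> (\<Sum>k<N. pi / 2 - arctan (\<bar>s S k - a\<bar> / \<eta>)) / real N"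
        using N by (simp add: abs_divide divide_right_mono)
    qed
    finally show ?thesis using leak by linarith
  qed
  have "\<bar>pi / 2 * (E (\<lambda>S. sv_cdf S a) - mp_sv_cdf \<gamma> a)\<bar> \<le> e2 / \<eta> + e4 / (3 * \<eta> ^ 3) + \<eta> / sqrt \<gamma> + 4 * \<eta> * (1 + 2 * (real K + 1) * W)"
    using main diff unfolding right_diff_distrib by linarith
  moreover have "\<bar>E (\<lambda>S. sv_cdf S a) - mp_sv_cdf \<gamma> a\<bar> \<le> \<bar>pi / 2 * (E (\<lambda>S. sv_cdf S a) - mp_sv_cdf \<gamma> a)\<bar>"
  proof -
    have "1 * \<bar>E (\<lambda>S. sv_cdf S a) - mp_sv_cdf \<gamma> a\<bar> \<le> pi / 2 * \<bar>E (\<lambda>S. sv_cdf S a) - mp_sv_cdf \<gamma> a\<bar>"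
      using pi_ge_two by (intro mult_right_mono) auto
    then show ?thesis by (simp add: abs_mult)
  qed
  ultimately show ?thesis unfolding W_def by linarith
qed

end

section \<open>From the Bernoulli measure to biregular graphs\<close>

definition edge_pairs :: "(nat + nat) set set \<Rightarrow> (nat \<times> nat) set" where
  "edge_pairs E = {(i, j). {Inl i, Inr j} \<in> E}"

lemma edge_pairs_image: "edge_pairs ((\<lambda>(i, j). {Inl i, Inr j}) ` S) = S"
  by (auto simp: edge_pairs_def doubleton_eq_iff image_iff)

lemma neighbours_edge_pairs:
  assumes E: "\<forall>e\<in>E. \<exists>b\<in>black_vertices M. \<exists>w\<in>white_vertices N. e = {b, w}"
  shows "card (neighbours E (Inl i)) = row_deg (edge_pairs E) i" "card (neighbours E (Inr j)) = col_deg (edge_pairs E) j"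
proof -
  have "neighbours E (Inl i) = Inr ` {j. (i, j) \<in> edge_pairs E}"
    using E by (fastforce simp: neighbours_def edge_pairs_def black_vertices_def white_vertices_def doubleton_eq_iff)
  then show "card (neighbours E (Inl i)) = row_deg (edge_pairs E) i" by (simp add: row_deg_def card_image)
  have "neighbours E (Inr j) = Inl ` {i. (i, j) \<in> edge_pairs E}"
  proof (rule equalityI; rule subsetI)
    fix u assume "u \<in> neighbours E (Inr j)"
    then have e: "{Inr j, u} \<in> E" by (simp add: neighbours_def)
    then obtain b w where "b \<in> black_vertices M" "w \<in> white_vertices N" "{Inr j, u} = {b, w}" using E by meson
    then obtain i where "u = Inl i" by (auto simp: black_vertices_def white_vertices_def doubleton_eq_iff)
    moreover have "{u, Inr j} \<in> E" using e by (simp only: insert_commute)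
    ultimately show "u \<in> Inl ` {i. (i, j) \<in> edge_pairs E}" by (auto simp: edge_pairs_def)
  next
    fix u :: "nat + nat" assume "u \<in> Inl ` {i. (i, j) \<in> edge_pairs E}"
    then have "{u, Inr j} \<in> E" by (auto simp: edge_pairs_def)
    then have "{Inr j, u} \<in> E" by (simp only: insert_commute)
    then show "u \<in> neighbours E (Inr j)" by (simp add: neighbours_def)
  qed
  then show "card (neighbours E (Inr j)) = col_deg (edge_pairs E) j" by (simp add: col_deg_def card_image)
qed

lemma bij_betw_edge_pairs:
  "bij_betw edge_pairs (biregular_graphs M N db dw) (margin_sets {..<M} {..<N} (\<lambda>_. db) (\<lambda>_. dw))"
proof (rule bij_betwI[where g = "\<lambda>S. (\<lambda>(i, j). {Inl i, Inr j}) ` S"])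
  show "edge_pairs \<in> biregular_graphs M N db dw \<rightarrow> margin_sets {..<M} {..<N} (\<lambda>_. db) (\<lambda>_. dw)"
  proof
    fix E assume E: "E \<in> biregular_graphs M N db dw"
    then have bip: "\<forall>e\<in>E. \<exists>b\<in>black_vertices M. \<exists>w\<in>white_vertices N. e = {b, w}" by (simp add: biregular_graphs_def)
    have "edge_pairs E \<subseteq> {..<M} \<times> {..<N}"
      using bip by (fastforce simp: edge_pairs_def black_vertices_def white_vertices_def doubleton_eq_iff)
    then show "edge_pairs E \<in> margin_sets {..<M} {..<N} (\<lambda>_. db) (\<lambda>_. dw)"
      using E neighbours_edge_pairs[OF bip]
      by (auto simp: margin_sets_def biregular_graphs_def black_vertices_def white_vertices_def)
  qed
  show "(\<lambda>S. (\<lambda>(i, j). {Inl i, Inr j}) ` S) \<in> margin_sets {..<M} {..<N} (\<lambda>_. db) (\<lambda>_. dw) \<rightarrow> biregular_graphs M N db dw"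
  proof
    fix S assume S: "S \<in> margin_sets {..<M} {..<N} (\<lambda>_. db) (\<lambda>_. dw)"
    let ?E = "(\<lambda>(i, j). {Inl i, Inr j}) ` S :: (nat + nat) set set"
    have sub: "S \<subseteq> {..<M} \<times> {..<N}" using S by (simp add: margin_sets_def)
    have bip: "\<forall>e\<in>?E. \<exists>b\<in>black_vertices M. \<exists>w\<in>white_vertices N. e = {b, w}"
      using sub by (auto simp: black_vertices_def white_vertices_def)
    have "?E \<in> simple_graphs (black_vertices M \<union> white_vertices N)"
      using sub by (auto simp: simple_graphs_def black_vertices_def white_vertices_def)
    then show "?E \<in> biregular_graphs M N db dw"
      unfolding biregular_graphs_def using bip S neighbours_edge_pairs[OF bip] edge_pairs_image[of S]
      by (auto simp: margin_sets_def black_vertices_def white_vertices_def)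
  qed
  show "(\<lambda>(i, j). {Inl i, Inr j}) ` edge_pairs E = E" if "E \<in> biregular_graphs M N db dw" for E
  proof -
    have "\<forall>e\<in>E. \<exists>b\<in>black_vertices M. \<exists>w\<in>white_vertices N. e = {b, w}" using that by (simp add: biregular_graphs_def)
    then show ?thesis by (fastforce simp: edge_pairs_def black_vertices_def white_vertices_def image_iff)
  qed
qed (auto simp: edge_pairs_image)

text \<open>All biregular graphs have the same weight under the Bernoulli measure, so the uniform measure is
  the Bernoulli measure conditioned on an event that is not too unlikely.\<close>

lemma uniform_prob_ge:
  assumes sz: "0 < M" "0 < N" "0 < db" "db < N" "M * db = N * dw" and p: "p = real db / real N"
    and Q: "\<And>E. E \<in> biregular_graphs M N db dw \<Longrightarrow> Q (edge_pairs E) \<Longrightarrow> E \<in> X"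
  shows "1 - (real (M * N) + 1) * (real N + 1) ^ M * (real M + 1) ^ N
       * cube_exp ({..<M} \<times> {..<N}) p (\<lambda>S. if Q S then 0 else 1)
     \<le> measure_pmf.prob (pmf_of_set (biregular_graphs M N db dw)) X"
proof -
  let ?\<Omega> = "biregular_graphs M N db dw"
  let ?I = "{..<M} \<times> {..<N}"
  define k where "k = M * db"
  define Ms where "Ms = margin_sets {..<M} {..<N} (\<lambda>_. db) (\<lambda>_. dw)"
  define B where "B = (real (M * N) + 1) * (real N + 1) ^ M * (real M + 1) ^ N"
  define w where "w = p ^ k * (1 - p) ^ (card ?I - k)"
  have p01: "0 < p" "p < 1" using sz p by auto
  have w: "0 < w" unfolding w_def using p01 by simp
  have B: "0 < B" unfolding B_def by (intro mult_pos_pos zero_less_power add_nonneg_pos) auto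
  have bij: "bij_betw edge_pairs ?\<Omega> Ms" unfolding Ms_def by (rule bij_betw_edge_pairs)
  have finM: "finite Ms" unfolding Ms_def by (intro finite_margin_sets) auto
  have fin\<Omega>: "finite ?\<Omega>" using bij finM bij_betw_finite by blast
  have subk: "Ms \<subseteq> {S. S \<subseteq> ?I \<and> card S = k}"
  proof safe
    fix S assume S: "S \<in> Ms"
    then have sub: "S \<subseteq> {..<M} \<times> {..<N}" by (simp add: Ms_def margin_sets_def)
    show "card S = k" using sum_row_deg[OF _ _ sub] S by (simp add: Ms_def margin_sets_def k_def)
  qed (auto simp: Ms_def margin_sets_def)
  have pk: "p = real k / real (card {..<M} * card {..<N})" using sz(1,2) by (simp add: k_def p)
  have "M * db < M * N" using sz(1,4) by simp
  then have "N * dw < N * M" unfolding sz(5) by (simp only: mult.commute)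
  then have "dw < M" by simp
  then have "1 \<le> B * cube_exp ?I p (\<lambda>S. if S \<in> Ms then 1 else 0)"
    using margin_sets_probability[of "{..<M}" "{..<N}" db k dw p] sz pk
    by (simp add: k_def Ms_def B_def)
  then have cardM: "1 \<le> B * (real (card Ms) * w)"
    using cube_exp_indicator_fixed_card[OF _ subk, of p] by (simp add: w_def)
  \<comment> \<open>The lower bound for the probability also shows that biregular graphs exist, so
    that \<open>pmf_of_set\<close> really is the uniform law.\<close>
  then have Mpos: "0 < card Ms" by (cases "card Ms = 0") auto
  then have ne: "?\<Omega> \<noteq> {}" using bij bij_betw_same_card by fastforce
  define bad where "bad = {S \<in> Ms. \<not> Q S}"
  have "card (?\<Omega> - X) \<le> card bad"
  proof (rule card_inj_on_le[where f = edge_pairs])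
    show "inj_on edge_pairs (?\<Omega> - X)" using bij by (auto simp: bij_betw_def intro: inj_on_subset)
    show "edge_pairs ` (?\<Omega> - X) \<subseteq> bad" using bij Q by (auto simp: bad_def bij_betw_def)
    show "finite bad" using finM by (simp add: bad_def)
  qed
  moreover have "card bad * w = cube_exp ?I p (\<lambda>S. if S \<in> bad then 1 else 0)"
    unfolding w_def using subk by (intro cube_exp_indicator_fixed_card[symmetric]) (auto simp: bad_def)
  moreover have "cube_exp ?I p (\<lambda>S. if S \<in> bad then 1 else (0::real)) \<le> cube_exp ?I p (\<lambda>S. if Q S then 0 else 1)"
    using p01 by (intro cube_exp_mono) (auto simp: bad_def)
  ultimately have badw: "real (card (?\<Omega> - X)) * w \<le> cube_exp ?I p (\<lambda>S. if Q S then 0 else 1)"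
    using w by (smt (verit) mult_right_mono of_nat_mono)
  have "real (card (?\<Omega> - X)) \<le> real (card (?\<Omega> - X)) * (B * (real (card Ms) * w))"
    using cardM mult_left_mono[of 1 "B * (real (card Ms) * w)" "real (card (?\<Omega> - X))"] by simp
  also have "\<dots> = B * (real (card (?\<Omega> - X)) * w) * real (card Ms)" by simp
  also have "\<dots> \<le> B * cube_exp ?I p (\<lambda>S. if Q S then 0 else 1) * real (card Ms)"
    using badw B by (intro mult_right_mono mult_left_mono) auto
  finally have ratio: "real (card (?\<Omega> - X)) / real (card Ms) \<le> B * cube_exp ?I p (\<lambda>S. if Q S then 0 else 1)"
    using Mpos by (simp add: divide_le_eq)
  have cM: "card ?\<Omega> = card Ms" by (rule bij_betw_same_card[OF bij])
  have "card (?\<Omega> \<inter> X) + card (?\<Omega> - X) = card ?\<Omega>"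
    using fin\<Omega> by (metis card_Int_Diff)
  then have "real (card (?\<Omega> \<inter> X)) / real (card ?\<Omega>) = 1 - real (card (?\<Omega> - X)) / real (card Ms)"
    using Mpos unfolding cM by (simp add: field_simps flip: of_nat_add)
  then show ?thesis using ratio measure_pmf_of_set[OF ne fin\<Omega>, of X] by (simp add: B_def)
qed

section \<open>Gram matrices and ordered eigenvalues\<close>

definition gram_matrix :: "nat \<Rightarrow> nat \<Rightarrow> (nat \<Rightarrow> nat \<Rightarrow> real) \<Rightarrow> real mat" where
  "gram_matrix M N H = transpose_mat (mat M N (\<lambda>(i, j). H i j)) * mat M N (\<lambda>(i, j). H i j)"

lemma gram_eigenbasis_exists:
  "\<exists>v d. gram_eigenbasis M N H v (\<lambda>k. sqrt (d k)) \<and> (\<forall>k<N. 0 \<le> d k)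
     \<and> proots (char_poly (gram_matrix M N H)) = mset (map d [0..<N])"
proof -
  define A where "A = mat M N (\<lambda>(i, j). H i j)"
  have A: "A \<in> carrier_mat M N" by (simp add: A_def)
  have X: "gram_matrix M N H = A\<^sup>T * A" by (simp add: gram_matrix_def A_def)
  have Xc: "A\<^sup>T * A \<in> carrier_mat N N" using A by simp
  have Xs: "(A\<^sup>T * A)\<^sup>T = A\<^sup>T * A" using A by (subst transpose_mult[of _ N M _ N]) auto
  have Xij: "(A\<^sup>T * A) $$ (j, l) = (\<Sum>i<M. H i j * H i l)" if "j < N" "l < N" for j l
    using that by (simp add: A_def scalar_prod_def atLeast0LessThan)
  obtain v d where v: "\<forall>k<N. \<forall>l<N. (\<Sum>j<N. v k j * v l j) = (if k = l then 1 else 0)"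
     "\<forall>i<N. \<forall>j<N. (\<Sum>k<N. v k i * v k j) = (if i = j then 1 else 0)"
     "\<forall>k<N. \<forall>i<N. (\<Sum>j<N. (A\<^sup>T * A) $$ (i, j) * v k j) = d k * v k i"
    and pr: "proots (char_poly (A\<^sup>T * A)) = mset (map d [0..<N])"
    using real_symmetric_eigenbasis[OF Xc Xs] by blast
  have ev: "(\<Sum>i<M. H i j * (\<Sum>l<N. H i l * v k l)) = d k * v k j" if "k < N" "j < N" for k j
  proof -
    have "(\<Sum>i<M. H i j * (\<Sum>l<N. H i l * v k l)) = (\<Sum>i<M. \<Sum>l<N. H i j * H i l * v k l)"
      by (simp add: sum_distrib_left mult.assoc)
    also have "\<dots> = (\<Sum>l<N. \<Sum>i<M. H i j * H i l * v k l)" by (rule sum.swap)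
    also have "\<dots> = (\<Sum>l<N. (A\<^sup>T * A) $$ (j, l) * v k l)"
      using that by (intro sum.cong refl) (simp add: Xij sum_distrib_right del: index_mult_mat)
    finally show ?thesis using v(3) that by simp
  qed
  have dn: "0 \<le> d k" if k: "k < N" for k
  proof -
    have "d k = d k * (\<Sum>j<N. v k j * v k j)" using v(1) k by simp
    also have "\<dots> = (\<Sum>j<N. v k j * (\<Sum>i<M. H i j * (\<Sum>l<N. H i l * v k l)))"
      unfolding sum_distrib_left[of "d k"] by (intro sum.cong refl) (simp add: ev k)
    also have "\<dots> = (\<Sum>i<M. \<Sum>j<N. v k j * (H i j * (\<Sum>l<N. H i l * v k l)))"
      unfolding sum_distrib_left[of "v k _"] by (rule sum.swap)
    also have "\<dots> = (\<Sum>i<M. (\<Sum>l<N. H i l * v k l) * (\<Sum>l<N. H i l * v k l))"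
      by (intro sum.cong refl) (simp add: sum_distrib_right mult_ac)
    also have "\<dots> \<ge> 0" by (intro sum_nonneg) auto
    finally show ?thesis .
  qed
  have "gram_eigenbasis M N H v (\<lambda>k. sqrt (d k))"
    unfolding gram_eigenbasis_def using v(1,2) ev dn by simp
  then show ?thesis using dn pr unfolding X by blast
qed

text \<open>The constant subtracted from every entry is
  \<open>sqrt (db * dw) / sqrt (M * N) = db / N\<close>, exactly the Bernoulli mean, so graph and
  Bernoulli sample with the same edges have the same centred matrix.\<close>

lemma X_star_eq_gram:
  assumes "0 < M" "0 < N" "M * db = N * dw" "0 < dw"
  shows "X_star M N db dw E = gram_matrix M N (bern_mat (real db / real N) (1 / sqrt (real dw)) (edge_pairs E))"
proof -
  have MN: "real M * real db = real N * real dw" using assms(3) by (metis of_nat_mult)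
  have "sqrt (real db * real dw) * (1 / sqrt (real M) * (1 / sqrt (real N))) = real db / real N"
  proof -
    have "sqrt (real db * real dw) * (1 / sqrt (real M) * (1 / sqrt (real N))) = sqrt ((real db * real dw) / (real M * real N))"
      by (simp add: real_sqrt_divide real_sqrt_mult)
    also have "(real db * real dw) / (real M * real N) = (real db / real N)\<^sup>2"
    proof -
      have "real dw = real M * real db / real N" using MN assms by (simp add: field_simps)
      then show ?thesis using assms by (simp add: power2_eq_square)
    qed
    also have "sqrt ((real db / real N)\<^sup>2) = real db / real N" by simp
    finally show ?thesis .
  qed
  moreover from this have "sqrt (real db * real dw) * (1 / sqrt (real N) * (1 / sqrt (real M))) = real db / real N"
    by (simp only: mult.commute[of "1 / sqrt (real N)"])
  ultimately have "H_mat M N db dw E = mat M N (\<lambda>(i, j). bern_mat (real db / real N) (1 / sqrt (real dw)) (edge_pairs E) i j)"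
    by (intro eq_matI)
      (auto simp: H_mat_def adj_block_def outer_prod_def const_unit_vec_def bern_mat_def edge_pairs_def)
  then show ?thesis by (simp add: X_star_def gram_matrix_def)
qed

context
  fixes d :: "nat \<Rightarrow> real" and N i :: nat and xs :: "real list"
  assumes xs: "xs = sorted_list_of_multiset (mset (map d [0..<N]))" and i: "1 \<le> i" "i \<le> N"
begin

lemma order_stat_facts: "sorted xs" "length xs = N" "mset xs = mset (map d [0..<N])"
proof -
  show "sorted xs" unfolding xs by (rule sorted_sorted_list_of_multiset)
  show m: "mset xs = mset (map d [0..<N])" unfolding xs by (rule mset_sorted_list_of_multiset)
  show "length xs = N" using arg_cong[OF m, of size] by simp
qed

lemma order_stat_count: "card {k. k < N \<and> d k \<le> y} = card {m. m < N \<and> xs ! m \<le> y}"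
proof -
  have "length (filter (\<lambda>x. x \<le> y) xs) = length (filter (\<lambda>x. x \<le> y) (map d [0..<N]))"
    using arg_cong[OF order_stat_facts(3), of "\<lambda>M. size (filter_mset (\<lambda>x. x \<le> y) M)"]
    by (simp only: mset_filter[symmetric] size_mset)
  then show ?thesis unfolding length_filter_conv_card using order_stat_facts(2) by (simp cong: conj_cong)
qed

lemma order_stat_le: assumes "i \<le> card {k. k < N \<and> d k \<le> y}" shows "xs ! (i - 1) \<le> y"
proof (rule ccontr)
  assume "\<not> xs ! (i - 1) \<le> y"
  then have "{m. m < N \<and> xs ! m \<le> y} \<subseteq> {..<i - 1}"
    using sorted_nth_mono[OF order_stat_facts(1), of "i - 1"] order_stat_facts(2)
    by (auto simp: not_le) (meson le_less_trans not_le order.strict_trans2)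
  then have "card {m. m < N \<and> xs ! m \<le> y} \<le> i - 1" using card_mono[of "{..<i - 1}"] by fastforce
  then show False using assms i unfolding order_stat_count by simp
qed

lemma order_stat_gt: assumes "card {k. k < N \<and> d k \<le> y} < i" shows "y < xs ! (i - 1)"
proof (rule ccontr)
  assume "\<not> y < xs ! (i - 1)"
  then have "{..<i} \<subseteq> {m. m < N \<and> xs ! m \<le> y}"
    using sorted_nth_mono[OF order_stat_facts(1), of _ "i - 1"] order_stat_facts(2) i
    by (auto simp: not_less intro!: order_trans[of "xs ! _" "xs ! (i - Suc 0)" y])
  then have "i \<le> card {m. m < N \<and> xs ! m \<le> y}" using card_mono[of "{m. m < N \<and> xs ! m \<le> y}" "{..<i}"] by simp
  then show False using assms unfolding order_stat_count by simp
qed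

text \<open>The \<open>N - i\<close> entries after the \<open>i\<close>-th are at least as large as
  it, so a bound on the trace limits bulk eigenvalues deterministically.\<close>

lemma order_stat_sum:
  assumes "\<And>k. k < N \<Longrightarrow> 0 \<le> d k"
  shows "0 \<le> xs ! (i - 1)" "(real N - real i) * xs ! (i - 1) \<le> (\<Sum>k<N. d k)"
proof -
  have nn: "0 \<le> xs ! m" if "m < N" for m
  proof -
    have "xs ! m \<in># mset xs" using that order_stat_facts(2) by simp
    then show ?thesis unfolding order_stat_facts(3) using assms by auto
  qed
  show "0 \<le> xs ! (i - 1)" using nn i by simp
  have "(\<Sum>k<N. d k) = sum_list (map d [0..<N])" by (simp add: interv_sum_list_conv_sum_set_nat atLeast0LessThan)
  also have "\<dots> = sum_list xs" using order_stat_facts(3) by (metis sum_mset_sum_list)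
  also have "\<dots> = (\<Sum>m<N. xs ! m)" using order_stat_facts(2) by (simp add: sum_list_sum_nth atLeast0LessThan)
  also have "\<dots> \<ge> (\<Sum>m\<in>{i..<N}. xs ! m)" using nn by (intro sum_mono2) auto
  also have "(\<Sum>m\<in>{i..<N}. xs ! m) \<ge> (\<Sum>m\<in>{i..<N}. xs ! (i - 1))"
    using sorted_nth_mono[OF order_stat_facts(1), of "i - 1"] order_stat_facts(2) i by (intro sum_mono) auto
  also have "(\<Sum>m\<in>{i..<N}. xs ! (i - 1)) = (real N - real i) * xs ! (i - 1)" using i by (simp add: of_nat_diff)
  finally show "(real N - real i) * xs ! (i - 1) \<le> (\<Sum>k<N. d k)" .
qed

end

section \<open>Bulk eigenvalue locations\<close>

text \<open>The law of the singular values has density at most \<open>c\<close> when \<open>M \<le> c * N\<close>, so the root of a bulk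
  classical location keeps distance \<open>2 * bulk_margin \<kappa> c\<close> from both edges.\<close>

definition bulk_margin :: "real \<Rightarrow> real \<Rightarrow> real" where
  "bulk_margin \<kappa> c = min 1 (\<kappa> / (2 * c))"

text \<open>The lower bound for the imaginary part of \<open>mp_w\<close> on vertical lines at distance \<open>\<tau>\<close> from the
  edges.\<close>

definition line_const :: "real \<Rightarrow> real" where
  "line_const \<tau> = min (\<tau> / 4) (sqrt (\<tau> ^ 5 / 10))"

text \<open>Collected in \<open>mean_cdf_rate\<close>: 13 = 5 + 8 bounds the two scaled errors of
  the Stieltjes transform, and 33 = 1 + 32 counts the direct terms and the dyadic sum.\<close>

definition rate_const :: "real \<Rightarrow> real \<Rightarrow> real" where
  "rate_const c \<tau> = 33 * (c + 13 / line_const \<tau>) + 4"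

text \<open>The density is at least \<tau> / pi at distance \<tau> from the edges. With
  \<open>A\<close> this constant, a shift by \<open>(A - 1) * \<delta>\<close> thus gains the error
  of the mean, the sampling error \<open>2 * \<delta>\<close> and a spare \<open>\<delta>\<close>
  for strictness. The leading 1 pays for the shift in \<open>sample_cdf_bounds\<close>.\<close>

definition shift_const :: "real \<Rightarrow> real \<Rightarrow> real" where
  "shift_const c \<tau> = 1 + pi / \<tau> * (rate_const c \<tau> + 3)"

context bernoulli_spectrum
begin

lemma inverse_sqrt_ratio:
  assumes c: "1 \<le> c" "real M \<le> c * real N" shows "1 / sqrt \<gamma> \<le> c"
proof -
  have N: "0 < real N" using sizes by simp
  have "1 / c \<le> \<gamma>" unfolding \<gamma>_def using c parameter_bounds N by (simp add: field_simps)
  moreover have "(1 / c)\<^sup>2 \<le> 1 / c" using c by (simp add: power2_eq_square divide_le_eq)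
  ultimately have "(1 / c)\<^sup>2 \<le> \<gamma>" by linarith
  then have "1 / c \<le> sqrt \<gamma>" by (rule real_le_rsqrt)
  then show ?thesis using c parameter_bounds by (simp add: divide_le_eq mult.commute)
qed

text \<open>At height \<open>\<eta> = \<xi> / r\<close> with \<open>r = D powr (1 / 4)\<close> both
  scaled errors are bounded. What dominates is \<open>\<eta>\<close> times the number of dyadic
  scales, and that number is O(\<xi>).\<close>

theorem mean_cdf_rate:
  assumes \<tau>: "0 < \<tau>" "\<tau> \<le> 1" "1 - sqrt \<gamma> + \<tau> \<le> a" "a \<le> 1 + sqrt \<gamma> - \<tau>"
    and \<xi>: "1 \<le> \<xi>" "ln (real N) \<le> \<xi>" "\<xi>\<^sup>2 \<le> D_param N db"
    and c: "1 \<le> c" "real M \<le> c * real N"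
  shows "\<bar>E (\<lambda>S. sv_cdf S a) - mp_sv_cdf \<gamma> a\<bar> \<le> rate_const c \<tau> * (\<xi>\<^sup>2 / D_param N db powr (1 / 4))"
proof -
  define D where "D = D_param N db"
  define r where "r = D powr (1 / 4)"
  define \<eta> where "\<eta> = \<xi> / r"
  define c0 where "c0 = line_const \<tau>"
  define e2 where "e2 = (3 / real db + 2 * p) / c0"
  define e4 where "e4 = 8 / real db / c0"
  have N: "1 \<le> real N" "0 < real N" using sizes by auto
  have c0: "0 < c0" using \<tau> by (simp add: c0_def line_const_def)
  have \<xi>1: "1 \<le> \<xi>\<^sup>2" using \<xi>(1) by (simp add: one_le_power)
  then have D1: "1 \<le> D" using \<xi>(3) by (simp add: D_def)
  have r1: "1 \<le> r" unfolding r_def using D1 by (simp add: ge_one_powr_ge_zero)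
  have r4: "r ^ 4 = D"
  proof -
    have "r ^ 4 = r powr 4" using r1 by simp
    then show ?thesis unfolding r_def powr_powr using D1 by simp
  qed
  have \<eta>: "0 < \<eta>" unfolding \<eta>_def using \<xi>(1) r1 by simp
  have Ddb: "D \<le> real db" "D \<le> (real N)\<^sup>2 / real db ^ 3" by (simp_all add: D_def D_param_def)
  have db: "1 \<le> real db" "real db \<le> real N" using sizes by auto
  have i1: "1 / real db \<le> 1 / r ^ 4" unfolding r4 using Ddb D1 by (intro divide_left_mono) auto
  \<comment> \<open>The second argument of the minimum in \<open>D_param\<close>, weakened by db^2
    \<le> db^3, gives \<open>r\<^sup>2 * db \<le> N\<close>.\<close>
  have pr: "p \<le> 1 / r\<^sup>2"
  proof -
    have "D * real db ^ 3 \<le> (real N)\<^sup>2" using Ddb(2) db by (simp add: pos_le_divide_eq)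
    moreover have "D * (real db)\<^sup>2 \<le> D * real db ^ 3" using D1 db by (intro mult_left_mono power_increasing) auto
    ultimately have "(r\<^sup>2 * real db)\<^sup>2 \<le> (real N)\<^sup>2" using r4 by (simp add: power_mult_distrib)
    then have "r\<^sup>2 * real db \<le> real N" using power2_le_imp_le N by (metis of_nat_0_le_iff)
    then show ?thesis unfolding p_def using N r1 by (simp add: field_simps)
  qed
  have r24: "1 / r ^ 4 \<le> 1 / r\<^sup>2" using r1 by (intro divide_left_mono power_increasing) auto
  have e2le: "e2 \<le> 5 / (c0 * r\<^sup>2)"
  proof -
    have "3 / real db + 2 * p \<le> 5 / r\<^sup>2" using i1 pr r24 by simp
    then have "e2 \<le> (5 / r\<^sup>2) / c0" unfolding e2_def using c0 by (intro divide_right_mono) auto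
    then show ?thesis by (simp add: mult.commute)
  qed
  have e4le: "e4 \<le> 8 / (c0 * r ^ 4)"
  proof -
    have "8 / real db \<le> 8 / r ^ 4" using i1 by simp
    then have "e4 \<le> (8 / r ^ 4) / c0" unfolding e4_def using c0 by (intro divide_right_mono) auto
    then show ?thesis by (simp add: mult.commute)
  qed
  have q2: "e2 / \<eta>\<^sup>2 \<le> 5 / c0"
  proof -
    have "e2 / \<eta>\<^sup>2 \<le> (5 / (c0 * r\<^sup>2)) / \<eta>\<^sup>2" using e2le by (intro divide_right_mono) auto
    also have "\<dots> = (5 / c0) / \<xi>\<^sup>2" unfolding \<eta>_def using r1 by (simp add: power_divide field_simps)
    also have "\<dots> \<le> (5 / c0) / 1" using \<xi>1 c0 by (intro divide_left_mono) auto
    finally show ?thesis by simp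
  qed
  have q4: "e4 / \<eta> ^ 4 \<le> 8 / c0"
  proof -
    have "e4 / \<eta> ^ 4 \<le> (8 / (c0 * r ^ 4)) / \<eta> ^ 4" using e4le \<eta> by (intro divide_right_mono) auto
    also have "\<dots> = (8 / c0) / \<xi> ^ 4" unfolding \<eta>_def using r1 by (simp add: power_divide field_simps)
    also have "\<dots> \<le> (8 / c0) / 1" using \<xi>(1) c0 by (intro divide_left_mono) (auto simp: one_le_power)
    finally show ?thesis by simp
  qed
  have t2: "e2 / \<eta> \<le> \<eta> * (5 / c0)"
  proof -
    have "e2 / \<eta> = \<eta> * (e2 / \<eta>\<^sup>2)" using \<eta> by (simp add: power2_eq_square)
    then show ?thesis using q2 \<eta> by (simp only:) (intro mult_left_mono, auto)
  qed
  have e40: "0 \<le> e4" unfolding e4_def using c0 by simp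
  have t4: "e4 / (3 * \<eta> ^ 3) \<le> \<eta> * (8 / c0)"
  proof -
    have "e4 / (3 * \<eta> ^ 3) \<le> e4 / \<eta> ^ 3" using \<eta> e40 by (intro divide_left_mono) auto
    also have "e4 / \<eta> ^ 3 = \<eta> * (e4 / \<eta> ^ 4)" using \<eta> by (simp add: power3_eq_cube power4_eq_xxxx)
    also have "\<dots> \<le> \<eta> * (8 / c0)" using q4 \<eta> by (intro mult_left_mono) auto
    finally show ?thesis .
  qed
  \<comment> \<open>\<open>K\<close> doublings lift \<open>\<eta>\<close> to height one, since
    \<open>2 ^ K\<close> is at least \<open>N\<close>, \<open>N\<close> at least \<open>r\<close>,
    and \<open>\<xi>\<close> at least 1. The dyadic sum stays short because log 2 N \<le> 2 ln N
    \<le> 2 \<xi>.\<close>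
  define K where "K = nat \<lceil>log 2 (real N)\<rceil>"
  have log0: "0 \<le> log 2 (real N)" using N by simp
  have K2: "real N \<le> 2 ^ K"
  proof -
    have "real N = 2 powr log 2 (real N)" using N by simp
    also have "\<dots> \<le> 2 powr real K" unfolding K_def using log0 by (intro powr_mono) (auto intro: order_trans[OF le_of_int_ceiling])
    also have "\<dots> = 2 ^ K" by (simp add: powr_realpow)
    finally show ?thesis .
  qed
  have K\<eta>: "1 \<le> 2 ^ K * \<eta>"
  proof -
    have "r * 1 \<le> r * r ^ 3" using r1 by (intro mult_left_mono) (auto simp: one_le_power)
    also have "\<dots> = D" unfolding r4[symmetric] by (simp add: power_numeral_reduce)
    finally have "r \<le> real N" using Ddb(1) db by linarith
    then have "r \<le> 2 ^ K" using K2 by linarith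
    then have "r * 1 \<le> 2 ^ K * \<xi>" using \<xi>(1) r1 by (intro mult_mono) auto
    then show ?thesis unfolding \<eta>_def using r1 by (simp add: pos_le_divide_eq)
  qed
  have K\<xi>: "real K + 1 \<le> 4 * \<xi>"
  proof -
    have "real K \<le> log 2 (real N) + 1" unfolding K_def using log0 by (simp add: of_nat_nat)
    also have "log 2 (real N) \<le> 2 * ln (real N)"
    proof -
      have "1 / 2 \<le> ln (2::real)" using ln_le_minus_one[of "1 / 2 :: real"] by (simp add: ln_div)
      then have "ln (real N) / ln 2 \<le> ln (real N) / (1 / 2)" using N by (intro divide_left_mono) auto
      then show ?thesis by (simp add: log_def)
    qed
    finally show ?thesis using \<xi> by linarith
  qed
  define g where "g = 1 / sqrt \<gamma>"
  have g: "0 \<le> g" "g \<le> c" using inverse_sqrt_ratio[OF c] parameter_bounds by (auto simp: g_def)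
  have "\<bar>E (\<lambda>S. sv_cdf S a) - mp_sv_cdf \<gamma> a\<bar> \<le> e2 / \<eta> + e4 / (3 * \<eta> ^ 3) + \<eta> / sqrt \<gamma>
     + 4 * \<eta> * (1 + 2 * (real K + 1) * (1 / sqrt \<gamma> + e2 / \<eta>\<^sup>2 + e4 / \<eta> ^ 4))"
    unfolding e2_def e4_def c0_def line_const_def by (rule mean_cdf_close[OF \<tau> \<eta> K\<eta>])
  also have "\<dots> = e2 / \<eta> + e4 / (3 * \<eta> ^ 3) + \<eta> * g
     + 4 * \<eta> * (1 + 2 * ((real K + 1) * (g + e2 / \<eta>\<^sup>2 + e4 / \<eta> ^ 4)))"
    by (simp add: g_def)
  also have "\<dots> \<le> \<eta> * (5 / c0) + \<eta> * (8 / c0) + \<eta> * c + 4 * \<eta> * (1 + 2 * ((4 * \<xi>) * (c + 5 / c0 + 8 / c0)))"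
  proof -
    have "(real K + 1) * (g + e2 / \<eta>\<^sup>2 + e4 / \<eta> ^ 4) \<le> (4 * \<xi>) * (c + 5 / c0 + 8 / c0)"
    proof (rule mult_mono)
      show "g + e2 / \<eta>\<^sup>2 + e4 / \<eta> ^ 4 \<le> c + 5 / c0 + 8 / c0" using g q2 q4 by linarith
      have "0 \<le> e2" unfolding e2_def using c0 parameter_bounds by simp
      then show "0 \<le> g + e2 / \<eta>\<^sup>2 + e4 / \<eta> ^ 4" using g e40 \<eta> by simp
    qed (use K\<xi> \<xi> in auto)
    then have "4 * \<eta> * (1 + 2 * ((real K + 1) * (g + e2 / \<eta>\<^sup>2 + e4 / \<eta> ^ 4))) \<le> 4 * \<eta> * (1 + 2 * ((4 * \<xi>) * (c + 5 / c0 + 8 / c0)))"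
      using \<eta> by (intro mult_left_mono) auto
    moreover have "\<eta> * g \<le> \<eta> * c" using g \<eta> by (intro mult_left_mono) auto
    ultimately show ?thesis using t2 t4 by linarith
  qed
  also have "\<dots> = \<eta> * (c + 13 / c0 + 4) + 32 * (\<eta> * \<xi> * (c + 13 / c0))"
    by (simp add: algebra_simps add_divide_distrib)
  also have "\<dots> \<le> \<eta> * \<xi> * (c + 13 / c0 + 4) + 32 * (\<eta> * \<xi> * (c + 13 / c0))"
  proof -
    have "\<eta> * 1 * (c + 13 / c0 + 4) \<le> \<eta> * \<xi> * (c + 13 / c0 + 4)"
      using \<eta> \<xi>(1) c c0 by (intro mult_right_mono mult_left_mono) auto
    then show ?thesis by simp
  qed
  also have "\<dots> = rate_const c \<tau> * (\<eta> * \<xi>)" unfolding rate_const_def c0_def by (simp add: algebra_simps)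
  also have "\<eta> * \<xi> = \<xi>\<^sup>2 / D_param N db powr (1 / 4)" by (simp add: \<eta>_def r_def D_def power2_eq_square)
  finally show ?thesis .
qed

end

lemma rate_const_pos:
  assumes "1 \<le> c" "0 < \<tau>" shows "0 < rate_const c \<tau>"
proof -
  have "0 < line_const \<tau>" using assms by (simp add: line_const_def)
  then have "0 < 13 / line_const \<tau>" by simp
  then show ?thesis using assms by (simp add: rate_const_def add_pos_pos)
qed

lemma shift_const_ge: assumes "1 \<le> c" "0 < \<tau>" shows "1 \<le> shift_const c \<tau>"
  using rate_const_pos[OF assms] assms by (simp add: shift_const_def)

text \<open>The second entry serves the case in which the error term exceeds the margin; the trace bound
  \<open>\<lambda>\<^sub>i \<le> 1 / \<kappa>\<close> then already suffices.\<close>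

definition loc_const :: "real \<Rightarrow> real \<Rightarrow> real" where
  "loc_const \<kappa> c = max (5 * shift_const c (bulk_margin \<kappa> c))
     ((4 + 1 / \<kappa>) * (shift_const c (bulk_margin \<kappa> c) + 1) / bulk_margin \<kappa> c)"

section \<open>One bulk index at fixed size\<close>

locale location_setup =
  fixes M N db dw i :: nat and \<kappa> c \<xi> :: real
  assumes sz: "0 < N" "N \<le> M" "0 < db" "db < N" "M * db = N * dw"
    and c: "1 \<le> c" "real M \<le> c * real N"
    and \<xi>: "1 \<le> \<xi>" "ln (real N) \<le> \<xi>" "\<xi>\<^sup>2 \<le> D_param N db"
    and \<kappa>: "0 < \<kappa>" and i: "\<kappa> * real N \<le> real i" "real i \<le> (1 - \<kappa>) * real N"
begin

abbreviation "p \<equiv> real db / real N"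
abbreviation "q \<equiv> 1 / sqrt (real dw)"
abbreviation "\<gamma> \<equiv> real N / real M"
abbreviation "\<delta> \<equiv> \<xi>\<^sup>2 / D_param N db powr (1 / 4)"
abbreviation "\<tau> \<equiv> bulk_margin \<kappa> c"
abbreviation "A \<equiv> shift_const c \<tau>"
abbreviation "eigval E \<equiv> nth_eigenvalue (X_star M N db dw E) i"

lemma i_range: "0 < i" "i < N" "1 \<le> i" "i \<le> N"
proof -
  have "0 < \<kappa> * real N" using \<kappa> sz by simp
  then show "0 < i" using i by linarith
  have "(1 - \<kappa>) * real N < real N" using \<kappa> sz by simp
  then show "i < N" using i by linarith
  then show "1 \<le> i" "i \<le> N" using \<open>0 < i\<close> by auto
qed

lemma M_dw_pos: "0 < M" "0 < dw"
  using sz by (auto intro: gr0I)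

lemma \<gamma>: "0 < \<gamma>" "\<gamma> \<le> 1" using sz by auto

lemma \<tau>: "0 < \<tau>" "\<tau> \<le> 1" using \<kappa> c by (auto simp: bulk_margin_def)

lemma shift_ge_1: "1 \<le> A" by (rule shift_const_ge[OF c(1) \<tau>(1)])

lemma D1: "1 \<le> D_param N db"
proof -
  have "1 \<le> \<xi>\<^sup>2" using \<xi>(1) by (simp add: one_le_power)
  then show ?thesis using \<xi>(3) by linarith
qed

lemma \<delta>_pos: "0 < \<delta>"
  using D1 \<xi>(1) by simp

lemma ex_spectrum:
  "\<exists>v d. bernoulli_spectrum M N db dw p q \<gamma> v (\<lambda>S k. sqrt (d S k)) \<and> (\<forall>S. \<forall>k<N. 0 \<le> d S k)
     \<and> (\<forall>S. proots (char_poly (gram_matrix M N (bern_mat p q S))) = mset (map (d S) [0..<N]))"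
proof -
  have "\<forall>S. \<exists>vd. gram_eigenbasis M N (bern_mat p q S) (fst vd) (\<lambda>k. sqrt (snd vd k)) \<and> (\<forall>k<N. 0 \<le> snd vd k)
     \<and> proots (char_poly (gram_matrix M N (bern_mat p q S))) = mset (map (snd vd) [0..<N])"
    using gram_eigenbasis_exists[of M N] by (simp add: split_paired_Ex)
  then obtain vd where vd: "\<forall>S. gram_eigenbasis M N (bern_mat p q S) (fst (vd S)) (\<lambda>k. sqrt (snd (vd S) k)) \<and> (\<forall>k<N. 0 \<le> snd (vd S) k)
     \<and> proots (char_poly (gram_matrix M N (bern_mat p q S))) = mset (map (snd (vd S)) [0..<N])"
    by (rule choice[THEN exE])
  have "bernoulli_spectrum M N db dw p q \<gamma> (\<lambda>S. fst (vd S)) (\<lambda>S k. sqrt (snd (vd S) k))"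
    using sz vd by unfold_locales auto
  then show ?thesis using vd by (intro exI[of _ "\<lambda>S. fst (vd S)"] exI[of _ "\<lambda>S. snd (vd S)"]) auto
qed

lemma eigenvalue_eq:
  assumes "proots (char_poly (gram_matrix M N (bern_mat p q (edge_pairs E)))) = mset (map d [0..<N])"
  shows "eigval E = sorted_list_of_multiset (mset (map d [0..<N])) ! (i - 1)"
  unfolding nth_eigenvalue_def sorted_eigenvalues_def X_star_eq_gram[OF M_dw_pos(1) sz(1,5) M_dw_pos(2)] assms ..

lemma location_large:
  assumes "\<tau> < (A + 1) * \<delta>"
  shows "1 \<le> measure_pmf.prob (pmf_of_set (biregular_graphs M N db dw))
     {E. \<bar>eigval E - classical_location \<gamma> N i\<bar> \<le> loc_const \<kappa> c * \<delta>}"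
proof -
  obtain v d where sp: "bernoulli_spectrum M N db dw p q \<gamma> v (\<lambda>S k. sqrt (d S k))"
    and d: "\<And>S k. k < N \<Longrightarrow> 0 \<le> d S k"
    and pr: "\<And>S. proots (char_poly (gram_matrix M N (bern_mat p q S))) = mset (map (d S) [0..<N])"
    using ex_spectrum by blast
  interpret bernoulli_spectrum M N db dw p q \<gamma> v "\<lambda>S k. sqrt (d S k)" by (rule sp)
  obtain a where a: "1 - sqrt \<gamma> < a" "a < 1 + sqrt \<gamma>" and cl: "classical_location \<gamma> N i = a\<^sup>2"
    using classical_location_sv[OF \<gamma> i_range(1,2)] by blast
  have a0: "0 < a" by (rule a_pos[OF \<gamma> a])
  have "sqrt \<gamma> \<le> 1" using \<gamma> by simp
  then have "a \<le> 2" using a by linarith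
  then have a2: "0 \<le> a\<^sup>2" "a\<^sup>2 \<le> 4" using a0 power_mono[of a 2 2] by auto
  have big: "4 + 1 / \<kappa> \<le> loc_const \<kappa> c * \<delta>"
  proof -
    have "(4 + 1 / \<kappa>) * \<tau> \<le> (4 + 1 / \<kappa>) * ((A + 1) * \<delta>)" using assms \<kappa> by (intro mult_left_mono) auto
    then have "4 + 1 / \<kappa> \<le> (4 + 1 / \<kappa>) * ((A + 1) * \<delta>) / \<tau>" using \<tau> by (simp only: pos_le_divide_eq)
    also have "\<dots> = (4 + 1 / \<kappa>) * (A + 1) / \<tau> * \<delta>" by (simp add: mult_ac)
    also have "\<dots> \<le> loc_const \<kappa> c * \<delta>" unfolding loc_const_def using \<delta>_pos by (intro mult_right_mono) auto
    finally show ?thesis .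
  qed
  have claim: "E \<in> {E. \<bar>eigval E - classical_location \<gamma> N i\<bar> \<le> loc_const \<kappa> c * \<delta>}" if E: "E \<in> biregular_graphs M N db dw" for E
  proof -
    define S where "S = edge_pairs E"
    have S: "S \<in> margin_sets {..<M} {..<N} (\<lambda>_. db) (\<lambda>_. dw)"
      using bij_betw_edge_pairs[of M N db dw] E unfolding S_def by (auto simp: bij_betw_def)
    then have sub: "S \<subseteq> {..<M} \<times> {..<N}" by (simp add: margin_sets_def)
    have cS: "card S = M * db" using sum_row_deg[OF _ _ sub] S by (simp add: margin_sets_def)
    \<comment> \<open>The trace is the squared Frobenius norm. It depends on the graph only through
      the number \<open>M * db\<close> of edges, so it is the same for all biregular graphs and at
      most \<open>N\<close>.\<close>
    have "(\<Sum>k<N. d S k) = (\<Sum>k<N. (sqrt (d S k))\<^sup>2)" using d by simp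
    also have "\<dots> = (\<Sum>i<M. \<Sum>j<N. (bern_mat p q S i j)\<^sup>2)" by (rule sum_squares_singular_values[OF geb])
    also have "\<dots> = (\<Sum>i<M. \<Sum>j<N. q\<^sup>2 * (1 - 2 * p) * (if (i, j) \<in> S then 1 else 0) + q\<^sup>2 * p\<^sup>2)"
      by (intro sum.cong refl) (auto simp: bern_mat_def power_mult_distrib power2_eq_square algebra_simps)
    also have "\<dots> = q\<^sup>2 * (1 - 2 * p) * (\<Sum>i<M. \<Sum>j<N. if (i, j) \<in> S then 1 else 0) + real M * real N * (q\<^sup>2 * p\<^sup>2)"
      by (simp add: sum.distrib sum_distrib_left)
    also have "(\<Sum>i<M. \<Sum>j<N. if (i, j) \<in> S then 1 else 0) = real (M * db)"
    proof -
      have "(\<Sum>i<M. \<Sum>j<N. if (i, j) \<in> S then 1 else 0) = (\<Sum>x\<in>{..<M} \<times> {..<N}. if x \<in> S then 1 else (0::real))"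
        by (subst sum.cartesian_product) (intro sum.cong, auto)
      also have "\<dots> = real (card S)" using sub by (simp add: sum.If_cases Int_absorb1)
      finally show ?thesis using cS by simp
    qed
    also have "q\<^sup>2 * (1 - 2 * p) * real (M * db) + real M * real N * (q\<^sup>2 * p\<^sup>2) = q\<^sup>2 * real (M * db) * (1 - p)"
    proof -
      have "x * (1 - 2 * y) * w + m * n * (x * y\<^sup>2) = x * w * (1 - y)" if "m * n * y = w" for x y w m n :: real
        unfolding that[symmetric] by (simp add: power2_eq_square algebra_simps)
      moreover have "real M * real N * p = real (M * db)" using sz(1) by simp
      ultimately show ?thesis by blast
    qed
    also have "\<dots> \<le> q\<^sup>2 * real (M * db) * 1" using parameter_bounds by (intro mult_left_mono) auto
    also have "\<dots> = real N" unfolding sz(5) using M_dw_pos by (simp add: power_divide)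
    finally have trace: "(\<Sum>k<N. d S k) \<le> real N" .
    define x where "x = sorted_list_of_multiset (mset (map (d S) [0..<N])) ! (i - 1)"
    have lx: "eigval E = x" unfolding x_def by (rule eigenvalue_eq) (simp add: pr S_def)
    have x0: "0 \<le> x" unfolding x_def by (rule order_stat_sum(1)[OF refl i_range(3,4)]) (rule d)
    have "(real N - real i) * x \<le> (\<Sum>k<N. d S k)" unfolding x_def by (rule order_stat_sum(2)[OF refl i_range(3,4)]) (rule d)
    then have "(real N - real i) * x \<le> real N" using trace by linarith
    moreover have "\<kappa> * real N * x \<le> (real N - real i) * x" using i x0 by (intro mult_right_mono) (auto simp: algebra_simps)
    ultimately have "\<kappa> * x * real N \<le> 1 * real N" by (simp add: mult_ac)
    then have "\<kappa> * x \<le> 1" using sz by (simp only: mult_le_cancel_right_pos of_nat_0_less_iff)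
    then have "x \<le> 1 / \<kappa>" using \<kappa> by (simp add: pos_le_divide_eq mult.commute)
    moreover have "0 < 1 / \<kappa>" using \<kappa> by simp
    ultimately have "\<bar>x - a\<^sup>2\<bar> \<le> 4 + 1 / \<kappa>" using x0 a2 by linarith
    then show ?thesis using big lx cl by simp
  qed
  \<comment> \<open>The estimate holds for every biregular graph, so the good event is
    \<open>True\<close> and its failure probability is 0.\<close>
  have "1 - (real (M * N) + 1) * (real N + 1) ^ M * (real M + 1) ^ N * cube_exp ({..<M} \<times> {..<N}) p (\<lambda>S. if True then 0 else 1)
    \<le> measure_pmf.prob (pmf_of_set (biregular_graphs M N db dw)) {E. \<bar>eigval E - classical_location \<gamma> N i\<bar> \<le> loc_const \<kappa> c * \<delta>}"
    by (rule uniform_prob_ge[OF M_dw_pos(1) sz(1,3,4,5) refl claim])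
  then show ?thesis by (simp add: cube_exp_const)
qed

text \<open>On the good event the sample distribution function exceeds \<open>i / N\<close> at
  \<open>a + A * \<delta>\<close> and stays below it at \<open>a - A * \<delta>\<close>, which
  encloses the \<open>i\<close>-th singular value. Four values of \<open>sv_max\<close> have to
  concentrate, hence 8 = 4 * 2.\<close>

lemma location_small:
  assumes small: "(A + 1) * \<delta> \<le> \<tau>"
  shows "1 - (real (M * N) + 1) * (real N + 1) ^ M * (real M + 1) ^ N * (8 * exp (real N - real N * \<xi> ^ 4))
    \<le> measure_pmf.prob (pmf_of_set (biregular_graphs M N db dw))
     {E. \<bar>eigval E - classical_location \<gamma> N i\<bar> \<le> loc_const \<kappa> c * \<delta>}"
proof -
  obtain v d where sp: "bernoulli_spectrum M N db dw p q \<gamma> v (\<lambda>S k. sqrt (d S k))"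
    and d: "\<And>S k. k < N \<Longrightarrow> 0 \<le> d S k"
    and pr: "\<And>S. proots (char_poly (gram_matrix M N (bern_mat p q S))) = mset (map (d S) [0..<N])"
    using ex_spectrum by blast
  interpret bernoulli_spectrum M N db dw p q \<gamma> v "\<lambda>S k. sqrt (d S k)" by (rule sp)
  obtain a where a: "1 - sqrt \<gamma> < a" "a < 1 + sqrt \<gamma>" and Ga: "mp_sv_cdf \<gamma> a = real i / real N"
    and cl: "classical_location \<gamma> N i = a\<^sup>2"
    using classical_location_sv[OF \<gamma> i_range(1,2)] by blast
  have a0: "0 < a" by (rule a_pos[OF \<gamma> a])
  have s1: "sqrt \<gamma> \<le> 1" using \<gamma> by simp
  then have a2: "a \<le> 2" using a by linarith
  have N: "0 < real N" using sz by simp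
  have slope: "2 / (pi * sqrt \<gamma>) \<le> c"
  proof -
    have "2 / (pi * sqrt \<gamma>) = (2 / pi) * (1 / sqrt \<gamma>)" by simp
    also have "\<dots> \<le> 1 * c" using inverse_sqrt_ratio[OF c] pi_ge_two \<gamma> c
      by (intro mult_mono) (auto simp: divide_le_eq)
    finally show ?thesis by simp
  qed
  have \<tau>c: "2 * \<tau> * c \<le> \<kappa>"
  proof -
    have "\<tau> \<le> \<kappa> / (2 * c)" by (simp add: bulk_margin_def)
    then show ?thesis using c by (simp add: pos_le_divide_eq mult_ac)
  qed
  have margin: "2 * \<tau> \<le> x" if "\<kappa> \<le> 2 / (pi * sqrt \<gamma>) * x" "0 \<le> x" for x
  proof -
    have "2 / (pi * sqrt \<gamma>) * x \<le> c * x" using slope that by (intro mult_right_mono)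
    then have "c * (2 * \<tau>) \<le> c * x" using that \<tau>c by (simp add: mult_ac)
    then show ?thesis using c by simp
  qed
  have m1: "2 * \<tau> \<le> a - (1 - sqrt \<gamma>)"
  proof (rule margin)
    have "\<kappa> \<le> real i / real N" using i N by (simp add: pos_le_divide_eq)
    also have "\<dots> = mp_sv_cdf \<gamma> a - mp_sv_cdf \<gamma> (1 - sqrt \<gamma>)" using Ga mp_sv_cdf_lower[OF \<gamma>] by simp
    also have "\<dots> \<le> 2 / (pi * sqrt \<gamma>) * (a - (1 - sqrt \<gamma>))" using a by (intro mp_sv_cdf_increment \<gamma>) auto
    finally show "\<kappa> \<le> 2 / (pi * sqrt \<gamma>) * (a - (1 - sqrt \<gamma>))" .
  qed (use a in simp)
  have m2: "2 * \<tau> \<le> (1 + sqrt \<gamma>) - a"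
  proof (rule margin)
    have "real i / real N \<le> 1 - \<kappa>" using i N by (simp add: pos_divide_le_eq)
    then have "\<kappa> \<le> 1 - real i / real N" by simp
    also have "\<dots> = mp_sv_cdf \<gamma> (1 + sqrt \<gamma>) - mp_sv_cdf \<gamma> a" using Ga mp_sv_cdf_upper[OF \<gamma>] by simp
    also have "\<dots> \<le> 2 / (pi * sqrt \<gamma>) * ((1 + sqrt \<gamma>) - a)" using a by (intro mp_sv_cdf_increment \<gamma>) auto
    finally show "\<kappa> \<le> 2 / (pi * sqrt \<gamma>) * ((1 + sqrt \<gamma>) - a)" .
  qed (use a in simp)
  have A\<delta>: "A * \<delta> \<le> \<tau>" "0 \<le> (A - 1) * \<delta>" "(A - 1) * \<delta> \<le> \<tau>" "0 \<le> A * \<delta>" "A * \<delta> = (A - 1) * \<delta> + \<delta>"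
  proof -
    have "A * x \<le> t \<and> 0 \<le> (A - 1) * x \<and> (A - 1) * x \<le> t \<and> 0 \<le> A * x \<and> A * x = (A - 1) * x + x"
      if "(A + 1) * x \<le> t" "0 < x" for x t :: real
      using mult_right_mono[OF shift_ge_1, of x] that by (simp add: algebra_simps)
    from this[OF small \<delta>_pos]
    show "A * \<delta> \<le> \<tau>" "0 \<le> (A - 1) * \<delta>" "(A - 1) * \<delta> \<le> \<tau>" "0 \<le> A * \<delta>" "A * \<delta> = (A - 1) * \<delta> + \<delta>" by blast+
  qed
  have gain: "\<tau> / pi * ((A - 1) * \<delta>) = (rate_const c \<tau> + 3) * \<delta>"
    unfolding shift_const_def using \<tau> by simp
  \<comment> \<open>The shift \<open>\<delta>\<close> of \<open>sample_cdf_bounds\<close> is spent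
    outwards on both sides: the mean is evaluated at distance \<open>(A - 1) * \<delta>\<close> from
    \<open>a\<close>, the sample at distance \<open>A * \<delta>\<close>.\<close>
  define y1 where "y1 = a + (A - 1) * \<delta>"
  define y2 where "y2 = a - A * \<delta>"
  have y1d: "y1 + \<delta> = a + A * \<delta>" and y2d: "y2 + \<delta> = a - (A - 1) * \<delta>" using A\<delta>(5) by (auto simp: y1_def y2_def)
  define Good where "Good x S \<longleftrightarrow> \<bar>sv_max x S - E (sv_max x)\<bar> < real N * \<delta>\<^sup>2" for x S
  define Q where "Q S \<longleftrightarrow> Good y1 S \<and> Good (y1 + \<delta>) S \<and> Good y2 S \<and> Good (y2 + \<delta>) S" for S
  have claim: "E' \<in> {E. \<bar>eigval E - classical_location \<gamma> N i\<bar> \<le> loc_const \<kappa> c * \<delta>}" if Q: "Q (edge_pairs E')" for E'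
  proof -
    define S where "S = edge_pairs E'"
    have Gd: "Good y1 S" "Good (y1 + \<delta>) S" "Good y2 S" "Good (y2 + \<delta>) S" using Q by (auto simp: Q_def S_def)
    have up: "real i / real N < sv_cdf S (a + A * \<delta>)"
    proof -
      have "E (\<lambda>S. sv_cdf S y1) - 2 * \<delta> \<le> sv_cdf S (y1 + \<delta>)"
        using Gd unfolding Good_def by (intro sample_cdf_bounds(2) \<delta>_pos)
      moreover have "\<bar>E (\<lambda>S. sv_cdf S y1) - mp_sv_cdf \<gamma> y1\<bar> \<le> rate_const c \<tau> * \<delta>"
        using m1 m2 A\<delta> \<tau> unfolding y1_def by (intro mean_cdf_rate \<xi> c) auto
      moreover have "\<tau> / pi * (y1 - a) \<le> mp_sv_cdf \<gamma> y1 - mp_sv_cdf \<gamma> a"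
        using m1 m2 A\<delta> \<tau> unfolding y1_def by (intro mp_sv_cdf_growth \<gamma>) auto
      moreover have "\<tau> / pi * (y1 - a) = rate_const c \<tau> * \<delta> + 3 * \<delta>" unfolding y1_def using gain by (simp only: distrib_right add_diff_cancel_left')
      ultimately show ?thesis using \<delta>_pos Ga unfolding y1d by linarith
    qed
    have lo: "sv_cdf S y2 < real i / real N"
    proof -
      have "sv_cdf S y2 \<le> E (\<lambda>S. sv_cdf S (y2 + \<delta>)) + 2 * \<delta>"
        using Gd unfolding Good_def by (intro sample_cdf_bounds(1) \<delta>_pos)
      moreover have "\<bar>E (\<lambda>S. sv_cdf S (y2 + \<delta>)) - mp_sv_cdf \<gamma> (y2 + \<delta>)\<bar> \<le> rate_const c \<tau> * \<delta>"
        using m1 m2 A\<delta> \<tau> unfolding y2d by (intro mean_cdf_rate \<xi> c) auto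
      moreover have "\<tau> / pi * (a - (y2 + \<delta>)) \<le> mp_sv_cdf \<gamma> a - mp_sv_cdf \<gamma> (y2 + \<delta>)"
        using m1 m2 A\<delta> \<tau> unfolding y2d by (intro mp_sv_cdf_growth \<gamma>) auto
      moreover have "\<tau> / pi * (a - (y2 + \<delta>)) = rate_const c \<tau> * \<delta> + 3 * \<delta>" unfolding y2d using gain by (simp only: distrib_right diff_diff_eq2 add_diff_cancel_left')
      ultimately show ?thesis using \<delta>_pos Ga by linarith
    qed
    define x where "x = sorted_list_of_multiset (mset (map (d S) [0..<N])) ! (i - 1)"
    have lx: "eigval E' = x" unfolding x_def by (rule eigenvalue_eq) (simp add: pr S_def)
    have cnt: "card {k. k < N \<and> sqrt (d S k) \<le> y} = card {k. k < N \<and> d S k \<le> y\<^sup>2}" if "0 \<le> y" for y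
    proof -
      have "sqrt u \<le> y \<longleftrightarrow> u \<le> y\<^sup>2" for u using real_sqrt_le_iff[of u "y\<^sup>2"] that by simp
      then show ?thesis by simp
    qed
    have y2p: "0 < y2" using m1 A\<delta> \<tau> s1 unfolding y2_def by linarith
    have yp: "0 \<le> a + A * \<delta>" using a0 A\<delta> by simp
    have ux: "x \<le> (a + A * \<delta>)\<^sup>2" unfolding x_def
    proof (rule order_stat_le[OF refl i_range(3,4)])
      have "real i < real (card {k. k < N \<and> sqrt (d S k) \<le> a + A * \<delta>})"
        using up N unfolding sv_cdf_def by (simp add: divide_less_cancel)
      then show "i \<le> card {k. k < N \<and> d S k \<le> (a + A * \<delta>)\<^sup>2}" unfolding cnt[OF yp] by simp
    qed
    have lx2: "y2\<^sup>2 < x" unfolding x_def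
    proof (rule order_stat_gt[OF refl i_range(3,4)])
      have "real (card {k. k < N \<and> sqrt (d S k) \<le> y2}) < real i"
        using lo N unfolding sv_cdf_def by (simp add: divide_less_cancel)
      then show "card {k. k < N \<and> d S k \<le> y2\<^sup>2} < i" using cnt[of y2] y2p by simp
    qed
    \<comment> \<open>Passing from singular values to their squares costs the factor
      \<open>2 * a + A * \<delta> \<le> 5\<close>, from \<open>a \<le> 2\<close> and
      \<open>A * \<delta> \<le> \<tau> \<le> 1\<close>.\<close>
    have d5: "A * \<delta> * (2 * a + A * \<delta>) \<le> A * \<delta> * 5" "A * \<delta> * (2 * a - A * \<delta>) \<le> A * \<delta> * 5"
      using A\<delta> a2 \<tau> by (intro mult_left_mono; linarith)+
    have "(a + A * \<delta>)\<^sup>2 - a\<^sup>2 = A * \<delta> * (2 * a + A * \<delta>)" "a\<^sup>2 - y2\<^sup>2 = A * \<delta> * (2 * a - A * \<delta>)"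
      unfolding y2_def by (simp_all add: power2_eq_square algebra_simps)
    then have "\<bar>x - a\<^sup>2\<bar> \<le> A * \<delta> * 5" using ux lx2 d5 by linarith
    also have "\<dots> = 5 * A * \<delta>" by simp
    also have "\<dots> \<le> loc_const \<kappa> c * \<delta>" unfolding loc_const_def using \<delta>_pos by (intro mult_right_mono) auto
    finally show ?thesis using lx cl by simp
  qed
  \<comment> \<open>D^(1/2) \<le> sqrt dw, since D \<le> db \<le> dw; this turns the exponent
    \<open>N * \<delta>\<^sup>2 * sqrt dw\<close> into \<open>N * \<xi> ^ 4\<close>.\<close>
  have \<delta>dw: "\<xi> ^ 4 \<le> \<delta>\<^sup>2 * sqrt (real dw)"
  proof -
    define D where "D = D_param N db"
    have D1': "1 \<le> D" using D1 by (simp add: D_def)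
    have "D \<le> real db" by (simp add: D_def D_param_def)
    also have "\<dots> \<le> real dw" using parameter_bounds(7) by simp
    finally have "sqrt D \<le> sqrt (real dw)" by simp
    moreover have "(D powr (1 / 4))\<^sup>2 = sqrt D"
    proof -
      have "(D powr (1 / 4))\<^sup>2 = D powr (1 / 4) * D powr (1 / 4)" by (simp add: power2_eq_square)
      also have "\<dots> = D powr (1 / 2)" by (simp add: powr_add[symmetric])
      finally show ?thesis using D1' by (simp add: powr_half_sqrt)
    qed
    ultimately have le: "(D powr (1 / 4))\<^sup>2 \<le> sqrt (real dw)" by simp
    have "\<xi> ^ 4 = \<delta>\<^sup>2 * (D powr (1 / 4))\<^sup>2"
      using D1' by (simp add: D_def[symmetric] power_divide power_mult[symmetric])
    also have "\<dots> \<le> \<delta>\<^sup>2 * sqrt (real dw)" using le by (intro mult_left_mono) auto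
    finally show ?thesis .
  qed
  have tail: "E (\<lambda>S. if Good x S then 0 else 1) \<le> 2 * exp (real N - real N * \<xi> ^ 4)" if "0 \<le> x" for x
  proof -
    have "E (\<lambda>S. if Good x S then 0 else 1) = E (\<lambda>S. if \<bar>sv_max x S - E (sv_max x)\<bar> \<ge> real N * \<delta>\<^sup>2 then 1 else 0)"
      by (intro cube_exp_cong) (auto simp: Good_def)
    also have "\<dots> \<le> 2 * exp (real N - real N * \<delta>\<^sup>2 * sqrt (real dw))" by (rule sv_max_tail[OF that])
    also have "\<dots> \<le> 2 * exp (real N - real N * \<xi> ^ 4)"
      using mult_left_mono[OF \<delta>dw, of "real N"] by (simp add: mult.assoc)
    finally show ?thesis .
  qed
  have y_nonneg: "0 \<le> y1" "0 \<le> y1 + \<delta>" "0 \<le> y2" "0 \<le> y2 + \<delta>"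
    using m1 A\<delta> \<tau> s1 a0 \<delta>_pos unfolding y1_def y2_def by linarith+
  have "E (\<lambda>S. if Q S then 0 else 1) \<le> E (\<lambda>S. (if Good y1 S then 0 else (1::real)) + (if Good (y1 + \<delta>) S then 0 else 1)
     + (if Good y2 S then 0 else 1) + (if Good (y2 + \<delta>) S then 0 else 1))"
    using parameter_bounds by (intro cube_exp_mono) (auto simp: Q_def)
  also have "\<dots> \<le> 8 * exp (real N - real N * \<xi> ^ 4)"
    unfolding cube_exp_add using tail[OF y_nonneg(1)] tail[OF y_nonneg(2)] tail[OF y_nonneg(3)] tail[OF y_nonneg(4)] by linarith
  finally have EQ: "E (\<lambda>S. if Q S then 0 else 1) \<le> 8 * exp (real N - real N * \<xi> ^ 4)" .
  have "1 - (real (M * N) + 1) * (real N + 1) ^ M * (real M + 1) ^ N * E (\<lambda>S. if Q S then 0 else 1)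
    \<le> measure_pmf.prob (pmf_of_set (biregular_graphs M N db dw)) {E. \<bar>eigval E - classical_location \<gamma> N i\<bar> \<le> loc_const \<kappa> c * \<delta>}"
    by (rule uniform_prob_ge[OF M_dw_pos(1) sz(1,3,4,5) refl claim])
  moreover have "(real (M * N) + 1) * (real N + 1) ^ M * (real M + 1) ^ N * E (\<lambda>S. if Q S then 0 else 1)
     \<le> (real (M * N) + 1) * (real N + 1) ^ M * (real M + 1) ^ N * (8 * exp (real N - real N * \<xi> ^ 4))"
    using EQ by (intro mult_left_mono) auto
  ultimately show ?thesis by linarith
qed

text \<open>Apart from \<open>- N * \<xi> ^ 4\<close>, the exponents add up to at most
  \<open>(10 + 2 * c) * N * \<xi>\<close>. Since \<open>\<xi> ^ 4 \<ge> 2 * \<xi>\<^sup>2\<close>,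
  one \<open>N * \<xi>\<^sup>2\<close> absorbs this sum and the other one dominates
  \<open>\<xi> * ln \<xi>\<close>.\<close>

lemma union_bound_exponent:
  assumes big: "11 + 2 * c \<le> \<xi>" and N2: "2 \<le> N"
  shows "(real (M * N) + 1) * (real N + 1) ^ M * (real M + 1) ^ N * (8 * exp (real N - real N * \<xi> ^ 4)) \<le> exp (- (\<xi> * ln \<xi>))"
proof -
  have N: "2 \<le> real N" using N2 by simp
  have Ne: "real N \<le> exp \<xi>" using \<xi>(2) N by (metis exp_le_cancel_iff exp_ln less_le_trans zero_less_numeral)
  have N1: "real N + 1 \<le> exp (2 * \<xi>)"
  proof -
    have "2 * real N \<le> real N * real N" using N by (intro mult_right_mono) auto
    then have "real N + 1 \<le> real N * real N" using N by linarith
    also have "\<dots> \<le> exp \<xi> * exp \<xi>" using Ne by (intro mult_mono) auto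
    finally show ?thesis by (simp add: exp_add[symmetric])
  qed
  have M1: "real M + 1 \<le> exp (2 * \<xi>)"
  proof -
    have "real M + 1 \<le> c * real N + 1 * real N" using c N by linarith
    also have "\<dots> = (c + 1) * real N" by (simp add: algebra_simps)
    also have "\<dots> \<le> exp \<xi> * exp \<xi>"
    proof (intro mult_mono Ne)
      have "\<xi> + 1 \<le> exp \<xi>" by (metis add.commute exp_ge_add_one_self)
      then show "c + 1 \<le> exp \<xi>" using big c by linarith
    qed (use c in auto)
    finally show ?thesis by (simp add: exp_add[symmetric])
  qed
  have MN1: "real (M * N) + 1 \<le> exp (4 * \<xi>)"
  proof -
    have "real (M * N) + 1 \<le> (real M + 1) * (real N + 1)" by (simp add: algebra_simps)
    also have "\<dots> \<le> exp (2 * \<xi>) * exp (2 * \<xi>)" using M1 N1 by (intro mult_mono) auto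
    finally show ?thesis by (simp add: exp_add[symmetric])
  qed
  have e8: "8 \<le> exp (3 * \<xi>)"
  proof -
    have "(2::real) ^ 3 \<le> exp 1 ^ 3" using exp_ge_add_one_self[of "1::real"] by (intro power_mono) auto
    also have "exp 1 ^ 3 = exp (3::real)" by (simp add: exp_of_nat_mult[symmetric])
    also have "\<dots> \<le> exp (3 * \<xi>)" using \<xi>(1) by simp
    finally show ?thesis by simp
  qed
  have pM: "(real N + 1) ^ M \<le> exp (real M * (2 * \<xi>))"
    using power_mono[OF N1, of M] by (simp add: exp_of_nat_mult)
  have pN: "(real M + 1) ^ N \<le> exp (real N * (2 * \<xi>))"
    using power_mono[OF M1, of N] by (simp add: exp_of_nat_mult)
  have "(real (M * N) + 1) * (real N + 1) ^ M * (real M + 1) ^ N * (8 * exp (real N - real N * \<xi> ^ 4))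
    \<le> exp (4 * \<xi>) * exp (real M * (2 * \<xi>)) * exp (real N * (2 * \<xi>)) * (exp (3 * \<xi>) * exp (real N - real N * \<xi> ^ 4))"
    using MN1 pM pN e8 by (intro mult_mono mult_nonneg_nonneg zero_le_power) auto
  also have "\<dots> = exp (4 * \<xi> + real M * (2 * \<xi>) + real N * (2 * \<xi>) + (3 * \<xi> + (real N - real N * \<xi> ^ 4)))"
    by (simp only: exp_add)
  also have "\<dots> \<le> exp (- (\<xi> * ln \<xi>))"
  proof -
    have x1: "\<xi> \<le> real N * \<xi>" using N \<xi>(1) by simp
    have x2: "real N \<le> real N * \<xi>" using N \<xi>(1) by simp
    have x3: "real M * (2 * \<xi>) \<le> 2 * c * (real N * \<xi>)"
      using mult_right_mono[OF c(2), of "2 * \<xi>"] \<xi>(1) by (simp add: mult_ac)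
    have x4: "(10 + 2 * c) * (real N * \<xi>) \<le> \<xi> * (real N * \<xi>)" using big N \<xi>(1) by (intro mult_right_mono) auto
    have "\<xi> * ln \<xi> \<le> \<xi> * \<xi>" using \<xi>(1) ln_le_minus_one[of \<xi>] by (intro mult_left_mono) auto
    also have "\<xi> * \<xi> \<le> real N * (\<xi> * \<xi>)" using N \<xi>(1) by simp
    finally have x5: "\<xi> * ln \<xi> \<le> real N * (\<xi> * \<xi>)" .
    have "2 * (\<xi> * \<xi>) \<le> (\<xi> * \<xi>) * (\<xi> * \<xi>)"
    proof (rule mult_right_mono)
      have "2 * 1 \<le> \<xi> * \<xi>" using big c \<xi>(1) by (intro mult_mono) auto
      then show "2 \<le> \<xi> * \<xi>" by simp
    qed simp
    then have x6: "real N * (2 * (\<xi> * \<xi>)) \<le> real N * \<xi> ^ 4" by (intro mult_left_mono) (auto simp: power4_eq_xxxx mult.assoc)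
    have "4 * \<xi> + real M * (2 * \<xi>) + real N * (2 * \<xi>) + (3 * \<xi> + (real N - real N * \<xi> ^ 4))
      \<le> (10 + 2 * c) * (real N * \<xi>) - real N * \<xi> ^ 4"
      using x1 x2 x3 by (simp add: algebra_simps)
    also have "\<dots> \<le> - (\<xi> * ln \<xi>)" using x4 x5 x6 by (simp add: algebra_simps)
    finally show ?thesis by simp
  qed
  finally show ?thesis .
qed

theorem location:
  assumes "11 + 2 * c \<le> \<xi>" "2 \<le> N"
  shows "1 - exp (- (\<xi> * ln \<xi>)) \<le> measure_pmf.prob (pmf_of_set (biregular_graphs M N db dw))
     {E. \<bar>eigval E - classical_location \<gamma> N i\<bar> \<le> loc_const \<kappa> c * \<delta>}"
proof (cases "(A + 1) * \<delta> \<le> \<tau>")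
  case True
  then show ?thesis using location_small union_bound_exponent[OF assms] by linarith
next
  case False
  then show ?thesis using location_large by (smt (verit) exp_gt_zero)
qed

end

text \<open>Extracts log N \<le> \<xi> from the growth hypothesis. As \<xi> may be any real
  sequence, negative \<open>x\<close> must be excluded too: there \<open>ln x = ln (- x)\<close>,
  and \<open>x * ln x\<close> stays below 1.\<close>

lemma xlnx_ge_imp_ge:
  fixes x L :: real
  assumes "1 \<le> L" "L\<^sup>2 \<le> x * ln x" shows "L \<le> x"
proof (rule ccontr)
  assume "\<not> L \<le> x"
  then have lt: "x < L" by simp
  have L2: "1 \<le> L\<^sup>2" using assms(1) by (simp add: one_le_power)
  show False
  proof (cases "0 < x")
    case True
    show ?thesis
    proof (cases "1 \<le> x")
      case True
      have "x * ln x \<le> x * x" using True ln_le_minus_one[of x] by (intro mult_left_mono) auto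
      also have "\<dots> < L\<^sup>2" using lt True unfolding power2_eq_square by (intro mult_strict_mono) auto
      finally show ?thesis using assms by simp
    next
      case False
      then have "x * ln x \<le> 0" using True by (intro mult_nonneg_nonpos) auto
      then show ?thesis using assms L2 by simp
    qed
  next
    case False
    define y where "y = - x"
    have y: "0 \<le> y" using False by (simp add: y_def)
    show ?thesis
    proof (cases "y = 0")
      case True
      then show ?thesis using assms L2 by (simp add: y_def)
    next
      case False
      then have y: "0 < y" using y by simp
      have "ln (1 / y) \<le> 1 / y - 1" using y by (intro ln_le_minus_one) simp
      then have "y * - ln y \<le> y * (1 / y - 1)" using y by (intro mult_left_mono) (auto simp: ln_div)
      then have "x * ln x \<le> 1 - y" using y ln_minus[of y] by (simp add: y_def algebra_simps)
      then show ?thesis using y assms L2 by simp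
    qed
  qed
qed

theorem corollary2p10:
  fixes M N db dw :: "nat \<Rightarrow> nat"
    and \<xi> :: "nat \<Rightarrow> real"
    and \<alpha> \<kappa> :: real
  assumes "filterlim N at_top sequentially"
    and "filterlim M at_top sequentially"
    and "\<And>n. N n \<le> M n"
    and "\<And>n. M n * db n = N n * dw n"
    and "(\<lambda>n. real (M n) / real (N n)) \<longlonglongrightarrow> \<alpha>"
    and "1 \<le> \<alpha>"
    and "(\<lambda>n. \<xi> n * ln (\<xi> n)) \<ggreater> (\<lambda>n. (ln (real (N n)))\<^sup>2)"
    and "(\<lambda>n. D_param (N n) (db n)) \<ggreater> (\<lambda>n. (\<xi> n)\<^sup>2)"
    and "0 < \<kappa>"
  shows "\<exists>C>0. \<forall>\<^sub>F n in sequentially. \<forall>i::nat.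
           \<kappa> * real (N n) \<le> real i \<and> real i \<le> (1 - \<kappa>) * real (N n) \<longrightarrow>
           measure_pmf.prob (pmf_of_set (biregular_graphs (M n) (N n) (db n) (dw n)))
             {E. \<bar>nth_eigenvalue (X_star (M n) (N n) (db n) (dw n) E) i
                    - classical_location (real (N n) / real (M n)) (N n) i\<bar>
                 \<le> C * ((\<xi> n)\<^sup>2 / D_param (N n) (db n) powr (1 / 4))}
           \<ge> 1 - exp (- (\<xi> n * ln (\<xi> n)))"
proof -
  \<comment> \<open>A bound strictly above the limit of M / N, hence valid eventually; together with
    \<open>\<kappa>\<close> it determines the final constant, uniformly in \<open>i\<close>.\<close>
  define c where "c = \<alpha> + 1"
  have c1: "1 \<le> c" using assms(6) by (simp add: c_def)
  have \<tau>: "0 < bulk_margin \<kappa> c" using assms(9) c1 by (simp add: bulk_margin_def)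
  have pos: "0 < loc_const \<kappa> c" unfolding loc_const_def using shift_const_ge[OF c1 \<tau>] by (simp add: less_max_iff_disj)
  have lnN: "filterlim (\<lambda>n. ln (real (N n))) at_top sequentially"
    by (rule filterlim_compose[OF ln_at_top]) (rule filterlim_compose[OF filterlim_real_sequentially assms(1)])
  have ev1: "\<forall>\<^sub>F n in sequentially. 11 + 2 * c \<le> ln (real (N n))" using lnN by (simp add: filterlim_at_top)
  have ev2: "\<forall>\<^sub>F n in sequentially. 2 \<le> N n" using assms(1) by (simp add: filterlim_at_top)
  have ev3: "\<forall>\<^sub>F n in sequentially. 1 \<le> \<xi> n * ln (\<xi> n) / (ln (real (N n)))\<^sup>2"
    using assms(7) unfolding much_greater_def filterlim_at_top by simp
  have ev4: "\<forall>\<^sub>F n in sequentially. 1 \<le> D_param (N n) (db n) / (\<xi> n)\<^sup>2"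
    using assms(8) unfolding much_greater_def filterlim_at_top by simp
  have ev5: "\<forall>\<^sub>F n in sequentially. real (M n) / real (N n) < c"
    by (rule order_tendstoD(2)[OF assms(5)]) (simp add: c_def)
  have "\<forall>\<^sub>F n in sequentially. \<forall>i::nat.
           \<kappa> * real (N n) \<le> real i \<and> real i \<le> (1 - \<kappa>) * real (N n) \<longrightarrow>
           measure_pmf.prob (pmf_of_set (biregular_graphs (M n) (N n) (db n) (dw n)))
             {E. \<bar>nth_eigenvalue (X_star (M n) (N n) (db n) (dw n) E) i
                    - classical_location (real (N n) / real (M n)) (N n) i\<bar>
                 \<le> loc_const \<kappa> c * ((\<xi> n)\<^sup>2 / D_param (N n) (db n) powr (1 / 4))}
           \<ge> 1 - exp (- (\<xi> n * ln (\<xi> n)))"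
    using ev1 ev2 ev3 ev4 ev5
  proof eventually_elim
    case (elim n)
    define L where "L = ln (real (N n))"
    have N2: "2 \<le> real (N n)" using elim(2) by simp
    have L1: "11 + 2 * c \<le> L" using elim(1) by (simp add: L_def)
    then have "1 \<le> L" using c1 by linarith
    then have "0 < L\<^sup>2" by simp
    then have "L\<^sup>2 \<le> \<xi> n * ln (\<xi> n)" using elim(3) unfolding L_def[symmetric] by (simp add: pos_le_divide_eq)
    then have \<xi>L: "L \<le> \<xi> n" by (rule xlnx_ge_imp_ge[OF \<open>1 \<le> L\<close>])
    have \<xi>1: "1 \<le> \<xi> n" using \<xi>L \<open>1 \<le> L\<close> by linarith
    have "0 < (\<xi> n)\<^sup>2" using \<xi>1 by simp
    then have \<xi>D: "(\<xi> n)\<^sup>2 \<le> D_param (N n) (db n)" using elim(4) by (simp add: pos_le_divide_eq)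
    have "1 \<le> (\<xi> n)\<^sup>2" using \<xi>1 by (simp add: one_le_power)
    moreover have "(\<xi> n)\<^sup>2 \<le> real (db n)" "(\<xi> n)\<^sup>2 \<le> (real (N n))\<^sup>2 / real (db n) ^ 3"
      using \<xi>D by (simp_all add: D_param_def)
    ultimately have D: "1 \<le> real (db n)" "1 \<le> (real (N n))\<^sup>2 / real (db n) ^ 3" by linarith+
    \<comment> \<open>D \<ge> 1 gives db^3 \<le> N^2, which excludes db \<ge> N once N \<ge> 2. So
      the Bernoulli parameter is below 1, as the comparison with the uniform law requires.\<close>
    have db_lt: "db n < N n"
    proof (rule ccontr)
      assume "\<not> db n < N n"
      then have "real (N n) ^ 3 \<le> real (db n) ^ 3" by (intro power_mono) auto
      also have "\<dots> \<le> (real (N n))\<^sup>2" using D by (simp add: pos_le_divide_eq)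
      finally have "real (N n) * (real (N n))\<^sup>2 \<le> 1 * (real (N n))\<^sup>2" by (simp add: power_numeral_reduce)
      then have "real (N n) \<le> 1" using N2 by (simp only: mult_le_cancel_right_pos zero_less_power)
      then show False using N2 by simp
    qed
    have Mc: "real (M n) \<le> c * real (N n)" using elim(5) N2 by (simp add: pos_divide_less_eq)
    show ?case
    proof (intro allI impI)
      fix i :: nat
      assume i: "\<kappa> * real (N n) \<le> real i \<and> real i \<le> (1 - \<kappa>) * real (N n)"
      interpret location_setup "M n" "N n" "db n" "dw n" i \<kappa> c "\<xi> n"
        by unfold_locales (use N2 assms(3,4,9) D(1) db_lt c1 Mc \<xi>1 \<xi>L \<xi>D i in \<open>auto simp: L_def\<close>)
      show "1 - exp (- (\<xi> n * ln (\<xi> n))) \<le>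
           measure_pmf.prob (pmf_of_set (biregular_graphs (M n) (N n) (db n) (dw n)))
             {E. \<bar>nth_eigenvalue (X_star (M n) (N n) (db n) (dw n) E) i
                    - classical_location (real (N n) / real (M n)) (N n) i\<bar>
                 \<le> loc_const \<kappa> c * ((\<xi> n)\<^sup>2 / D_param (N n) (db n) powr (1 / 4))}"
        using \<xi>L L1 elim(2) by (intro location) auto
    qed
  qed
  then show ?thesis using pos by blast
qed

end
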